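(* Let $r\in\mathbb{N}$, let $F_r$ be the free group of rank $r$, and let $F_r\curvearrowright(X,\mu)$ be a measure-preserving action on a standard probability space. Then $s(F_r,X)=\underline{s}(F_r,X)=r$.
   Context: $\mathbb{N}=\{1,2,\dots\}$. A discrete measurable groupoid is a groupoid $\mathcal{G}$ (source map $\mathfrak{s}$, range map $\mathfrak{r}$, unit space $\mathcal{G}^0$; $xy$ is defined when $\mathfrak{s}(x)=\mathfrak{r}(y)$) with the structure of a standard Borel space such that $\mathcal{G}^0$ is Borel, the source, range, multiplication and inversion maps are Borel, and $\mathfrak{s}^{-1}(x)$ is countable for every $x\in\mathcal{G}^0$. A probability-measure-preserving (p.m.p.) groupoid is a discrete measurable groupoid together with a Borel probability measure $\mu$ on $\mathcal{G}^0$ such that $\int_{\mathcal{G}^0}|\mathfrak{s}^{-1}(x)\cap B|\,d\mu(x)=\int_{\mathcal{G}^0}|\mathfrak{r}^{-1}(x)\cap B|\,d\mu(x)$ for every Borel $B\subseteq\mathcal{G}$; this common value defines a $\sigma$-finite Borel measure on $\mathcal{G}$, again denoted $\mu$. For a Borel set $B\subseteq\mathcal{G}$ on which $\mathfrak{s}$ and $\mathfrak{r}$ are injective, $s_B$ is the partial isometry on $L^2(\mathcal{G},\mu)$ given by $s_B\xi(x)=\xi(y^{-1})$ if $y$ is the element of $\mathfrak{r}^{-1}(\mathfrak{s}(x))$ with $xy\in B$, and $s_B\xi(x)=0$ if there is no such $y$. $I_{\mathcal{G}}$ is the set of all such $s_B$; it is an inverse semigroup with inverse $s\mapsto s^*$.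 $\mathrm{VN}(\mathcal{G})$ is the von Neumann algebra generated by $I_{\mathcal{G}}$, with trace $\tau(a)=\langle a1_{\mathcal{G}^0},1_{\mathcal{G}^0}\rangle$ and $\|a\|_2=\tau(a^*a)^{1/2}$. $I_d$ is the set of partial permutation matrices in $M_d=M_d(\mathbb{C})$ (partial isometries with all entries $0$ or $1$), $\mathrm{tr}$ is the normalized trace on $M_d$, and $\|a\|_2=\mathrm{tr}(a^*a)^{1/2}$ on $M_d$. For $\Omega\subseteq I_{\mathcal{G}}$: $\Omega^*=\{s^*:s\in\Omega\}$; $\Omega^n$ is the set of products $s_1\cdots s_n$ with $s_i\in\Omega$; $\Omega^{\le n}=\bigcup_{k=1}^n\Omega^k$; $[\Omega]$ is the linear span of $\Omega$ in $\mathrm{VN}(\mathcal{G})$. For a finite set $F\subseteq I_{\mathcal{G}}$, $n,d\in\mathbb{N}$ and $\delta>0$, $\mathrm{SA}(F,n,\delta,d)$ is the set of all linear maps $\varphi:[I_{\mathcal{G}}]\to M_d$ such that (1) $\|\varphi(s_1\cdots s_k)-\varphi(s_1)\cdots\varphi(s_k)\|_2<\delta$ for all $k=1,\dots,n$ and $s_1,\dots,s_k\in F\cup F^*$, (2) $\varphi((F\cup F^* )^{\le n})\subseteq I_d$, (3) $|\mathrm{tr}\circ\varphi(s)-\tau(s)|<\delta$ for all $s\in(F\cup F^* )^{\le n}$. For a set $\mathcal{Y}$ of maps, $|\mathcal{Y}|_E$ denotes the cardinality of the set of restrictions $\{\varphi|_E:\varphi\in\mathcal{Y}\}$. For finite $E,F\subseteq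 I_{\mathcal{G}}$ set $s_E(F,n,\delta)=\limsup_{d\to\infty}\frac{1}{d\log d}\log|\mathrm{SA}(F,n,\delta,d)|_E$ (with $\log 0=-\infty$) and $s_E(F)=\inf_{n\in\mathbb{N}}\inf_{\delta>0}s_E(F,n,\delta)$. The sofic dimension is $s(\mathcal{G})=\sup_E\inf_F s_E(F)$, with $E$ and $F$ ranging over the finite subsets of $I_{\mathcal{G}}$; the lower sofic dimension $\underline{s}(\mathcal{G})$ is defined in the same way with $\liminf_{d\to\infty}$ in place of $\limsup_{d\to\infty}$. For a measure-preserving action of a countable discrete group $G$ on a standard probability space $(X,\mu)$, the associated p.m.p. groupoid is $\mathcal{G}=G\times X$ with unit space $\{e\}\times X\cong X$ (carrying $\mu$), source $(g,x)\mapsto x$, range $(g,x)\mapsto gx$, and product $(h,gx)(g,x)=(hg,x)$. One writes $s(G,X)=s(\mathcal{G})$ and $\underline{s}(G,X)=\underline{s}(\mathcal{G})$. *)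

theory Defs
  imports
    "HOL-Probability.Probability_Measure"
    "HOL-Algebra.Group_Action"
    "Jordan_Normal_Form.Schur_Decomposition"
begin

section \<open>Discrete measurable groupoids\<close>

definition standard_borel :: "'a measure \<Rightarrow> bool" where
  "standard_borel M \<longleftrightarrow>
     (\<exists>T. completely_metrizable_space T \<and> second_countable T \<and> topspace T = space M \<and>
          sets M = sigma_sets (space M) {U. openin T U})"

text \<open>
  Only the measurable space underlying \<open>arr\<close> matters; the measure is \<open>umeas\<close>, which lives on
  the unit space. Units are identified with objects, so source and range are maps from
  arrows to arrows.
\<close>

record 'g mgroupoid =
  arr :: "'g measure"
  src :: "'g \<Rightarrow> 'g"
  rng :: "'g \<Rightarrow> 'g"
  gmul :: "'g \<Rightarrow> 'g \<Rightarrow> 'g"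
  ginv :: "'g \<Rightarrow> 'g"
  umeas :: "'g measure"

definition arrows :: "('g, 'z) mgroupoid_scheme \<Rightarrow> 'g set" where
  "arrows \<G> = space (arr \<G>)"

definition units :: "('g, 'z) mgroupoid_scheme \<Rightarrow> 'g set" where
  "units \<G> = src \<G> ` arrows \<G>"

locale groupoid =
  fixes \<G> :: "('g, 'z) mgroupoid_scheme"
  assumes src_arrow: "x \<in> arrows \<G> \<Longrightarrow> src \<G> x \<in> arrows \<G>"
    and rng_unit: "x \<in> arrows \<G> \<Longrightarrow> rng \<G> x \<in> units \<G>"
    and src_of_unit: "u \<in> units \<G> \<Longrightarrow> src \<G> u = u"
    and rng_of_unit: "u \<in> units \<G> \<Longrightarrow> rng \<G> u = u"
    and gmul_arrow: "\<lbrakk>x \<in> arrows \<G>; y \<in> arrows \<G>; src \<G> x = rng \<G> y\<rbrakk> \<Longrightarrow> gmul \<G> x y \<in> arrows \<G>"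
    and src_gmul: "\<lbrakk>x \<in> arrows \<G>; y \<in> arrows \<G>; src \<G> x = rng \<G> y\<rbrakk> \<Longrightarrow> src \<G> (gmul \<G> x y) = src \<G> y"
    and rng_gmul: "\<lbrakk>x \<in> arrows \<G>; y \<in> arrows \<G>; src \<G> x = rng \<G> y\<rbrakk> \<Longrightarrow> rng \<G> (gmul \<G> x y) = rng \<G> x"
    and gmul_assoc: "\<lbrakk>x \<in> arrows \<G>; y \<in> arrows \<G>; z \<in> arrows \<G>; src \<G> x = rng \<G> y; src \<G> y = rng \<G> z\<rbrakk>
          \<Longrightarrow> gmul \<G> (gmul \<G> x y) z = gmul \<G> x (gmul \<G> y z)"
    and gmul_src: "x \<in> arrows \<G> \<Longrightarrow> gmul \<G> x (src \<G> x) = x"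
    and rng_gmul_id: "x \<in> arrows \<G> \<Longrightarrow> gmul \<G> (rng \<G> x) x = x"
    and ginv_arrow: "x \<in> arrows \<G> \<Longrightarrow> ginv \<G> x \<in> arrows \<G>"
    and src_ginv: "x \<in> arrows \<G> \<Longrightarrow> src \<G> (ginv \<G> x) = rng \<G> x"
    and rng_ginv: "x \<in> arrows \<G> \<Longrightarrow> rng \<G> (ginv \<G> x) = src \<G> x"
    and gmul_ginv: "x \<in> arrows \<G> \<Longrightarrow> gmul \<G> x (ginv \<G> x) = rng \<G> x"
    and ginv_gmul: "x \<in> arrows \<G> \<Longrightarrow> gmul \<G> (ginv \<G> x) x = src \<G> x"

definition composable :: "('g, 'z) mgroupoid_scheme \<Rightarrow> ('g \<times> 'g) set" where
  "composable \<G> = {(x, y) \<in> arrows \<G> \<times> arrows \<G>. src \<G> x = rng \<G> y}"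

locale discrete_measurable_groupoid = groupoid +
  assumes standard: "standard_borel (arr \<G>)"
    and units_borel: "units \<G> \<in> sets (arr \<G>)"
    and src_borel: "src \<G> \<in> measurable (arr \<G>) (arr \<G>)"
    and rng_borel: "rng \<G> \<in> measurable (arr \<G>) (arr \<G>)"
    and gmul_borel: "(\<lambda>(x, y). gmul \<G> x y)
          \<in> measurable (restrict_space (arr \<G> \<Otimes>\<^sub>M arr \<G>) (composable \<G>)) (arr \<G>)"
    and ginv_borel: "ginv \<G> \<in> measurable (arr \<G>) (arr \<G>)"
    and countable_fibre: "u \<in> units \<G> \<Longrightarrow> countable {x \<in> arrows \<G>. src \<G> x = u}"

locale pmp_groupoid = discrete_measurable_groupoid +
  assumes umeas_prob: "prob_space (umeas \<G>)"
    and sets_umeas: "sets (umeas \<G>) = sets (restrict_space (arr \<G>) (units \<G>))"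
    and invariant: "B \<in> sets (arr \<G>) \<Longrightarrow>
          (\<integral>\<^sup>+u. emeasure (count_space UNIV) {x \<in> B. src \<G> x = u} \<partial>umeas \<G>)
        = (\<integral>\<^sup>+u. emeasure (count_space UNIV) {x \<in> B. rng \<G> x = u} \<partial>umeas \<G>)"

definition gmeas :: "('g, 'z) mgroupoid_scheme \<Rightarrow> 'g measure" where
  "gmeas \<G> = measure_of (arrows \<G>) (sets (arr \<G>))
     (\<lambda>B. \<integral>\<^sup>+u. emeasure (count_space UNIV) {x \<in> B. src \<G> x = u} \<partial>umeas \<G>)"


section \<open>The Hilbert space of square-integrable functions and its operators\<close>

text \<open>
  Vectors are almost-everywhere equivalence classes of measurable square-integrable functions.
  The operations on classes are computed on arbitrary representatives.
\<close>

type_synonym 'g vect = "('g \<Rightarrow> complex) set"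
type_synonym 'g oper = "'g vect \<Rightarrow> 'g vect"

definition l2_class :: "'g measure \<Rightarrow> ('g \<Rightarrow> complex) \<Rightarrow> 'g vect" where
  "l2_class M f = {h \<in> borel_measurable M. AE x in M. h x = f x}"

definition L2 :: "'g measure \<Rightarrow> 'g vect set" where
  "L2 M = l2_class M ` {f \<in> borel_measurable M. integrable M (\<lambda>x. (cmod (f x))\<^sup>2)}"

definition l2_rep :: "'g vect \<Rightarrow> 'g \<Rightarrow> complex" where
  "l2_rep a = (SOME f. f \<in> a)"

definition l2_add :: "'g measure \<Rightarrow> 'g vect \<Rightarrow> 'g vect \<Rightarrow> 'g vect" where
  "l2_add M a b = l2_class M (\<lambda>x. l2_rep a x + l2_rep b x)"

definition l2_scale :: "'g measure \<Rightarrow> complex \<Rightarrow> 'g vect \<Rightarrow> 'g vect" where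
  "l2_scale M c a = l2_class M (\<lambda>x. c * l2_rep a x)"

definition l2_inner :: "'g measure \<Rightarrow> 'g vect \<Rightarrow> 'g vect \<Rightarrow> complex" where
  "l2_inner M a b = (LINT x|M. l2_rep a x * cnj (l2_rep b x))"

definition l2_norm :: "'g measure \<Rightarrow> 'g vect \<Rightarrow> real" where
  "l2_norm M a = sqrt (Re (l2_inner M a a))"

text \<open>Operators are functions on \<^term>\<open>L2 M\<close>, extensional so that equality is equality on \<^term>\<open>L2 M\<close>.\<close>

definition bounded_ops :: "'g measure \<Rightarrow> 'g oper set" where
  "bounded_ops M = {T \<in> L2 M \<rightarrow>\<^sub>E L2 M.
     (\<forall>a\<in>L2 M. \<forall>b\<in>L2 M. T (l2_add M a b) = l2_add M (T a) (T b)) \<and>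
     (\<forall>c. \<forall>a\<in>L2 M. T (l2_scale M c a) = l2_scale M c (T a)) \<and>
     (\<exists>K. \<forall>a\<in>L2 M. l2_norm M (T a) \<le> K * l2_norm M a)}"

definition op_zero :: "'g measure \<Rightarrow> 'g oper" where
  "op_zero M = (\<lambda>a\<in>L2 M. l2_class M (\<lambda>x. 0))"

definition op_id :: "'g measure \<Rightarrow> 'g oper" where
  "op_id M = (\<lambda>a\<in>L2 M. a)"

definition op_add :: "'g measure \<Rightarrow> 'g oper \<Rightarrow> 'g oper \<Rightarrow> 'g oper" where
  "op_add M S T = (\<lambda>a\<in>L2 M. l2_add M (S a) (T a))"

definition op_scale :: "'g measure \<Rightarrow> complex \<Rightarrow> 'g oper \<Rightarrow> 'g oper" where
  "op_scale M c T = (\<lambda>a\<in>L2 M. l2_scale M c (T a))"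

definition op_mult :: "'g measure \<Rightarrow> 'g oper \<Rightarrow> 'g oper \<Rightarrow> 'g oper" where
  "op_mult M S T = compose (L2 M) S T"

definition op_adjoint :: "'g measure \<Rightarrow> 'g oper \<Rightarrow> 'g oper" where
  "op_adjoint M T = (THE S. S \<in> bounded_ops M \<and>
     (\<forall>a\<in>L2 M. \<forall>b\<in>L2 M. l2_inner M (T a) b = l2_inner M a (S b)))"

definition op_subspace :: "'g measure \<Rightarrow> 'g oper set \<Rightarrow> bool" where
  "op_subspace M V \<longleftrightarrow> op_zero M \<in> V \<and> (\<forall>S\<in>V. \<forall>T\<in>V. op_add M S T \<in> V) \<and>
     (\<forall>c. \<forall>T\<in>V. op_scale M c T \<in> V)"

definition commutant :: "'g measure \<Rightarrow> 'g oper set \<Rightarrow> 'g oper set" where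
  "commutant M \<Omega> = {T \<in> bounded_ops M. \<forall>S\<in>\<Omega>. op_mult M T S = op_mult M S T}"

definition op_prod :: "'g measure \<Rightarrow> 'g oper list \<Rightarrow> 'g oper" where
  "op_prod M ss = foldr (op_mult M) ss (op_id M)"

definition adjoint_set :: "'g measure \<Rightarrow> 'g oper set \<Rightarrow> 'g oper set" where
  "adjoint_set M \<Omega> = op_adjoint M ` \<Omega>"

definition powers :: "'g measure \<Rightarrow> 'g oper set \<Rightarrow> nat \<Rightarrow> 'g oper set" where
  "powers M \<Omega> n = {op_prod M ss | ss. length ss = n \<and> set ss \<subseteq> \<Omega>}"

definition powers_le :: "'g measure \<Rightarrow> 'g oper set \<Rightarrow> nat \<Rightarrow> 'g oper set" where
  "powers_le M \<Omega> n = (\<Union>k\<in>{1..n}. powers M \<Omega> k)"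


section \<open>The inverse semigroup and the von Neumann algebra of a groupoid\<close>

definition bisections :: "('g, 'z) mgroupoid_scheme \<Rightarrow> 'g set set" where
  "bisections \<G> = {B \<in> sets (arr \<G>). inj_on (src \<G>) B \<and> inj_on (rng \<G>) B}"

definition bis_fun :: "('g, 'z) mgroupoid_scheme \<Rightarrow> 'g set \<Rightarrow> ('g \<Rightarrow> complex) \<Rightarrow> 'g \<Rightarrow> complex" where
  "bis_fun \<G> B \<xi> x =
     (let P = (\<lambda>y. y \<in> arrows \<G> \<and> rng \<G> y = src \<G> x \<and> gmul \<G> x y \<in> B)
      in if \<exists>y. P y then \<xi> (ginv \<G> (THE y. P y)) else 0)"

definition bis_op :: "('g, 'z) mgroupoid_scheme \<Rightarrow> 'g set \<Rightarrow> 'g oper" where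
  "bis_op \<G> B = (\<lambda>a\<in>L2 (gmeas \<G>). l2_class (gmeas \<G>) (bis_fun \<G> B (l2_rep a)))"

definition inv_semigroup :: "('g, 'z) mgroupoid_scheme \<Rightarrow> 'g oper set" where
  "inv_semigroup \<G> = bis_op \<G> ` bisections \<G>"

text \<open>
  The generating set is self-adjoint and contains the identity, so the von Neumann algebra it
  generates is its double commutant.
\<close>

definition VN :: "('g, 'z) mgroupoid_scheme \<Rightarrow> 'g oper set" where
  "VN \<G> = commutant (gmeas \<G>) (commutant (gmeas \<G>) (inv_semigroup \<G>))"

definition vn_trace :: "('g, 'z) mgroupoid_scheme \<Rightarrow> 'g oper \<Rightarrow> complex" where
  "vn_trace \<G> T = (let \<eta> = l2_class (gmeas \<G>) (indicator (units \<G>))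
                   in l2_inner (gmeas \<G>) (T \<eta>) \<eta>)"

definition vn_span :: "('g, 'z) mgroupoid_scheme \<Rightarrow> 'g oper set \<Rightarrow> 'g oper set" where
  "vn_span \<G> \<Omega> = (\<lambda>V. V \<subseteq> VN \<G> \<and> op_subspace (gmeas \<G>) V) hull \<Omega>"


section \<open>Matrices\<close>

definition ntrace :: "complex mat \<Rightarrow> complex" where
  "ntrace A = (\<Sum>i<dim_row A. A $$ (i, i)) / of_nat (dim_row A)"

definition hs_norm :: "complex mat \<Rightarrow> real" where
  "hs_norm A = sqrt (Re (ntrace (mat_adjoint A * A)))"

definition partial_perm_mats :: "nat \<Rightarrow> complex mat set" where
  "partial_perm_mats d = {A \<in> carrier_mat d d. A * mat_adjoint A * A = A \<and>
     (\<forall>i<d. \<forall>j<d. A $$ (i, j) \<in> {0, 1})}"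

definition mat_prod :: "nat \<Rightarrow> complex mat list \<Rightarrow> complex mat" where
  "mat_prod d As = foldr (*) As (1\<^sub>m d)"


section \<open>Sofic dimension\<close>

definition linear_maps :: "('g, 'z) mgroupoid_scheme \<Rightarrow> nat \<Rightarrow> ('g oper \<Rightarrow> complex mat) set" where
  "linear_maps \<G> d = {\<phi> \<in> vn_span \<G> (inv_semigroup \<G>) \<rightarrow>\<^sub>E carrier_mat d d.
     (\<forall>S\<in>vn_span \<G> (inv_semigroup \<G>). \<forall>T\<in>vn_span \<G> (inv_semigroup \<G>).
        \<phi> (op_add (gmeas \<G>) S T) = \<phi> S + \<phi> T) \<and>
     (\<forall>c. \<forall>T\<in>vn_span \<G> (inv_semigroup \<G>). \<phi> (op_scale (gmeas \<G>) c T) = c \<cdot>\<^sub>m \<phi> T)}"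

definition SA :: "('g, 'z) mgroupoid_scheme \<Rightarrow> 'g oper set \<Rightarrow> nat \<Rightarrow> real \<Rightarrow> nat
    \<Rightarrow> ('g oper \<Rightarrow> complex mat) set" where
  "SA \<G> F n \<delta> d = {\<phi> \<in> linear_maps \<G> d.
     (let M = gmeas \<G>; F' = F \<union> adjoint_set M F in
       (\<forall>ss. set ss \<subseteq> F' \<and> 1 \<le> length ss \<and> length ss \<le> n \<longrightarrow>
          hs_norm (\<phi> (op_prod M ss) - mat_prod d (map \<phi> ss)) < \<delta>) \<and>
       \<phi> ` powers_le M F' n \<subseteq> partial_perm_mats d \<and>
       (\<forall>s\<in>powers_le M F' n. cmod (ntrace (\<phi> s) - vn_trace \<G> s) < \<delta>))}"

definition restrictions :: "'a set \<Rightarrow> ('a \<Rightarrow> 'b) set \<Rightarrow> ('a \<Rightarrow> 'b) set" where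
  "restrictions E Y = (\<lambda>\<phi>. restrict \<phi> E) ` Y"

text \<open>
  The set of restrictions to \<open>E\<close> can be infinite when \<open>E\<close> is not contained in \<open>F\<close>, so infinite
  cardinality has to be told apart from cardinality zero.
\<close>

definition log_card :: "'a set \<Rightarrow> ereal" where
  "log_card A = (if infinite A then \<infinity> else if A = {} then -\<infinity> else ereal (ln (real (card A))))"

text \<open>\<open>L\<close> is the limit functional as the matrix size tends to infinity: upper or lower limit.\<close>

definition sofic_rate :: "((nat \<Rightarrow> ereal) \<Rightarrow> ereal) \<Rightarrow> ('g, 'z) mgroupoid_scheme \<Rightarrow> 'g oper set
    \<Rightarrow> 'g oper set \<Rightarrow> nat \<Rightarrow> real \<Rightarrow> ereal" where
  "sofic_rate L \<G> E F n \<delta> =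
     L (\<lambda>d. ereal (1 / (real d * ln (real d))) * log_card (restrictions E (SA \<G> F n \<delta> d)))"

definition sofic_rate_inf :: "((nat \<Rightarrow> ereal) \<Rightarrow> ereal) \<Rightarrow> ('g, 'z) mgroupoid_scheme \<Rightarrow> 'g oper set
    \<Rightarrow> 'g oper set \<Rightarrow> ereal" where
  "sofic_rate_inf L \<G> E F = (INF n\<in>{1..}. INF \<delta>\<in>{0<..}. sofic_rate L \<G> E F n \<delta>)"

definition sofic_dim_wrt :: "((nat \<Rightarrow> ereal) \<Rightarrow> ereal) \<Rightarrow> ('g, 'z) mgroupoid_scheme \<Rightarrow> ereal" where
  "sofic_dim_wrt L \<G> =
     (SUP E\<in>{E. finite E \<and> E \<subseteq> inv_semigroup \<G>}.
        INF F\<in>{F. finite F \<and> F \<subseteq> inv_semigroup \<G>}. sofic_rate_inf L \<G> E F)"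

definition sofic_dim :: "('g, 'z) mgroupoid_scheme \<Rightarrow> ereal" where
  "sofic_dim \<G> = sofic_dim_wrt (\<lambda>a. limsup a) \<G>"

definition lower_sofic_dim :: "('g, 'z) mgroupoid_scheme \<Rightarrow> ereal" where
  "lower_sofic_dim \<G> = sofic_dim_wrt (\<lambda>a. liminf a) \<G>"


section \<open>Measure-preserving actions\<close>

definition standard_prob_space :: "'x measure \<Rightarrow> bool" where
  "standard_prob_space M \<longleftrightarrow> prob_space M \<and> standard_borel M"

definition pmp_action :: "('a, 'z) monoid_scheme \<Rightarrow> 'x measure \<Rightarrow> ('a \<Rightarrow> 'x \<Rightarrow> 'x) \<Rightarrow> bool" where
  "pmp_action G M \<alpha> \<longleftrightarrow> group_action G (space M) \<alpha> \<and>
     (\<forall>g\<in>carrier G. \<alpha> g \<in> measurable M M \<and> distr M M (\<alpha> g) = M)"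

definition action_groupoid :: "('a, 'z) monoid_scheme \<Rightarrow> 'x measure \<Rightarrow> ('a \<Rightarrow> 'x \<Rightarrow> 'x)
    \<Rightarrow> ('a \<times> 'x) mgroupoid" where
  "action_groupoid G M \<alpha> =
     (let A = count_space (carrier G) \<Otimes>\<^sub>M M in
      \<lparr> arr = A,
        src = (\<lambda>(g, x). (\<one>\<^bsub>G\<^esub>, x)),
        rng = (\<lambda>(g, x). (\<one>\<^bsub>G\<^esub>, \<alpha> g x)),
        gmul = (\<lambda>(h, y) (g, x). (h \<otimes>\<^bsub>G\<^esub> g, x)),
        ginv = (\<lambda>(g, x). (inv\<^bsub>G\<^esub> g, \<alpha> g x)),
        umeas = distr M (restrict_space A ({\<one>\<^bsub>G\<^esub>} \<times> space M)) (\<lambda>x. (\<one>\<^bsub>G\<^esub>, x)) \<rparr>)"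

definition action_sofic_dim :: "('a, 'z) monoid_scheme \<Rightarrow> 'x measure \<Rightarrow> ('a \<Rightarrow> 'x \<Rightarrow> 'x) \<Rightarrow> ereal" where
  "action_sofic_dim G M \<alpha> = sofic_dim (action_groupoid G M \<alpha>)"

definition action_lower_sofic_dim :: "('a, 'z) monoid_scheme \<Rightarrow> 'x measure \<Rightarrow> ('a \<Rightarrow> 'x \<Rightarrow> 'x) \<Rightarrow> ereal" where
  "action_lower_sofic_dim G M \<alpha> = lower_sofic_dim (action_groupoid G M \<alpha>)"


section \<open>Free groups\<close>

text \<open>The letter \<open>(i, b)\<close> is the \<open>i\<close>-th generator if \<open>b\<close> holds and its inverse otherwise.\<close>

type_synonym letter = "nat \<times> bool"

definition flip :: "letter \<Rightarrow> letter" where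
  "flip a = (fst a, \<not> snd a)"

definition reduced :: "letter list \<Rightarrow> bool" where
  "reduced w \<longleftrightarrow> successively (\<lambda>a b. b \<noteq> flip a) w"

text \<open>Left multiplication of a reduced word by a letter, with cancellation.\<close>

fun push :: "letter \<Rightarrow> letter list \<Rightarrow> letter list" where
  "push a [] = [a]"
| "push a (b # w) = (if b = flip a then w else a # b # w)"

definition free_group :: "nat \<Rightarrow> letter list monoid" where
  "free_group r =
     \<lparr> carrier = {w. reduced w \<and> set w \<subseteq> {..<r} \<times> UNIV},
       mult = (\<lambda>v w. foldr push v w),
       one = [] \<rparr>"

lemma flip_flip [simp]: "flip (flip a) = a"
  by (simp add: flip_def)

lemma reduced_Nil [simp]: "reduced []"
  by (simp add: reduced_def)

lemma reduced_Cons: "reduced (a # w) \<longleftrightarrow> (w = [] \<or> hd w \<noteq> flip a) \<and> reduced w"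
  by (cases w) (auto simp: reduced_def)

lemma reduced_push: "reduced w \<Longrightarrow> reduced (push a w)"
  by (cases w) (auto simp: reduced_Cons)

lemma set_push: "set (push a w) \<subseteq> insert a (set w)"
  by (cases w) auto

lemma push_push: "reduced w \<Longrightarrow> push a (push (flip a) w) = w"
proof (cases w)
  case (Cons b v)
  assume "reduced w"
  then show ?thesis using Cons by (cases v) (auto simp: reduced_Cons)
qed simp

lemma push_reduced_Cons: "reduced (a # w) \<Longrightarrow> push a w = a # w"
  by (cases w) (auto simp: reduced_Cons)

lemma reduced_foldr_push: "reduced w \<Longrightarrow> reduced (foldr push v w)"
  by (induction v) (auto intro: reduced_push)

lemma set_foldr_push: "set (foldr push v w) \<subseteq> set v \<union> set w"
proof (induction v)
  case (Cons a v)
  then show ?case using set_push[of a "foldr push v w"] by auto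
qed simp

lemma foldr_push_push: "reduced w \<Longrightarrow> foldr push (push a v) w = push a (foldr push v w)"
proof (cases v)
  case (Cons b u)
  assume "reduced w"
  then show ?thesis using Cons push_push[OF reduced_foldr_push, of w a u] by auto
qed simp

lemma foldr_push_assoc:
  "reduced w \<Longrightarrow> foldr push (foldr push u v) w = foldr push u (foldr push v w)"
  by (induction u) (simp_all add: foldr_push_push)

lemma foldr_push_Nil: "reduced v \<Longrightarrow> foldr push v [] = v"
  by (induction v) (auto simp: reduced_Cons push_reduced_Cons)

lemma foldr_push_inverse: "reduced w \<Longrightarrow> foldr push (rev (map flip w)) w = []"
proof (induction w)
  case (Cons a w)
  have "foldr push (rev (map flip (a # w))) (a # w) = foldr push (rev (map flip w)) w"
    by simp
  then show ?case using Cons by (simp add: reduced_Cons)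
qed simp

theorem group_free_group: "group (free_group r)"
proof (rule groupI)
  fix w assume w: "w \<in> carrier (free_group r)"
  define v where "v = foldr push (rev (map flip w)) []"
  have "set v \<subseteq> flip ` set w"
    using set_foldr_push[of "rev (map flip w)" "[]"] by (auto simp: v_def)
  also have "\<dots> \<subseteq> {..<r} \<times> UNIV"
    using w by (auto simp: free_group_def flip_def)
  finally have "v \<in> carrier (free_group r)"
    by (auto simp: free_group_def v_def intro!: reduced_foldr_push)
  moreover have "foldr push v w = []"
    using w foldr_push_assoc[of w "rev (map flip w)" "[]"]
    by (simp add: v_def free_group_def foldr_push_inverse)
  ultimately show "\<exists>v\<in>carrier (free_group r). v \<otimes>\<^bsub>free_group r\<^esub> w = \<one>\<^bsub>free_group r\<^esub>"
    by (auto simp: free_group_def)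
next
  fix u v assume "u \<in> carrier (free_group r)" "v \<in> carrier (free_group r)"
  then show "u \<otimes>\<^bsub>free_group r\<^esub> v \<in> carrier (free_group r)"
    using set_foldr_push[of u v] by (auto simp: free_group_def intro!: reduced_foldr_push)
qed (auto simp: free_group_def foldr_push_assoc)

lemma countable_free_group: "countable (carrier (free_group r))"
  by (rule countable_subset[OF subset_UNIV]) simp


section \<open>The groupoid of a measure-preserving action\<close>

lemma standard_borel_count_space_pair:
  assumes I: "countable I" and M: "standard_borel M"
  shows "standard_borel (count_space I \<Otimes>\<^sub>M M)"
proof -
  obtain T where T: "completely_metrizable_space T" "second_countable T" "topspace T = space M"
    "sets M = sigma_sets (space M) {U. openin T U}"
    using M by (auto simp: standard_borel_def)
  let ?P = "prod_topology (discrete_topology I) T"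
  let ?S = "sigma_sets (I \<times> space M) {U. openin ?P U}"
  obtain \<B> where \<B>: "countable \<B>" "\<And>V. V \<in> \<B> \<Longrightarrow> openin T V"
    "\<And>U x. openin T U \<Longrightarrow> x \<in> U \<Longrightarrow> \<exists>V\<in>\<B>. x \<in> V \<and> V \<subseteq> U"
    using T(2) unfolding second_countable_def by metis
  interpret S: sigma_algebra "I \<times> space M" ?S
    using openin_subset[of ?P] T(3) by (intro sigma_algebra_sigma_sets) auto
  have cm: "completely_metrizable_space ?P"
    using T(1) by (simp add: completely_metrizable_space_prod_topology
        completely_metrizable_space_discrete_topology)
  have sc: "second_countable ?P"
    unfolding second_countable_def
  proof (intro exI conjI allI impI ballI)
    let ?B = "(\<lambda>(i, V). {i} \<times> V) ` (I \<times> \<B>)"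
    show "countable ?B" using I \<B>(1) by auto
    show "openin ?P V" if "V \<in> ?B" for V
      using that \<B>(2) by (auto simp: openin_prod_Times_iff)
    show "\<exists>V\<in>?B. p \<in> V \<and> V \<subseteq> U" if U: "openin ?P U \<and> p \<in> U" for U p
    proof -
      obtain i x where p: "p = (i, x)" by (cases p)
      obtain C D where CD: "openin (discrete_topology I) C" "openin T D" "i \<in> C" "x \<in> D" "C \<times> D \<subseteq> U"
        using openin_prod_topology_alt[THEN iffD1, OF conjunct1[OF U], rule_format, of i x] U p by auto
      obtain V where V: "V \<in> \<B>" "x \<in> V" "V \<subseteq> D" using \<B>(3)[OF CD(2,4)] by blast
      have "i \<in> I" using CD by auto
      then show ?thesis
        using V CD p by (intro bexI[of _ "{i} \<times> V"]) auto
    qed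
  qed
  have slice: "{i} \<times> b \<in> ?S" if "i \<in> I" "b \<in> sets M" for i b
  proof -
    have "b \<in> sigma_sets (space M) {U. openin T U}" using that T(4) by simp
    then show ?thesis
    proof induction
      case (Basic a)
      then have "openin ?P ({i} \<times> a)" using that by (simp add: openin_prod_Times_iff)
      then show ?case by (intro sigma_sets.Basic) simp
    next
      case (Compl a)
      have "{i} \<times> space M \<in> ?S"
      proof (intro sigma_sets.Basic CollectI)
        show "openin ?P ({i} \<times> space M)"
          using that openin_topspace[of T] unfolding T(3) by (simp add: openin_prod_Times_iff)
      qed
      moreover have "{i} \<times> (space M - a) = {i} \<times> space M - {i} \<times> a" by auto
      ultimately show ?case using Compl by (metis S.Diff)
    next
      case (Union a)
      have "{i} \<times> (\<Union>n. a n) = (\<Union>n. {i} \<times> a n)" by auto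
      then show ?case using Union by (metis sigma_sets.Union)
    qed (simp add: sigma_sets.Empty)
  qed
  have "sets (count_space I \<Otimes>\<^sub>M M) = ?S"
  proof
    show "sets (count_space I \<Otimes>\<^sub>M M) \<subseteq> ?S"
      unfolding sets_pair_measure space_count_space
    proof (rule sigma_sets_mono, safe)
      fix a b assume "a \<in> sets (count_space I)" "b \<in> sets M"
      then have a: "a \<subseteq> I" and b: "b \<in> sets M" by auto
      have "a \<times> b = (\<Union>i\<in>a. {i} \<times> b)" by auto
      also have "\<dots> \<in> ?S"
        using a b slice countable_subset[OF a I] by (intro S.countable_UN') auto
      finally show "a \<times> b \<in> ?S" .
    qed
    show "?S \<subseteq> sets (count_space I \<Otimes>\<^sub>M M)"
    proof -
      have "U \<in> sets (count_space I \<Otimes>\<^sub>M M)" if U: "openin ?P U" for U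
      proof -
        have sub: "U \<subseteq> I \<times> space M" using openin_subset[OF U] T(3) by auto
        have "openin T {x. (i, x) \<in> U}" if "i \<in> I" for i
          unfolding openin_subopen[of T "{x. (i, x) \<in> U}"]
        proof safe
          fix x assume "(i, x) \<in> U"
          then obtain C D where "openin T D" "i \<in> C" "x \<in> D" "C \<times> D \<subseteq> U"
            using openin_prod_topology_alt[THEN iffD1, OF U, rule_format, of i x] by blast
          then show "\<exists>W. openin T W \<and> x \<in> W \<and> W \<subseteq> {x. (i, x) \<in> U}" by blast
        qed
        then have "{x. (i, x) \<in> U} \<in> sets M" if "i \<in> I" for i
          using that T(4) by auto
        then have "(\<Union>i\<in>I. {i} \<times> {x. (i, x) \<in> U}) \<in> sets (count_space I \<Otimes>\<^sub>M M)"
          using I by (intro sets.countable_UN') auto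
        moreover have "(\<Union>i\<in>I. {i} \<times> {x. (i, x) \<in> U}) = U" using sub by auto
        ultimately show ?thesis by simp
      qed
      then show ?thesis
        using sets.sigma_sets_subset[of "{U. openin ?P U}" "count_space I \<Otimes>\<^sub>M M"]
        by (auto simp: space_pair_measure)
    qed
  qed
  then show ?thesis
    unfolding standard_borel_def using cm sc T(3)
    by (intro exI[of _ ?P]) (auto simp: space_pair_measure)
qed

theorem pmp_groupoid_action_groupoid:
  assumes G: "countable (carrier G)" and M: "standard_prob_space M" and act: "pmp_action G M \<alpha>"
  shows "pmp_groupoid (action_groupoid G M \<alpha>)"
proof -
  interpret group_action G "space M" \<alpha> using act by (simp add: pmp_action_def)
  interpret group G using group_hom group_hom.axioms(1) by blast
  interpret M: prob_space M using M by (simp add: standard_prob_space_def)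
  let ?A = "count_space (carrier G) \<Otimes>\<^sub>M M"
  let ?\<G> = "action_groupoid G M \<alpha>"
  note defs = action_groupoid_def Let_def
  have meas: "\<alpha> g \<in> measurable M M" and pres: "distr M M (\<alpha> g) = M" if "g \<in> carrier G" for g
    using act that by (auto simp: pmp_action_def)
  have sp: "\<alpha> g x \<in> space M" if "g \<in> carrier G" "x \<in> space M" for g x
    using element_image[OF that] by simp
  have one: "\<alpha> \<one>\<^bsub>G\<^esub> x = x" if "x \<in> space M" for x
    using id_eq_one that by (metis restrict_apply')
  have mul: "\<alpha> (g \<otimes>\<^bsub>G\<^esub> h) x = \<alpha> g (\<alpha> h x)" if "g \<in> carrier G" "h \<in> carrier G" "x \<in> space M" for g h x
    using composition_rule[OF that(3,1,2)] by simp
  have invl: "\<alpha> (inv\<^bsub>G\<^esub> g) (\<alpha> g x) = x" if "g \<in> carrier G" "x \<in> space M" for g x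
    using that by (metis inv_closed l_inv mul one)
  have invr: "\<alpha> g (\<alpha> (inv\<^bsub>G\<^esub> g) x) = x" if "g \<in> carrier G" "x \<in> space M" for g x
    using that by (metis inv_closed r_inv mul one)
  have arrows: "arrows ?\<G> = carrier G \<times> space M"
    by (simp add: arrows_def defs space_pair_measure)
  have units: "units ?\<G> = {\<one>\<^bsub>G\<^esub>} \<times> space M"
    unfolding units_def arrows by (force simp: defs)
  have arr: "arr ?\<G> = ?A" by (simp add: defs)
  have um: "umeas ?\<G> = distr M (restrict_space ?A ({\<one>\<^bsub>G\<^esub>} \<times> space M)) (\<lambda>x. (\<one>\<^bsub>G\<^esub>, x))"
    by (simp add: defs)
  have sel: "src ?\<G> (g, x) = (\<one>\<^bsub>G\<^esub>, x)" "rng ?\<G> (g, x) = (\<one>\<^bsub>G\<^esub>, \<alpha> g x)"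
      "gmul ?\<G> (h, y) (g, x) = (h \<otimes>\<^bsub>G\<^esub> g, x)" "ginv ?\<G> (g, x) = (inv\<^bsub>G\<^esub> g, \<alpha> g x)" for g h x y
    by (simp_all add: defs)
  have act_meas: "(\<lambda>p. \<alpha> (fst p) (snd p)) \<in> measurable ?A M"
    by (rule measurable_pair_measure_countable1[OF G]) (simp add: meas)
  have emb: "(\<lambda>x. (\<one>\<^bsub>G\<^esub>, x)) \<in> measurable M (restrict_space ?A ({\<one>\<^bsub>G\<^esub>} \<times> space M))"
    by (rule measurable_restrict_space2) auto
  have key: "(\<integral>\<^sup>+u. emeasure (count_space UNIV) {p \<in> B. f p = u} \<partial>umeas ?\<G>)
       = (\<integral>\<^sup>+g. emeasure M {x \<in> space M. (g, x) \<in> B} \<partial>count_space (carrier G))"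
    if B: "B \<in> sets ?A" and f: "\<And>g x. g \<in> carrier G \<Longrightarrow> x \<in> space M \<Longrightarrow> f (g, x) = (\<one>\<^bsub>G\<^esub>, \<beta> g x)"
      and \<beta>: "\<And>g. g \<in> carrier G \<Longrightarrow> \<beta>' g \<in> measurable M M"
             "\<And>g. g \<in> carrier G \<Longrightarrow> distr M M (\<beta>' g) = M"
             "\<And>g x. g \<in> carrier G \<Longrightarrow> x \<in> space M \<Longrightarrow> \<beta> g x \<in> space M"
             "\<And>g x. g \<in> carrier G \<Longrightarrow> x \<in> space M \<Longrightarrow> \<beta> g (\<beta>' g x) = x"
             "\<And>g x. g \<in> carrier G \<Longrightarrow> x \<in> space M \<Longrightarrow> \<beta>' g (\<beta> g x) = x" for B f \<beta> \<beta>'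
  proof -
    have Bsub: "B \<subseteq> carrier G \<times> space M"
      using sets.sets_into_space[OF B] by (simp add: space_pair_measure)
    have \<beta>'sp: "\<beta>' g x \<in> space M" if "g \<in> carrier G" "x \<in> space M" for g x
      using \<beta>(1)[OF that(1)] that(2) by (rule measurable_space)
    have fib: "emeasure (count_space UNIV) {p \<in> B. f p = (\<one>\<^bsub>G\<^esub>, x)}
        = (\<integral>\<^sup>+g. indicator B (g, \<beta>' g x) \<partial>count_space (carrier G))" if x: "x \<in> space M" for x
    proof -
      let ?K = "{g \<in> carrier G. (g, \<beta>' g x) \<in> B}"
      have "{p \<in> B. f p = (\<one>\<^bsub>G\<^esub>, x)} = (\<lambda>g. (g, \<beta>' g x)) ` ?K"
      proof safe
        fix g y assume gy: "(g, y) \<in> B" "f (g, y) = (\<one>\<^bsub>G\<^esub>, x)"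
        then have "g \<in> carrier G" "y \<in> space M" using Bsub by auto
        then have "y = \<beta>' g x" using gy(2) f \<beta>(5) by auto
        then show "(g, y) \<in> (\<lambda>g. (g, \<beta>' g x)) ` ?K" using gy \<open>g \<in> carrier G\<close> by auto
      next
        fix g assume "g \<in> carrier G" 
        then show "f (g, \<beta>' g x) = (\<one>\<^bsub>G\<^esub>, x)" using f \<beta>(4) \<beta>'sp x by auto
      qed
      then have "emeasure (count_space UNIV) {p \<in> B. f p = (\<one>\<^bsub>G\<^esub>, x)} = emeasure (count_space (carrier G)) ?K"
        by (simp add: emeasure_count_space inj_on_def card_image finite_image_iff)
      also have "\<dots> = (\<integral>\<^sup>+g. indicator ?K g \<partial>count_space (carrier G))"
        by (subst nn_integral_indicator) auto
      also have "\<dots> = (\<integral>\<^sup>+g. indicator B (g, \<beta>' g x) \<partial>count_space (carrier G))"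
        by (rule nn_integral_cong) (auto simp: indicator_def)
      finally show ?thesis .
    qed
    have ind: "(\<lambda>y. indicator B (g, y) :: ennreal) \<in> borel_measurable M" if "g \<in> carrier G" for g
    proof -
      have "(\<lambda>y. (g, y)) \<in> measurable M ?A" using that by simp
      then show ?thesis using B by measurable
    qed
    have ind': "(\<lambda>y. indicator B (g, \<beta>' g y) :: ennreal) \<in> borel_measurable M" if "g \<in> carrier G" for g
      using measurable_compose[OF \<beta>(1)[OF that] ind[OF that]] .
    interpret C: sigma_finite_measure "count_space (carrier G)"
      using G by (rule sigma_finite_measure_count_space_countable)
    have mK: "(\<lambda>p. indicator B (fst p, \<beta>' (fst p) (snd p)) :: ennreal) \<in> borel_measurable ?A"
      by (rule measurable_pair_measure_countable1[OF G]) (simp add: ind')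
    have mK2: "(\<lambda>x. \<integral>\<^sup>+g. indicator B (g, \<beta>' g x) \<partial>count_space (carrier G)) \<in> borel_measurable M"
    proof (rule C.borel_measurable_nn_integral)
      have "(\<lambda>(x, g). (g, x)) \<in> measurable (M \<Otimes>\<^sub>M count_space (carrier G)) ?A"
        by (rule measurable_pair_swap')
      from measurable_compose[OF this mK]
      show "(\<lambda>(x, g). indicator B (g, \<beta>' g x) :: ennreal) \<in> borel_measurable (M \<Otimes>\<^sub>M count_space (carrier G))"
        by (simp add: split_beta')
    qed
    have mI: "(\<lambda>u. emeasure (count_space UNIV) {p \<in> B. f p = u})
        \<in> borel_measurable (restrict_space ?A ({\<one>\<^bsub>G\<^esub>} \<times> space M))"
    proof (subst measurable_cong)
      fix u assume "u \<in> space (restrict_space ?A ({\<one>\<^bsub>G\<^esub>} \<times> space M))"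
      then have "u = (\<one>\<^bsub>G\<^esub>, snd u)" "snd u \<in> space M" by (auto simp: space_restrict_space)
      then show "emeasure (count_space UNIV) {p \<in> B. f p = u}
          = (\<integral>\<^sup>+g. indicator B (g, \<beta>' g (snd u)) \<partial>count_space (carrier G))"
        using fib[of "snd u"] by simp
    next
      show "(\<lambda>u. \<integral>\<^sup>+g. indicator B (g, \<beta>' g (snd u)) \<partial>count_space (carrier G))
          \<in> borel_measurable (restrict_space ?A ({\<one>\<^bsub>G\<^esub>} \<times> space M))"
        by (intro measurable_restrict_space1 measurable_compose[OF _ mK2]) simp
    qed
    have "(\<integral>\<^sup>+u. emeasure (count_space UNIV) {p \<in> B. f p = u} \<partial>umeas ?\<G>)
        = (\<integral>\<^sup>+x. emeasure (count_space UNIV) {p \<in> B. f p = (\<one>\<^bsub>G\<^esub>, x)} \<partial>M)"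
      unfolding um by (rule nn_integral_distr[OF emb]) (use mI in simp)
    also have "\<dots> = (\<integral>\<^sup>+x. \<integral>\<^sup>+g. indicator B (g, \<beta>' g x) \<partial>count_space (carrier G) \<partial>M)"
      by (rule nn_integral_cong) (rule fib)
    also have "\<dots> = (\<integral>\<^sup>+g. \<integral>\<^sup>+x. indicator B (g, \<beta>' g x) \<partial>M \<partial>count_space (carrier G))"
      by (rule nn_integral_count_space_nn_integral[OF G ind'])
    also have "\<dots> = (\<integral>\<^sup>+g. emeasure M {x \<in> space M. (g, x) \<in> B} \<partial>count_space (carrier G))"
    proof (rule nn_integral_cong)
      fix g assume "g \<in> space (count_space (carrier G))"
      then have g: "g \<in> carrier G" by simp
      have "(\<integral>\<^sup>+x. indicator B (g, \<beta>' g x) \<partial>M) = (\<integral>\<^sup>+x. indicator B (g, x) \<partial>distr M M (\<beta>' g))"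
        using nn_integral_distr[OF \<beta>(1)[OF g], of "\<lambda>y. indicator B (g, y)"] ind[OF g] by simp
      also have "\<dots> = (\<integral>\<^sup>+x. indicator {x \<in> space M. (g, x) \<in> B} x \<partial>M)"
        unfolding \<beta>(2)[OF g] by (rule nn_integral_cong) (auto simp: indicator_def)
      also have "\<dots> = emeasure M {x \<in> space M. (g, x) \<in> B}"
      proof (rule nn_integral_indicator)
        have "Pair g \<in> measurable M ?A" using g by simp
        from measurable_sets[OF this B] show "{x \<in> space M. (g, x) \<in> B} \<in> sets M"
          by (simp add: vimage_def Int_def conj_commute)
      qed
      finally show "(\<integral>\<^sup>+x. indicator B (g, \<beta>' g x) \<partial>M) = emeasure M {x \<in> space M. (g, x) \<in> B}" .
    qed
    finally show ?thesis .
  qed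
  show ?thesis
  proof (intro pmp_groupoid.intro pmp_groupoid_axioms.intro discrete_measurable_groupoid.intro
      discrete_measurable_groupoid_axioms.intro groupoid.intro)
    fix B assume "B \<in> sets (arr ?\<G>)"
    then have B: "B \<in> sets ?A" by (simp add: arr)
    have "distr M M (\<lambda>x. x) = M" by (rule distr_id2) simp
    then show "(\<integral>\<^sup>+u. emeasure (count_space UNIV) {x \<in> B. src ?\<G> x = u} \<partial>umeas ?\<G>)
        = (\<integral>\<^sup>+u. emeasure (count_space UNIV) {x \<in> B. rng ?\<G> x = u} \<partial>umeas ?\<G>)"
      using key[OF B, of "src ?\<G>" "\<lambda>g x. x" "\<lambda>g x. x"]
        key[OF B, of "rng ?\<G>" \<alpha> "\<lambda>g. \<alpha> (inv\<^bsub>G\<^esub> g)"]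
      by (simp add: defs meas pres sp invl invr)
  next
    show "prob_space (umeas ?\<G>)" unfolding um by (rule M.prob_space_distr[OF emb])
  next
    show "standard_borel (arr ?\<G>)"
      unfolding arr using M G by (auto simp: standard_prob_space_def intro: standard_borel_count_space_pair)
  next
    show "src ?\<G> \<in> measurable (arr ?\<G>) (arr ?\<G>)"
      by (simp add: defs split_beta')
  next
    show "rng ?\<G> \<in> measurable (arr ?\<G>) (arr ?\<G>)"
      using act_meas by (simp add: defs split_beta')
  next
    have "(\<lambda>p. inv\<^bsub>G\<^esub> (fst p)) \<in> measurable ?A (count_space (carrier G))"
      by (rule measurable_compose[OF measurable_fst]) simp
    then show "ginv ?\<G> \<in> measurable (arr ?\<G>) (arr ?\<G>)"
      using act_meas by (simp add: defs split_beta')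
  next
    have "(\<lambda>q. (fst (fst q), fst (snd q))) \<in> measurable (?A \<Otimes>\<^sub>M ?A) (count_space (carrier G) \<Otimes>\<^sub>M count_space (carrier G))"
      by measurable
    then have 1: "(\<lambda>q. (fst (fst q), fst (snd q))) \<in> measurable (?A \<Otimes>\<^sub>M ?A) (count_space (carrier G \<times> carrier G))"
      by (simp add: pair_measure_countable G)
    have 2: "(\<lambda>(h, g). h \<otimes>\<^bsub>G\<^esub> g) \<in> measurable (count_space (carrier G \<times> carrier G)) (count_space (carrier G))"
      by auto
    have "(\<lambda>q. fst (fst q) \<otimes>\<^bsub>G\<^esub> fst (snd q)) \<in> measurable (?A \<Otimes>\<^sub>M ?A) (count_space (carrier G))"
      using measurable_compose[OF 1 2] by simp
    then have "(\<lambda>q. (fst (fst q) \<otimes>\<^bsub>G\<^esub> fst (snd q), snd (snd q))) \<in> measurable (?A \<Otimes>\<^sub>M ?A) ?A"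
      by simp
    then show "(\<lambda>(x, y). gmul ?\<G> x y)
        \<in> measurable (restrict_space (arr ?\<G> \<Otimes>\<^sub>M arr ?\<G>) (composable ?\<G>)) (arr ?\<G>)"
      by (intro measurable_restrict_space1) (simp add: defs split_beta')
  next
    fix u
    have "{x \<in> arrows ?\<G>. src ?\<G> x = u} \<subseteq> carrier G \<times> {snd u}"
      unfolding arrows by (auto simp: defs)
    then show "countable {x \<in> arrows ?\<G>. src ?\<G> x = u}"
      by (rule countable_subset) (simp add: G)
  next
    show "units ?\<G> \<in> sets (arr ?\<G>)"
      unfolding units arr by (intro pair_measureI) auto
  next
    show "sets (umeas ?\<G>) = sets (restrict_space (arr ?\<G>) (units ?\<G>))"
      by (simp add: um units arr)
  qed (auto simp: arrows units sel sp mul one invl invr m_assoc)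
qed

end

theory Submission
  imports Defs "HOL-Combinatorics.Permutations" "HOL-Real_Asymp.Real_Asymp"
begin

text \<open>
  Why the equality holds. A map in \<open>SA \<G> F n \<delta> d\<close> sends the operators of finitely many
  bisections to partial permutation matrices, so it is a finite family of partial injections of
  \<open>{..<d}\<close> that imitate the bisections. On the scale \<open>d log d\<close> a free choice of one partial injection
  costs exactly \<open>1\<close>, since there are between \<open>d!\<close> and \<open>(d + 1)\<^sup>d\<close> of them, while choices that number at
  most \<open>C\<^sup>d\<close> cost nothing. The dimension therefore counts the partial injections that can be chosen
  freely, and the claim is that these are the ones imitating the \<open>r\<close> generators.

  Upper bound. Let \<open>E\<close> be a finite set of operators of bisections. Up to a set of small measure, each
  of these bisections is a finite disjoint union of graphs of short words \<open>w\<close> restricted to Borel sets,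
  together with the set of points at which it is undefined. Put the generators and the diagonal
  projections onto these pieces into \<open>F\<close>. Approximate multiplicativity then lets one read off the
  image of the bisection, up to a small proportion of the \<open>d\<close> points, from the images of the generators and from the
  fixed point sets of the projections (\<open>decode_bisection\<close>). The generators contribute at most \<open>(d + 1)\<^sup>r\<^sup>d\<close>
  choices, the fixed point sets at most \<open>C\<^sup>d\<close>, and correcting each bisection at \<open>\<beta> d\<close> points at most
  \<open>2\<^sup>d (d + 1)\<^sup>\<beta>\<^sup>d\<close> (\<open>card_hamming_ball_le\<close>). Letting \<open>\<beta>\<close> tend to zero gives \<open>sofic_dim_le\<close>.

  Lower bound. Given \<open>F\<close>, \<open>n\<close> and \<open>\<delta>\<close>, take a finite Borel partition of \<open>X\<close> that records all that matters about
  the products of elements of \<open>F\<close>. Label a point of \<open>X\<close> by its itinerary, the partition cells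
  visited by the short words applied to it, and choose labels on \<open>{..<d}\<close> with the right frequencies. A
  generator determines a coupling of the label distribution with itself, and after rounding some permutation
  of \<open>{..<d}\<close> realises this coupling outside boundedly many points. Composing it with permutations that preserve
  the finitely many types of points leaves \<open>d! / C\<^sup>d\<close> choices for each generator (\<open>ex_permutation_models\<close>).
  Because itineraries are consistent along words, every such choice of \<open>r\<close> permutations imitates the
  action. No relation between the generators has to be met, and this is where
  freeness of the group enters. The action itself may have fixed points, whereas a nontrivial word
  must act on \<open>{..<d}\<close> almost without fixed points, so that traces come out right; therefore the labels also carry
  a point of a finite set on which short nontrivial words act freely, which exists because free groups are
  residually finite (\<open>ex_free_finite_action\<close>). The linear map attached to such
  permutations is written down by matrix coefficients (\<open>phi\<close>), which avoids choosing
  a basis of the span of the inverse semigroup, and \<open>phi_in_SA\<close> shows that it is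
  a sofic approximation. Distinct choices differ on the generators, whence \<open>lower_sofic_dim_ge\<close>.
\<close>

section \<open>Partial permutation matrices\<close>

definition pmat :: "nat \<Rightarrow> (nat \<Rightarrow> nat) \<Rightarrow> complex mat" where
  "pmat d f = mat d d (\<lambda>(j, i). if f i = j then 1 else 0)"

text \<open>
  The value \<open>d\<close> means undefined, and functions are total on \<open>nat\<close>. Composition of partial maps is then
  the plain \<open>\<circ>\<close>, and the identity of \<open>{..<d}\<close> becomes \<open>\<lambda>i. min i d\<close>.
\<close>

definition partial_injections :: "nat \<Rightarrow> (nat \<Rightarrow> nat) set" where
  "partial_injections d = {f. (\<forall>i. f i \<le> d) \<and> (\<forall>i\<ge>d. f i = d) \<and> inj_on f {i. f i < d}}"

definition disagreements :: "nat \<Rightarrow> (nat \<Rightarrow> nat) \<Rightarrow> (nat \<Rightarrow> nat) \<Rightarrow> nat set" where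
  "disagreements d f g = {i. i < d \<and> f i \<noteq> g i}"

lemma partial_injectionsD:
  assumes "f \<in> partial_injections d"
  shows "f i \<le> d" "i \<ge> d \<Longrightarrow> f i = d" "f i < d \<Longrightarrow> f i = f j \<Longrightarrow> i = j"
  using assms by (auto simp: partial_injections_def inj_on_def)

lemma partial_injectionsI:
  assumes "\<And>i. f i \<le> d" "\<And>i. i \<ge> d \<Longrightarrow> f i = d" "\<And>i j. i < d \<Longrightarrow> j < d \<Longrightarrow> f i < d \<Longrightarrow> f i = f j \<Longrightarrow> i = j"
  shows "f \<in> partial_injections d"
proof -
  have "i < d" if "f i < d" for i using assms(2)[of i] that by (cases "i < d") auto
  then show ?thesis using assms unfolding partial_injections_def inj_on_def by blast
qed

lemma pmat_carrier [simp]: "pmat d f \<in> carrier_mat d d"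
  by (simp add: pmat_def)

lemma index_pmat: "j < d \<Longrightarrow> i < d \<Longrightarrow> pmat d f $$ (j, i) = (if f i = j then 1 else 0)"
  by (simp add: pmat_def)

lemma comp_partial_injections:
  "f \<in> partial_injections d \<Longrightarrow> g \<in> partial_injections d \<Longrightarrow> f \<circ> g \<in> partial_injections d"
proof (rule partial_injectionsI)
  fix i j assume f: "f \<in> partial_injections d" and g: "g \<in> partial_injections d"
    and h: "(f \<circ> g) i < d" "(f \<circ> g) i = (f \<circ> g) j"
  then have "g i = g j" using partial_injectionsD(3)[OF f] by (metis comp_apply)
  moreover have "g i < d" using h(1) partial_injectionsD(2)[OF f, of "g i"] by (cases "g i < d") auto
  ultimately show "i = j" using partial_injectionsD(3)[OF g] by metis
qed (auto dest: partial_injectionsD simp: partial_injectionsD)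

lemma min_partial_injections: "(\<lambda>i. min i d) \<in> partial_injections d"
  by (rule partial_injectionsI) auto

lemma pmat_min: "pmat d (\<lambda>i. min i d) = 1\<^sub>m d"
  by (rule eq_matI) (auto simp: pmat_def)

lemma pmat_mult:
  assumes f: "f \<in> partial_injections d" and g: "g \<in> partial_injections d"
  shows "pmat d f * pmat d g = pmat d (f \<circ> g)"
proof (rule eq_matI)
  fix j i assume "j < dim_row (pmat d (f \<circ> g))" "i < dim_col (pmat d (f \<circ> g))"
  then have ji: "j < d" "i < d" by (auto simp: pmat_def)
  have "(pmat d f * pmat d g) $$ (j, i) = (\<Sum>k = 0..<d. pmat d f $$ (j, k) * pmat d g $$ (k, i))"
    using ji by (simp add: scalar_prod_def pmat_def)
  also have "\<dots> = (\<Sum>k = 0..<d. if k = g i then (if f k = j then 1 else 0) else 0)"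
    using ji by (intro sum.cong) (auto simp: index_pmat)
  also have "\<dots> = (if g i < d \<and> f (g i) = j then 1 else 0)"
    by (simp add: sum.delta)
  also have "\<dots> = pmat d (f \<circ> g) $$ (j, i)"
    using ji partial_injectionsD(2)[OF f, of "g i"] by (auto simp: index_pmat not_less)
  finally show "(pmat d f * pmat d g) $$ (j, i) = pmat d (f \<circ> g) $$ (j, i)" .
qed (auto simp: pmat_def)

lemma mat_prod_pmat:
  assumes "\<forall>s\<in>set ss. f s \<in> partial_injections d"
  shows "mat_prod d (map (\<lambda>s. pmat d (f s)) ss) = pmat d (foldr (\<lambda>s. (\<circ>) (f s)) ss (\<lambda>i. min i d))
    \<and> foldr (\<lambda>s. (\<circ>) (f s)) ss (\<lambda>i. min i d) \<in> partial_injections d"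
  using assms
  by (induction ss) (auto simp: mat_prod_def pmat_min min_partial_injections pmat_mult
      intro!: comp_partial_injections)

text \<open>
  Passing from matrices to partial injections loses nothing, so counting restrictions of approximating
  maps amounts to counting families of partial injections.
\<close>

lemma pmat_eqD:
  assumes f: "f \<in> partial_injections d" and g: "g \<in> partial_injections d" and eq: "pmat d f = pmat d g"
  shows "f = g"
proof
  fix i
  have *: "(f i = j) = (g i = j)" if "i < d" "j < d" for j
  proof -
    have "pmat d f $$ (j, i) = pmat d g $$ (j, i)" using eq by simp
    then show ?thesis using that by (simp add: index_pmat split: if_splits)
  qed
  show "f i = g i"
  proof (cases "i < d")
    case True
    then show ?thesis using *[OF True] partial_injectionsD(1)[OF f, of i] partial_injectionsD(1)[OF g, of i]
      by (metis nat_less_le)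
  qed (simp add: partial_injectionsD[OF f] partial_injectionsD[OF g])
qed

lemma index_mat_adjoint: 
  "A \<in> carrier_mat n m \<Longrightarrow> i < m \<Longrightarrow> j < n \<Longrightarrow> mat_adjoint A $$ (i, j) = cnj (A $$ (j, i))"
  by (simp add: mat_adjoint_def mat_of_rows_def)

lemma mat_adjoint_carrier: "A \<in> carrier_mat n m \<Longrightarrow> mat_adjoint A \<in> carrier_mat m n"
  by (auto simp: mat_adjoint_def mat_of_rows_def)

lemma triple_product_entry:
  assumes A: "A \<in> carrier_mat d d" and ij: "i < d" "j < d"
  shows "(A * mat_adjoint A * A) $$ (i, j) = (\<Sum>l<d. \<Sum>k<d. A $$ (i, k) * cnj (A $$ (l, k)) * A $$ (l, j))"
proof -
  note B = mat_adjoint_carrier[OF A]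
  have entry: "(C * A) $$ (i, j) = (\<Sum>l<d. C $$ (i, l) * A $$ (l, j))" if "C \<in> carrier_mat d d" for C
    using A ij that by (simp add: scalar_prod_def atLeast0LessThan)
  have "A * mat_adjoint A \<in> carrier_mat d d" using A B by simp
  then have "(A * mat_adjoint A * A) $$ (i, j) = (\<Sum>l<d. (A * mat_adjoint A) $$ (i, l) * A $$ (l, j))"
    by (rule entry)
  also have "\<dots> = (\<Sum>l<d. (\<Sum>k<d. A $$ (i, k) * cnj (A $$ (l, k))) * A $$ (l, j))"
    using A B ij by (intro sum.cong refl) (simp add: scalar_prod_def atLeast0LessThan index_mat_adjoint)
  finally show ?thesis by (simp add: sum_distrib_right)
qed

text \<open>
  For a \<open>0\<close>-\<open>1\<close> matrix, being a partial isometry forces at most one \<open>1\<close> in every row and column: an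
  entry of \<open>A A\<^sup>* A\<close> counts paths of length three, and two ones in the same line would give
  an entry above \<open>1\<close>.
\<close>

lemma partial_perm_mats_eq: "partial_perm_mats d = pmat d ` partial_injections d"
proof (intro subset_antisym subsetI)
  fix A assume A0: "A \<in> partial_perm_mats d"
  then have A: "A \<in> carrier_mat d d" and AAA: "A * mat_adjoint A * A = A"
    and v: "\<And>i j. i < d \<Longrightarrow> j < d \<Longrightarrow> A $$ (i, j) \<in> {0, 1}"
    by (auto simp: partial_perm_mats_def)
  let ?a = "\<lambda>i j. A $$ (i, j) = 1"
  define T where "T i j = (\<lambda>(l, k). if ?a i k \<and> ?a l k \<and> ?a l j then 1 else 0 :: nat)" for i j
  have sumT: "sum (T i j) ({..<d} \<times> {..<d}) = 1" if "i < d" "j < d" "?a i j" for i j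
  proof -
    have "A $$ (i, j) = (\<Sum>l<d. \<Sum>k<d. A $$ (i, k) * cnj (A $$ (l, k)) * A $$ (l, j))"
      using triple_product_entry[OF A that(1,2)] AAA by simp
    also have "\<dots> = (\<Sum>l<d. \<Sum>k<d. of_nat (T i j (l, k)))"
    proof (intro sum.cong refl)
      fix l k assume "l \<in> {..<d}" "k \<in> {..<d}"
      then show "A $$ (i, k) * cnj (A $$ (l, k)) * A $$ (l, j) = of_nat (T i j (l, k))"
        using v[OF that(1), of k] v[of l k] v[of l j] that unfolding T_def by auto
    qed
    also have "\<dots> = of_nat (sum (T i j) ({..<d} \<times> {..<d}))"
      by (simp add: sum.cartesian_product)
    finally have "of_nat (sum (T i j) ({..<d} \<times> {..<d})) = (1 :: complex)" using that by simp
    then show ?thesis by (metis of_nat_eq_1_iff)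
  qed
  have two: False if "i < d" "j < d" "?a i j" "p \<in> {..<d} \<times> {..<d}" "p \<noteq> (i, j)" "T i j p = 1" for i j p
  proof -
    have "sum (T i j) {p, (i, j)} \<le> sum (T i j) ({..<d} \<times> {..<d})"
      using that by (intro sum_mono2) auto
    then show False using that sumT[of i j] by (simp add: T_def)
  qed
  have row: "j = k" if "i < d" "j < d" "k < d" "?a i j" "?a i k" for i j k
    using two[of i j "(i, k)"] that by (auto simp: T_def)
  have col: "i = l" if "i < d" "j < d" "l < d" "?a i j" "?a l j" for i j l
    using two[of i j "(l, j)"] that by (auto simp: T_def)
  define f where "f i = (if \<exists>j<d. i < d \<and> ?a j i then THE j. j < d \<and> ?a j i else d)" for i
  have f1: "f i = j" if "i < d" "j < d" "?a j i" for i j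
    using that col unfolding f_def by (auto intro!: the_equality)
  have f2: "f i < d \<and> ?a (f i) i \<or> f i = d \<and> (\<forall>j<d. \<not> ?a j i)" if "i < d" for i
  proof (cases "\<exists>j<d. ?a j i")
    case True
    then show ?thesis using f1[OF that] by metis
  next
    case False
    then have "f i = d" unfolding f_def by (intro if_not_P) blast
    then show ?thesis using False by blast
  qed
  have "f \<in> partial_injections d"
  proof (rule partial_injectionsI)
    show "f i \<le> d" for i
    proof (cases "i < d")
      case True
      then show ?thesis using f2[OF True] by linarith
    next
      case False
      then have "f i = d" unfolding f_def by (intro if_not_P) blast
      then show ?thesis by simp
    qed
    show "f i = d" if "d \<le> i" for i using that by (auto simp: f_def)
    show "i = j" if "i < d" "j < d" "f i < d" "f i = f j" for i j
      using f2[of i] f2[of j] row[of "f i" i j] that by auto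
  qed
  moreover have "A = pmat d f"
  proof (rule eq_matI)
    fix i j assume "i < dim_row (pmat d f)" "j < dim_col (pmat d f)"
    then have ij: "i < d" "j < d" by (auto simp: pmat_def)
    show "A $$ (i, j) = pmat d f $$ (i, j)"
      using v[OF ij] f1[OF ij(2,1)] f2[OF ij(2)] ij by (auto simp: index_pmat)
  qed (use A in \<open>auto simp: pmat_def\<close>)
  ultimately show "A \<in> pmat d ` partial_injections d" by blast
next
  fix A assume "A \<in> pmat d ` partial_injections d"
  then obtain f where f: "f \<in> partial_injections d" and A: "A = pmat d f" by blast
  have "pmat d f * mat_adjoint (pmat d f) * pmat d f = pmat d f"
  proof (rule eq_matI)
    fix i j assume "i < dim_row (pmat d f)" "j < dim_col (pmat d f)"
    then have ij: "i < d" "j < d" by (auto simp: pmat_def)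
    have "(pmat d f * mat_adjoint (pmat d f) * pmat d f) $$ (i, j)
      = (\<Sum>l<d. \<Sum>k<d. pmat d f $$ (i, k) * cnj (pmat d f $$ (l, k)) * pmat d f $$ (l, j))"
      by (rule triple_product_entry[OF pmat_carrier ij])
    also have "\<dots> = (\<Sum>l<d. \<Sum>k<d. if k = j then if l = i then if f j = i then 1 else 0 else 0 else 0)"
      using ij partial_injectionsD(3)[OF f] by (intro sum.cong refl) (auto simp: index_pmat)
    also have "\<dots> = pmat d f $$ (i, j)" using ij by (simp add: index_pmat)
    finally show "(pmat d f * mat_adjoint (pmat d f) * pmat d f) $$ (i, j) = pmat d f $$ (i, j)" .
  qed (auto simp: pmat_def mat_adjoint_def)
  then show "A \<in> partial_perm_mats d"
    unfolding A partial_perm_mats_def by (auto simp: index_pmat)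
qed

lemma ntrace_pmat: "ntrace (pmat d f) = of_real (real (card {i. i < d \<and> f i = i}) / real d)"
proof -
  have "(\<Sum>i<d. pmat d f $$ (i, i)) = (\<Sum>i<d. if f i = i then 1 else 0)"
    by (intro sum.cong) (auto simp: index_pmat)
  also have "\<dots> = of_nat (card {i. i < d \<and> f i = i})"
    by (simp add: sum.If_cases Collect_conj_eq lessThan_def)
  finally show ?thesis by (simp add: ntrace_def pmat_def)
qed

lemma ntrace_adjoint_mult:
  assumes A: "A \<in> carrier_mat d d"
  shows "ntrace (mat_adjoint A * A) = of_real ((\<Sum>i<d. \<Sum>j<d. (cmod (A $$ (j, i)))\<^sup>2) / real d)"
proof -
  have "(mat_adjoint A * A) $$ (i, i) = of_real (\<Sum>j<d. (cmod (A $$ (j, i)))\<^sup>2)" if "i < d" for i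
  proof -
    have "(mat_adjoint A * A) $$ (i, i) = (\<Sum>j<d. cnj (A $$ (j, i)) * A $$ (j, i))"
      using that A mat_adjoint_carrier[OF A]
      by (simp add: scalar_prod_def atLeast0LessThan index_mat_adjoint)
    also have "\<dots> = (\<Sum>j<d. of_real ((cmod (A $$ (j, i)))\<^sup>2))"
      by (intro sum.cong refl) (simp only: complex_norm_square mult.commute)
    finally show ?thesis by simp
  qed
  then show ?thesis using A mat_adjoint_carrier[OF A] by (simp add: ntrace_def)
qed

lemma hs_norm_nonneg:
  assumes A: "A \<in> carrier_mat d d"
  shows "0 \<le> hs_norm A"
proof -
  have "0 \<le> (\<Sum>i<d. \<Sum>j<d. (cmod (A $$ (j, i)))\<^sup>2) / real d"
    by (intro divide_nonneg_nonneg sum_nonneg) auto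
  then show ?thesis unfolding hs_norm_def ntrace_adjoint_mult[OF A] Re_complex_of_real by (rule real_sqrt_ge_zero)
qed

lemma hs_norm_square:
  assumes A: "A \<in> carrier_mat d d"
  shows "(hs_norm A)\<^sup>2 = (\<Sum>i<d. \<Sum>j<d. (cmod (A $$ (j, i)))\<^sup>2) / real d"
proof -
  have "0 \<le> (\<Sum>i<d. \<Sum>j<d. (cmod (A $$ (j, i)))\<^sup>2) / real d"
    by (intro divide_nonneg_nonneg sum_nonneg) auto
  then show ?thesis unfolding hs_norm_def ntrace_adjoint_mult[OF A] Re_complex_of_real by (rule real_sqrt_pow2)
qed

text \<open>
  This turns Hilbert-Schmidt estimates into counting: a column where \<open>f\<close> and \<open>g\<close> disagree contributes \<open>2 / d\<close> to the
  squared norm, or \<open>1 / d\<close> when one of them is undefined there.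
\<close>

lemma hs_norm_pmat_diff:
  assumes f: "\<And>i. f i \<le> d" and g: "\<And>i. g i \<le> d" and d: "d > 0"
  shows "real (card (disagreements d f g)) \<le> real d * (hs_norm (pmat d f - pmat d g))\<^sup>2"
    and "real d * (hs_norm (pmat d f - pmat d g))\<^sup>2 \<le> 2 * real (card (disagreements d f g))"
proof -
  have col: "(\<Sum>j<d. (cmod ((pmat d f - pmat d g) $$ (j, i)))\<^sup>2)
     = (if f i = g i then 0 else of_bool (f i < d) + of_bool (g i < d))" if i: "i < d" for i
  proof -
    have "(\<Sum>j<d. (cmod ((pmat d f - pmat d g) $$ (j, i)))\<^sup>2)
      = (\<Sum>j<d. if f i = g i then 0 else (if j = f i then 1 else 0) + (if j = g i then 1 else 0 :: real))"
    proof (rule sum.cong)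
      fix j assume "j \<in> {..<d}"
      then have "(pmat d f - pmat d g) $$ (j, i) = pmat d f $$ (j, i) - pmat d g $$ (j, i)"
        using i by (auto simp: pmat_def)
      then show "(cmod ((pmat d f - pmat d g) $$ (j, i)))\<^sup>2
         = (if f i = g i then 0 else (if j = f i then 1 else 0) + (if j = g i then 1 else 0 :: real))"
        using i \<open>j \<in> _\<close> by (auto simp: index_pmat)
    qed simp
    then show ?thesis by (auto simp: sum.distrib)
  qed
  have "pmat d f - pmat d g \<in> carrier_mat d d" by (rule minus_carrier_mat) simp
  from hs_norm_square[OF this] d
  have eq: "real d * (hs_norm (pmat d f - pmat d g))\<^sup>2
    = (\<Sum>i<d. if f i = g i then 0 else of_bool (f i < d) + of_bool (g i < d))"
    using col by simp
  have c: "real (card (disagreements d f g)) = (\<Sum>i<d. if f i = g i then 0 else 1)"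
  proof -
    have "disagreements d f g = {..<d} \<inter> - {i. f i = g i}" by (auto simp: disagreements_def)
    then show ?thesis by (simp add: sum.If_cases)
  qed
  show "real (card (disagreements d f g)) \<le> real d * (hs_norm (pmat d f - pmat d g))\<^sup>2"
    unfolding eq c
  proof (rule sum_mono)
    fix i show "(if f i = g i then 0 else 1 :: real) \<le> (if f i = g i then 0 else of_bool (f i < d) + of_bool (g i < d))"
      using f[of i] g[of i] by auto
  qed
  show "real d * (hs_norm (pmat d f - pmat d g))\<^sup>2 \<le> 2 * real (card (disagreements d f g))"
    unfolding eq c sum_distrib_left by (rule sum_mono) auto
qed

section \<open>Square-integrable functions and bounded operators\<close>

lemma borel_measurable_cnj [measurable]:
  "f \<in> borel_measurable N \<Longrightarrow> (\<lambda>x. cnj (f x)) \<in> borel_measurable N"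
  by (rule borel_measurable_continuous_on[OF _ , of cnj]) (auto intro: continuous_intros)

definition square_integrable :: "'g measure \<Rightarrow> ('g \<Rightarrow> complex) set" where
  "square_integrable N = {f \<in> borel_measurable N. integrable N (\<lambda>x. (cmod (f x))\<^sup>2)}"

lemma square_integrable_measurable: "f \<in> square_integrable N \<Longrightarrow> f \<in> borel_measurable N"
  by (simp add: square_integrable_def)

lemma l2_class_cong:
  assumes "f \<in> borel_measurable N" "g \<in> borel_measurable N" "AE x in N. f x = g x"
  shows "l2_class N f = l2_class N g"
proof -
  have "(AE x in N. h x = f x) = (AE x in N. h x = g x)" for h :: "_ \<Rightarrow> complex"
  proof
    assume "AE x in N. h x = f x" then show "AE x in N. h x = g x" using assms(3) by eventually_elim simp
  next
    assume "AE x in N. h x = g x" then show "AE x in N. h x = f x" using assms(3) by eventually_elim simp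
  qed
  then show ?thesis unfolding l2_class_def by simp
qed

lemma l2_rep_class:
  assumes "f \<in> borel_measurable N"
  shows "l2_rep (l2_class N f) \<in> borel_measurable N" "AE x in N. l2_rep (l2_class N f) x = f x"
proof -
  have "f \<in> l2_class N f" using assms by (simp add: l2_class_def)
  then have "l2_rep (l2_class N f) \<in> l2_class N f" unfolding l2_rep_def by (rule someI[of "\<lambda>h. h \<in> l2_class N f"])
  then show "l2_rep (l2_class N f) \<in> borel_measurable N" "AE x in N. l2_rep (l2_class N f) x = f x"
    by (auto simp: l2_class_def)
qed

lemma L2_eq: "L2 N = l2_class N ` square_integrable N"
  by (simp add: L2_def square_integrable_def)

lemma square_integrable_add:
  assumes f: "f \<in> square_integrable N" and g: "g \<in> square_integrable N"
  shows "(\<lambda>x. f x + g x) \<in> square_integrable N"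
proof -
  have "integrable N (\<lambda>x. 2 * (cmod (f x))\<^sup>2 + 2 * (cmod (g x))\<^sup>2)"
    using f g by (auto simp: square_integrable_def)
  then have "integrable N (\<lambda>x. (cmod (f x + g x))\<^sup>2)"
  proof (rule Bochner_Integration.integrable_bound)
    show "(\<lambda>x. (cmod (f x + g x))\<^sup>2) \<in> borel_measurable N"
      using f g by (auto simp: square_integrable_def)
    have "(cmod (f x + g x))\<^sup>2 \<le> 2 * (cmod (f x))\<^sup>2 + 2 * (cmod (g x))\<^sup>2" for x
    proof -
      have "(cmod (f x + g x))\<^sup>2 \<le> (cmod (f x) + cmod (g x))\<^sup>2"
        by (intro power_mono norm_triangle_ineq) auto
      also have "\<dots> \<le> 2 * (cmod (f x))\<^sup>2 + 2 * (cmod (g x))\<^sup>2"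
        using sum_squares_bound[of "cmod (f x)" "cmod (g x)"] by (simp add: power2_sum)
      finally show ?thesis .
    qed
    then show "AE x in N. norm ((cmod (f x + g x))\<^sup>2) \<le> norm (2 * (cmod (f x))\<^sup>2 + 2 * (cmod (g x))\<^sup>2)"
      by auto
  qed
  then show ?thesis using f g by (auto simp: square_integrable_def)
qed

lemma square_integrable_scale:
  "f \<in> square_integrable N \<Longrightarrow> (\<lambda>x. c * f x) \<in> square_integrable N"
  by (auto simp: square_integrable_def norm_mult power_mult_distrib)

lemma square_integrable_zero: "(\<lambda>x. 0) \<in> square_integrable N"
  by (simp add: square_integrable_def)

lemma square_integrable_product:
  assumes f: "f \<in> square_integrable N" and g: "g \<in> square_integrable N"
  shows "integrable N (\<lambda>x. f x * cnj (g x))"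
proof (rule Bochner_Integration.integrable_bound)
  show "integrable N (\<lambda>x. (cmod (f x))\<^sup>2 + (cmod (g x))\<^sup>2)"
    using f g by (auto simp: square_integrable_def)
  show "(\<lambda>x. f x * cnj (g x)) \<in> borel_measurable N"
    using f g by (auto simp: square_integrable_def)
  have "cmod (f x) * cmod (g x) \<le> (cmod (f x))\<^sup>2 + (cmod (g x))\<^sup>2" for x
    using sum_squares_bound[of "cmod (f x)" "cmod (g x)"] mult_nonneg_nonneg[OF norm_ge_zero norm_ge_zero, of "f x" "g x"]
    by linarith
  then show "AE x in N. norm (f x * cnj (g x)) \<le> norm ((cmod (f x))\<^sup>2 + (cmod (g x))\<^sup>2)"
    by (auto simp: norm_mult)
qed

lemma l2_add_class:
  assumes f: "f \<in> borel_measurable N" and g: "g \<in> borel_measurable N"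
  shows "l2_add N (l2_class N f) (l2_class N g) = l2_class N (\<lambda>x. f x + g x)"
  unfolding l2_add_def
proof (rule l2_class_cong)
  show "AE x in N. l2_rep (l2_class N f) x + l2_rep (l2_class N g) x = f x + g x"
    using l2_rep_class(2)[OF f] l2_rep_class(2)[OF g] by eventually_elim simp
qed (use f g l2_rep_class(1)[OF f] l2_rep_class(1)[OF g] in simp_all)

lemma l2_scale_class:
  assumes f: "f \<in> borel_measurable N"
  shows "l2_scale N c (l2_class N f) = l2_class N (\<lambda>x. c * f x)"
  unfolding l2_scale_def
proof (rule l2_class_cong)
  show "AE x in N. c * l2_rep (l2_class N f) x = c * f x"
    using l2_rep_class(2)[OF f] by eventually_elim simp
qed (use f l2_rep_class(1)[OF f] in simp_all)

lemma l2_inner_class: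
  assumes f: "f \<in> borel_measurable N" and g: "g \<in> borel_measurable N"
  shows "l2_inner N (l2_class N f) (l2_class N g) = (LINT x|N. f x * cnj (g x))"
  unfolding l2_inner_def
proof (rule integral_cong_AE)
  show "AE x in N. l2_rep (l2_class N f) x * cnj (l2_rep (l2_class N g) x) = f x * cnj (g x)"
    using l2_rep_class(2)[OF f] l2_rep_class(2)[OF g] by eventually_elim simp
qed (use f g l2_rep_class(1)[OF f] l2_rep_class(1)[OF g] in simp_all)

lemma l2_norm_class:
  assumes f: "f \<in> borel_measurable N"
  shows "l2_norm N (l2_class N f) = sqrt (LINT x|N. (cmod (f x))\<^sup>2)"
proof -
  have "(LINT x|N. f x * cnj (f x)) = (LINT x|N. of_real ((cmod (f x))\<^sup>2))"
    by (intro Bochner_Integration.integral_cong refl) (simp only: complex_norm_square)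
  then show ?thesis
    by (simp add: l2_norm_def l2_inner_class[OF f f] del: of_real_power)
qed

lemma l2_add_in: "a \<in> L2 N \<Longrightarrow> b \<in> L2 N \<Longrightarrow> l2_add N a b \<in> L2 N"
  by (auto simp: L2_eq l2_add_class square_integrable_measurable intro!: square_integrable_add)

lemma l2_scale_in: "a \<in> L2 N \<Longrightarrow> l2_scale N c a \<in> L2 N"
  by (auto simp: L2_eq l2_scale_class square_integrable_measurable intro!: square_integrable_scale)

lemma l2_zero_in: "l2_class N (\<lambda>x. 0) \<in> L2 N"
  by (auto simp: L2_eq intro!: square_integrable_zero)

lemma l2_inner_add:
  assumes "a \<in> L2 N" "b \<in> L2 N" "c \<in> L2 N"
  shows "l2_inner N (l2_add N a b) c = l2_inner N a c + l2_inner N b c"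
proof -
  obtain f g h where fgh: "f \<in> square_integrable N" "g \<in> square_integrable N" "h \<in> square_integrable N"
    and eq: "a = l2_class N f" "b = l2_class N g" "c = l2_class N h"
    using assms by (auto simp: L2_eq)
  note m = fgh[THEN square_integrable_measurable]
  have m': "(\<lambda>x. f x + g x) \<in> borel_measurable N" using m by auto
  show ?thesis
    using square_integrable_product[OF fgh(1,3)] square_integrable_product[OF fgh(2,3)]
    by (simp add: eq l2_add_class m l2_inner_class m' distrib_right)
qed

lemma l2_inner_scale:
  assumes "a \<in> L2 N" "b \<in> L2 N"
  shows "l2_inner N (l2_scale N c a) b = c * l2_inner N a b"
proof -
  obtain f g where fg: "f \<in> square_integrable N" "g \<in> square_integrable N"
    and eq: "a = l2_class N f" "b = l2_class N g"
    using assms by (auto simp: L2_eq)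
  note m = fg[THEN square_integrable_measurable]
  have m': "(\<lambda>x. c * f x) \<in> borel_measurable N" using m by auto
  show ?thesis
    by (simp add: eq l2_scale_class m l2_inner_class m' mult.assoc)
qed

lemma l2_norm_add_le:
  assumes "a \<in> L2 N" "b \<in> L2 N"
  shows "l2_norm N (l2_add N a b) \<le> 2 * (l2_norm N a + l2_norm N b)"
proof -
  obtain f g where fg: "f \<in> square_integrable N" "g \<in> square_integrable N"
    and eq: "a = l2_class N f" "b = l2_class N g"
    using assms by (auto simp: L2_eq)
  note m = fg[THEN square_integrable_measurable]
  have m': "(\<lambda>x. f x + g x) \<in> borel_measurable N" using m by auto
  let ?F = "LINT x|N. (cmod (f x))\<^sup>2" and ?G = "LINT x|N. (cmod (g x))\<^sup>2"
  have nn: "0 \<le> ?F" "0 \<le> ?G" by auto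
  have "(cmod (f x + g x))\<^sup>2 \<le> 2 * (cmod (f x))\<^sup>2 + 2 * (cmod (g x))\<^sup>2" for x
  proof -
    have "(cmod (f x + g x))\<^sup>2 \<le> (cmod (f x) + cmod (g x))\<^sup>2"
      by (intro power_mono norm_triangle_ineq) auto
    also have "\<dots> \<le> 2 * (cmod (f x))\<^sup>2 + 2 * (cmod (g x))\<^sup>2"
      using sum_squares_bound[of "cmod (f x)" "cmod (g x)"] by (simp add: power2_sum)
    finally show ?thesis .
  qed
  then have "(LINT x|N. (cmod (f x + g x))\<^sup>2) \<le> (LINT x|N. 2 * (cmod (f x))\<^sup>2 + 2 * (cmod (g x))\<^sup>2)"
    using fg square_integrable_add[OF fg] by (intro integral_mono) (auto simp: square_integrable_def)
  also have "\<dots> = 2 * ?F + 2 * ?G"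
    using fg by (subst Bochner_Integration.integral_add) (auto simp: square_integrable_def)
  also have "\<dots> \<le> (2 * (sqrt ?F + sqrt ?G))\<^sup>2"
    using nn by (simp add: power2_sum power_mult_distrib)
  finally show ?thesis
    using nn by (simp add: eq l2_add_class m l2_norm_class m' real_sqrt_le_iff real_le_lsqrt)
qed

lemma l2_norm_scale: "a \<in> L2 N \<Longrightarrow> l2_norm N (l2_scale N c a) = cmod c * l2_norm N a"
  by (auto simp: L2_eq l2_scale_class l2_norm_class square_integrable_measurable square_integrable_scale
      norm_mult power_mult_distrib real_sqrt_mult)

lemma l2_add_middle:
  assumes "a \<in> L2 N" "b \<in> L2 N" "c \<in> L2 N" "d \<in> L2 N"
  shows "l2_add N (l2_add N a b) (l2_add N c d) = l2_add N (l2_add N a c) (l2_add N b d)"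
  using assms
  by (auto simp only: L2_eq l2_add_class square_integrable_measurable square_integrable_add add_ac image_iff Bex_def)

lemma l2_scale_add:
  assumes "a \<in> L2 N" "b \<in> L2 N"
  shows "l2_scale N c (l2_add N a b) = l2_add N (l2_scale N c a) (l2_scale N c b)"
  using assms
  by (auto simp only: L2_eq l2_add_class l2_scale_class square_integrable_measurable square_integrable_add
      square_integrable_scale distrib_left image_iff Bex_def)

lemma l2_scale_commute:
  assumes "a \<in> L2 N"
  shows "l2_scale N c (l2_scale N c' a) = l2_scale N c' (l2_scale N c a)"
  using assms
  by (auto simp only: L2_eq l2_scale_class square_integrable_measurable
      square_integrable_scale mult_ac image_iff Bex_def)

lemma l2_scale_0: "a \<in> L2 N \<Longrightarrow> l2_scale N 0 a = l2_class N (\<lambda>x. 0)"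
  by (auto simp: L2_eq l2_scale_class square_integrable_measurable)

lemma bounded_ops_bound:
  assumes "T \<in> bounded_ops N"
  obtains K where "\<And>a. a \<in> L2 N \<Longrightarrow> l2_norm N (T a) \<le> K * l2_norm N a"
  using assms unfolding bounded_ops_def by blast

lemma bounded_opsI:
  assumes "\<And>a. a \<in> L2 N \<Longrightarrow> T a \<in> L2 N" "T \<in> extensional (L2 N)"
    "\<And>a b. a \<in> L2 N \<Longrightarrow> b \<in> L2 N \<Longrightarrow> T (l2_add N a b) = l2_add N (T a) (T b)"
    "\<And>a c. a \<in> L2 N \<Longrightarrow> T (l2_scale N c a) = l2_scale N c (T a)"
    "\<And>a. a \<in> L2 N \<Longrightarrow> l2_norm N (T a) \<le> K * l2_norm N a"
  shows "T \<in> bounded_ops N"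
  unfolding bounded_ops_def
  by (intro CollectI conjI PiE_I ballI allI exI[of _ K]) (use assms in \<open>auto simp: extensional_def\<close>)

lemma bounded_opsD:
  assumes "T \<in> bounded_ops N"
  shows "a \<in> L2 N \<Longrightarrow> T a \<in> L2 N" "T \<in> extensional (L2 N)"
    "a \<in> L2 N \<Longrightarrow> b \<in> L2 N \<Longrightarrow> T (l2_add N a b) = l2_add N (T a) (T b)"
    "a \<in> L2 N \<Longrightarrow> T (l2_scale N c a) = l2_scale N c (T a)"
    "T (l2_class N (\<lambda>x. 0)) = l2_class N (\<lambda>x. 0)"
proof -
  show *: "a \<in> L2 N \<Longrightarrow> T a \<in> L2 N" "T \<in> extensional (L2 N)" for a
    using assms by (auto simp: bounded_ops_def PiE_def)
  show "a \<in> L2 N \<Longrightarrow> b \<in> L2 N \<Longrightarrow> T (l2_add N a b) = l2_add N (T a) (T b)"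
    using assms by (auto simp: bounded_ops_def)
  show **: "a \<in> L2 N \<Longrightarrow> T (l2_scale N c a) = l2_scale N c (T a)" for a c
    using assms by (auto simp: bounded_ops_def)
  have "T (l2_scale N 0 (l2_class N (\<lambda>x. 0))) = l2_scale N 0 (T (l2_class N (\<lambda>x. 0)))"
    by (intro ** l2_zero_in)
  then show "T (l2_class N (\<lambda>x. 0)) = l2_class N (\<lambda>x. 0)"
    by (simp add: l2_scale_0 l2_zero_in *)
qed

lemma op_zero_bounded: "op_zero N \<in> bounded_ops N"
proof -
  have "l2_norm N (op_zero N a) \<le> 0 * l2_norm N a" if "a \<in> L2 N" for a
    using that by (simp add: op_zero_def l2_norm_class)
  then show ?thesis
    by (intro bounded_opsI[where K = 0])
       (simp_all add: op_zero_def l2_zero_in l2_add_in l2_scale_in l2_add_class l2_scale_class)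
qed

lemma op_add_bounded:
  assumes S: "S \<in> bounded_ops N" and T: "T \<in> bounded_ops N"
  shows "op_add N S T \<in> bounded_ops N"
proof -
  obtain K where K: "\<And>a. a \<in> L2 N \<Longrightarrow> l2_norm N (S a) \<le> K * l2_norm N a"
    using bounded_ops_bound[OF S] by blast
  obtain K' where K': "\<And>a. a \<in> L2 N \<Longrightarrow> l2_norm N (T a) \<le> K' * l2_norm N a"
    using bounded_ops_bound[OF T] by blast
  have "l2_norm N (op_add N S T a) \<le> 2 * (K + K') * l2_norm N a" if "a \<in> L2 N" for a
    using l2_norm_add_le[OF bounded_opsD(1)[OF S that] bounded_opsD(1)[OF T that]] K[OF that] K'[OF that] that
    by (simp add: op_add_def algebra_simps)
  with bounded_opsD[OF S] bounded_opsD[OF T] show ?thesis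
    by (intro bounded_opsI[where K = "2 * (K + K')"])
       (simp_all add: op_add_def l2_add_in l2_scale_in l2_scale_add l2_add_middle)
qed

lemma op_scale_bounded:
  assumes T: "T \<in> bounded_ops N"
  shows "op_scale N c T \<in> bounded_ops N"
proof -
  obtain K where K: "\<And>a. a \<in> L2 N \<Longrightarrow> l2_norm N (T a) \<le> K * l2_norm N a"
    using bounded_ops_bound[OF T] by blast
  have "l2_norm N (op_scale N c T a) \<le> cmod c * K * l2_norm N a" if "a \<in> L2 N" for a
    using K[OF that] that bounded_opsD(1)[OF T that]
    by (simp add: op_scale_def l2_norm_scale mult.assoc mult_left_mono)
  with bounded_opsD[OF T] show ?thesis
    by (intro bounded_opsI[where K = "cmod c * K"])
       (simp_all add: op_scale_def l2_add_in l2_scale_in l2_scale_add l2_scale_commute[of _ _ c])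
qed

lemma op_mult_eq:
  "op_mult N S T = (\<lambda>a\<in>L2 N. S (T a))"
  by (simp add: op_mult_def compose_def)

lemma commutant_subspace:
  assumes \<Omega>: "\<Omega> \<subseteq> bounded_ops N"
  shows "op_subspace N (commutant N \<Omega>)"
  unfolding op_subspace_def
proof (intro conjI ballI allI)
  show "op_zero N \<in> commutant N \<Omega>"
    unfolding commutant_def op_mult_eq
  proof (intro CollectI conjI ballI restrict_ext op_zero_bounded)
    fix U a assume U: "U \<in> \<Omega>" and a: "a \<in> L2 N"
    then have "U \<in> bounded_ops N" using \<Omega> by auto
    from bounded_opsD[OF this] show "op_zero N (U a) = U (op_zero N a)"
      using a by (simp add: op_zero_def)
  qed
next
  fix S T assume "S \<in> commutant N \<Omega>" "T \<in> commutant N \<Omega>"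
  then have ST: "S \<in> bounded_ops N" "T \<in> bounded_ops N"
    and c: "\<And>U a. U \<in> \<Omega> \<Longrightarrow> a \<in> L2 N \<Longrightarrow> S (U a) = U (S a) \<and> T (U a) = U (T a)"
    unfolding commutant_def op_mult_eq by (auto dest: fun_cong simp: restrict_def) (metis)+
  show "op_add N S T \<in> commutant N \<Omega>"
    unfolding commutant_def op_mult_eq
  proof (intro CollectI conjI ballI restrict_ext op_add_bounded[OF ST])
    fix U a assume U: "U \<in> \<Omega>" and a: "a \<in> L2 N"
    then have "U \<in> bounded_ops N" using \<Omega> by auto
    note U' = bounded_opsD[OF this]
    show "op_add N S T (U a) = U (op_add N S T a)"
      using a U' c[OF U a] bounded_opsD(1)[OF ST(1)] bounded_opsD(1)[OF ST(2)] by (simp add: op_add_def)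
  qed
next
  fix z T assume "T \<in> commutant N \<Omega>"
  then have T: "T \<in> bounded_ops N"
    and c: "\<And>U a. U \<in> \<Omega> \<Longrightarrow> a \<in> L2 N \<Longrightarrow> T (U a) = U (T a)"
    unfolding commutant_def op_mult_eq by (auto dest: fun_cong simp: restrict_def) (metis)+
  show "op_scale N z T \<in> commutant N \<Omega>"
    unfolding commutant_def op_mult_eq
  proof (intro CollectI conjI ballI restrict_ext op_scale_bounded[OF T])
    fix U a assume U: "U \<in> \<Omega>" and a: "a \<in> L2 N"
    then have "U \<in> bounded_ops N" using \<Omega> by auto
    note U' = bounded_opsD[OF this]
    show "op_scale N z T (U a) = U (op_scale N z T a)"
      using a U' c[OF U a] bounded_opsD(1)[OF T] by (simp add: op_scale_def)
  qed
qed

lemma commutant_bounded: "commutant N \<Omega> \<subseteq> bounded_ops N"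
  by (auto simp: commutant_def)

text \<open>
  The span is a hull inside the von Neumann algebra, and would be everything if the generators were not all
  in it. Bounded generators lie in their own double commutant, which is a subspace of bounded operators.
\<close>

lemma vn_span_bounded:
  assumes I: "inv_semigroup \<G> \<subseteq> bounded_ops (gmeas \<G>)"
  shows "vn_span \<G> (inv_semigroup \<G>) \<subseteq> bounded_ops (gmeas \<G>)"
proof -
  have "inv_semigroup \<G> \<subseteq> VN \<G>" using I by (auto simp: VN_def commutant_def)
  moreover have "op_subspace (gmeas \<G>) (VN \<G>)"
    unfolding VN_def by (rule commutant_subspace[OF commutant_bounded])
  ultimately have "vn_span \<G> (inv_semigroup \<G>) \<subseteq> VN \<G>"
    unfolding vn_span_def by (intro hull_minimal) auto
  then show ?thesis unfolding VN_def using commutant_bounded by blast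
qed

text \<open>
  The adjoint is a definite description; exhibiting one bounded operator with the defining property
  evaluates it, since two such operators have the same inner product against every vector.
\<close>

lemma op_adjoint_unique:
  assumes S: "S \<in> bounded_ops N"
    and adj: "\<And>a b. a \<in> L2 N \<Longrightarrow> b \<in> L2 N \<Longrightarrow> l2_inner N (T a) b = l2_inner N a (S b)"
  shows "op_adjoint N T = S"
  unfolding op_adjoint_def
proof (rule the_equality)
  fix S' assume S': "S' \<in> bounded_ops N \<and>
     (\<forall>a\<in>L2 N. \<forall>b\<in>L2 N. l2_inner N (T a) b = l2_inner N a (S' b))"
  show "S' = S"
  proof (rule extensionalityI[of _ "L2 N"])
    show "S' \<in> extensional (L2 N)" "S \<in> extensional (L2 N)" using S S' bounded_opsD(2) by blast+
    fix b assume b: "b \<in> L2 N"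
    obtain f where f: "f \<in> square_integrable N" "S b = l2_class N f"
      using bounded_opsD(1)[OF S b] by (auto simp: L2_eq)
    obtain f' where f': "f' \<in> square_integrable N" "S' b = l2_class N f'"
      using S' bounded_opsD(1)[OF _ b, of S'] by (auto simp: L2_eq)
    define g where "g x = f x + (-1) * f' x" for x
    have g: "g \<in> square_integrable N" unfolding g_def
      by (intro square_integrable_add square_integrable_scale f f')
    note m = f(1)[THEN square_integrable_measurable] f'(1)[THEN square_integrable_measurable] 
      g[THEN square_integrable_measurable]
    have "l2_class N g \<in> L2 N" using g by (auto simp: L2_eq)
    then have "l2_inner N (l2_class N g) (S b) = l2_inner N (l2_class N g) (S' b)"
      using S' adj b by metis
    then have "(LINT x|N. g x * cnj (f x)) - (LINT x|N. g x * cnj (f' x)) = 0"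
      using m by (simp add: f f' l2_inner_class)
    then have "(LINT x|N. g x * cnj (f x) - g x * cnj (f' x)) = 0"
      using square_integrable_product[OF g f(1)] square_integrable_product[OF g f'(1)] by simp
    moreover have "g x * cnj (f x) - g x * cnj (f' x) = of_real ((cmod (g x))\<^sup>2)" for x
      unfolding complex_norm_square by (simp add: g_def algebra_simps)
    ultimately have "(LINT x|N. complex_of_real ((cmod (g x))\<^sup>2)) = 0" by simp
    then have "(LINT x|N. (cmod (g x))\<^sup>2) = 0" by (simp only: integral_complex_of_real of_real_eq_0_iff)
    then have "AE x in N. (cmod (g x))\<^sup>2 = 0"
      using integral_nonneg_eq_0_iff_AE[of N "\<lambda>x. (cmod (g x))\<^sup>2"] g by (simp add: square_integrable_def)
    then have "AE x in N. f' x = f x" by eventually_elim (simp add: g_def)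
    then show "S' b = S b" unfolding f f' using m by (intro l2_class_cong) auto
  qed
qed (use S adj in auto)

section \<open>Bisections of an action groupoid\<close>

locale countable_pmp_action =
  fixes G :: "('a, 'z) monoid_scheme" (structure) and M :: "'x measure" and \<alpha> :: "'a \<Rightarrow> 'x \<Rightarrow> 'x"
  assumes countable_carrier: "countable (carrier G)"
    and prob: "prob_space M"
    and pmp: "pmp_action G M \<alpha>"
begin

sublocale action: group_action G "space M" \<alpha>
  using pmp by (simp add: pmp_action_def)

sublocale group G
  using action.group_hom group_hom.axioms(1) by blast

sublocale prob_space M by (rule prob)

abbreviation \<G> where "\<G> \<equiv> action_groupoid G M \<alpha>"
abbreviation N where "N \<equiv> gmeas \<G>"

lemma act_measurable [measurable]: "g \<in> carrier G \<Longrightarrow> \<alpha> g \<in> measurable M M"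
  using pmp by (simp add: pmp_action_def)

lemma act_space: "g \<in> carrier G \<Longrightarrow> x \<in> space M \<Longrightarrow> \<alpha> g x \<in> space M"
  using action.element_image by auto

lemma act_one: "x \<in> space M \<Longrightarrow> \<alpha> \<one> x = x"
  using action.id_eq_one by (metis restrict_apply')

lemma act_mult:
  "g \<in> carrier G \<Longrightarrow> h \<in> carrier G \<Longrightarrow> x \<in> space M \<Longrightarrow> \<alpha> (g \<otimes> h) x = \<alpha> g (\<alpha> h x)"
  using action.composition_rule by simp

lemma act_inv: "g \<in> carrier G \<Longrightarrow> x \<in> space M \<Longrightarrow> \<alpha> (inv g) (\<alpha> g x) = x"
  by (metis inv_closed l_inv act_mult act_one)

lemma act_inv': "g \<in> carrier G \<Longrightarrow> x \<in> space M \<Longrightarrow> \<alpha> g (\<alpha> (inv g) x) = x"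
  by (metis inv_closed r_inv act_mult act_one)

lemma emeasure_act:
  assumes "g \<in> carrier G" "S \<in> sets M"
  shows "emeasure M {x \<in> space M. \<alpha> g x \<in> S} = emeasure M S"
proof -
  have "emeasure M S = emeasure (distr M M (\<alpha> g)) S" using pmp assms by (simp add: pmp_action_def)
  also have "\<dots> = emeasure M {x \<in> space M. \<alpha> g x \<in> S}"
    using assms by (subst emeasure_distr) (auto intro!: arg_cong2[where f=emeasure])
  finally show ?thesis by simp
qed

lemma measure_act:
  "g \<in> carrier G \<Longrightarrow> S \<in> sets M \<Longrightarrow> measure M {x \<in> space M. \<alpha> g x \<in> S} = measure M S"
  by (simp add: measure_def emeasure_act)

lemma arr_eq: "arr \<G> = count_space (carrier G) \<Otimes>\<^sub>M M"
  by (simp add: action_groupoid_def Let_def)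

lemma groupoid_simps:
  "src \<G> (g, x) = (\<one>, x)" "rng \<G> (g, x) = (\<one>, \<alpha> g x)"
  "gmul \<G> (h, y) (g, x) = (h \<otimes> g, x)" "ginv \<G> (g, x) = (inv g, \<alpha> g x)"
  by (simp_all add: action_groupoid_def Let_def)

lemma arrows_eq: "arrows \<G> = carrier G \<times> space M"
  by (simp add: arrows_def arr_eq space_pair_measure)

lemma units_eq: "units \<G> = {\<one>} \<times> space M"
  unfolding units_def arrows_eq by (force simp: groupoid_simps)

lemma fibre_emeasure:
  assumes "E \<in> sets (count_space (carrier G) \<Otimes>\<^sub>M M)"
  shows "emeasure (count_space (carrier G) \<Otimes>\<^sub>M M) E
    = (\<integral>\<^sup>+x. emeasure (count_space (carrier G)) {g \<in> carrier G. (g, x) \<in> E} \<partial>M)"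
    "(\<lambda>x. emeasure (count_space (carrier G)) {g \<in> carrier G. (g, x) \<in> E}) \<in> borel_measurable M"
proof -
  interpret C: sigma_finite_measure "count_space (carrier G)"
    by (rule sigma_finite_measure_count_space_countable[OF countable_carrier])
  interpret P: pair_sigma_finite "count_space (carrier G)" M ..
  have eq: "(\<lambda>g. (g, x)) -` E = {g \<in> carrier G. (g, x) \<in> E}" for x
    using sets.sets_into_space[OF assms] by (auto simp: space_pair_measure)
  show "emeasure (count_space (carrier G) \<Otimes>\<^sub>M M) E
    = (\<integral>\<^sup>+x. emeasure (count_space (carrier G)) {g \<in> carrier G. (g, x) \<in> E} \<partial>M)"
    using P.emeasure_pair_measure_alt2[OF assms] by (simp add: eq)
  show "(\<lambda>x. emeasure (count_space (carrier G)) {g \<in> carrier G. (g, x) \<in> E}) \<in> borel_measurable M"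
    using P.measurable_emeasure_Pair2[OF assms] by (simp add: eq)
qed

text \<open>
  Integrating the size of the fibres of the source map over \<open>M\<close> is the same as summing the measures of the sections over the
  countable group, so analysis on the groupoid reduces to product measures.
\<close>

lemma gmeas_eq: "N = count_space (carrier G) \<Otimes>\<^sub>M M"
proof -
  let ?A = "count_space (carrier G) \<Otimes>\<^sub>M M"
  have um: "umeas \<G> = distr M (restrict_space ?A ({\<one>} \<times> space M)) (\<lambda>x. (\<one>, x))"
    by (simp add: action_groupoid_def Let_def)
  have emb: "(\<lambda>x. (\<one>, x)) \<in> measurable M (restrict_space ?A ({\<one>} \<times> space M))"
    by (rule measurable_restrict_space2) auto
  have "(\<integral>\<^sup>+u. emeasure (count_space UNIV) {p \<in> B. src \<G> p = u} \<partial>umeas \<G>) = emeasure ?A B"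
    if B: "B \<in> sets ?A" for B
  proof -
    have Bsub: "B \<subseteq> carrier G \<times> space M"
      using sets.sets_into_space[OF B] by (simp add: space_pair_measure)
    have fib: "emeasure (count_space UNIV) {p \<in> B. src \<G> p = (\<one>, x)}
        = emeasure (count_space (carrier G)) {g \<in> carrier G. (g, x) \<in> B}" for x
    proof -
      have "{p \<in> B. src \<G> p = (\<one>, x)} = (\<lambda>g. (g, x)) ` {g \<in> carrier G. (g, x) \<in> B}"
        using Bsub by (auto simp: groupoid_simps)
      then show ?thesis
        by (simp add: emeasure_count_space inj_on_def card_image finite_image_iff)
    qed
    have "(\<integral>\<^sup>+u. emeasure (count_space UNIV) {p \<in> B. src \<G> p = u} \<partial>umeas \<G>)
        = (\<integral>\<^sup>+x. emeasure (count_space UNIV) {p \<in> B. src \<G> p = (\<one>, x)} \<partial>M)"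
      unfolding um
    proof (subst nn_integral_distr[OF emb])
      show "(\<lambda>u. emeasure (count_space UNIV) {p \<in> B. src \<G> p = u})
        \<in> borel_measurable (distr M (restrict_space ?A ({\<one>} \<times> space M)) (\<lambda>x. (\<one>, x)))"
      proof (subst measurable_cong)
        fix u assume "u \<in> space (distr M (restrict_space ?A ({\<one>} \<times> space M)) (\<lambda>x. (\<one>, x)))"
        then have "u = (\<one>, snd u)" by (auto simp: space_restrict_space)
        then show "emeasure (count_space UNIV) {p \<in> B. src \<G> p = u}
            = emeasure (count_space (carrier G)) {g \<in> carrier G. (g, snd u) \<in> B}"
          using fib[of "snd u"] by simp
      next
        show "(\<lambda>u. emeasure (count_space (carrier G)) {g \<in> carrier G. (g, snd u) \<in> B})
          \<in> borel_measurable (distr M (restrict_space ?A ({\<one>} \<times> space M)) (\<lambda>x. (\<one>, x)))"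
          unfolding measurable_distr_eq1
          by (intro measurable_restrict_space1 measurable_compose[OF _ fibre_emeasure(2)[OF B]]) simp
      qed
    qed simp
    also have "\<dots> = emeasure ?A B"
      by (simp add: fib fibre_emeasure(1)[OF B])
    finally show ?thesis .
  qed
  then have "N = measure_of (space ?A) (sets ?A) (emeasure ?A)"
    unfolding gmeas_def arrows_def arr_eq
    by (intro measure_of_eq) (auto simp: sets.space_closed sets.sigma_sets_eq)
  then show ?thesis by (simp add: measure_of_of_measure)
qed

lemma space_N: "space N = carrier G \<times> space M"
  by (simp add: gmeas_eq space_pair_measure)

lemma sets_N_iff:
  "E \<in> sets N \<longleftrightarrow> E \<subseteq> carrier G \<times> space M \<and> (\<forall>g\<in>carrier G. {x \<in> space M. (g, x) \<in> E} \<in> sets M)"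
proof (intro iffI conjI ballI)
  assume E: "E \<in> sets N"
  then show "E \<subseteq> carrier G \<times> space M" using sets.sets_into_space space_N by blast
  fix g assume "g \<in> carrier G"
  then have "Pair g \<in> measurable M N" by (simp add: gmeas_eq)
  from measurable_sets[OF this E] show "{x \<in> space M. (g, x) \<in> E} \<in> sets M"
    by (simp add: vimage_def Int_def conj_commute)
next
  assume E: "E \<subseteq> carrier G \<times> space M \<and> (\<forall>g\<in>carrier G. {x \<in> space M. (g, x) \<in> E} \<in> sets M)"
  have "(\<Union>g\<in>carrier G. {g} \<times> {x \<in> space M. (g, x) \<in> E}) \<in> sets N"
    unfolding gmeas_eq using E countable_carrier by (intro sets.countable_UN') auto
  also have "(\<Union>g\<in>carrier G. {g} \<times> {x \<in> space M. (g, x) \<in> E}) = E" using E by auto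
  finally show "E \<in> sets N" .
qed

lemma measurable_N_iff:
  "f \<in> measurable N L \<longleftrightarrow> (\<forall>g\<in>carrier G. (\<lambda>x. f (g, x)) \<in> measurable M L)"
proof (intro iffI ballI)
  fix g assume "f \<in> measurable N L" "g \<in> carrier G"
  then show "(\<lambda>x. f (g, x)) \<in> measurable M L"
    unfolding gmeas_eq by (intro measurable_compose[of "Pair g" M _ f]) auto
next
  assume "\<forall>g\<in>carrier G. (\<lambda>x. f (g, x)) \<in> measurable M L"
  then show "f \<in> measurable N L"
    unfolding gmeas_eq by (intro measurable_pair_measure_countable1[OF countable_carrier]) auto
qed

definition section_at :: "('a \<times> 'x) set \<Rightarrow> 'a \<Rightarrow> 'x set" where
  "section_at B g = {x \<in> space M. (g, x) \<in> B}"

lemma section_at_sets: "B \<in> sets N \<Longrightarrow> g \<in> carrier G \<Longrightarrow> section_at B g \<in> sets M"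
  by (simp add: section_at_def sets_N_iff)

text \<open>
  Injectivity of range and source, expressed by group elements: a point of \<open>X\<close> is the source, and
  the range, of at most one arrow of \<open>B\<close>.
\<close>

definition bisection :: "('a \<times> 'x) set \<Rightarrow> bool" where
  "bisection B \<longleftrightarrow> B \<in> sets N \<and> (\<forall>g g' x. (g, x) \<in> B \<longrightarrow> (g', x) \<in> B \<longrightarrow> g = g') \<and>
     (\<forall>g g' x x'. (g, x) \<in> B \<longrightarrow> (g', x') \<in> B \<longrightarrow> \<alpha> g x = \<alpha> g' x' \<longrightarrow> g = g')"

lemma bisectionD:
  assumes "bisection B"
  shows "B \<in> sets N" "(g, x) \<in> B \<Longrightarrow> (g', x) \<in> B \<Longrightarrow> g = g'"
    "(g, x) \<in> B \<Longrightarrow> (g', x') \<in> B \<Longrightarrow> \<alpha> g x = \<alpha> g' x' \<Longrightarrow> g = g'"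
    "(g, x) \<in> B \<Longrightarrow> g \<in> carrier G" "(g, x) \<in> B \<Longrightarrow> x \<in> space M"
proof -
  show "B \<in> sets N" using assms by (simp add: bisection_def)
  then have "B \<subseteq> carrier G \<times> space M" by (simp add: sets_N_iff)
  then show "(g, x) \<in> B \<Longrightarrow> g \<in> carrier G" "(g, x) \<in> B \<Longrightarrow> x \<in> space M" by auto
qed (use assms in \<open>unfold bisection_def, blast+\<close>)

lemma act_inj: "g \<in> carrier G \<Longrightarrow> x \<in> space M \<Longrightarrow> x' \<in> space M \<Longrightarrow> \<alpha> g x = \<alpha> g x' \<Longrightarrow> x = x'"
  by (metis act_inv)

lemma sets_arr: "sets (arr \<G>) = sets N"
  by (simp add: arr_eq gmeas_eq)

lemma bisections_eq: "bisections \<G> = {B. bisection B}"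
proof (intro Set.set_eqI iffI; (unfold mem_Collect_eq)?)
  fix B assume B: "B \<in> bisections \<G>"
  then have s: "B \<in> sets N" and i: "inj_on (src \<G>) B" "inj_on (rng \<G>) B"
    by (auto simp: bisections_def sets_arr)
  show "bisection B"
    unfolding bisection_def
  proof (intro conjI allI impI s)
    fix g g' x assume "(g, x) \<in> B" "(g', x) \<in> B"
    then show "g = g'" using inj_onD[OF i(1), of "(g, x)" "(g', x)"] by (simp add: groupoid_simps)
  next
    fix g g' x x' assume "(g, x) \<in> B" "(g', x') \<in> B" "\<alpha> g x = \<alpha> g' x'"
    then show "g = g'" using inj_onD[OF i(2), of "(g, x)" "(g', x')"] by (simp add: groupoid_simps)
  qed
next
  fix B assume B: "bisection B"
  show "B \<in> bisections \<G>"
    unfolding bisections_def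
  proof (intro CollectI conjI inj_onI)
    show "B \<in> sets (arr \<G>)" using bisectionD(1)[OF B] by (simp add: sets_arr)
    fix p q assume pq: "p \<in> B" "q \<in> B"
    obtain g x g' x' where p: "p = (g, x)" and q: "q = (g', x')" by (cases p; cases q)
    show "p = q" if "src \<G> p = src \<G> q"
    proof -
      have "x = x'" using that by (simp add: p q groupoid_simps)
      then show ?thesis using pq bisectionD(2)[OF B, of g x g'] by (simp add: p q)
    qed
    show "p = q" if "rng \<G> p = rng \<G> q"
    proof -
      have "\<alpha> g x = \<alpha> g' x'" using that by (simp add: p q groupoid_simps)
      then have "g = g'" using pq bisectionD(3)[OF B, of g x g' x'] by (simp add: p q)
      moreover have "x = x'"
        using act_inj[of g x x'] \<open>\<alpha> g x = \<alpha> g' x'\<close> \<open>g = g'\<close> pq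
          bisectionD(4,5)[OF B, of g x] bisectionD(5)[OF B, of g' x'] by (simp add: p q)
      ultimately show ?thesis by (simp add: p q)
    qed
  qed
qed

text \<open>
  The groupoid acts on itself, and along an orbit this is seen inside the group: the arrow of \<open>B\<close> starting at
  \<open>\<alpha> h' x\<close> leads to \<open>\<alpha> h x\<close>. In these terms the operator of \<open>B\<close> pulls the value at \<open>(h', x)\<close> to \<open>(h, x)\<close>.
\<close>

definition sends :: "('a \<times> 'x) set \<Rightarrow> 'x \<Rightarrow> 'a \<Rightarrow> 'a \<Rightarrow> bool" where
  "sends B x h h' \<longleftrightarrow> h \<in> carrier G \<and> h' \<in> carrier G \<and> (h \<otimes> inv h', \<alpha> h' x) \<in> B"

lemma sends_unique_left:
  assumes B: "bisection B" and "sends B x h h'" "sends B x k h'"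
  shows "h = k"
proof -
  have "h \<otimes> inv h' = k \<otimes> inv h'" using assms bisectionD(2)[OF B] unfolding sends_def by blast
  then show ?thesis using assms by (simp add: sends_def)
qed

lemma sends_unique_right:
  assumes B: "bisection B" and x: "x \<in> space M" and s: "sends B x h h'" "sends B x h k'"
  shows "h' = k'"
proof -
  have c: "h \<in> carrier G" "h' \<in> carrier G" "k' \<in> carrier G" using s by (auto simp: sends_def)
  have "\<alpha> (h \<otimes> inv h') (\<alpha> h' x) = \<alpha> h x" "\<alpha> (h \<otimes> inv k') (\<alpha> k' x) = \<alpha> h x"
    using c x by (simp_all add: act_mult[symmetric] act_space m_assoc)
  then have "h \<otimes> inv h' = h \<otimes> inv k'" using s bisectionD(3)[OF B] unfolding sends_def by metis
  then have "inv h' = inv k'" using c by simp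
  then show ?thesis using c by (metis inv_inv)
qed

definition moved :: "('a \<times> 'x) set \<Rightarrow> ('a \<times> 'x) set" where
  "moved B = {(h, x). x \<in> space M \<and> (\<exists>h'. sends B x h h')}"

text \<open>The partial transformation underlying the operator of \<open>B\<close>; its range is \<open>moved (binv B)\<close>.\<close>

definition move :: "('a \<times> 'x) set \<Rightarrow> 'a \<times> 'x \<Rightarrow> 'a \<times> 'x" where
  "move B p = (if p \<in> moved B then (THE h'. sends B (snd p) (fst p) h', snd p) else p)"

lemma move_eq:
  assumes "bisection B" "x \<in> space M" "sends B x h h'"
  shows "move B (h, x) = (h', x)" "(h, x) \<in> moved B"
proof -
  show "(h, x) \<in> moved B" using assms by (auto simp: moved_def)
  moreover have "(THE h'. sends B x h h') = h'" using assms sends_unique_right by blast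
  ultimately show "move B (h, x) = (h', x)" by (simp add: move_def)
qed

lemma bis_fun_eq:
  assumes B: "bisection B" and p: "p \<in> space N"
  shows "bis_fun \<G> B \<xi> p = (if p \<in> moved B then \<xi> (move B p) else 0)"
proof -
  obtain h x where hx: "p = (h, x)" "h \<in> carrier G" "x \<in> space M" using p by (auto simp: space_N)
  let ?P = "\<lambda>y. y \<in> arrows \<G> \<and> rng \<G> y = src \<G> (h, x) \<and> gmul \<G> (h, x) y \<in> B"
  have P: "?P y \<longleftrightarrow> (\<exists>h'. sends B x h h' \<and> y = (inv h', \<alpha> h' x))" for y
  proof
    assume y: "?P y"
    obtain k z where kz: "y = (k, z)" by (cases y)
    then have k: "k \<in> carrier G" "z \<in> space M" "\<alpha> k z = x" "(h \<otimes> k, z) \<in> B"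
      using y by (auto simp: arrows_eq groupoid_simps)
    then have z: "\<alpha> (inv k) x = z" using act_inv by blast
    have "sends B x h (inv k)" unfolding sends_def z using k hx by simp
    moreover have "y = (inv (inv k), \<alpha> (inv k) x)" unfolding z using k kz by simp
    ultimately show "\<exists>h'. sends B x h h' \<and> y = (inv h', \<alpha> h' x)" by blast
  next
    assume "\<exists>h'. sends B x h h' \<and> y = (inv h', \<alpha> h' x)"
    then show "?P y" using hx by (auto simp: sends_def arrows_eq groupoid_simps act_space act_inv)
  qed
  show ?thesis
  proof (cases "\<exists>h'. sends B x h h'")
    case True
    then obtain h' where h': "sends B x h h'" by blast
    then have c: "h' \<in> carrier G" by (simp add: sends_def)
    have "(THE y. ?P y) = (inv h', \<alpha> h' x)"
      unfolding P using h' sends_unique_right[OF B hx(3)] by (intro the_equality) blast+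
    moreover have "\<exists>y. ?P y" unfolding P using h' by blast
    ultimately have "bis_fun \<G> B \<xi> p = \<xi> (ginv \<G> (inv h', \<alpha> h' x))"
      unfolding bis_fun_def hx(1) Let_def by simp
    also have "ginv \<G> (inv h', \<alpha> h' x) = (h', x)" using c hx by (simp add: groupoid_simps act_inv)
    finally show ?thesis using move_eq[OF B hx(3) h'] hx(1) by simp
  next
    case False
    then have "\<not> (\<exists>y. ?P y)" unfolding P by blast
    then have "bis_fun \<G> B \<xi> p = 0" unfolding bis_fun_def hx(1) Let_def by (simp only: if_False)
    moreover have "p \<notin> moved B" using False hx by (auto simp: moved_def)
    ultimately show ?thesis by simp
  qed
qed

lemma bis_fun_sends:
  assumes "bisection B" "x \<in> space M" "sends B x h h'"
  shows "bis_fun \<G> B \<xi> (h, x) = \<xi> (h', x)"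
  using assms by (subst bis_fun_eq) (auto simp: move_eq space_N sends_def)

lemma bis_fun_not_sends:
  assumes "bisection B" "x \<in> space M" "h \<in> carrier G" "\<And>h'. \<not> sends B x h h'"
  shows "bis_fun \<G> B \<xi> (h, x) = 0"
  using assms by (subst bis_fun_eq) (auto simp: moved_def space_N)

lemma sends_sets:
  assumes B: "bisection B"
  shows "{x \<in> space M. sends B x h h'} \<in> sets M"
proof (cases "h \<in> carrier G \<and> h' \<in> carrier G")
  case True
  then have "{x \<in> space M. sends B x h h'} = \<alpha> h' -` section_at B (h \<otimes> inv h') \<inter> space M"
    by (auto simp: sends_def section_at_def act_space)
  also have "\<dots> \<in> sets M"
    using True section_at_sets[OF bisectionD(1)[OF B]] by (intro measurable_sets[OF act_measurable]) auto
  finally show ?thesis .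
qed (auto simp: sends_def)

lemma moved_sets:
  assumes B: "bisection B"
  shows "moved B \<in> sets N"
  unfolding sets_N_iff
proof (intro conjI ballI)
  show "moved B \<subseteq> carrier G \<times> space M" by (auto simp: moved_def sends_def)
  fix h assume "h \<in> carrier G"
  have "{x \<in> space M. (h, x) \<in> moved B} = (\<Union>h'\<in>carrier G. {x \<in> space M. sends B x h h'})"
    by (auto simp: moved_def sends_def)
  also have "\<dots> \<in> sets M"
    using countable_carrier sends_sets[OF B] by (intro sets.countable_UN') auto
  finally show "{x \<in> space M. (h, x) \<in> moved B} \<in> sets M" .
qed

lemma move_measurable:
  assumes B: "bisection B"
  shows "move B \<in> measurable N N"
  unfolding measurable_N_iff
proof
  fix h assume h: "h \<in> carrier G"
  define i where "i x = fst (move B (h, x))" for x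
  have ic: "i x \<in> carrier G" if "x \<in> space M" for x
  proof (cases "\<exists>h'. sends B x h h'")
    case True
    then obtain h' where h': "sends B x h h'" by blast
    then show ?thesis using move_eq[OF B that h'] by (simp add: i_def sends_def)
  next
    case False
    then have "(h, x) \<notin> moved B" by (auto simp: moved_def)
    then show ?thesis by (simp add: i_def move_def h)
  qed
  have "i \<in> measurable M (count_space (carrier G))"
  proof (subst measurable_count_space_eq_countable[OF countable_carrier], intro conjI ballI)
    fix k assume k: "k \<in> carrier G"
    have "i -` {k} \<inter> space M
      = {x \<in> space M. sends B x h k} \<union> (if k = h then space M - {x \<in> space M. (h, x) \<in> moved B} else {})"
    proof (rule Set.set_eqI)
      fix x
      show "x \<in> i -` {k} \<inter> space M \<longleftrightarrow> x \<in> {x \<in> space M. sends B x h k} \<union>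
        (if k = h then space M - {x \<in> space M. (h, x) \<in> moved B} else {})"
      proof (cases "x \<in> space M \<and> (\<exists>h'. sends B x h h')")
        case True
        then obtain h' where h': "sends B x h h'" and x: "x \<in> space M" by blast
        have "i x = h'" "(h, x) \<in> moved B" using move_eq[OF B x h'] by (simp_all add: i_def)
        moreover have "sends B x h k \<longleftrightarrow> h' = k" using sends_unique_right[OF B x h'] h' by blast
        ultimately show ?thesis using x by simp
      next
        case False
        show ?thesis
        proof (cases "x \<in> space M")
          case True
          then have no: "\<not> sends B x h k" "(h, x) \<notin> moved B" using False by (auto simp: moved_def)
          then have "i x = h" by (simp add: i_def move_def)
          then show ?thesis using no True by auto
        qed auto
      qed
    qed
    also have "\<dots> \<in> sets M"
      using sends_sets[OF B] moved_sets[OF B] h by (auto simp: sets_N_iff)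
    finally show "i -` {k} \<inter> space M \<in> sets M" .
  qed (use ic in auto)
  then have "(\<lambda>x. (i x, x)) \<in> measurable M N" unfolding gmeas_eq by simp
  moreover have "move B (h, x) = (i x, x)" for x by (simp add: i_def move_def)
  ultimately show "(\<lambda>x. move B (h, x)) \<in> measurable M N" by simp
qed

definition binv :: "('a \<times> 'x) set \<Rightarrow> ('a \<times> 'x) set" where
  "binv B = {(g, x). g \<in> carrier G \<and> x \<in> space M \<and> (inv g, \<alpha> g x) \<in> B}"

lemma sends_binv:
  assumes "x \<in> space M"
  shows "sends (binv B) x h' h \<longleftrightarrow> sends B x h h'"
proof (cases "h \<in> carrier G \<and> h' \<in> carrier G")
  case True
  then have "\<alpha> (h' \<otimes> inv h) (\<alpha> h x) = \<alpha> h' x" "inv (h' \<otimes> inv h) = h \<otimes> inv h'"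
    using assms by (simp_all add: act_mult[symmetric] act_space m_assoc inv_mult_group)
  then show ?thesis using True assms by (simp add: sends_def binv_def act_space)
qed (auto simp: sends_def)

lemma bisection_binv:
  assumes B: "bisection B"
  shows "bisection (binv B)"
  unfolding bisection_def sets_N_iff
proof (intro conjI allI impI ballI)
  show "binv B \<subseteq> carrier G \<times> space M" by (auto simp: binv_def)
  fix g assume g: "g \<in> carrier G"
  have "{x \<in> space M. (g, x) \<in> binv B} = \<alpha> g -` section_at B (inv g) \<inter> space M"
    using g by (auto simp: binv_def section_at_def act_space)
  also have "\<dots> \<in> sets M"
    using g section_at_sets[OF bisectionD(1)[OF B]] by (intro measurable_sets[OF act_measurable]) auto
  finally show "{x \<in> space M. (g, x) \<in> binv B} \<in> sets M" .
next
  fix g g' x assume "(g, x) \<in> binv B" "(g', x) \<in> binv B"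
  then have "g \<in> carrier G" "g' \<in> carrier G" "x \<in> space M" "(inv g, \<alpha> g x) \<in> B" "(inv g', \<alpha> g' x) \<in> B"
    by (auto simp: binv_def)
  moreover from this have "inv g = inv g'" using bisectionD(3)[OF B, of "inv g"] by (simp add: act_inv)
  ultimately show "g = g'" by (metis inv_inv)
next
  fix g g' x x' assume "(g, x) \<in> binv B" "(g', x') \<in> binv B" "\<alpha> g x = \<alpha> g' x'"
  then have "g \<in> carrier G" "g' \<in> carrier G" "(inv g, \<alpha> g x) \<in> B" "(inv g', \<alpha> g x) \<in> B"
    by (auto simp: binv_def)
  moreover from this have "inv g = inv g'" using bisectionD(2)[OF B] by blast
  ultimately show "g = g'" by (metis inv_inv)
qed

text \<open>
  Over a fixed point \<open>x\<close>, \<open>move B\<close> is a bijection between subsets of the group, and the measure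
  counts group elements over \<open>x\<close>.
\<close>

lemma emeasure_move:
  assumes B: "bisection B" and E: "E \<in> sets N"
  shows "emeasure N {p \<in> moved B. move B p \<in> E} = emeasure N (E \<inter> moved (binv B))"
proof -
  have S1: "{p \<in> moved B. move B p \<in> E} \<in> sets N"
  proof -
    have "{p \<in> moved B. move B p \<in> E} = moved B \<inter> (move B -` E \<inter> space N)"
      using sets.sets_into_space[OF moved_sets[OF B]] by auto
    then show ?thesis using moved_sets[OF B] measurable_sets[OF move_measurable[OF B] E] by auto
  qed
  have S2: "E \<inter> moved (binv B) \<in> sets N" using E moved_sets[OF bisection_binv[OF B]] by auto
  note em = fibre_emeasure(1)[folded gmeas_eq]
  have "emeasure (count_space (carrier G)) {h \<in> carrier G. (h, x) \<in> {p \<in> moved B. move B p \<in> E}}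
    = emeasure (count_space (carrier G)) {h' \<in> carrier G. (h', x) \<in> E \<inter> moved (binv B)}"
    if x: "x \<in> space M" for x
  proof -
    have "bij_betw (\<lambda>h. fst (move B (h, x))) {h \<in> carrier G. (h, x) \<in> {p \<in> moved B. move B p \<in> E}}
      {h' \<in> carrier G. (h', x) \<in> E \<inter> moved (binv B)}"
      unfolding bij_betw_def
    proof (intro conjI inj_onI Set.set_eqI iffI)
      fix h k assume "h \<in> {h \<in> carrier G. (h, x) \<in> {p \<in> moved B. move B p \<in> E}}"
        "k \<in> {h \<in> carrier G. (h, x) \<in> {p \<in> moved B. move B p \<in> E}}"
        and eq: "fst (move B (h, x)) = fst (move B (k, x))"
      then obtain h' k' where "sends B x h h'" "sends B x k k'" by (auto simp: moved_def)
      moreover from this have "h' = k'"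
        using eq move_eq(1)[OF B x] by simp
      ultimately show "h = k" using sends_unique_left[OF B] by blast
    next
      fix h' assume "h' \<in> (\<lambda>h. fst (move B (h, x))) ` {h \<in> carrier G. (h, x) \<in> {p \<in> moved B. move B p \<in> E}}"
      then obtain h k where h: "h' = fst (move B (h, x))" "sends B x h k" "move B (h, x) \<in> E"
        by (auto simp: moved_def)
      then have "h' = k" "(k, x) \<in> E" "sends (binv B) x k h" using move_eq[OF B x h(2)] x by (auto simp: sends_binv)
      then show "h' \<in> {h' \<in> carrier G. (h', x) \<in> E \<inter> moved (binv B)}"
        using x by (auto simp: moved_def sends_def)
    next
      fix h' assume h': "h' \<in> {h' \<in> carrier G. (h', x) \<in> E \<inter> moved (binv B)}"
      then obtain h where "sends (binv B) x h' h" by (auto simp: moved_def)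
      then have h: "sends B x h h'" using x by (simp add: sends_binv)
      show "h' \<in> (\<lambda>h. fst (move B (h, x))) ` {h \<in> carrier G. (h, x) \<in> {p \<in> moved B. move B p \<in> E}}"
        using h' h move_eq[OF B x h] by (intro image_eqI[of _ _ h]) (auto simp: sends_def)
    qed
    from bij_betw_same_card[OF this] bij_betw_finite[OF this] show ?thesis
      by (subst (1 2) emeasure_count_space) auto
  qed
  then show ?thesis unfolding em[OF S1] em[OF S2] by (intro nn_integral_cong)
qed

lemma move_change_of_variables:
  fixes F :: "'a \<times> 'x \<Rightarrow> 'b :: {banach, second_countable_topology}"
  assumes B: "bisection B" and F: "F \<in> borel_measurable N"
  shows "integrable N (\<lambda>p. indicator (moved B) p *\<^sub>R F (move B p))
      \<longleftrightarrow> integrable N (\<lambda>p. indicator (moved (binv B)) p *\<^sub>R F p)"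
    and "(LINT p|N. indicator (moved B) p *\<^sub>R F (move B p)) = (LINT p|N. indicator (moved (binv B)) p *\<^sub>R F p)"
proof -
  let ?R = "moved B" and ?D = "moved (binv B)"
  have R: "?R \<in> sets N" and D: "?D \<in> sets N"
    by (auto intro: moved_sets bisection_binv B)
  have T: "move B \<in> measurable (restrict_space N ?R) N"
    by (rule measurable_restrict_space1[OF move_measurable[OF B]])
  have eq: "distr (restrict_space N ?R) N (move B) = density N (indicator ?D)"
  proof (rule measure_eqI)
    fix E assume "E \<in> sets (distr (restrict_space N ?R) N (move B))"
    then have E: "E \<in> sets N" by simp
    have sp: "space (restrict_space N ?R) = ?R"
      using sets.sets_into_space[OF R] by (auto simp: space_restrict_space)
    have "emeasure (distr (restrict_space N ?R) N (move B)) E = emeasure (restrict_space N ?R) (move B -` E \<inter> ?R)"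
      using T E by (simp add: emeasure_distr sp)
    also have "\<dots> = emeasure N (move B -` E \<inter> ?R)"
      using R by (intro emeasure_restrict_space) auto
    also have "move B -` E \<inter> ?R = {p \<in> ?R. move B p \<in> E}" by auto
    also have "emeasure N \<dots> = emeasure N (E \<inter> ?D)" by (rule emeasure_move[OF B E])
    also have "\<dots> = emeasure (density N (indicator ?D)) E"
    proof -
      have "emeasure (density N (indicator ?D)) E = (\<integral>\<^sup>+p. indicator ?D p * indicator E p \<partial>N)"
        using D E by (intro emeasure_density) auto
      also have "\<dots> = (\<integral>\<^sup>+p. indicator (E \<inter> ?D) p \<partial>N)"
        by (intro nn_integral_cong) (auto simp: indicator_def)
      finally show ?thesis using D E by simp
    qed
    finally show "emeasure (distr (restrict_space N ?R) N (move B)) E = emeasure (density N (indicator ?D)) E" .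
  qed simp
  have dens: "density N (indicator ?D) = density N (\<lambda>p. ennreal (indicator ?D p))"
    by (simp add: ennreal_indicator)
  have "integrable N (\<lambda>p. indicator ?R p *\<^sub>R F (move B p)) \<longleftrightarrow> integrable (distr (restrict_space N ?R) N (move B)) F"
    using R F T by (simp add: integrable_distr_eq integrable_restrict_space)
  also have "\<dots> \<longleftrightarrow> integrable N (\<lambda>p. indicator ?D p *\<^sub>R F p)"
    unfolding eq dens using D F by (intro integrable_density) auto
  finally show "integrable N (\<lambda>p. indicator ?R p *\<^sub>R F (move B p)) \<longleftrightarrow> integrable N (\<lambda>p. indicator ?D p *\<^sub>R F p)" .
  have "(LINT p|N. indicator ?R p *\<^sub>R F (move B p)) = integral\<^sup>L (distr (restrict_space N ?R) N (move B)) F"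
    using R F T by (simp add: integral_distr integral_restrict_space)
  also have "\<dots> = (LINT p|N. indicator ?D p *\<^sub>R F p)"
    unfolding eq dens using D F by (intro integral_density) auto
  finally show "(LINT p|N. indicator ?R p *\<^sub>R F (move B p)) = (LINT p|N. indicator ?D p *\<^sub>R F p)" .
qed

end

section \<open>The inverse semigroup of an action groupoid\<close>

context countable_pmp_action
begin

lemma bis_fun_measurable:
  assumes B: "bisection B" and f: "f \<in> borel_measurable N"
  shows "bis_fun \<G> B f \<in> borel_measurable N"
proof -
  have "(\<lambda>p. if p \<in> moved B then f (move B p) else 0) \<in> borel_measurable N"
    using moved_sets[OF B] measurable_compose[OF move_measurable[OF B] f] by measurable
  then show ?thesis by (subst measurable_cong[OF bis_fun_eq[OF B]])
qed

text \<open>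
  The operator is defined through arbitrary representatives. It is well defined on classes because \<open>move\<close> preserves
  null sets.
\<close>

lemma bis_fun_AE_cong:
  assumes B: "bisection B" and f: "f \<in> borel_measurable N" and g: "g \<in> borel_measurable N"
    and eq: "AE p in N. f p = g p"
  shows "AE p in N. bis_fun \<G> B f p = bis_fun \<G> B g p"
proof -
  let ?E = "{p \<in> space N. f p \<noteq> g p}"
  have E: "?E \<in> sets N" using f g by measurable
  have "emeasure N {p \<in> moved B. move B p \<in> ?E} = emeasure N (?E \<inter> moved (binv B))"
    by (rule emeasure_move[OF B E])
  also have "\<dots> \<le> emeasure N ?E" using E by (intro emeasure_mono) auto
  also have "\<dots> = 0" using eq E by (simp add: AE_iff_measurable)
  finally have z: "emeasure N {p \<in> moved B. move B p \<in> ?E} = 0" by simp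
  have "{p \<in> moved B. move B p \<in> ?E} = moved B \<inter> (move B -` ?E \<inter> space N)"
    using sets.sets_into_space[OF moved_sets[OF B]] by auto
  also have "\<dots> \<in> sets N" using moved_sets[OF B] measurable_sets[OF move_measurable[OF B] E] by auto
  finally have s: "{p \<in> moved B. move B p \<in> ?E} \<in> sets N" .
  have "AE p in N. p \<notin> {p \<in> moved B. move B p \<in> ?E}"
    by (rule AE_not_in) (use z s in \<open>simp add: null_setsI\<close>)
  then show ?thesis
  proof (rule AE_mp, intro AE_I2 impI)
    fix p assume p: "p \<in> space N" "p \<notin> {p \<in> moved B. move B p \<in> ?E}"
    have "move B p \<in> space N" using measurable_space[OF move_measurable[OF B] p(1)] .
    then show "bis_fun \<G> B f p = bis_fun \<G> B g p" using p by (simp add: bis_fun_eq[OF B])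
  qed
qed

lemma bis_fun_square_integrable:
  assumes B: "bisection B" and f: "f \<in> square_integrable N"
  shows "bis_fun \<G> B f \<in> square_integrable N"
    and "(LINT p|N. (cmod (bis_fun \<G> B f p))\<^sup>2) \<le> (LINT p|N. (cmod (f p))\<^sup>2)"
proof -
  note m = square_integrable_measurable[OF f]
  let ?F = "\<lambda>p. (cmod (f p))\<^sup>2"
  have F: "?F \<in> borel_measurable N" using m by measurable
  have iF: "integrable N ?F" using f by (simp add: square_integrable_def)
  have D: "moved (binv B) \<in> sets N" by (rule moved_sets[OF bisection_binv[OF B]])
  have iD: "integrable N (\<lambda>p. indicator (moved (binv B)) p *\<^sub>R ?F p)"
    by (rule integrable_mult_indicator[OF D iF])
  have eq: "(cmod (bis_fun \<G> B f p))\<^sup>2 = indicator (moved B) p *\<^sub>R ?F (move B p)" if "p \<in> space N" for p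
    using bis_fun_eq[OF B that, of f] by (simp add: indicator_def)
  have "integrable N (\<lambda>p. (cmod (bis_fun \<G> B f p))\<^sup>2)"
    using move_change_of_variables(1)[OF B F] iD
    by (subst Bochner_Integration.integrable_cong[OF refl eq]) auto
  then show "bis_fun \<G> B f \<in> square_integrable N"
    using bis_fun_measurable[OF B m] by (simp add: square_integrable_def)
  have "(LINT p|N. (cmod (bis_fun \<G> B f p))\<^sup>2) = (LINT p|N. indicator (moved B) p *\<^sub>R ?F (move B p))"
    by (rule Bochner_Integration.integral_cong[OF refl eq])
  also have "\<dots> = (LINT p|N. indicator (moved (binv B)) p *\<^sub>R ?F p)"
    by (rule move_change_of_variables(2)[OF B F])
  also have "\<dots> \<le> (LINT p|N. ?F p)"
    by (intro integral_mono iD iF) (auto simp: indicator_def)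
  finally show "(LINT p|N. (cmod (bis_fun \<G> B f p))\<^sup>2) \<le> (LINT p|N. (cmod (f p))\<^sup>2)" .
qed

lemma bis_op_class:
  assumes B: "bisection B" and f: "f \<in> square_integrable N"
  shows "bis_op \<G> B (l2_class N f) = l2_class N (bis_fun \<G> B f)"
proof -
  note m = square_integrable_measurable[OF f]
  have "l2_class N f \<in> L2 N" using f by (auto simp: L2_eq)
  then have "bis_op \<G> B (l2_class N f) = l2_class N (bis_fun \<G> B (l2_rep (l2_class N f)))"
    by (simp add: bis_op_def)
  also have "\<dots> = l2_class N (bis_fun \<G> B f)"
    using l2_rep_class[OF m] m
    by (intro l2_class_cong bis_fun_measurable[OF B] bis_fun_AE_cong[OF B]) auto
  finally show ?thesis .
qed

lemma bis_op_bounded: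
  assumes B: "bisection B"
  shows "bis_op \<G> B \<in> bounded_ops N"
proof (rule bounded_opsI[where K = 1])
  show "bis_op \<G> B \<in> extensional (L2 N)" by (simp add: bis_op_def)
  fix a assume "a \<in> L2 N"
  then obtain f where f: "f \<in> square_integrable N" and a: "a = l2_class N f" by (auto simp: L2_eq)
  note mf = square_integrable_measurable[OF f]
  note sf = bis_fun_square_integrable[OF B f]
  show "bis_op \<G> B a \<in> L2 N" using sf(1) by (auto simp: a bis_op_class[OF B f] L2_eq)
  show "l2_norm N (bis_op \<G> B a) \<le> 1 * l2_norm N a"
    using sf(2) by (simp add: a bis_op_class[OF B f] l2_norm_class bis_fun_measurable[OF B] mf)
  show "bis_op \<G> B (l2_scale N c a) = l2_scale N c (bis_op \<G> B a)" for c
    unfolding a l2_scale_class[OF mf] bis_op_class[OF B f] bis_op_class[OF B square_integrable_scale[OF f]]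
      l2_scale_class[OF bis_fun_measurable[OF B mf]]
    using square_integrable_measurable[OF square_integrable_scale[OF f, of c]]
      bis_fun_measurable[OF B square_integrable_measurable[OF square_integrable_scale[OF f, of c]]] bis_fun_measurable[OF B mf]
    by (intro l2_class_cong AE_I2) (auto simp: bis_fun_eq[OF B])
  fix b assume "b \<in> L2 N"
  then obtain g where g: "g \<in> square_integrable N" and b: "b = l2_class N g" by (auto simp: L2_eq)
  note mg = square_integrable_measurable[OF g]
  show "bis_op \<G> B (l2_add N a b) = l2_add N (bis_op \<G> B a) (bis_op \<G> B b)"
    unfolding a b l2_add_class[OF mf mg] bis_op_class[OF B f] bis_op_class[OF B g]
      bis_op_class[OF B square_integrable_add[OF f g]]
      l2_add_class[OF bis_fun_measurable[OF B mf] bis_fun_measurable[OF B mg]]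
    using bis_fun_measurable[OF B square_integrable_measurable[OF square_integrable_add[OF f g]]]
      bis_fun_measurable[OF B mf] bis_fun_measurable[OF B mg]
    by (intro l2_class_cong AE_I2) (auto simp: bis_fun_eq[OF B])
qed

lemma inv_semigroup_eq: "inv_semigroup \<G> = bis_op \<G> ` {B. bisection B}"
  by (simp add: inv_semigroup_def bisections_eq)

lemma vn_span_bounded_ops: "vn_span \<G> (inv_semigroup \<G>) \<subseteq> bounded_ops N"
  by (rule vn_span_bounded) (auto simp: inv_semigroup_eq bis_op_bounded)

lemma bis_op_in_vn_span: "bisection B \<Longrightarrow> bis_op \<G> B \<in> vn_span \<G> (inv_semigroup \<G>)"
  unfolding vn_span_def by (rule hull_inc) (auto simp: inv_semigroup_eq)

definition bmult :: "('a \<times> 'x) set \<Rightarrow> ('a \<times> 'x) set \<Rightarrow> ('a \<times> 'x) set" where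
  "bmult B C = {(g, x). g \<in> carrier G \<and> x \<in> space M \<and> (\<exists>k. (k, x) \<in> C \<and> (g \<otimes> inv k, \<alpha> k x) \<in> B)}"

lemma bmult_iff:
  assumes "bisection B" "bisection C"
  shows "(g, x) \<in> bmult B C \<longleftrightarrow> (\<exists>k h. (k, x) \<in> C \<and> (h, \<alpha> k x) \<in> B \<and> g = h \<otimes> k)"
proof
  assume "(g, x) \<in> bmult B C"
  then obtain k where k: "g \<in> carrier G" "(k, x) \<in> C" "(g \<otimes> inv k, \<alpha> k x) \<in> B" by (auto simp: bmult_def)
  then have "k \<in> carrier G" using bisectionD(4)[OF assms(2)] by blast
  then have "g = g \<otimes> inv k \<otimes> k" using k by (simp add: m_assoc)
  then show "\<exists>k h. (k, x) \<in> C \<and> (h, \<alpha> k x) \<in> B \<and> g = h \<otimes> k" using k by blast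
next
  assume "\<exists>k h. (k, x) \<in> C \<and> (h, \<alpha> k x) \<in> B \<and> g = h \<otimes> k"
  then obtain k h where k: "(k, x) \<in> C" "(h, \<alpha> k x) \<in> B" "g = h \<otimes> k" by blast
  then have c: "k \<in> carrier G" "h \<in> carrier G" "x \<in> space M"
    using bisectionD(4,5)[OF assms(2)] bisectionD(4)[OF assms(1)] by blast+
  then have "g \<otimes> inv k = h" using k by (simp add: m_assoc)
  then show "(g, x) \<in> bmult B C" using k c by (auto simp: bmult_def)
qed

lemma bisection_bmult:
  assumes B: "bisection B" and C: "bisection C"
  shows "bisection (bmult B C)"
  unfolding bisection_def sets_N_iff
proof (intro conjI allI impI ballI)
  show "bmult B C \<subseteq> carrier G \<times> space M" by (auto simp: bmult_def)
  fix g assume g: "g \<in> carrier G"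
  have "{x \<in> space M. (g, x) \<in> bmult B C}
    = (\<Union>k\<in>carrier G. section_at C k \<inter> (\<alpha> k -` section_at B (g \<otimes> inv k) \<inter> space M))"
    (is "_ = (\<Union>k\<in>_. ?S k)")
  proof (intro Set.set_eqI iffI)
    fix x assume "x \<in> {x \<in> space M. (g, x) \<in> bmult B C}"
    then obtain k where k: "x \<in> space M" "(k, x) \<in> C" "(g \<otimes> inv k, \<alpha> k x) \<in> B" by (auto simp: bmult_def)
    then have "k \<in> carrier G" using bisectionD(4)[OF C] by blast
    then show "x \<in> (\<Union>k\<in>carrier G. ?S k)" using k by (auto simp: section_at_def act_space)
  next
    fix x assume "x \<in> (\<Union>k\<in>carrier G. ?S k)"
    then show "x \<in> {x \<in> space M. (g, x) \<in> bmult B C}" using g by (auto simp: bmult_def section_at_def)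
  qed
  also have "\<dots> \<in> sets M"
    using g section_at_sets[OF bisectionD(1)[OF B]] section_at_sets[OF bisectionD(1)[OF C]]
    by (intro sets.countable_UN' countable_carrier sets.Int measurable_sets[OF act_measurable] image_subsetI) auto
  finally show "{x \<in> space M. (g, x) \<in> bmult B C} \<in> sets M" .
next
  fix g g' x assume "(g, x) \<in> bmult B C" "(g', x) \<in> bmult B C"
  then obtain k h k' h' where k: "(k, x) \<in> C" "(h, \<alpha> k x) \<in> B" "g = h \<otimes> k"
      "(k', x) \<in> C" "(h', \<alpha> k' x) \<in> B" "g' = h' \<otimes> k'"
    unfolding bmult_iff[OF B C] by blast
  then have "k = k'" using bisectionD(2)[OF C] by blast
  moreover from this have "h = h'" using k bisectionD(2)[OF B] by blast
  ultimately show "g = g'" using k by simp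
next
  fix g g' x x' assume a: "(g, x) \<in> bmult B C" "(g', x') \<in> bmult B C" "\<alpha> g x = \<alpha> g' x'"
  then obtain k h k' h' where k: "(k, x) \<in> C" "(h, \<alpha> k x) \<in> B" "g = h \<otimes> k"
      "(k', x') \<in> C" "(h', \<alpha> k' x') \<in> B" "g' = h' \<otimes> k'"
    unfolding bmult_iff[OF B C] by blast
  then have c: "k \<in> carrier G" "k' \<in> carrier G" "h \<in> carrier G" "h' \<in> carrier G" "x \<in> space M" "x' \<in> space M"
    using bisectionD(4,5)[OF C] bisectionD(4)[OF B] by blast+
  have e: "\<alpha> h (\<alpha> k x) = \<alpha> h' (\<alpha> k' x')"
    using a(3) unfolding k(3,6) by (simp only: act_mult c)
  then have "h = h'" using k bisectionD(3)[OF B] by blast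
  moreover from this have "\<alpha> k x = \<alpha> k' x'" using e c act_inj act_space by metis
  then have "k = k'" using k bisectionD(3)[OF C] by blast
  ultimately show "g = g'" using k by simp
qed

lemma sends_bmult:
  assumes B: "bisection B" and C: "bisection C" and x: "x \<in> space M"
  shows "sends (bmult B C) x h h'' \<longleftrightarrow> (\<exists>h'. sends B x h h' \<and> sends C x h' h'')"
proof
  assume s: "sends (bmult B C) x h h''"
  then have c: "h \<in> carrier G" "h'' \<in> carrier G" by (auto simp: sends_def)
  obtain k l where k: "(k, \<alpha> h'' x) \<in> C" "(l, \<alpha> k (\<alpha> h'' x)) \<in> B" "h \<otimes> inv h'' = l \<otimes> k"
    using s unfolding sends_def bmult_iff[OF B C] by blast
  have kl: "k \<in> carrier G" "l \<in> carrier G" using k bisectionD(4)[OF B] bisectionD(4)[OF C] by blast+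
  have "h = h \<otimes> inv h'' \<otimes> h''" using c by (simp add: m_assoc)
  then have h: "h = l \<otimes> (k \<otimes> h'')" using k(3) kl c by (simp add: m_assoc)
  then have "h \<otimes> inv (k \<otimes> h'') = l" "k \<otimes> h'' \<otimes> inv h'' = k"
    using kl c by (simp_all add: m_assoc)
  then have "sends B x h (k \<otimes> h'')" "sends C x (k \<otimes> h'') h''"
    using k kl c x by (simp_all add: sends_def act_mult)
  then show "\<exists>h'. sends B x h h' \<and> sends C x h' h''" by blast
next
  assume "\<exists>h'. sends B x h h' \<and> sends C x h' h''"
  then obtain h' where s: "sends B x h h'" "sends C x h' h''" by blast
  then have c: "h \<in> carrier G" "h' \<in> carrier G" "h'' \<in> carrier G" by (auto simp: sends_def)
  have "\<alpha> (h' \<otimes> inv h'') (\<alpha> h'' x) = \<alpha> h' x"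
    using c x by (simp add: act_mult[symmetric] act_space m_assoc)
  moreover have "h \<otimes> inv h'' = (h \<otimes> inv h') \<otimes> (h' \<otimes> inv h'')"
  proof -
    have "(h \<otimes> inv h') \<otimes> (h' \<otimes> inv h'') = h \<otimes> (inv h' \<otimes> h') \<otimes> inv h''"
      using c by (simp only: m_assoc m_closed inv_closed)
    then show ?thesis using c by simp
  qed
  ultimately show "sends (bmult B C) x h h''"
    using s c unfolding sends_def bmult_iff[OF B C] by metis
qed

lemma bis_fun_bmult:
  assumes B: "bisection B" and C: "bisection C" and p: "p \<in> space N"
  shows "bis_fun \<G> (bmult B C) f p = bis_fun \<G> B (bis_fun \<G> C f) p"
proof -
  obtain h x where hx: "p = (h, x)" "h \<in> carrier G" "x \<in> space M" using p by (auto simp: space_N)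
  note BC = bisection_bmult[OF B C]
  show ?thesis
  proof (cases "\<exists>h'. sends B x h h'")
    case True
    then obtain h' where h': "sends B x h h'" by blast
    have eq: "bis_fun \<G> B (bis_fun \<G> C f) p = bis_fun \<G> C f (h', x)"
      using bis_fun_sends[OF B hx(3) h'] hx by simp
    show ?thesis
    proof (cases "\<exists>h''. sends C x h' h''")
      case True
      then obtain h'' where h'': "sends C x h' h''" by blast
      then have "sends (bmult B C) x h h''" using h' sends_bmult[OF B C hx(3)] by blast
      then show ?thesis
        using bis_fun_sends[OF C hx(3) h''] bis_fun_sends[OF BC hx(3)] hx eq by simp
    next
      case False
      have "\<not> sends (bmult B C) x h h''" for h''
        using False h' sends_bmult[OF B C hx(3)] sends_unique_right[OF B hx(3) h'] by blast
      moreover have "h' \<in> carrier G" using h' by (simp add: sends_def)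
      ultimately show ?thesis
        using bis_fun_not_sends[OF C hx(3), of h'] bis_fun_not_sends[OF BC hx(3,2)] False hx eq by simp
    qed
  next
    case False
    then have "\<not> sends (bmult B C) x h h''" for h'' using sends_bmult[OF B C hx(3)] by blast
    then show ?thesis
      using bis_fun_not_sends[OF B hx(3,2)] bis_fun_not_sends[OF BC hx(3,2)] False hx by simp
  qed
qed

text \<open>
  The operators of bisections multiply like the bisections, which reduces every product in the
  definition of \<open>SA\<close> to a computation with sets of arrows.
\<close>

lemma op_mult_bis_op:
  assumes B: "bisection B" and C: "bisection C"
  shows "op_mult N (bis_op \<G> B) (bis_op \<G> C) = bis_op \<G> (bmult B C)"
proof (rule extensionalityI[of _ "L2 N"])
  show "op_mult N (bis_op \<G> B) (bis_op \<G> C) \<in> extensional (L2 N)" by (simp add: op_mult_eq)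
  show "bis_op \<G> (bmult B C) \<in> extensional (L2 N)" by (simp add: bis_op_def)
  fix a assume a: "a \<in> L2 N"
  then obtain f where f: "f \<in> square_integrable N" and af: "a = l2_class N f" by (auto simp: L2_eq)
  note BC = bisection_bmult[OF B C]
  note Cf = bis_fun_square_integrable(1)[OF C f]
  have "op_mult N (bis_op \<G> B) (bis_op \<G> C) a = l2_class N (bis_fun \<G> B (bis_fun \<G> C f))"
    using a by (simp add: op_mult_eq) (simp add: af bis_op_class[OF C f] bis_op_class[OF B Cf])
  also have "\<dots> = l2_class N (bis_fun \<G> (bmult B C) f)"
    using f Cf BC
    by (intro l2_class_cong bis_fun_measurable[OF B] bis_fun_measurable[OF BC] AE_I2)
       (auto simp: bis_fun_bmult[OF B C] square_integrable_measurable)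
  also have "\<dots> = bis_op \<G> (bmult B C) a" by (simp add: af bis_op_class[OF BC f])
  finally show "op_mult N (bis_op \<G> B) (bis_op \<G> C) a = bis_op \<G> (bmult B C) a" .
qed

text \<open>The graph of a group element over a set; with \<open>g = \<one>\<close> its operator is the diagonal projection of \<open>A\<close>.\<close>

definition slab :: "'a \<Rightarrow> 'x set \<Rightarrow> ('a \<times> 'x) set" where
  "slab g A = {g} \<times> A"

lemma bisection_slab:
  assumes "g \<in> carrier G" "A \<in> sets M"
  shows "bisection (slab g A)"
  unfolding bisection_def sets_N_iff
proof (intro conjI ballI)
  show "slab g A \<subseteq> carrier G \<times> space M" using assms sets.sets_into_space by (auto simp: slab_def)
  fix h assume "h \<in> carrier G"
  have "{x \<in> space M. (h, x) \<in> slab g A} = (if h = g then A else {})"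
    using sets.sets_into_space[OF assms(2)] by (auto simp: slab_def)
  then show "{x \<in> space M. (h, x) \<in> slab g A} \<in> sets M" using assms by simp
qed (auto simp: slab_def)

lemma op_id_eq: "op_id N = bis_op \<G> (slab \<one> (space M))"
proof (rule extensionalityI[of _ "L2 N"])
  show "op_id N \<in> extensional (L2 N)" by (simp add: op_id_def)
  show "bis_op \<G> (slab \<one> (space M)) \<in> extensional (L2 N)" by (simp add: bis_op_def)
  fix a assume a: "a \<in> L2 N"
  then obtain f where f: "f \<in> square_integrable N" and af: "a = l2_class N f" by (auto simp: L2_eq)
  have U: "bisection (slab \<one> (space M))" by (rule bisection_slab) auto
  have "bis_fun \<G> (slab \<one> (space M)) f p = f p" if p: "p \<in> space N" for p
  proof -
    obtain h x where hx: "p = (h, x)" "h \<in> carrier G" "x \<in> space M" using p by (auto simp: space_N)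
    then have "sends (slab \<one> (space M)) x h h" by (simp add: sends_def slab_def act_space)
    from bis_fun_sends[OF U hx(3) this] show ?thesis by (simp add: hx)
  qed
  then have "l2_class N (bis_fun \<G> (slab \<one> (space M)) f) = l2_class N f"
    using f by (intro l2_class_cong bis_fun_measurable[OF U] AE_I2) (auto simp: square_integrable_measurable)
  then show "op_id N a = bis_op \<G> (slab \<one> (space M)) a"
    using a by (simp add: op_id_def) (simp add: af bis_op_class[OF U f])
qed

definition bprod :: "('a \<times> 'x) set list \<Rightarrow> ('a \<times> 'x) set" where
  "bprod Bs = foldr bmult Bs (slab \<one> (space M))"

lemma bprod_simps: "bprod [] = slab \<one> (space M)" "bprod (B # Bs) = bmult B (bprod Bs)"
  by (simp_all add: bprod_def)

lemma bisection_bprod: "\<forall>B\<in>set Bs. bisection B \<Longrightarrow> bisection (bprod Bs)"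
  by (induction Bs) (auto simp: bprod_simps bisection_slab bisection_bmult)

lemma op_prod_bis_op:
  "\<forall>B\<in>set Bs. bisection B \<Longrightarrow> op_prod N (map (bis_op \<G>) Bs) = bis_op \<G> (bprod Bs)"
proof (induction Bs)
  case Nil
  then show ?case by (simp add: op_prod_def op_id_eq bprod_simps)
next
  case (Cons B Bs)
  then have "op_prod N (map (bis_op \<G>) (B # Bs)) = op_mult N (bis_op \<G> B) (bis_op \<G> (bprod Bs))"
    by (simp add: op_prod_def)
  also have "\<dots> = bis_op \<G> (bprod (B # Bs))"
    using Cons.prems by (simp add: op_mult_bis_op bisection_bprod bprod_simps)
  finally show ?case .
qed

lemma op_adjoint_bis_op:
  assumes B: "bisection B"
  shows "op_adjoint N (bis_op \<G> B) = bis_op \<G> (binv B)"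
proof (rule op_adjoint_unique)
  note B' = bisection_binv[OF B]
  show "bis_op \<G> (binv B) \<in> bounded_ops N" by (rule bis_op_bounded[OF B'])
  fix a b assume "a \<in> L2 N" "b \<in> L2 N"
  then obtain f g where f: "f \<in> square_integrable N" and a: "a = l2_class N f"
    and g: "g \<in> square_integrable N" and b: "b = l2_class N g" by (auto simp: L2_eq)
  note mf = square_integrable_measurable[OF f] and mg = square_integrable_measurable[OF g]
  define F where "F p = f p * cnj (bis_fun \<G> (binv B) g p)" for p
  have F: "F \<in> borel_measurable N" unfolding F_def using mf bis_fun_measurable[OF B' mg] by measurable
  have 1: "bis_fun \<G> B f p * cnj (g p) = indicator (moved B) p *\<^sub>R F (move B p)" if p: "p \<in> space N" for p
  proof (cases "p \<in> moved B")
    case True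
    then obtain h x h' where h: "p = (h, x)" "x \<in> space M" "sends B x h h'" by (auto simp: moved_def)
    have "bis_fun \<G> B f (h, x) = f (h', x)" by (rule bis_fun_sends[OF B h(2,3)])
    moreover have "bis_fun \<G> (binv B) g (h', x) = g (h, x)"
      using bis_fun_sends[OF B' h(2)] h(2,3) sends_binv by blast
    moreover have "move B (h, x) = (h', x)" by (rule move_eq[OF B h(2,3)])
    ultimately show ?thesis using True by (simp add: h(1) F_def)
  qed (simp add: bis_fun_eq[OF B p])
  have 2: "f p * cnj (bis_fun \<G> (binv B) g p) = indicator (moved (binv B)) p *\<^sub>R F p" if p: "p \<in> space N" for p
    by (cases "p \<in> moved (binv B)") (simp_all add: F_def bis_fun_eq[OF B' p])
  have "l2_inner N (bis_op \<G> B a) b = (LINT p|N. bis_fun \<G> B f p * cnj (g p))"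
    unfolding a b bis_op_class[OF B f] by (rule l2_inner_class[OF bis_fun_measurable[OF B mf] mg])
  also have "\<dots> = (LINT p|N. indicator (moved B) p *\<^sub>R F (move B p))"
    by (rule Bochner_Integration.integral_cong[OF refl 1])
  also have "\<dots> = (LINT p|N. indicator (moved (binv B)) p *\<^sub>R F p)"
    by (rule move_change_of_variables(2)[OF B F])
  also have "\<dots> = (LINT p|N. f p * cnj (bis_fun \<G> (binv B) g p))"
    by (rule Bochner_Integration.integral_cong[OF refl 2[symmetric]])
  also have "\<dots> = l2_inner N a (bis_op \<G> (binv B) b)"
    unfolding a b bis_op_class[OF B' g] by (rule l2_inner_class[OF mf bis_fun_measurable[OF B' mg], symmetric])
  finally show "l2_inner N (bis_op \<G> B a) b = l2_inner N a (bis_op \<G> (binv B) b)" .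
qed

definition slab_vect :: "'a \<Rightarrow> 'x set \<Rightarrow> ('a \<times> 'x) vect" where
  "slab_vect g A = l2_class N (indicator (slab g A))"

lemma emeasure_slab:
  assumes "g \<in> carrier G" "A \<in> sets M"
  shows "emeasure N (slab g A) = emeasure M A"
proof -
  have "emeasure N (slab g A) = emeasure (count_space (carrier G)) {g} * emeasure M A"
    unfolding gmeas_eq slab_def using assms by (intro emeasure_pair_measure_Times) auto
  then show ?thesis using assms by (simp add: emeasure_count_space)
qed

lemma slab_sets: "g \<in> carrier G \<Longrightarrow> A \<in> sets M \<Longrightarrow> slab g A \<in> sets N"
  using bisection_slab bisectionD(1) by blast

lemma indicator_slab_square_integrable:
  assumes "g \<in> carrier G" "A \<in> sets M"
  shows "(indicator (slab g A) :: _ \<Rightarrow> complex) \<in> square_integrable N"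
proof -
  have "integrable N (indicator (slab g A) :: _ \<Rightarrow> real)"
    using slab_sets[OF assms] emeasure_slab[OF assms]
    by (intro integrable_real_indicator) (simp_all add: emeasure_eq_measure)
  moreover have "(cmod (indicator (slab g A) p))\<^sup>2 = (indicator (slab g A) p :: real)" for p
    by (simp add: indicator_def)
  ultimately show ?thesis using slab_sets[OF assms] by (simp add: square_integrable_def)
qed

lemma slab_vect_in_L2: "g \<in> carrier G \<Longrightarrow> A \<in> sets M \<Longrightarrow> slab_vect g A \<in> L2 N"
  unfolding slab_vect_def L2_eq using indicator_slab_square_integrable by blast

text \<open>
  This matrix coefficient measures the part of \<open>Q\<close> on which \<open>B\<close> acts as \<open>g\<close>. It is linear in the operator,
  and it is what makes it possible to define linear maps on the span by a formula.
\<close>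

lemma inner_bis_op_slab:
  assumes B: "bisection B" and g: "g \<in> carrier G" and Q: "Q \<in> sets M"
  shows "l2_inner N (bis_op \<G> B (slab_vect \<one> Q)) (slab_vect g Q)
    = of_real (measure M (Q \<inter> section_at B g))"
proof -
  note s1 = indicator_slab_square_integrable[OF one_closed Q]
    and s2 = indicator_slab_square_integrable[OF g Q]
  note m = square_integrable_measurable
  let ?A = "Q \<inter> section_at B g"
  have A: "?A \<in> sets M" using Q section_at_sets[OF bisectionD(1)[OF B] g] by auto
  have eq: "bis_fun \<G> B (indicator (slab \<one> Q)) p * cnj (indicator (slab g Q) p)
    = of_real (indicator (slab g ?A) p)" if p: "p \<in> space N" for p
  proof (cases "p \<in> slab g Q")
    case True
    then obtain x where p: "p = (g, x)" and x: "x \<in> space M" "x \<in> Q"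
      using sets.sets_into_space[OF Q] by (auto simp: slab_def)
    have sd: "sends B x g \<one> \<longleftrightarrow> (g, x) \<in> B" using g x by (simp add: sends_def act_one)
    show ?thesis
    proof (cases "\<exists>h'. sends B x g h'")
      case True
      then obtain h' where h': "sends B x g h'" by blast
      then have "bis_fun \<G> B (indicator (slab \<one> Q)) p = (indicator (slab \<one> Q) (h', x) :: complex)"
        unfolding p by (rule bis_fun_sends[OF B x(1)])
      moreover have "h' = \<one> \<longleftrightarrow> (g, x) \<in> B" using h' sd sends_unique_right[OF B x(1)] by metis
      ultimately show ?thesis using x by (auto simp: p slab_def section_at_def indicator_def)
    next
      case False
      then have "bis_fun \<G> B (indicator (slab \<one> Q)) p = (0 :: complex)" "(g, x) \<notin> B"
        unfolding p using bis_fun_not_sends[OF B x(1) g] sd by auto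
      then show ?thesis by (simp add: p slab_def section_at_def indicator_def)
    qed
  next
    case False
    then show ?thesis by (auto simp: indicator_def slab_def)
  qed
  have "l2_inner N (bis_op \<G> B (slab_vect \<one> Q)) (slab_vect g Q)
    = (LINT p|N. bis_fun \<G> B (indicator (slab \<one> Q)) p * cnj (indicator (slab g Q) p))"
    unfolding slab_vect_def bis_op_class[OF B s1]
    by (rule l2_inner_class[OF bis_fun_measurable[OF B m[OF s1]] m[OF s2]])
  also have "\<dots> = (LINT p|N. of_real (indicator (slab g ?A) p))"
    by (rule Bochner_Integration.integral_cong[OF refl eq])
  also have "\<dots> = of_real (LINT p|N. indicator (slab g ?A) p)" by (rule integral_complex_of_real)
  also have "(LINT p|N. indicator (slab g ?A) p) = measure M ?A"
    using slab_sets[OF g A] emeasure_slab[OF g A] sets.sets_into_space[OF slab_sets[OF g A]]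
    by (simp add: measure_def Int_absorb2)
  finally show ?thesis .
qed

lemma vn_trace_bis_op:
  assumes B: "bisection B"
  shows "vn_trace \<G> (bis_op \<G> B) = of_real (measure M (section_at B \<one>))"
proof -
  have "section_at B \<one> \<subseteq> space M" by (auto simp: section_at_def)
  then show ?thesis
    using inner_bis_op_slab[OF B one_closed sets.top]
    by (simp add: vn_trace_def units_eq slab_vect_def slab_def Int_absorb1)
qed

lemma adjoint_set_inv_semigroup:
  assumes "F \<subseteq> inv_semigroup \<G>"
  shows "adjoint_set N F \<subseteq> inv_semigroup \<G>"
proof
  fix s assume "s \<in> adjoint_set N F"
  then obtain t where t: "t \<in> F" "s = op_adjoint N t" by (auto simp: adjoint_set_def)
  then obtain B where "bisection B" "t = bis_op \<G> B" using assms by (auto simp: inv_semigroup_eq)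
  then show "s \<in> inv_semigroup \<G>"
    using t op_adjoint_bis_op bisection_binv by (auto simp: inv_semigroup_eq)
qed

lemma linear_maps_zero:
  assumes "\<phi> \<in> linear_maps \<G> d"
  shows "\<phi> (bis_op \<G> {}) = 0\<^sub>m d d"
proof -
  have b: "bisection {}" by (simp add: bisection_def)
  note v = bis_op_in_vn_span[OF b]
  have "op_scale N 0 (bis_op \<G> {}) = bis_op \<G> {}"
  proof (rule extensionalityI[of _ "L2 N"])
    fix a assume a: "a \<in> L2 N"
    then obtain f where f: "f \<in> square_integrable N" and af: "a = l2_class N f" by (auto simp: L2_eq)
    have z: "bis_fun \<G> {} f = (\<lambda>p. 0)"
      by (rule ext) (auto simp: bis_fun_def)
    show "op_scale N 0 (bis_op \<G> {}) a = bis_op \<G> {} a"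
      using a by (simp add: op_scale_def) (simp add: af bis_op_class[OF b f] z l2_scale_class)
  qed (auto simp: op_scale_def bis_op_def)
  moreover have "\<phi> (op_scale N 0 (bis_op \<G> {})) = 0 \<cdot>\<^sub>m \<phi> (bis_op \<G> {})"
    using assms v by (simp add: linear_maps_def)
  moreover have "\<phi> (bis_op \<G> {}) \<in> carrier_mat d d"
    using assms v by (auto simp: linear_maps_def)
  moreover have "0 \<cdot>\<^sub>m A = 0\<^sub>m d d" if "A \<in> carrier_mat d d" for A :: "complex mat"
    using that by (intro eq_matI) auto
  ultimately show ?thesis by metis
qed

end

section \<open>Permutations with prescribed transitions\<close>

text \<open>
  Sort all permutations \<open>\<rho>\<close> by the colouring \<open>c \<circ> \<rho>\<close>. There are at most \<open>card (c ` A) ^ card A\<close> such colourings, and two permutations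
  with the same one differ by a permutation preserving colours. For boundedly many
  colours, restricting to those costs only a factor \<open>C\<^sup>d\<close>.
\<close>

lemma card_colour_preserving_permutations:
  fixes c :: "'i \<Rightarrow> 'k"
  assumes A: "finite A"
  shows "fact (card A) \<le> card {\<rho>. \<rho> permutes A \<and> (\<forall>i\<in>A. c (\<rho> i) = c i)} * card (c ` A) ^ card A"
proof -
  let ?P = "{\<rho>. \<rho> permutes A}" and ?S = "{\<rho>. \<rho> permutes A \<and> (\<forall>i\<in>A. c (\<rho> i) = c i)}"
  define \<Phi> where "\<Phi> \<rho> = restrict (c \<circ> \<rho>) A" for \<rho>
  have finP: "finite ?P" by (rule finite_permutations[OF A])
  have finS: "finite ?S" by (rule finite_subset[OF _ finP]) auto
  have fibre: "card {\<rho> \<in> ?P. \<Phi> \<rho> = y} \<le> card ?S" if y: "y \<in> \<Phi> ` ?P" for y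
  proof -
    obtain \<rho>0 where r0: "\<rho>0 permutes A" "y = \<Phi> \<rho>0" using y by auto
    have "(\<lambda>\<rho>. \<rho> \<circ> inv_into UNIV \<rho>0) ` {\<rho> \<in> ?P. \<Phi> \<rho> = y} \<subseteq> ?S"
    proof (clarify, intro conjI ballI)
      fix \<rho> assume r: "\<rho> permutes A" "y = \<Phi> \<rho>"
      show "\<rho> \<circ> inv_into UNIV \<rho>0 permutes A" using r r0 permutes_compose permutes_inv by blast
      fix i assume "i \<in> A"
      then have j: "inv_into UNIV \<rho>0 i \<in> A" using r0 permutes_inv permutes_in_image by metis
      have "c (\<rho> (inv_into UNIV \<rho>0 i)) = c (\<rho>0 (inv_into UNIV \<rho>0 i))"
      proof -
        have "\<Phi> \<rho> = \<Phi> \<rho>0" using r(2) r0(2) by simp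
        from fun_cong[OF this, of "inv_into UNIV \<rho>0 i"] show ?thesis using j by (simp add: \<Phi>_def)
      qed
      then show "c ((\<rho> \<circ> inv_into UNIV \<rho>0) i) = c i" using permutes_inverses(1)[OF r0(1)] by simp
    qed
    moreover have "inj_on (\<lambda>\<rho>. \<rho> \<circ> inv_into UNIV \<rho>0) {\<rho> \<in> ?P. \<Phi> \<rho> = y}"
    proof (rule inj_onI)
      fix \<rho> \<rho>' assume "\<rho> \<circ> inv_into UNIV \<rho>0 = \<rho>' \<circ> inv_into UNIV \<rho>0"
      then have "\<rho> \<circ> inv_into UNIV \<rho>0 \<circ> \<rho>0 = \<rho>' \<circ> inv_into UNIV \<rho>0 \<circ> \<rho>0" by simp
      then show "\<rho> = \<rho>'" unfolding comp_assoc permutes_inv_o(2)[OF r0(1)] by simp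
    qed
    ultimately show ?thesis using card_inj_on_le finS by blast
  qed
  have "\<Phi> ` ?P \<subseteq> A \<rightarrow>\<^sub>E c ` A"
    using permutes_in_image by (fastforce simp: \<Phi>_def)
  then have img: "card (\<Phi> ` ?P) \<le> card (c ` A) ^ card A"
    using card_mono[of "A \<rightarrow>\<^sub>E c ` A" "\<Phi> ` ?P"] A by (simp add: finite_PiE card_PiE)
  have "fact (card A) = card ?P" using card_permutations[OF refl A] by simp
  also have "\<dots> \<le> card (\<Union>y\<in>\<Phi> ` ?P. {\<rho> \<in> ?P. \<Phi> \<rho> = y})"
    using finP by (intro card_mono) auto
  also have "\<dots> \<le> (\<Sum>y\<in>\<Phi> ` ?P. card {\<rho> \<in> ?P. \<Phi> \<rho> = y})"
    using finP by (intro card_UN_le) auto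
  also have "\<dots> \<le> card (\<Phi> ` ?P) * card ?S"
    using sum_bounded_above[OF fibre, of "\<Phi> ` ?P"] by simp
  also have "\<dots> \<le> card (c ` A) ^ card A * card ?S" by (rule mult_right_mono[OF img]) simp
  finally show ?thesis by (simp add: mult.commute)
qed

lemma ex_disjoint_parts:
  assumes "finite I" "finite V" "sum m I \<le> card V"
  shows "\<exists>h. \<forall>i\<in>I. card {v \<in> V. h v = Some i} = m i"
  using assms
proof (induction I arbitrary: V rule: finite_induct)
  case (insert j I)
  have s: "m j + sum m I \<le> card V"
    using insert.prems(2) by (simp only: sum.insert[OF insert.hyps])
  then have "m j \<le> card V" by simp
  then obtain W where W: "W \<subseteq> V" "card W = m j" by (rule obtain_subset_with_card_n)
  then have "sum m I \<le> card (V - W)"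
    using s card_Diff_subset[OF finite_subset[OF W(1) insert.prems(1)] W(1)] by linarith
  from insert.IH[OF _ this] insert.prems(1) obtain h
    where h: "\<forall>i\<in>I. card {v \<in> V - W. h v = Some i} = m i" by blast
  define h' where "h' v = (if v \<in> W then Some j else if h v = Some j then None else h v)" for v
  have "{v \<in> V. h' v = Some j} = W" using W by (auto simp: h'_def)
  moreover have "{v \<in> V. h' v = Some i} = {v \<in> V - W. h v = Some i}" if "i \<in> I" for i
    using that insert.hyps by (auto simp: h'_def)
  ultimately have "\<forall>i\<in>insert j I. card {v \<in> V. h' v = Some i} = m i" using h W by simp
  then show ?case by blast
qed simp

text \<open>
  Given \<open>n a b\<close> transitions wanted from label \<open>a\<close> to label \<open>b\<close>, reserve sources inside each label class and, independently,
  targets inside each label class, and match them up; what is not reserved is mapped arbitrarily. The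
  exceptional set \<open>Z\<close> collects the sources that are not reserved.
\<close>

lemma ex_coupling_permutation:
  fixes h :: "'i \<Rightarrow> 'l option" and n :: "'l \<Rightarrow> 'l \<Rightarrow> nat"
  assumes fin: "finite \<Lambda>" "finite A"
    and row: "\<And>a. a \<in> \<Lambda> \<Longrightarrow> (\<Sum>b\<in>\<Lambda>. n a b) \<le> card {i \<in> A. h i = Some a}"
    and col: "\<And>b. b \<in> \<Lambda> \<Longrightarrow> (\<Sum>a\<in>\<Lambda>. n a b) \<le> card {i \<in> A. h i = Some b}"
  obtains \<sigma> Z where "\<sigma> permutes A" "Z \<subseteq> A" "card Z + (\<Sum>a\<in>\<Lambda>. \<Sum>b\<in>\<Lambda>. n a b) = card A"
    "\<And>i. i \<in> A - Z \<Longrightarrow> \<exists>a\<in>\<Lambda>. \<exists>b\<in>\<Lambda>. h i = Some a \<and> h (\<sigma> i) = Some b \<and> n a b > 0"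
proof -
  let ?V = "\<lambda>a. {i \<in> A. h i = Some a}"
  have "\<forall>a\<in>\<Lambda>. \<exists>g. \<forall>b\<in>\<Lambda>. card {i \<in> ?V a. g i = Some b} = n a b"
    using fin row by (intro ballI ex_disjoint_parts) auto
  from bchoice[OF this] obtain g
    where g: "\<And>a b. a \<in> \<Lambda> \<Longrightarrow> b \<in> \<Lambda> \<Longrightarrow> card {i \<in> ?V a. g a i = Some b} = n a b" by blast
  have "\<forall>b\<in>\<Lambda>. \<exists>g. \<forall>a\<in>\<Lambda>. card {i \<in> ?V b. g i = Some a} = n a b"
    using fin col by (intro ballI ex_disjoint_parts) auto
  from bchoice[OF this] obtain g'
    where g': "\<And>a b. a \<in> \<Lambda> \<Longrightarrow> b \<in> \<Lambda> \<Longrightarrow> card {i \<in> ?V b. g' b i = Some a} = n a b" by blast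
  define f where "f i = (if \<exists>a\<in>\<Lambda>. \<exists>b\<in>\<Lambda>. h i = Some a \<and> g a i = Some b
    then Some (the (h i), the (g (the (h i)) i)) else None)" for i
  define f' where "f' i = (if \<exists>a\<in>\<Lambda>. \<exists>b\<in>\<Lambda>. h i = Some b \<and> g' b i = Some a
    then Some (the (g' (the (h i)) i), the (h i)) else None)" for i
  have f: "f i = Some (a, b) \<longleftrightarrow> a \<in> \<Lambda> \<and> b \<in> \<Lambda> \<and> h i = Some a \<and> g a i = Some b" for i a b
    by (auto simp: f_def)
  have f': "f' i = Some (a, b) \<longleftrightarrow> a \<in> \<Lambda> \<and> b \<in> \<Lambda> \<and> h i = Some b \<and> g' b i = Some a" for i a b
    by (auto simp: f'_def)
  have cf: "card {i \<in> A. f i = Some (a, b)} = (if a \<in> \<Lambda> \<and> b \<in> \<Lambda> then n a b else 0)" for a b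
    using g[of a b] by (auto simp: f conj_ac)
  have cf': "card {i \<in> A. f' i = Some (a, b)} = (if a \<in> \<Lambda> \<and> b \<in> \<Lambda> then n a b else 0)" for a b
    using g'[of a b] by (auto simp: f' conj_ac)
  have none: "card {i \<in> A. F i = None} + (\<Sum>a\<in>\<Lambda>. \<Sum>b\<in>\<Lambda>. n a b) = card A"
    if F: "\<And>a b. card {i \<in> A. F i = Some (a, b)} = (if a \<in> \<Lambda> \<and> b \<in> \<Lambda> then n a b else 0)"
      "\<And>i a b. F i = Some (a, b) \<Longrightarrow> a \<in> \<Lambda> \<and> b \<in> \<Lambda>" for F :: "'i \<Rightarrow> ('l \<times> 'l) option"
  proof -
    have "{i \<in> A. F i \<noteq> None} = (\<Union>p\<in>\<Lambda> \<times> \<Lambda>. {i \<in> A. F i = Some p})"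
    proof (intro subset_antisym subsetI)
      fix i assume i: "i \<in> {i \<in> A. F i \<noteq> None}"
      then obtain a b where ab: "F i = Some (a, b)" by auto
      from F(2)[OF this] ab i show "i \<in> (\<Union>p\<in>\<Lambda> \<times> \<Lambda>. {i \<in> A. F i = Some p})" by auto
    qed auto
    then have "card {i \<in> A. F i \<noteq> None} = (\<Sum>p\<in>\<Lambda> \<times> \<Lambda>. card {i \<in> A. F i = Some p})"
      using fin by (simp only:) (intro card_UN_disjoint, auto)
    also have "\<dots> = (\<Sum>(a, b)\<in>\<Lambda> \<times> \<Lambda>. n a b)" using F(1) by (intro sum.cong) auto
    also have "\<dots> = (\<Sum>a\<in>\<Lambda>. \<Sum>b\<in>\<Lambda>. n a b)" by (simp add: sum.cartesian_product)
    finally have *: "card {i \<in> A. F i \<noteq> None} = (\<Sum>a\<in>\<Lambda>. \<Sum>b\<in>\<Lambda>. n a b)" .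
    have "A = {i \<in> A. F i = None} \<union> {i \<in> A. F i \<noteq> None}" by blast
    then have "card A = card ({i \<in> A. F i = None} \<union> {i \<in> A. F i \<noteq> None})" by (rule arg_cong)
    also have "\<dots> = card {i \<in> A. F i = None} + card {i \<in> A. F i \<noteq> None}"
      using fin by (intro card_Un_disjoint) auto
    finally show ?thesis using * by simp
  qed
  have nf: "card {i \<in> A. f i = None} + (\<Sum>a\<in>\<Lambda>. \<Sum>b\<in>\<Lambda>. n a b) = card A"
    by (rule none[OF cf]) (simp add: f)
  moreover have "card {i \<in> A. f' i = None} + (\<Sum>a\<in>\<Lambda>. \<Sum>b\<in>\<Lambda>. n a b) = card A"
    by (rule none[OF cf']) (simp add: f')
  ultimately have eqN: "card {i \<in> A. f i = y} = card {i \<in> A. f' i = y}" for y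
    using cf cf' by (cases y) auto
  have cnt: "count (image_mset F (mset_set A)) y = card {i \<in> A. F i = y}" for F :: "'i \<Rightarrow> ('l \<times> 'l) option" and y
  proof -
    have "count (image_mset F (mset_set A)) y = sum (count (mset_set A)) (F -` {y} \<inter> A)"
      using fin by (simp add: count_image_mset)
    also have "\<dots> = (\<Sum>i\<in>F -` {y} \<inter> A. 1)" using fin by (intro sum.cong) auto
    also have "\<dots> = card {i \<in> A. F i = y}" by (simp add: vimage_def Int_def conj_commute)
    finally show ?thesis .
  qed
  have "image_mset f (mset_set A) = image_mset f' (mset_set A)"
    by (rule multiset_eqI) (simp only: cnt eqN)
  from image_mset_eq_implies_permutes[OF fin(2) this] obtain \<sigma>
    where \<sigma>: "\<sigma> permutes A" "\<forall>i\<in>A. f i = f' (\<sigma> i)" by blast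
  show ?thesis
  proof (rule that[OF \<sigma>(1) _ nf])
    fix i assume i: "i \<in> A - {i \<in> A. f i = None}"
    then obtain a b where ab: "f i = Some (a, b)" by auto
    then have "f' (\<sigma> i) = Some (a, b)" using \<sigma>(2) i by simp
    moreover have "n a b > 0"
    proof -
      have "i \<in> {i \<in> A. f i = Some (a, b)}" using i ab by simp
      then have "{i \<in> A. f i = Some (a, b)} \<noteq> {}" by blast
      moreover have "finite {i \<in> A. f i = Some (a, b)}" using fin(2) by simp
      ultimately have "card {i \<in> A. f i = Some (a, b)} > 0" unfolding card_gt_0_iff by blast
      then show ?thesis unfolding cf by (simp split: if_splits)
    qed
    ultimately show "\<exists>a\<in>\<Lambda>. \<exists>b\<in>\<Lambda>. h i = Some a \<and> h (\<sigma> i) = Some b \<and> n a b > 0"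
      using ab f f' by blast
  qed auto
qed

lemma sum_floor_bounds:
  fixes p :: "'l \<Rightarrow> real"
  assumes nn: "\<And>a. a \<in> \<Lambda> \<Longrightarrow> 0 \<le> p a"
  shows "real (\<Sum>a\<in>\<Lambda>. nat \<lfloor>p a\<rfloor>) \<le> sum p \<Lambda>" "sum p \<Lambda> \<le> real (\<Sum>a\<in>\<Lambda>. nat \<lfloor>p a\<rfloor>) + real (card \<Lambda>)"
proof -
  have "real (\<Sum>a\<in>\<Lambda>. nat \<lfloor>p a\<rfloor>) = (\<Sum>a\<in>\<Lambda>. real (nat \<lfloor>p a\<rfloor>))" by simp
  also have "\<dots> \<le> sum p \<Lambda>" using nn by (intro sum_mono) (simp add: of_nat_floor)
  finally show "real (\<Sum>a\<in>\<Lambda>. nat \<lfloor>p a\<rfloor>) \<le> sum p \<Lambda>" .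
  have "sum p \<Lambda> \<le> (\<Sum>a\<in>\<Lambda>. real (nat \<lfloor>p a\<rfloor>) + 1)"
  proof (intro sum_mono)
    fix a assume "a \<in> \<Lambda>"
    then have "0 \<le> \<lfloor>p a\<rfloor>" using nn by simp
    then have "real (nat \<lfloor>p a\<rfloor>) = of_int \<lfloor>p a\<rfloor>" by simp
    then show "p a \<le> real (nat \<lfloor>p a\<rfloor>) + 1" by linarith
  qed
  then show "sum p \<Lambda> \<le> real (\<Sum>a\<in>\<Lambda>. nat \<lfloor>p a\<rfloor>) + real (card \<Lambda>)" by (simp add: sum.distrib)
qed

text \<open>
  Round the coupling \<open>w k\<close> of \<open>p\<close> with itself, scaled by \<open>d\<close>, down to integers; the rounding loses a number of
  points bounded independently of \<open>d\<close>. Each permutation in \<open>S k\<close> is one coupling permutation precomposed with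
  permutations preserving the label of the point and of its image. The points of the exceptional set \<open>Z\<close>
  are fixed by these, so that the members of \<open>S k\<close> differ only where their transitions are
  admissible and can be recovered from the approximation.
\<close>

lemma ex_permutation_models:
  fixes p :: "'l \<Rightarrow> real" and w :: "nat \<Rightarrow> 'l \<Rightarrow> 'l \<Rightarrow> real"
  assumes fin: "finite \<Lambda>" "\<Lambda> \<noteq> {}"
    and p: "\<And>a. a \<in> \<Lambda> \<Longrightarrow> 0 \<le> p a" "sum p \<Lambda> = 1"
    and w: "\<And>k a b. k < r \<Longrightarrow> a \<in> \<Lambda> \<Longrightarrow> b \<in> \<Lambda> \<Longrightarrow> 0 \<le> w k a b"
    and row: "\<And>k a. k < r \<Longrightarrow> a \<in> \<Lambda> \<Longrightarrow> (\<Sum>b\<in>\<Lambda>. w k a b) = p a"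
    and col: "\<And>k b. k < r \<Longrightarrow> b \<in> \<Lambda> \<Longrightarrow> (\<Sum>a\<in>\<Lambda>. w k a b) = p b"
  obtains C :: nat where "\<And>d. \<exists>L Z S. (\<forall>i. L i \<in> \<Lambda>) \<and> Z \<subseteq> {..<d} \<and> card Z \<le> C \<and>
    (\<forall>a\<in>\<Lambda>. \<bar>real (card {i. i < d \<and> L i = a}) - real d * p a\<bar> \<le> real C) \<and>
    (\<forall>k<r. (\<forall>\<sigma>\<in>S k. \<sigma> permutes {..<d} \<and> (\<forall>i\<in>{..<d} - Z. 0 < w k (L i) (L (\<sigma> i)))) \<and>
       (\<forall>\<sigma>\<in>S k. \<forall>\<sigma>'\<in>S k. \<forall>i\<in>Z. \<sigma> i = \<sigma>' i) \<and> fact d \<le> card (S k) * C ^ d)"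
proof -
  define q where "q = card \<Lambda>"
  define C where "C = q + r * q\<^sup>2 + q\<^sup>2"
  have "\<exists>L Z S. (\<forall>i. L i \<in> \<Lambda>) \<and> Z \<subseteq> {..<d} \<and> card Z \<le> C \<and>
    (\<forall>a\<in>\<Lambda>. \<bar>real (card {i. i < d \<and> L i = a}) - real d * p a\<bar> \<le> real C) \<and>
    (\<forall>k<r. (\<forall>\<sigma>\<in>S k. \<sigma> permutes {..<d} \<and> (\<forall>i\<in>{..<d} - Z. 0 < w k (L i) (L (\<sigma> i)))) \<and>
       (\<forall>\<sigma>\<in>S k. \<forall>\<sigma>'\<in>S k. \<forall>i\<in>Z. \<sigma> i = \<sigma>' i) \<and> fact d \<le> card (S k) * C ^ d)" for d
  proof -
    let ?A = "{..<d}"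
    define m where "m a = nat \<lfloor>real d * p a\<rfloor>" for a
    have dp: "0 \<le> real d * p a" if "a \<in> \<Lambda>" for a using p that by simp
    have sdp: "(\<Sum>a\<in>\<Lambda>. real d * p a) = real d" using p(2) by (simp flip: sum_distrib_left)
    note sm = sum_floor_bounds[of \<Lambda> "\<lambda>a. real d * p a", OF dp, folded m_def, unfolded sdp]
    have "sum m \<Lambda> \<le> card ?A" using sm(1) by (simp only: of_nat_le_iff card_lessThan)
    from ex_disjoint_parts[OF fin(1) finite_lessThan this] obtain h
      where h: "\<And>a. a \<in> \<Lambda> \<Longrightarrow> card {i \<in> ?A. h i = Some a} = m a" by blast
    obtain a0 where a0: "a0 \<in> \<Lambda>" using fin by auto
    define L where "L i = (if \<exists>a\<in>\<Lambda>. h i = Some a then the (h i) else a0)" for i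
    have Lin: "L i \<in> \<Lambda>" for i using a0 by (auto simp: L_def)
    have Lh: "L i = a" if "h i = Some a" "a \<in> \<Lambda>" for i a using that by (auto simp: L_def)
    let ?J = "{i \<in> ?A. \<not> (\<exists>a\<in>\<Lambda>. h i = Some a)}"
    have "card {i \<in> ?A. \<exists>a\<in>\<Lambda>. h i = Some a} = sum m \<Lambda>"
    proof -
      have "{i \<in> ?A. \<exists>a\<in>\<Lambda>. h i = Some a} = (\<Union>a\<in>\<Lambda>. {i \<in> ?A. h i = Some a})" by auto
      then have "card {i \<in> ?A. \<exists>a\<in>\<Lambda>. h i = Some a} = (\<Sum>a\<in>\<Lambda>. card {i \<in> ?A. h i = Some a})"
        using fin by (simp only:) (intro card_UN_disjoint, auto)
      then show ?thesis using h by simp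
    qed
    moreover have "card ?A = card {i \<in> ?A. \<exists>a\<in>\<Lambda>. h i = Some a} + card ?J"
    proof -
      have "?A = {i \<in> ?A. \<exists>a\<in>\<Lambda>. h i = Some a} \<union> ?J" by blast
      then have "card ?A = card ({i \<in> ?A. \<exists>a\<in>\<Lambda>. h i = Some a} \<union> ?J)" by (rule arg_cong)
      then show ?thesis by (subst (asm) card_Un_disjoint) auto
    qed
    ultimately have J: "real (card ?J) \<le> real q" using sm(2) unfolding card_lessThan q_def by linarith
    have freq: "\<bar>real (card {i. i < d \<and> L i = a}) - real d * p a\<bar> \<le> real C"
      if a: "a \<in> \<Lambda>" for a
    proof -
      have "card {i \<in> ?A. h i = Some a} \<le> card {i. i < d \<and> L i = a}"
        using Lh a by (intro card_mono) auto
      moreover have "card {i. i < d \<and> L i = a} \<le> card ({i \<in> ?A. h i = Some a} \<union> ?J)"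
        by (intro card_mono) (auto simp: L_def)
      moreover have "card ({i \<in> ?A. h i = Some a} \<union> ?J) \<le> card {i \<in> ?A. h i = Some a} + card ?J"
        by (rule card_Un_le)
      ultimately have b: "m a \<le> card {i. i < d \<and> L i = a}" "card {i. i < d \<and> L i = a} \<le> m a + card ?J"
        using h[OF a] by simp_all
      have "real (m a) \<le> real d * p a" "real d * p a \<le> real (m a) + 1"
        using sum_floor_bounds[of "{a}" "\<lambda>a. real d * p a"] dp[OF a] by (simp_all add: m_def)
      moreover have "1 \<le> q" using fin card_0_eq[OF fin(1)] unfolding q_def by linarith
      moreover have "q \<le> C" by (simp add: C_def)
      ultimately show ?thesis using b J by linarith
    qed
    define n where "n k a b = nat \<lfloor>real d * w k a b\<rfloor>" for k a b
    have dw: "0 \<le> real d * w k a b" if "k < r" "a \<in> \<Lambda>" "b \<in> \<Lambda>" for k a b using w that by simp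
    have "\<exists>\<sigma> Z. \<sigma> permutes ?A \<and> Z \<subseteq> ?A \<and> card Z + (\<Sum>a\<in>\<Lambda>. \<Sum>b\<in>\<Lambda>. n k a b) = card ?A \<and>
      (\<forall>i\<in>?A - Z. \<exists>a\<in>\<Lambda>. \<exists>b\<in>\<Lambda>. h i = Some a \<and> h (\<sigma> i) = Some b \<and> n k a b > 0)" if k: "k < r" for k
    proof -
      have floor_le: "s \<le> m a" if "real s \<le> real d * p a" for s a
        using that unfolding m_def by linarith
      have 1: "(\<Sum>b\<in>\<Lambda>. n k a b) \<le> card {i \<in> ?A. h i = Some a}" if a: "a \<in> \<Lambda>" for a
      proof -
        have "real (\<Sum>b\<in>\<Lambda>. n k a b) \<le> (\<Sum>b\<in>\<Lambda>. real d * w k a b)"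
          unfolding n_def by (rule sum_floor_bounds(1)) (rule dw[OF k a])
        also have "\<dots> = real d * p a" by (simp only: sum_distrib_left[symmetric] row[OF k a])
        finally show ?thesis unfolding h[OF a] by (rule floor_le)
      qed
      have 2: "(\<Sum>a\<in>\<Lambda>. n k a b) \<le> card {i \<in> ?A. h i = Some b}" if b: "b \<in> \<Lambda>" for b
      proof -
        have "real (\<Sum>a\<in>\<Lambda>. n k a b) \<le> (\<Sum>a\<in>\<Lambda>. real d * w k a b)"
          unfolding n_def by (rule sum_floor_bounds(1)) (rule dw[OF k _ b])
        also have "\<dots> = real d * p b" by (simp only: sum_distrib_left[symmetric] col[OF k b])
        finally show ?thesis unfolding h[OF b] by (rule floor_le)
      qed
      show ?thesis
        by (rule ex_coupling_permutation[OF fin(1) finite_lessThan 1 2]) blast+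
    qed
    then obtain \<sigma>0 Zs where s0: "\<And>k. k < r \<Longrightarrow> \<sigma>0 k permutes ?A" "\<And>k. k < r \<Longrightarrow> Zs k \<subseteq> ?A"
      "\<And>k. k < r \<Longrightarrow> card (Zs k) + (\<Sum>a\<in>\<Lambda>. \<Sum>b\<in>\<Lambda>. n k a b) = card ?A"
      "\<And>k i. k < r \<Longrightarrow> i \<in> ?A - Zs k \<Longrightarrow>
         \<exists>a\<in>\<Lambda>. \<exists>b\<in>\<Lambda>. h i = Some a \<and> h (\<sigma>0 k i) = Some b \<and> n k a b > 0"
    proof -
      let ?Q = "\<lambda>k \<sigma> Z. \<sigma> permutes ?A \<and> Z \<subseteq> ?A \<and> card Z + (\<Sum>a\<in>\<Lambda>. \<Sum>b\<in>\<Lambda>. n k a b) = card ?A \<and>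
        (\<forall>i\<in>?A - Z. \<exists>a\<in>\<Lambda>. \<exists>b\<in>\<Lambda>. h i = Some a \<and> h (\<sigma> i) = Some b \<and> n k a b > 0)"
      assume ex: "\<And>k. k < r \<Longrightarrow> \<exists>\<sigma> Z. ?Q k \<sigma> Z"
      define s z where "s k = (SOME \<sigma>. \<exists>Z. ?Q k \<sigma> Z)" and "z k = (SOME Z. ?Q k (s k) Z)" for k
      have Q: "?Q k (s k) (z k)" if k: "k < r" for k
        unfolding z_def by (rule someI_ex) (use someI_ex[OF ex[OF k]] in \<open>simp only: s_def\<close>)
      show thesis by (rule that[of s z]) (use Q in blast)+
    qed
    have cZ: "card (Zs k) \<le> q\<^sup>2" if k: "k < r" for k
    proof -
      have "(\<Sum>(a, b)\<in>\<Lambda> \<times> \<Lambda>. real d * w k a b) = (\<Sum>a\<in>\<Lambda>. real d * p a)"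
        unfolding sum.cartesian_product[symmetric] sum_distrib_left[symmetric]
        by (intro arg_cong2[where f = "(*)"] refl sum.cong row[OF k])
      moreover have "(\<Sum>x\<in>\<Lambda> \<times> \<Lambda>. case x of (a, b) \<Rightarrow> real d * w k a b)
          \<le> real (\<Sum>x\<in>\<Lambda> \<times> \<Lambda>. nat \<lfloor>case x of (a, b) \<Rightarrow> real d * w k a b\<rfloor>) + real (card (\<Lambda> \<times> \<Lambda>))"
        by (rule sum_floor_bounds(2)) (use dw[OF k] in auto)
      moreover have "(\<Sum>x\<in>\<Lambda> \<times> \<Lambda>. nat \<lfloor>case x of (a, b) \<Rightarrow> real d * w k a b\<rfloor>) = (\<Sum>(a, b)\<in>\<Lambda> \<times> \<Lambda>. n k a b)"
        by (intro sum.cong) (auto simp: n_def)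
      ultimately have "real d \<le> real (\<Sum>(a, b)\<in>\<Lambda> \<times> \<Lambda>. n k a b) + real (card (\<Lambda> \<times> \<Lambda>))"
        unfolding sdp by linarith
      moreover have "(\<Sum>(a, b)\<in>\<Lambda> \<times> \<Lambda>. n k a b) = (\<Sum>a\<in>\<Lambda>. \<Sum>b\<in>\<Lambda>. n k a b)"
        by (simp add: sum.cartesian_product)
      moreover have "card (\<Lambda> \<times> \<Lambda>) = q\<^sup>2" by (simp add: q_def card_cartesian_product power2_eq_square)
      ultimately show ?thesis using s0(3)[OF k] unfolding card_lessThan by linarith
    qed
    define Z where "Z = (\<Union>k<r. Zs k)"
    have Zsub: "Z \<subseteq> ?A" using s0(2) by (auto simp: Z_def)
    have "card Z \<le> (\<Sum>k<r. card (Zs k))" unfolding Z_def by (rule card_UN_le) simp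
    also have "\<dots> \<le> r * q\<^sup>2" using cZ sum_bounded_above[of "{..<r}" "\<lambda>k. card (Zs k)" "q\<^sup>2"] by simp
    finally have Zc: "card Z \<le> r * q\<^sup>2" .
    \<comment> \<open>Points of \<open>Z\<close> get colours of their own, so a permutation preserving colours fixes them.\<close>
    define c where "c k i = (if i \<in> Z then Inr i else Inl (L i, L (\<sigma>0 k i)))" for k i
    define S where "S k = (\<lambda>\<rho>. \<sigma>0 k \<circ> \<rho>) ` {\<rho>. \<rho> permutes ?A \<and> (\<forall>i\<in>?A. c k (\<rho> i) = c k i)}" for k
    have "(\<forall>\<sigma>\<in>S k. \<sigma> permutes ?A \<and> (\<forall>i\<in>?A - Z. 0 < w k (L i) (L (\<sigma> i)))) \<and>
       (\<forall>\<sigma>\<in>S k. \<forall>\<sigma>'\<in>S k. \<forall>i\<in>Z. \<sigma> i = \<sigma>' i) \<and> fact d \<le> card (S k) * C ^ d" if k: "k < r" for k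
    proof (intro conjI ballI)
      fix \<sigma> assume "\<sigma> \<in> S k"
      then obtain \<rho> where \<rho>: "\<rho> permutes ?A" "\<And>i. i \<in> ?A \<Longrightarrow> c k (\<rho> i) = c k i" and \<sigma>: "\<sigma> = \<sigma>0 k \<circ> \<rho>"
        by (auto simp: S_def)
      show "\<sigma> permutes ?A" unfolding \<sigma> by (rule permutes_compose[OF \<rho>(1) s0(1)[OF k]])
      show "0 < w k (L i) (L (\<sigma> i))" if i: "i \<in> ?A - Z" for i
      proof -
        have "c k (\<rho> i) = Inl (L i, L (\<sigma>0 k i))" using \<rho>(2)[of i] i by (simp add: c_def)
        then have "L (\<rho> i) = L i" "L (\<sigma>0 k (\<rho> i)) = L (\<sigma>0 k i)" by (auto simp: c_def split: if_splits)
        moreover have "i \<in> ?A - Zs k" using i k by (auto simp: Z_def)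
        from s0(4)[OF k this] obtain a b where ab: "a \<in> \<Lambda>" "b \<in> \<Lambda>" "h i = Some a" "h (\<sigma>0 k i) = Some b" "n k a b > 0"
          by blast
        from ab have "L i = a" "L (\<sigma>0 k i) = b" using Lh by auto
        moreover have "0 < w k a b"
        proof (rule ccontr)
          assume "\<not> 0 < w k a b"
          then have "w k a b = 0" using w[OF k ab(1,2)] by linarith
          then have "n k a b = 0" by (simp add: n_def)
          then show False using ab(5) by simp
        qed
        ultimately show ?thesis by (simp add: \<sigma>)
      qed
    next
      have fx: "\<rho> i = i" if "\<forall>i\<in>?A. c k (\<rho> i) = c k i" "i \<in> Z" for \<rho> i
      proof -
        have "c k (\<rho> i) = c k i" using that Zsub by blast
        then have "c k (\<rho> i) = Inr i" using that by (simp add: c_def)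
        then show ?thesis by (auto simp: c_def split: if_splits)
      qed
      fix \<sigma> \<sigma>' i assume s: "\<sigma> \<in> S k" "\<sigma>' \<in> S k" and i: "i \<in> Z"
      have h: "\<tau> i = \<sigma>0 k i" if \<tau>: "\<tau> \<in> S k" for \<tau>
      proof -
        obtain \<rho> where "\<forall>i\<in>?A. c k (\<rho> i) = c k i" "\<tau> = \<sigma>0 k \<circ> \<rho>" using \<tau> unfolding S_def by blast
        then show ?thesis using fx[OF _ i, of \<rho>] by simp
      qed
      show "\<sigma> i = \<sigma>' i" using h[OF s(1)] h[OF s(2)] by (rule trans[OF _ sym])
    next
      have inj: "inj_on (\<lambda>\<rho>. \<sigma>0 k \<circ> \<rho>) X" for X
      proof (rule inj_onI)
        fix \<rho> \<rho>' assume "\<sigma>0 k \<circ> \<rho> = \<sigma>0 k \<circ> \<rho>'"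
        then have "\<sigma>0 k (\<rho> i) = \<sigma>0 k (\<rho>' i)" for i by (metis comp_apply)
        then have "\<rho> i = \<rho>' i" for i by (rule injD[OF permutes_inj[OF s0(1)[OF k]]])
        then show "\<rho> = \<rho>'" by (rule ext)
      qed
      have "c k ` ?A \<subseteq> Inr ` Z \<union> Inl ` (\<Lambda> \<times> \<Lambda>)" using Lin by (auto simp: c_def)
      then have "card (c k ` ?A) \<le> card (Inr ` Z \<union> Inl ` (\<Lambda> \<times> \<Lambda>) :: ('l \<times> 'l + nat) set)"
        using fin finite_subset[OF Zsub] by (intro card_mono) auto
      also have "\<dots> \<le> card (Inr ` Z :: ('l \<times> 'l + nat) set) + card (Inl ` (\<Lambda> \<times> \<Lambda>) :: ('l \<times> 'l + nat) set)"
        by (rule card_Un_le)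
      also have "\<dots> \<le> C" using Zc by (simp add: card_image C_def card_cartesian_product q_def power2_eq_square)
      finally have "card (c k ` ?A) ^ d \<le> C ^ d" by (intro power_mono) auto
      then have "card (S k) * card (c k ` ?A) ^ d \<le> card (S k) * C ^ d" by (intro mult_left_mono) auto
      moreover have "fact d \<le> card (S k) * card (c k ` ?A) ^ d"
        using card_colour_preserving_permutations[of ?A "c k"] unfolding S_def card_image[OF inj] by simp
      ultimately show "fact d \<le> card (S k) * C ^ d" by linarith
    qed
    moreover have "card Z \<le> C" using Zc by (simp add: C_def)
    ultimately show ?thesis using Lin Zsub freq by (intro exI[of _ L] exI[of _ Z] exI[of _ S]) blast
  qed
  then show ?thesis by (rule that)
qed

section \<open>Free groups are residually finite\<close>

definition letter_perm :: "(nat \<Rightarrow> 'i \<Rightarrow> 'i) \<Rightarrow> letter \<Rightarrow> 'i \<Rightarrow> 'i" where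
  "letter_perm \<sigma> a = (if snd a then \<sigma> (fst a) else inv_into UNIV (\<sigma> (fst a)))"

definition short_words :: "nat \<Rightarrow> nat \<Rightarrow> letter list set" where
  "short_words r m = {w. reduced w \<and> set w \<subseteq> {..<r} \<times> UNIV \<and> length w \<le> m}"

lemma finite_short_words: "finite (short_words r m)"
proof (rule finite_subset)
  show "short_words r m \<subseteq> {w. set w \<subseteq> {..<r} \<times> (UNIV :: bool set) \<and> length w \<le> m}"
    by (auto simp: short_words_def)
qed (simp add: finite_lists_length_le)

lemma short_words_carrier: "w \<in> short_words r m \<Longrightarrow> w \<in> carrier (free_group r)"
  by (simp add: short_words_def free_group_def)

lemma carrier_short_words: "w \<in> carrier (free_group r) \<Longrightarrow> w \<in> short_words r m \<longleftrightarrow> length w \<le> m"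
  by (simp add: short_words_def free_group_def)

lemma Nil_short_words: "[] \<in> short_words r m"
  by (simp add: short_words_def)

lemma short_words_ConsD:
  "a # w \<in> short_words r m \<Longrightarrow> w \<in> short_words r m \<and> fst a < r \<and> push a w = a # w"
  by (auto simp: short_words_def reduced_Cons push_reduced_Cons)

lemma length_push: "length (push a w) \<le> Suc (length w)"
  by (cases w) auto

lemma length_foldr_push: "length (foldr push v w) \<le> length v + length w"
proof (induction v)
  case (Cons a v)
  then show ?case using length_push[of a "foldr push v w"] by simp
qed simp

lemma mult_short_words:
  assumes "v \<in> short_words r m" "w \<in> short_words r n"
  shows "foldr push v w \<in> short_words r (m + n)"
  using assms length_foldr_push[of v w] set_foldr_push[of v w]
  by (auto simp: short_words_def intro: reduced_foldr_push)

lemma foldr_push_act: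
  assumes "\<And>a i. a \<in> set v \<union> set w \<Longrightarrow> \<tau> a (\<tau> (flip a) i) = i"
  shows "foldr \<tau> (foldr push v w) i = foldr \<tau> v (foldr \<tau> w i)"
  using assms
proof (induction v)
  case (Cons a v)
  have *: "foldr \<tau> (push a u) i = \<tau> a (foldr \<tau> u i)" for u
    using Cons.prems[of a] by (cases u) auto
  show ?case using Cons by (simp add: *)
qed simp

lemma letter_perm_flip:
  assumes "bij (\<sigma> (fst a))"
  shows "letter_perm \<sigma> a (letter_perm \<sigma> (flip a) i) = i"
  using assms by (simp add: letter_perm_def flip_def bij_is_surj surj_f_inv_f bij_is_inj)

lemma letter_perm_permutes:
  "\<sigma> (fst a) permutes A \<Longrightarrow> letter_perm \<sigma> a permutes A"
  by (simp add: letter_perm_def permutes_inv)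

lemma word_permutes:
  "\<forall>a\<in>set w. \<sigma> (fst a) permutes A \<Longrightarrow> foldr (letter_perm \<sigma>) w permutes A"
proof (induction w)
  case (Cons a w)
  then have "letter_perm \<sigma> a \<circ> foldr (letter_perm \<sigma>) w permutes A"
    by (intro permutes_compose letter_perm_permutes) auto
  then show ?case by (simp add: comp_def)
qed (simp add: permutes_id[unfolded id_def])

lemma extend_partial_injection:
  assumes B: "finite B" and A: "A \<subseteq> B" and f: "inj_on f A" "f ` A \<subseteq> B"
  obtains \<tau> where "\<tau> permutes B" "\<And>x. x \<in> A \<Longrightarrow> \<tau> x = f x"
proof -
  have "card (B - A) = card (B - f ` A)"
    using assms by (simp add: card_Diff_subset finite_subset card_image)
  then obtain g where g: "bij_betw g (B - A) (B - f ` A)"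
    using B finite_same_card_bij[of "B - A" "B - f ` A"] by auto
  define \<tau> where "\<tau> x = (if x \<in> A then f x else if x \<in> B then g x else x)" for x
  have "bij_betw \<tau> A (f ` A)"
    using f by (subst bij_betw_cong[of A \<tau> f]) (auto simp: \<tau>_def bij_betw_def)
  moreover have "bij_betw \<tau> (B - A) (B - f ` A)"
    using g by (subst bij_betw_cong[of "B - A" \<tau> g]) (auto simp: \<tau>_def)
  ultimately have "bij_betw \<tau> (A \<union> (B - A)) (f ` A \<union> (B - f ` A))"
    by (rule bij_betw_combine) auto
  moreover have "A \<union> (B - A) = B" "f ` A \<union> (B - f ` A) = B" using A f by auto
  ultimately have "\<tau> permutes B" by (intro bij_imp_permutes) (auto simp: \<tau>_def A subsetD[OF A])
  then show ?thesis by (rule that) (simp add: \<tau>_def)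
qed

text \<open>
  Prepending a letter is a partial injection of the finite set \<open>B\<close> of short words. Extended to permutations
  of \<open>B\<close>, the letters make a short word carry the empty word to itself, so no short nontrivial word acts
  as the identity on \<open>B\<close>. To have no fixed point at all, let the group act by left multiplication on the permutations of \<open>B\<close>,
  as in Cayley's theorem.
\<close>

lemma ex_free_finite_action:
  obtains Y :: "(letter list \<Rightarrow> letter list) set" and \<theta>
  where "finite Y" "Y \<noteq> {}" "\<And>k. k < r \<Longrightarrow> \<theta> k permutes Y"
    "\<And>w y. w \<in> short_words r m \<Longrightarrow> w \<noteq> [] \<Longrightarrow> y \<in> Y \<Longrightarrow> foldr (letter_perm \<theta>) w y \<noteq> y"
proof -
  define B where "B = short_words r m"
  have finB: "finite B" by (simp add: B_def finite_short_words)
  have redB: "reduced v" if "v \<in> B" for v using that by (simp add: B_def short_words_def)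
  have "\<exists>\<tau>. \<tau> permutes B \<and> (\<forall>v\<in>B. push (k, True) v \<in> B \<longrightarrow> \<tau> v = push (k, True) v)" for k
  proof -
    let ?A = "{v \<in> B. push (k, True) v \<in> B}"
    have "inj_on (push (k, True)) ?A"
    proof (rule inj_onI)
      fix u v assume uv: "u \<in> ?A" "v \<in> ?A" and "push (k, True) u = push (k, True) v"
      then have "push (k, False) (push (k, True) u) = push (k, False) (push (k, True) v)" by simp
      then show "u = v"
        using push_push[of u "(k, False)"] push_push[of v "(k, False)"] redB uv by (simp add: flip_def)
    qed
    then obtain \<tau> where "\<tau> permutes B" "\<And>v. v \<in> ?A \<Longrightarrow> \<tau> v = push (k, True) v"
      using extend_partial_injection[OF finB, of ?A "push (k, True)"] by auto
    then show ?thesis by blast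
  qed
  then obtain \<tau> where \<tau>: "\<And>k. \<tau> k permutes B"
    "\<And>k v. v \<in> B \<Longrightarrow> push (k, True) v \<in> B \<Longrightarrow> \<tau> k v = push (k, True) v"
    by metis
  have letter: "letter_perm \<tau> a v = a # v" if "a # v \<in> B" for a v
  proof -
    have v: "v \<in> B" "push a v = a # v" using that short_words_ConsD by (auto simp: B_def)
    show ?thesis
    proof (cases "snd a")
      case True
      have "a = (fst a, True)" using True by (cases a) auto
      then have "push (fst a, True) v = a # v" using v(2) by metis
      then show ?thesis using \<tau>(2)[of v "fst a"] v(1) that True by (simp add: letter_perm_def)
    next
      case False
      then have a: "a = (fst a, False)" by (cases a) auto
      have "push (flip a) (a # v) = v" by simp
      then have "\<tau> (fst a) (a # v) = v"
        using \<tau>(2)[of "a # v" "fst a"] v that False by (simp add: flip_def)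
      then show ?thesis
        using permutes_inverses(2)[OF \<tau>(1), of "fst a" "a # v"] False by (simp add: letter_perm_def)
    qed
  qed
  have word: "foldr (letter_perm \<tau>) w [] = w" if "w \<in> B" for w
    using that
  proof (induction w)
    case (Cons a w)
    then have "w \<in> B" using short_words_ConsD by (auto simp: B_def)
    then show ?case using Cons letter by simp
  qed simp
  define Y where "Y = {q. q permutes B}"
  define \<theta> where "\<theta> k q = (if q \<in> Y then \<tau> k \<circ> q else q)" for k q
  have comp: "letter_perm \<tau> a \<circ> q \<in> Y" if "q \<in> Y" for a q
    using permutes_compose[OF _ letter_perm_permutes[of \<tau> a B, OF \<tau>(1)]] that by (simp add: Y_def)
  have th: "\<theta> k permutes Y" for k
  proof (rule bij_imp_permutes)
    show "bij_betw (\<theta> k) Y Y"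
    proof (rule bij_betw_byWitness[where f' = "\<lambda>q. inv_into UNIV (\<tau> k) \<circ> q"])
      show "\<forall>q\<in>Y. inv_into UNIV (\<tau> k) \<circ> \<theta> k q = q"
        by (auto simp: \<theta>_def o_assoc permutes_inv_o[OF \<tau>(1)])
      show "\<forall>q\<in>Y. \<theta> k (inv_into UNIV (\<tau> k) \<circ> q) = q"
        using comp[of _ "(k, False)"] by (auto simp: \<theta>_def letter_perm_def o_assoc permutes_inv_o[OF \<tau>(1)])
      show "\<theta> k ` Y \<subseteq> Y" using comp[of _ "(k, True)"] by (auto simp: \<theta>_def letter_perm_def)
      show "(\<lambda>q. inv_into UNIV (\<tau> k) \<circ> q) ` Y \<subseteq> Y" using comp[of _ "(k, False)"] by (auto simp: letter_perm_def)
    qed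
  qed (simp add: \<theta>_def)
  have lth: "letter_perm \<theta> a q = letter_perm \<tau> a \<circ> q" if q: "q \<in> Y" for a q
  proof (cases "snd a")
    case True
    then show ?thesis using q by (simp add: letter_perm_def \<theta>_def)
  next
    case False
    have "letter_perm \<tau> a \<circ> q \<in> Y" by (rule comp[OF q])
    then have "\<theta> (fst a) (letter_perm \<tau> a \<circ> q) = q"
      using False by (simp add: \<theta>_def letter_perm_def o_assoc permutes_inv_o[OF \<tau>(1)])
    then show ?thesis
      using permutes_inverses(2)[OF th, of "fst a" "letter_perm \<tau> a \<circ> q"] False by (simp add: letter_perm_def)
  qed
  have wth: "foldr (letter_perm \<theta>) w q = foldr (letter_perm \<tau>) w \<circ> q" if "q \<in> Y" for w q
  proof -
    have "foldr (letter_perm \<theta>) w q = foldr (letter_perm \<tau>) w \<circ> q \<and> foldr (letter_perm \<tau>) w \<circ> q \<in> Y"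
      using that
    proof (induction w)
      case (Cons a w)
      then show ?case using comp[of "foldr (letter_perm \<tau>) w \<circ> q" a] lth[of "foldr (letter_perm \<tau>) w \<circ> q" a]
        by (simp add: comp_def)
    qed (simp add: comp_def)
    then show ?thesis by blast
  qed
  show ?thesis
  proof (rule that)
    show "finite Y" unfolding Y_def by (rule finite_permutations[OF finB])
    show "Y \<noteq> {}" unfolding Y_def using permutes_id[of B] by blast
    show "\<theta> k permutes Y" for k by (rule th)
    fix w q assume w: "w \<in> short_words r m" "w \<noteq> []" and q: "q \<in> Y"
    show "foldr (letter_perm \<theta>) w q \<noteq> q"
    proof
      assume "foldr (letter_perm \<theta>) w q = q"
      from fun_cong[OF this, of "inv_into UNIV q []"]
      have "foldr (letter_perm \<tau>) w (q (inv_into UNIV q [])) = q (inv_into UNIV q [])"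
        unfolding wth[OF q] by simp
      then have "foldr (letter_perm \<tau>) w [] = []"
        using permutes_inverses(1)[of q B "[]"] q by (simp add: Y_def)
      then show False using word[of w] w by (simp add: B_def)
    qed
  qed
qed

section \<open>Sofic models of an action of a free group\<close>

lemma (in finite_measure) sum_measure_label:
  assumes K: "finite K" and F: "\<And>x. x \<in> space M \<Longrightarrow> F x \<in> K"
    and S: "\<And>b. b \<in> K \<Longrightarrow> {x \<in> space M. P x \<and> F x = b} \<in> sets M"
  shows "(\<Sum>b\<in>K. measure M {x \<in> space M. P x \<and> F x = b}) = measure M {x \<in> space M. P x}"
proof -
  have "measure M (\<Union>b\<in>K. {x \<in> space M. P x \<and> F x = b}) = (\<Sum>b\<in>K. measure M {x \<in> space M. P x \<and> F x = b})"
    using K S by (intro finite_measure_finite_Union) (auto simp: disjoint_family_on_def)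
  moreover have "(\<Union>b\<in>K. {x \<in> space M. P x \<and> F x = b}) = {x \<in> space M. P x}" using F by auto
  ultimately show ?thesis by simp
qed

locale free_pmp_action =
  fixes r :: nat and M :: "'x measure" and \<alpha> :: "letter list \<Rightarrow> 'x \<Rightarrow> 'x"
  assumes rank: "r \<ge> 1" and prob': "prob_space M" and pmp': "pmp_action (free_group r) M \<alpha>"
begin

sublocale countable_pmp_action "free_group r" M \<alpha>
  by (rule countable_pmp_action.intro[OF countable_free_group prob' pmp'])

abbreviation W :: "nat \<Rightarrow> letter list set" where "W \<equiv> short_words r"
abbreviation gen :: "nat \<Rightarrow> letter list" where "gen k \<equiv> [(k, True)]"

lemma one_eq: "\<one>\<^bsub>free_group r\<^esub> = []" and mult_eq: "v \<otimes>\<^bsub>free_group r\<^esub> w = foldr push v w"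
  by (simp_all add: free_group_def)

lemma letter_carrier: "fst a < r \<Longrightarrow> [a] \<in> carrier (free_group r)"
  by (cases a) (auto simp: free_group_def reduced_def)

lemma gen_carrier: "k < r \<Longrightarrow> gen k \<in> carrier (free_group r)"
  by (simp add: letter_carrier)

lemma W_carrier: "w \<in> W m \<Longrightarrow> w \<in> carrier (free_group r)"
  by (rule short_words_carrier)

lemma act_push_mult:
  "v \<in> carrier (free_group r) \<Longrightarrow> w \<in> carrier (free_group r) \<Longrightarrow> x \<in> space M \<Longrightarrow>
    \<alpha> (foldr push v w) x = \<alpha> v (\<alpha> w x)"
  using act_mult[of v w x] by (simp add: mult_eq)

lemma label_sets:
  assumes \<Lambda>: "\<And>c. {x \<in> space M. \<pi> x = c} \<in> sets M" and g: "g \<in> carrier (free_group r)"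
  shows "{x \<in> space M. \<pi> (\<alpha> g x) = c} \<in> sets M"
proof -
  have "{x \<in> space M. \<pi> (\<alpha> g x) = c} = \<alpha> g -` {x \<in> space M. \<pi> x = c} \<inter> space M"
    using act_space[OF g] by auto
  then show ?thesis using measurable_sets[OF act_measurable[OF g] \<Lambda>] by simp
qed

text \<open>
  For a finite measurable labelling \<open>\<pi>\<close> of the space, this provides a labelling of \<open>{..<d}\<close> with nearly the same frequencies
  and, for every generator, many permutations such that any combination of them reproduces, around all
  but boundedly many points, label patterns on short words that occur with positive
  measure in \<open>X\<close>, with short words acting without fixed points.

  The proof applies \<open>ex_permutation_models\<close> to refined labels: the itinerary of \<open>x\<close>, the map sending a short word
  \<open>g\<close> to \<open>\<pi> (\<alpha> g x)\<close>, paired with a point \<open>y\<close> of a finite free action. The coupling of a generator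
  is the joint distribution of the itineraries of \<open>x\<close> and of its image, and moves \<open>y\<close> by the finite action; it has equal
  marginals because the action preserves the measure. A transition admissible for refined
  labels shifts the itinerary, so by induction along a word the labels met by \<open>i\<close> are those recorded in its own itinerary.
\<close>

theorem ex_sofic_models:
  fixes \<pi> :: "'x \<Rightarrow> 'l"
  assumes fin: "finite \<Lambda>" and \<pi>: "\<And>x. x \<in> space M \<Longrightarrow> \<pi> x \<in> \<Lambda>"
    and \<pi>_sets: "\<And>c. {x \<in> space M. \<pi> x = c} \<in> sets M" and m: "m \<ge> 1"
  obtains C :: nat where "\<And>d. \<exists>lbl Z S. Z \<subseteq> {..<d} \<and> card Z \<le> C \<and>
    (\<forall>i. lbl i \<in> \<Lambda>) \<and>
    (\<forall>c\<in>\<Lambda>. \<bar>real (card {i. i < d \<and> lbl i = c}) - real d * measure M {x \<in> space M. \<pi> x = c}\<bar> \<le> real C) \<and>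
    (\<forall>k<r. (\<forall>\<sigma>\<in>S k. \<sigma> permutes {..<d} \<and>
         (\<forall>i\<in>{..<d} - Z. 0 < measure M {x \<in> space M. \<pi> x = lbl i \<and> \<pi> (\<alpha> (gen k) x) = lbl (\<sigma> i)})) \<and>
       (\<forall>\<sigma>\<in>S k. \<forall>\<sigma>'\<in>S k. \<forall>i\<in>Z. \<sigma> i = \<sigma>' i) \<and> fact d \<le> card (S k) * C ^ d) \<and>
    (\<forall>\<sigma>. (\<forall>k<r. \<sigma> k \<in> S k) \<longrightarrow> (\<exists>Bad\<subseteq>{..<d}. card Bad \<le> C \<and> (\<forall>i\<in>{..<d} - Bad.
        0 < measure M {x \<in> space M. \<forall>g\<in>W m. \<pi> (\<alpha> g x) = lbl (foldr (letter_perm \<sigma>) g i)} \<and>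
        (\<forall>g\<in>W m. g \<noteq> [] \<longrightarrow> foldr (letter_perm \<sigma>) g i \<noteq> i))))"
proof -
  obtain Y :: "(letter list \<Rightarrow> letter list) set" and \<theta>
    where Y: "finite Y" "Y \<noteq> {}" and \<theta>: "\<And>k. k < r \<Longrightarrow> \<theta> k permutes Y"
      and free: "\<And>w y. w \<in> W m \<Longrightarrow> w \<noteq> [] \<Longrightarrow> y \<in> Y \<Longrightarrow> foldr (letter_perm \<theta>) w y \<noteq> y"
    by (rule ex_free_finite_action[of r m]) (rule that)
  define it where "it x = restrict (\<lambda>g. \<pi> (\<alpha> g x)) (W m)" for x
  define I where "I = W m \<rightarrow>\<^sub>E \<Lambda>"
  define LL where "LL = I \<times> Y"
  have finI: "finite I" unfolding I_def by (intro finite_PiE finite_short_words fin)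
  have itI: "it x \<in> I" if "x \<in> space M" for x
  proof -
    have "\<pi> (\<alpha> g x) \<in> \<Lambda>" if "g \<in> W m" for g using \<pi>[OF act_space[OF W_carrier[OF that] \<open>x \<in> space M\<close>]] .
    then show ?thesis by (simp add: it_def I_def)
  qed
  have ne: "space M \<noteq> {}" using not_empty by simp
  then have "I \<noteq> {}" using itI by blast
  have it_sets: "{x \<in> space M. it (\<alpha> h x) = a} \<in> sets M" if h: "h \<in> carrier (free_group r)" for a h
  proof (cases "a \<in> extensional (W m)")
    case True
    have "{x \<in> space M. it (\<alpha> h x) = a} = {x \<in> space M. \<forall>g\<in>W m. \<pi> (\<alpha> (foldr push g h) x) = a g}"
    proof (intro Collect_cong conj_cong refl)
      fix x assume x: "x \<in> space M"
      have "it (\<alpha> h x) = a \<longleftrightarrow> (\<forall>g\<in>W m. \<pi> (\<alpha> g (\<alpha> h x)) = a g)"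
        using True by (auto simp: it_def fun_eq_iff extensional_def restrict_def)
      then show "it (\<alpha> h x) = a \<longleftrightarrow> (\<forall>g\<in>W m. \<pi> (\<alpha> (foldr push g h) x) = a g)"
        using act_push_mult[OF W_carrier h x] by simp
    qed
    also have "\<dots> = (\<Inter>g\<in>W m. {x \<in> space M. \<pi> (\<alpha> (foldr push g h) x) = a g})"
      using Nil_short_words by auto
    also have "\<dots> \<in> sets M"
    proof (intro sets.finite_INT finite_short_words label_sets \<pi>_sets)
      show "W m \<noteq> {}" using Nil_short_words by auto
      fix g assume "g \<in> W m"
      then show "foldr push g h \<in> carrier (free_group r)"
        using m_closed[OF W_carrier h] by (simp add: mult_eq)
    qed
    finally show ?thesis .
  next
    case False
    then have "{x \<in> space M. it (\<alpha> h x) = a} = {}" by (auto simp: it_def)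
    then show ?thesis by (metis sets.empty_sets)
  qed
  have one: "\<alpha> [] x = x" if "x \<in> space M" for x using act_one[OF that] by (simp add: one_eq)
  have NilC: "[] \<in> carrier (free_group r)" using one_closed by (simp add: one_eq)
  have it_sets0: "{x \<in> space M. it x = a} \<in> sets M" for a
  proof -
    have "{x \<in> space M. it x = a} = {x \<in> space M. it (\<alpha> [] x) = a}" by (auto simp: one)
    then show ?thesis using it_sets[OF NilC] by simp
  qed
  have it_sets2: "{x \<in> space M. it x = a \<and> it (\<alpha> (gen k) x) = b} \<in> sets M" if "k < r" for k a b
  proof -
    have "{x \<in> space M. it x = a \<and> it (\<alpha> (gen k) x) = b}
      = {x \<in> space M. it x = a} \<inter> {x \<in> space M. it (\<alpha> (gen k) x) = b}" by auto
    then show ?thesis using it_sets0 it_sets[OF gen_carrier[OF that]] by simp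
  qed
  define N where "N = real (card Y)"
  have N: "N > 0" using Y by (simp add: N_def card_gt_0_iff)
  define p where "p = (\<lambda>(a, y :: letter list \<Rightarrow> letter list). measure M {x \<in> space M. it x = a} / N)"
  define w where "w k = (\<lambda>(a, y) (b, y'). if y' = \<theta> k y
    then measure M {x \<in> space M. it x = a \<and> it (\<alpha> (gen k) x) = b} / N else 0)" for k
  have sumI: "(\<Sum>a\<in>I. measure M {x \<in> space M. it x = a}) = 1"
    using sum_measure_label[where F = it and P = "\<lambda>x. True", OF finI itI] it_sets0 prob_space by simp
  have sump: "sum p LL = 1"
  proof -
    have "sum p LL = (\<Sum>a\<in>I. \<Sum>y\<in>Y. p (a, y))" by (simp add: LL_def sum.cartesian_product)
    also have "\<dots> = (\<Sum>a\<in>I. measure M {x \<in> space M. it x = a})" using N by (simp add: p_def N_def)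
    finally show ?thesis using sumI by simp
  qed
  have row: "(\<Sum>b\<in>LL. w k a b) = p a" if k: "k < r" and a: "a \<in> LL" for k a
  proof -
    obtain a1 y where ay: "a = (a1, y)" "y \<in> Y" using a by (auto simp: LL_def)
    have "\<theta> k y \<in> Y" using permutes_in_image[OF \<theta>[OF k]] ay by simp
    have "(\<Sum>b\<in>LL. w k a b) = (\<Sum>b\<in>I. \<Sum>y'\<in>Y. w k a (b, y'))" by (simp add: LL_def sum.cartesian_product)
    also have "\<dots> = (\<Sum>b\<in>I. measure M {x \<in> space M. it x = a1 \<and> it (\<alpha> (gen k) x) = b} / N)"
      using Y \<open>\<theta> k y \<in> Y\<close> by (simp add: w_def ay)
    also have "\<dots> = measure M {x \<in> space M. it x = a1} / N"
      using sum_measure_label[where F = "\<lambda>x. it (\<alpha> (gen k) x)" and P = "\<lambda>x. it x = a1", OF finI]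
        itI act_space[OF gen_carrier[OF k]] it_sets2[OF k]
      by (simp add: sum_divide_distrib[symmetric])
    finally show ?thesis by (simp add: p_def ay)
  qed
  have col: "(\<Sum>a\<in>LL. w k a b) = p b" if k: "k < r" and b: "b \<in> LL" for k b
  proof -
    obtain b1 y' where by': "b = (b1, y')" "y' \<in> Y" using b by (auto simp: LL_def)
    have eq: "y' = \<theta> k y \<longleftrightarrow> y = inv_into UNIV (\<theta> k) y'" for y
      using permutes_inverses[OF \<theta>[OF k]] by metis
    have "inv_into UNIV (\<theta> k) y' \<in> Y" using permutes_in_image[OF permutes_inv[OF \<theta>[OF k]]] by' by simp
    then have "(\<Sum>y\<in>Y. w k (a, y) b) = measure M {x \<in> space M. it (\<alpha> (gen k) x) = b1 \<and> it x = a} / N" for a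
      using Y by (simp add: w_def by' eq conj_commute)
    then have "(\<Sum>a\<in>LL. w k a b)
      = (\<Sum>a\<in>I. measure M {x \<in> space M. it (\<alpha> (gen k) x) = b1 \<and> it x = a} / N)"
    proof -
      assume s: "\<And>a. (\<Sum>y\<in>Y. w k (a, y) b) = measure M {x \<in> space M. it (\<alpha> (gen k) x) = b1 \<and> it x = a} / N"
      have "(\<Sum>a\<in>LL. w k a b) = (\<Sum>a\<in>I. \<Sum>y\<in>Y. w k (a, y) b)" by (simp add: LL_def sum.cartesian_product)
      then show ?thesis unfolding s .
    qed
    also have "\<dots> = measure M {x \<in> space M. it (\<alpha> (gen k) x) = b1} / N"
      unfolding sum_divide_distrib[symmetric]
      by (subst sum_measure_label[where F = it and P = "\<lambda>x. it (\<alpha> (gen k) x) = b1", OF finI])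
         (use itI it_sets2[OF k] in \<open>auto simp: conj_commute\<close>)
    also have "measure M {x \<in> space M. it (\<alpha> (gen k) x) = b1} = measure M {x \<in> space M. it x = b1}"
    proof -
      have "{x \<in> space M. it (\<alpha> (gen k) x) = b1} = {x \<in> space M. \<alpha> (gen k) x \<in> {x \<in> space M. it x = b1}}"
        using act_space[OF gen_carrier[OF k]] by auto
      then show ?thesis using measure_act[OF gen_carrier[OF k] it_sets0] by simp
    qed
    finally show ?thesis by (simp add: p_def by')
  qed
  have finLL: "finite LL" "LL \<noteq> {}" using finI Y \<open>I \<noteq> {}\<close> by (auto simp: LL_def)
  obtain C0 :: nat where C0: "\<And>d. \<exists>L Z S. (\<forall>i. L i \<in> LL) \<and> Z \<subseteq> {..<d} \<and> card Z \<le> C0 \<and>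
    (\<forall>a\<in>LL. \<bar>real (card {i. i < d \<and> L i = a}) - real d * p a\<bar> \<le> real C0) \<and>
    (\<forall>k<r. (\<forall>\<sigma>\<in>S k. \<sigma> permutes {..<d} \<and> (\<forall>i\<in>{..<d} - Z. 0 < w k (L i) (L (\<sigma> i)))) \<and>
       (\<forall>\<sigma>\<in>S k. \<forall>\<sigma>'\<in>S k. \<forall>i\<in>Z. \<sigma> i = \<sigma>' i) \<and> fact d \<le> card (S k) * C0 ^ d)"
  proof (rule ex_permutation_models[of LL p r w, OF finLL _ sump _ row col])
    show "0 \<le> p a" for a using N by (simp add: p_def split: prod.split)
    show "0 \<le> w k a b" for k a b using N by (simp add: w_def split: prod.split)
  qed blast+
  define C where "C = C0 + card LL * C0 + card (W m) * (C0 + r * C0)"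
  show ?thesis
  proof (rule that[of C])
    fix d
    obtain L Z S where LZS: "\<forall>i. L i \<in> LL" "Z \<subseteq> {..<d}" "card Z \<le> C0"
        "\<forall>a\<in>LL. \<bar>real (card {i. i < d \<and> L i = a}) - real d * p a\<bar> \<le> real C0"
        "\<forall>k<r. (\<forall>\<sigma>\<in>S k. \<sigma> permutes {..<d} \<and> (\<forall>i\<in>{..<d} - Z. 0 < w k (L i) (L (\<sigma> i)))) \<and>
          (\<forall>\<sigma>\<in>S k. \<forall>\<sigma>'\<in>S k. \<forall>i\<in>Z. \<sigma> i = \<sigma>' i) \<and> fact d \<le> card (S k) * C0 ^ d"
      using C0[of d] by blast
    have L: "\<And>i. L i \<in> LL" and Z: "Z \<subseteq> {..<d}" "card Z \<le> C0"
      and freq: "\<And>a. a \<in> LL \<Longrightarrow> \<bar>real (card {i. i < d \<and> L i = a}) - real d * p a\<bar> \<le> real C0"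
      and S: "\<And>k \<sigma>. k < r \<Longrightarrow> \<sigma> \<in> S k \<Longrightarrow> \<sigma> permutes {..<d}"
        "\<And>k \<sigma> i. k < r \<Longrightarrow> \<sigma> \<in> S k \<Longrightarrow> i \<in> {..<d} - Z \<Longrightarrow> 0 < w k (L i) (L (\<sigma> i))"
        "\<And>k \<sigma> \<sigma>' i. k < r \<Longrightarrow> \<sigma> \<in> S k \<Longrightarrow> \<sigma>' \<in> S k \<Longrightarrow> i \<in> Z \<Longrightarrow> \<sigma> i = \<sigma>' i"
        "\<And>k. k < r \<Longrightarrow> fact d \<le> card (S k) * C0 ^ d"
      using LZS by blast+
    define lbl where "lbl i = fst (L i) []" for i
    have lbl: "lbl i \<in> \<Lambda>" for i using L[of i] Nil_short_words[of r m] by (auto simp: LL_def I_def lbl_def)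
    have itNil: "it x [] = \<pi> x" if "x \<in> space M" for x
      using that one Nil_short_words by (simp add: it_def)
    \<comment> \<open>An admissible transition is witnessed by a point of \<open>X\<close>, so it shifts the itinerary.\<close>
    have step: "snd (L (\<sigma> i)) = \<theta> k (snd (L i)) \<and>
        0 < measure M {x \<in> space M. it x = fst (L i) \<and> it (\<alpha> (gen k) x) = fst (L (\<sigma> i))}"
      if "k < r" "\<sigma> \<in> S k" "i \<in> {..<d} - Z" for k \<sigma> i
      using S(2)[OF that] N by (auto simp: w_def split: prod.splits if_splits simp: zero_less_divide_iff)
    have stepx: "\<exists>x\<in>space M. it x = fst (L i) \<and> it (\<alpha> (gen k) x) = fst (L (\<sigma> i))"
      if "k < r" "\<sigma> \<in> S k" "i \<in> {..<d} - Z" for k \<sigma> i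
    proof (rule ccontr)
      assume "\<not> ?thesis"
      then have e: "{x \<in> space M. it x = fst (L i) \<and> it (\<alpha> (gen k) x) = fst (L (\<sigma> i))} = {}" by blast
      have "0 < measure M {x \<in> space M. it x = fst (L i) \<and> it (\<alpha> (gen k) x) = fst (L (\<sigma> i))}"
        using step[OF that] by blast
      then show False unfolding e by simp
    qed
    have stepl: "fst (L (\<sigma> i)) h = fst (L i) (foldr push h (gen k))"
      if k: "k < r" and \<sigma>: "\<sigma> \<in> S k" and i: "i \<in> {..<d} - Z"
        and h: "h \<in> W m" "foldr push h (gen k) \<in> W m" for k \<sigma> i h
    proof -
      obtain x where x: "x \<in> space M" "it x = fst (L i)" "it (\<alpha> (gen k) x) = fst (L (\<sigma> i))"
        using stepx[OF k \<sigma> i] by blast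
      have "fst (L (\<sigma> i)) h = \<pi> (\<alpha> h (\<alpha> (gen k) x))"
        unfolding x(3)[symmetric] using h by (simp add: it_def)
      also have "\<dots> = \<pi> (\<alpha> (foldr push h (gen k)) x)"
        using act_push_mult[OF W_carrier[OF h(1)] gen_carrier[OF k] x(1)] by simp
      also have "\<dots> = fst (L i) (foldr push h (gen k))"
        unfolding x(2)[symmetric] using h by (simp add: it_def)
      finally show ?thesis .
    qed
    have main: "\<exists>Bad\<subseteq>{..<d}. card Bad \<le> C \<and> (\<forall>i\<in>{..<d} - Bad.
        0 < measure M {x \<in> space M. \<forall>g\<in>W m. \<pi> (\<alpha> g x) = lbl (foldr (letter_perm \<sigma>) g i)} \<and>
        (\<forall>g\<in>W m. g \<noteq> [] \<longrightarrow> foldr (letter_perm \<sigma>) g i \<noteq> i))"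
      if \<sigma>: "\<And>k. k < r \<Longrightarrow> \<sigma> k \<in> S k" for \<sigma>
    proof -
      let ?t = "\<lambda>v. foldr (letter_perm \<sigma>) v"
      let ?inv = "\<lambda>k. inv_into UNIV (\<sigma> k)"
      have perm: "\<sigma> k permutes {..<d}" if "k < r" for k using S(1)[OF that \<sigma>[OF that]] .
      have tperm: "?t v permutes {..<d}" if v: "v \<in> W m" for v
        using v perm by (intro word_permutes) (auto simp: short_words_def)
      \<comment> \<open>The inverses are included because an inverse letter uses the transition into the current point.\<close>
      define Bad where "Bad = (\<Union>v\<in>W m. (\<Union>f\<in>insert id (?inv ` {..<r}). {i. i < d \<and> f (?t v i) \<in> Z}))"
      have cardpre: "card {i. i < d \<and> f (?t v i) \<in> Z} \<le> C0" if f: "f permutes {..<d}" and v: "v \<in> W m" for f v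
      proof -
        have "inj (f \<circ> ?t v)" using permutes_inj[OF permutes_compose[OF tperm[OF v] f]] .
        then have "card {i. i < d \<and> f (?t v i) \<in> Z} \<le> card Z"
          using finite_subset[OF Z(1)]
          by (intro card_inj_on_le[of "f \<circ> ?t v"]) (auto simp: inj_on_def)
        then show ?thesis using Z by simp
      qed
      have fp: "f permutes {..<d}" if "f \<in> insert id (?inv ` {..<r})" for f
        using that perm permutes_id permutes_inv by auto
      have "card Bad \<le> (\<Sum>v\<in>W m. card (\<Union>f\<in>insert id (?inv ` {..<r}). {i. i < d \<and> f (?t v i) \<in> Z}))"
        unfolding Bad_def by (rule card_UN_le[OF finite_short_words])
      also have "\<dots> \<le> (\<Sum>v\<in>W m. C0 + r * C0)"
      proof (rule sum_mono)
        fix v assume v: "v \<in> W m"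
        have "card (\<Union>f\<in>insert id (?inv ` {..<r}). {i. i < d \<and> f (?t v i) \<in> Z})
          \<le> (\<Sum>f\<in>insert id (?inv ` {..<r}). card {i. i < d \<and> f (?t v i) \<in> Z})"
          by (rule card_UN_le) simp
        also have "\<dots> \<le> card (insert id (?inv ` {..<r})) * C0"
          using sum_bounded_above[of "insert id (?inv ` {..<r})" "\<lambda>f. card {i. i < d \<and> f (?t v i) \<in> Z}" C0]
            cardpre[OF fp v] by simp
        also have "\<dots> \<le> (1 + r) * C0"
        proof (rule mult_right_mono)
          have "card (insert id (?inv ` {..<r})) \<le> Suc (card (?inv ` {..<r}))" by (rule card_insert_le_m1) auto
          also have "card (?inv ` {..<r}) \<le> r" using card_image_le[of "{..<r}" ?inv] by simp
          finally show "card (insert id (?inv ` {..<r})) \<le> 1 + r" by simp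
        qed simp
        finally show "card (\<Union>f\<in>insert id (?inv ` {..<r}). {i. i < d \<and> f (?t v i) \<in> Z}) \<le> C0 + r * C0" by simp
      qed
      also have "\<dots> \<le> C" by (simp add: C_def)
      finally have cBad: "card Bad \<le> C" .
      have "0 < measure M {x \<in> space M. \<forall>g\<in>W m. \<pi> (\<alpha> g x) = lbl (?t g i)} \<and>
        (\<forall>g\<in>W m. g \<noteq> [] \<longrightarrow> ?t g i \<noteq> i)" if i: "i \<in> {..<d} - Bad" for i
      proof -
        have tv: "?t v i \<in> {..<d}" if v: "v \<in> W m" for v using permutes_in_image[OF tperm[OF v]] i by simp
        have good: "?t v i \<in> {..<d} - Z" if v: "v \<in> W m" for v
          using i v tv[OF v] by (auto simp: Bad_def)
        have good': "?inv k (?t v i) \<in> {..<d} - Z" if v: "v \<in> W m" and k: "k < r" for v k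
        proof -
          have "?inv k (?t v i) \<in> {..<d}" using permutes_in_image[OF permutes_inv[OF perm[OF k]]] tv[OF v] by blast
          moreover have "?inv k (?t v i) \<notin> Z" using i v k by (auto simp: Bad_def)
          ultimately show ?thesis by simp
        qed
        have letter: "fst (L (letter_perm \<sigma> a (?t v i))) h = fst (L (?t v i)) (foldr push h [a]) \<and>
            snd (L (letter_perm \<sigma> a (?t v i))) = letter_perm \<theta> a (snd (L (?t v i)))"
          if v: "v \<in> W m" and a: "fst a < r" and h: "h \<in> W m" "foldr push h [a] \<in> W m" for a v h
        proof (cases "snd a")
          case True
          then have a': "a = (fst a, True)" by (cases a) auto
          have "fst (L (\<sigma> (fst a) (?t v i))) h = fst (L (?t v i)) (foldr push h (gen (fst a)))"
            using stepl[OF a \<sigma>[OF a] good[OF v] h(1)] h(2) a' by simp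
          then show ?thesis
            using step[OF a \<sigma>[OF a] good[OF v]] True a' by (simp add: letter_perm_def)
        next
          case False
          then have a': "a = (fst a, False)" by (cases a) auto
          let ?k = "fst a" and ?h = "foldr push h [a]"
          let ?j = "?inv ?k (?t v i)"
          have j: "\<sigma> ?k ?j = ?t v i" using permutes_inverses(1)[OF perm[OF a]] .
          have red: "reduced h" using h by (simp add: short_words_def)
          have hh: "foldr push ?h (gen ?k) = h"
          proof -
            have "foldr push ?h (gen ?k) = foldr push h (foldr push [a] (gen ?k))"
              by (rule foldr_push_assoc) (simp add: reduced_def)
            also have "foldr push [a] (gen ?k) = []" using a' by (simp add: flip_def prod_eq_iff)
            finally show ?thesis using foldr_push_Nil[OF red] by simp
          qed
          have "fst (L (\<sigma> ?k ?j)) ?h = fst (L ?j) (foldr push ?h (gen ?k))"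
            using stepl[OF a \<sigma>[OF a] good'[OF v a] h(2)] h(1) hh by simp
          then have 1: "fst (L ?j) h = fst (L (?t v i)) ?h" using j hh by simp
          have "snd (L (\<sigma> ?k ?j)) = \<theta> ?k (snd (L ?j))" using step[OF a \<sigma>[OF a] good'[OF v a]] by blast
          then have "snd (L ?j) = inv_into UNIV (\<theta> ?k) (snd (L (?t v i)))"
            using j permutes_inverses(2)[OF \<theta>[OF a]] by metis
          then show ?thesis using 1 False by (simp add: letter_perm_def)
        qed
        have claim: "(\<forall>h. reduced h \<and> set h \<subseteq> {..<r} \<times> UNIV \<and> length h + length v \<le> m \<longrightarrow>
            fst (L (?t v i)) h = fst (L i) (foldr push h v)) \<and> snd (L (?t v i)) = foldr (letter_perm \<theta>) v (snd (L i))"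
          if "v \<in> W m" for v
          using that
        proof (induction v)
          case Nil
          then show ?case by (simp add: foldr_push_Nil)
        next
          case (Cons a v)
          have v: "v \<in> W m" "fst a < r" "push a v = a # v" using short_words_ConsD[OF Cons.prems] by auto
          have len: "Suc (length v) \<le> m" using Cons.prems by (simp add: short_words_def)
          note IH = Cons.IH[OF v(1)]
          show ?case
          proof (intro conjI allI impI)
            fix h assume h: "reduced h \<and> set h \<subseteq> {..<r} \<times> UNIV \<and> length h + length (a # v) \<le> m"
            have red: "reduced (foldr push h [a])" by (rule reduced_foldr_push) (simp add: reduced_def)
            have st: "set (foldr push h [a]) \<subseteq> {..<r} \<times> UNIV"
              using set_foldr_push[of h "[a]"] h v(2) by (cases a) auto
            have ln: "length (foldr push h [a]) \<le> length h + 1" using length_foldr_push[of h "[a]"] by simp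
            have "h \<in> W m" "foldr push h [a] \<in> W m" using h red st ln by (auto simp: short_words_def)
            then have "fst (L (?t (a # v) i)) h = fst (L (?t v i)) (foldr push h [a])"
              using letter[OF v(1,2)] by simp
            also have "\<dots> = fst (L i) (foldr push (foldr push h [a]) v)" using IH red st ln h by simp
            also have "foldr push (foldr push h [a]) v = foldr push h (push a v)"
              using foldr_push_assoc[of v h "[a]"] v(1) by (simp add: short_words_def)
            finally show "fst (L (?t (a # v) i)) h = fst (L i) (foldr push h (a # v))" by (simp add: v(3))
          next
            have "foldr push [] [a] \<in> W m" using len v(2) by (cases a) (auto simp: short_words_def reduced_def)
            then show "snd (L (?t (a # v) i)) = foldr (letter_perm \<theta>) (a # v) (snd (L i))"
              using letter[OF v(1,2) Nil_short_words] IH by simp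
          qed
        qed
        have lab: "lbl (?t v i) = fst (L i) v" if v: "v \<in> W m" for v
          using claim[OF v] v by (auto simp: lbl_def short_words_def)
        have r0: "0 < r" using rank by simp
        have i0: "i \<in> {..<d} - Z" using good[OF Nil_short_words] by simp
        have "0 < measure M {x \<in> space M. it x = fst (L i) \<and> it (\<alpha> (gen 0) x) = fst (L (\<sigma> 0 i))}"
          using step[OF r0 \<sigma>[OF r0] i0] by blast
        also have "\<dots> \<le> measure M {x \<in> space M. it x = fst (L i)}"
          by (rule finite_measure_mono) (auto simp: it_sets0)
        also have "{x \<in> space M. it x = fst (L i)} = {x \<in> space M. \<forall>g\<in>W m. \<pi> (\<alpha> g x) = lbl (?t g i)}"
        proof (intro Collect_cong conj_cong refl)
          fix x assume "x \<in> space M"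
          have "fst (L i) \<in> extensional (W m)" using L[of i] by (auto simp: LL_def I_def PiE_def)
          then have "it x = fst (L i) \<longleftrightarrow> (\<forall>g\<in>W m. \<pi> (\<alpha> g x) = fst (L i) g)"
            by (auto simp: it_def fun_eq_iff extensional_def restrict_def)
          then show "it x = fst (L i) \<longleftrightarrow> (\<forall>g\<in>W m. \<pi> (\<alpha> g x) = lbl (?t g i))" using lab by simp
        qed
        finally have pos: "0 < measure M {x \<in> space M. \<forall>g\<in>W m. \<pi> (\<alpha> g x) = lbl (?t g i)}" .
        moreover have "?t g i \<noteq> i" if g: "g \<in> W m" "g \<noteq> []" for g
        proof
          assume "?t g i = i"
          then have "foldr (letter_perm \<theta>) g (snd (L i)) = snd (L i)"
            using conjunct2[OF claim[OF g(1)]] by simp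
          moreover have "snd (L i) \<in> Y" using L[of i] by (auto simp: LL_def)
          ultimately show False using free[OF g, of "snd (L i)"] by simp
        qed
        ultimately show ?thesis by simp
      qed
      moreover have "Bad \<subseteq> {..<d}" by (auto simp: Bad_def)
      ultimately show ?thesis using cBad by blast
    qed
    have freq': "\<bar>real (card {i. i < d \<and> lbl i = c}) - real d * measure M {x \<in> space M. \<pi> x = c}\<bar> \<le> real C"
      if c: "c \<in> \<Lambda>" for c
    proof -
      let ?I = "{a \<in> I. a [] = c}"
      let ?LL = "?I \<times> Y"
      have fI: "finite ?I" using finI by simp
      have "{i. i < d \<and> lbl i = c} = (\<Union>a\<in>?LL. {i. i < d \<and> L i = a})"
      proof (intro Set.set_eqI iffI)
        fix i assume "i \<in> {i. i < d \<and> lbl i = c}"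
        then have "i < d" "L i \<in> ?LL" using L[of i] by (auto simp: lbl_def LL_def)
        then show "i \<in> (\<Union>a\<in>?LL. {i. i < d \<and> L i = a})" by (intro UN_I[of "L i"]) simp_all
      next
        fix i assume "i \<in> (\<Union>a\<in>?LL. {i. i < d \<and> L i = a})"
        then obtain a where "a \<in> ?LL" "i < d" "L i = a" by blast
        then show "i \<in> {i. i < d \<and> lbl i = c}" by (cases a) (simp add: lbl_def)
      qed
      moreover have "card (\<Union>a\<in>?LL. {i. i < d \<and> L i = a}) = (\<Sum>a\<in>?LL. card {i. i < d \<and> L i = a})"
      proof (rule card_UN_disjoint)
        show "finite ?LL" using fI Y by simp
      qed (simp, blast)
      ultimately have "card {i. i < d \<and> lbl i = c} = (\<Sum>a\<in>?LL. card {i. i < d \<and> L i = a})" by simp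
      moreover have "measure M {x \<in> space M. \<pi> x = c} = (\<Sum>a\<in>?LL. p a)"
      proof -
        have "(\<Sum>a\<in>?LL. p a) = (\<Sum>a\<in>?I. \<Sum>y\<in>Y. p (a, y))" by (simp add: sum.cartesian_product)
        also have "\<dots> = (\<Sum>a\<in>?I. measure M {x \<in> space M. it x = a})" using N by (simp add: p_def N_def)
        also have "\<dots> = (\<Sum>a\<in>?I. measure M {x \<in> space M. \<pi> x = c \<and> it x = a})"
          using itNil by (intro sum.cong refl arg_cong[where f = "measure M"]) auto
        also have "\<dots> = (\<Sum>a\<in>I. measure M {x \<in> space M. \<pi> x = c \<and> it x = a})"
        proof (rule sum.mono_neutral_left[OF finI])
          show "\<forall>a\<in>I - ?I. measure M {x \<in> space M. \<pi> x = c \<and> it x = a} = 0"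
          proof
            fix a assume "a \<in> I - ?I"
            then have "{x \<in> space M. \<pi> x = c \<and> it x = a} = {}" using itNil by auto
            then show "measure M {x \<in> space M. \<pi> x = c \<and> it x = a} = 0" by (simp only: measure_empty)
          qed
        qed auto
        also have "\<dots> = measure M {x \<in> space M. \<pi> x = c}"
        proof (rule sum_measure_label[where F = it, OF finI itI])
          fix a
          have "{x \<in> space M. \<pi> x = c \<and> it x = a} = {x \<in> space M. \<pi> x = c} \<inter> {x \<in> space M. it x = a}" by auto
          then show "{x \<in> space M. \<pi> x = c \<and> it x = a} \<in> sets M" using \<pi>_sets it_sets0 by simp
        qed
        finally show ?thesis by simp
      qed
      ultimately have "\<bar>real (card {i. i < d \<and> lbl i = c}) - real d * measure M {x \<in> space M. \<pi> x = c}\<bar>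
        = \<bar>\<Sum>a\<in>?LL. real (card {i. i < d \<and> L i = a}) - real d * p a\<bar>"
        by (simp add: sum_subtractf sum_distrib_left)
      also have "\<dots> \<le> (\<Sum>a\<in>?LL. \<bar>real (card {i. i < d \<and> L i = a}) - real d * p a\<bar>)" by (rule sum_abs)
      also have "\<dots> \<le> (\<Sum>a\<in>?LL. real C0)" by (intro sum_mono freq) (auto simp: LL_def)
      also have "\<dots> = real (card ?LL * C0)" by simp
      also have "\<dots> \<le> real (card LL * C0)"
        by (intro of_nat_mono mult_right_mono card_mono finLL) (auto simp: LL_def)
      also have "\<dots> \<le> real C" by (simp add: C_def)
      finally show ?thesis .
    qed
    have CC: "C0 \<le> C" by (simp add: C_def)
    have cnt: "fact d \<le> card (S k) * C ^ d" if "k < r" for k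
      using S(4)[OF that] mult_left_mono[OF power_mono[OF CC, of d], of "card (S k)"] by linarith
    have adm: "0 < measure M {x \<in> space M. \<pi> x = lbl i \<and> \<pi> (\<alpha> (gen k) x) = lbl (\<sigma> i)}"
      if "k < r" "\<sigma> \<in> S k" "i \<in> {..<d} - Z" for k \<sigma> i
    proof -
      have "{x \<in> space M. \<pi> x = lbl i \<and> \<pi> (\<alpha> (gen k) x) = lbl (\<sigma> i)}
        = {x \<in> space M. \<pi> x = lbl i} \<inter> {x \<in> space M. \<pi> (\<alpha> (gen k) x) = lbl (\<sigma> i)}" by auto
      then have s: "{x \<in> space M. \<pi> x = lbl i \<and> \<pi> (\<alpha> (gen k) x) = lbl (\<sigma> i)} \<in> sets M"
        using \<pi>_sets label_sets[OF \<pi>_sets gen_carrier[OF that(1)]] by simp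
      have "0 < measure M {x \<in> space M. it x = fst (L i) \<and> it (\<alpha> (gen k) x) = fst (L (\<sigma> i))}"
        using step[OF that] by blast
      also have "\<dots> \<le> measure M {x \<in> space M. \<pi> x = lbl i \<and> \<pi> (\<alpha> (gen k) x) = lbl (\<sigma> i)}"
        using itNil act_space[OF gen_carrier[OF that(1)]] s
        by (intro finite_measure_mono) (auto simp: lbl_def, metis+)
      finally show ?thesis .
    qed
    show "\<exists>lbl Z S. Z \<subseteq> {..<d} \<and> card Z \<le> C \<and>
    (\<forall>i. lbl i \<in> \<Lambda>) \<and>
    (\<forall>c\<in>\<Lambda>. \<bar>real (card {i. i < d \<and> lbl i = c}) - real d * measure M {x \<in> space M. \<pi> x = c}\<bar> \<le> real C) \<and>
    (\<forall>k<r. (\<forall>\<sigma>\<in>S k. \<sigma> permutes {..<d} \<and>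
         (\<forall>i\<in>{..<d} - Z. 0 < measure M {x \<in> space M. \<pi> x = lbl i \<and> \<pi> (\<alpha> (gen k) x) = lbl (\<sigma> i)})) \<and>
       (\<forall>\<sigma>\<in>S k. \<forall>\<sigma>'\<in>S k. \<forall>i\<in>Z. \<sigma> i = \<sigma>' i) \<and> fact d \<le> card (S k) * C ^ d) \<and>
    (\<forall>\<sigma>. (\<forall>k<r. \<sigma> k \<in> S k) \<longrightarrow> (\<exists>Bad\<subseteq>{..<d}. card Bad \<le> C \<and> (\<forall>i\<in>{..<d} - Bad.
        0 < measure M {x \<in> space M. \<forall>g\<in>W m. \<pi> (\<alpha> g x) = lbl (foldr (letter_perm \<sigma>) g i)} \<and>
        (\<forall>g\<in>W m. g \<noteq> [] \<longrightarrow> foldr (letter_perm \<sigma>) g i \<noteq> i))))"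
    proof (rule exI[of _ lbl], rule exI[of _ Z], rule exI[of _ S], intro conjI allI ballI impI)
      show "\<exists>Bad\<subseteq>{..<d}. card Bad \<le> C \<and> (\<forall>i\<in>{..<d} - Bad.
        0 < measure M {x \<in> space M. \<forall>g\<in>W m. \<pi> (\<alpha> g x) = lbl (foldr (letter_perm \<sigma>) g i)} \<and>
        (\<forall>g\<in>W m. g \<noteq> [] \<longrightarrow> foldr (letter_perm \<sigma>) g i \<noteq> i))" if "\<forall>k<r. \<sigma> k \<in> S k" for \<sigma>
        by (rule main) (use that in blast)
    qed (use Z CC lbl freq' S(1) S(3) cnt adm in \<open>auto\<close>)
  qed
qed

end

section \<open>From permutations to sofic approximations\<close>

context free_pmp_action
begin

lemma inv_W: "w \<in> W m \<Longrightarrow> inv\<^bsub>free_group r\<^esub> w \<in> W m"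
proof -
  assume w: "w \<in> W m"
  define v where "v = foldr push (rev (map flip w)) []"
  have "set v \<subseteq> flip ` set w"
    using set_foldr_push[of "rev (map flip w)" "[]"] by (auto simp: v_def)
  also have "\<dots> \<subseteq> {..<r} \<times> UNIV"
    using w by (auto simp: short_words_def flip_def)
  finally have "set v \<subseteq> {..<r} \<times> UNIV" .
  moreover have "length v \<le> length w" using length_foldr_push[of "rev (map flip w)" "[]"] by (simp add: v_def)
  moreover have "reduced v" unfolding v_def by (rule reduced_foldr_push) simp
  ultimately have v: "v \<in> W m" using w by (auto simp: short_words_def)
  have "foldr push v w = []"
    using w foldr_push_assoc[of w "rev (map flip w)" "[]"]
    by (simp add: v_def short_words_def foldr_push_inverse)
  then have "v \<otimes>\<^bsub>free_group r\<^esub> w = \<one>\<^bsub>free_group r\<^esub>" by (simp add: one_eq mult_eq)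
  then have "inv\<^bsub>free_group r\<^esub> w = v" using W_carrier[OF v] W_carrier[OF w] by (metis inv_equality)
  then show ?thesis using v by simp
qed

text \<open>
  The points where some of the given bisections acts by a long word. They form a small set for large \<open>m\<close>,
  because a bisection uses a single word at each point.
\<close>

definition tail :: "(letter list \<times> 'x) set set \<Rightarrow> nat \<Rightarrow> 'x set" where
  "tail \<B> m = {x \<in> space M. \<exists>B\<in>\<B>. \<exists>g. g \<notin> W m \<and> (g, x) \<in> B}"

lemma tail_sets:
  assumes "finite \<B>" "\<And>B. B \<in> \<B> \<Longrightarrow> bisection B"
  shows "tail \<B> m \<in> sets M"
proof -
  have "tail \<B> m = (\<Union>B\<in>\<B>. \<Union>g\<in>carrier (free_group r) - W m. section_at B g)"
    using assms(2) bisectionD(4) by (fastforce simp: tail_def section_at_def)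
  also have "\<dots> \<in> sets M"
  proof (rule sets.finite_UN[OF assms(1)])
    fix B assume B: "B \<in> \<B>"
    show "(\<Union>g\<in>carrier (free_group r) - W m. section_at B g) \<in> sets M"
    proof (rule sets.countable_UN')
      show "countable (carrier (free_group r) - W m)" using countable_carrier by blast
      show "section_at B ` (carrier (free_group r) - W m) \<subseteq> sets M"
        using section_at_sets[OF bisectionD(1)[OF assms(2)[OF B]]] by blast
    qed
  qed
  finally show ?thesis .
qed

lemma W_mono: "m \<le> n \<Longrightarrow> W m \<subseteq> W n"
  by (auto simp: short_words_def)

lemma ex_small_tail:
  assumes fin: "finite \<B>" and bis: "\<And>B. B \<in> \<B> \<Longrightarrow> bisection B" and \<epsilon>: "\<epsilon> > 0"
  obtains m where "m \<ge> 1" "measure M (tail \<B> m) < \<epsilon>"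
proof -
  have "(\<Inter>m. tail \<B> m) = {}"
  proof (rule ccontr)
    assume "(\<Inter>m. tail \<B> m) \<noteq> {}"
    then obtain x where x: "\<And>m. x \<in> tail \<B> m" by blast
    define len where "len B = length (SOME g. (g, x) \<in> B)" for B :: "(letter list \<times> 'x) set"
    have "x \<in> tail \<B> (\<Sum>B\<in>\<B>. len B)" by (rule x)
    then obtain B g where B: "B \<in> \<B>" "g \<notin> W (\<Sum>B\<in>\<B>. len B)" "(g, x) \<in> B" unfolding tail_def by blast
    have "(SOME g. (g, x) \<in> B) = g"
      by (rule some_equality[of "\<lambda>g. (g, x) \<in> B", OF B(3)]) (rule bisectionD(2)[OF bis[OF B(1)] _ B(3)])
    then have "length g \<le> (\<Sum>B\<in>\<B>. len B)"
      using member_le_sum[of B \<B> len] B(1) fin by (simp add: len_def)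
    then show False using B(2) carrier_short_words[OF bisectionD(4)[OF bis[OF B(1)] B(3)]] by simp
  qed
  moreover have "(\<lambda>m. measure M (tail \<B> m)) \<longlonglongrightarrow> measure M (\<Inter>m. tail \<B> m)"
  proof (rule finite_Lim_measure_decseq)
    show "range (tail \<B>) \<subseteq> sets M" using tail_sets[OF fin bis] by blast
    show "antimono_on UNIV (tail \<B>)"
    proof (rule monotone_onI)
      fix m n :: nat assume "m \<le> n"
      then have sub: "W m \<subseteq> W n" by (rule W_mono)
      show "tail \<B> n \<subseteq> tail \<B> m"
      proof
        fix x assume "x \<in> tail \<B> n"
        then obtain B g where "x \<in> space M" "B \<in> \<B>" "g \<notin> W n" "(g, x) \<in> B" unfolding tail_def by blast
        then show "x \<in> tail \<B> m" using sub unfolding tail_def by blast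
      qed
    qed
  qed
  ultimately have "(\<lambda>m. measure M (tail \<B> m)) \<longlonglongrightarrow> 0" by simp
  from order_tendstoD(2)[OF this \<epsilon>] obtain m0 where m0: "\<And>m. m \<ge> m0 \<Longrightarrow> measure M (tail \<B> m) < \<epsilon>"
    by (auto simp: eventually_sequentially)
  show ?thesis by (rule that[of "max m0 1"]) (auto intro: m0)
qed

end

text \<open>
  The labels \<open>lbl\<close> of \<open>{..<d}\<close> and the permutations \<open>\<sigma>\<close> of the generators are meant to imitate the labels \<open>\<pi>\<close> of \<open>X\<close> and the
  action; here only what makes sense of the construction is assumed, while the
  quality of the imitation enters through \<open>shadow\<close>.
\<close>

locale labelled_permutations = free_pmp_action r M \<alpha>
  for r and M :: "'x measure" and \<alpha> +
  fixes \<pi> :: "'x \<Rightarrow> 'l" and lbl :: "nat \<Rightarrow> 'l" and d m :: nat and \<sigma> :: "nat \<Rightarrow> nat \<Rightarrow> nat"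
  assumes label_set: "\<And>c. {x \<in> space M. \<pi> x = c} \<in> sets M"
    and perm: "\<And>k. k < r \<Longrightarrow> \<sigma> k permutes {..<d}"
    and m1: "m \<ge> 1"
begin

abbreviation t :: "letter list \<Rightarrow> nat \<Rightarrow> nat" where "t g \<equiv> foldr (letter_perm \<sigma>) g"
text \<open>
  Words up to twice the length \<open>m\<close>, since the arrow of one factor between two points \<open>\<alpha> v x\<close> and \<open>\<alpha> w x\<close> with \<open>v\<close> and
  \<open>w\<close> of length at most \<open>m\<close> carries the word \<open>w v\<^sup>-\<^sup>1\<close>.
\<close>

abbreviation K :: "letter list set" where "K \<equiv> W (2 * m)"

definition cell :: "letter list \<Rightarrow> nat \<Rightarrow> nat \<Rightarrow> 'x set" where
  "cell g i j = {x \<in> space M. \<pi> x = lbl i \<and> \<pi> (\<alpha> g x) = lbl j}"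

text \<open>
  The entry from \<open>i\<close> to \<open>j\<close> adds up, over the words \<open>g\<close> leading from \<open>i\<close> to \<open>j\<close>, the fraction of the points labelled like \<open>i\<close> and
  sent by \<open>g\<close> to a point labelled like \<open>j\<close> at which the operator acts as \<open>g\<close>. Each
  summand is a matrix coefficient of \<open>T\<close>, so linearity on the whole span is evident, and for bisections whose behaviour is determined by labels
  each fraction is \<open>0\<close> or \<open>1\<close>. A null cell contributes \<open>0\<close> by the convention on division by zero.
\<close>

definition phi :: "(letter list \<times> 'x) oper \<Rightarrow> complex mat" where
  "phi = (\<lambda>T\<in>vn_span \<G> (inv_semigroup \<G>). mat d d (\<lambda>(j, i). \<Sum>g\<in>{g \<in> K. t g i = j}.
      l2_inner N (T (slab_vect [] (cell g i j))) (slab_vect g (cell g i j)) / of_real (measure M (cell g i j))))"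

definition saturated :: "'x set \<Rightarrow> bool" where
  "saturated A \<longleftrightarrow> (\<forall>x\<in>space M. \<forall>y\<in>space M. \<pi> x = \<pi> y \<longrightarrow> x \<in> A \<longrightarrow> y \<in> A)"

text \<open>
  Whether \<open>B\<close> acts by \<open>g\<close> at a point depends only on the label of that point, and likewise for
  arriving by \<open>g\<close>. The condition on the inverse makes \<open>transition B\<close> injective.
\<close>

definition determined :: "(letter list \<times> 'x) set \<Rightarrow> bool" where
  "determined B \<longleftrightarrow> bisection B \<and>
    (\<forall>g\<in>K. saturated (section_at B g) \<and> saturated (section_at (binv B) (inv\<^bsub>free_group r\<^esub> g)))"

definition hit :: "(letter list \<times> 'x) set \<Rightarrow> nat \<Rightarrow> letter list \<Rightarrow> bool" where
  "hit B i g \<longleftrightarrow> g \<in> K \<and> 0 < measure M (cell g i (t g i) \<inter> section_at B g)"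

text \<open>The partial injection by which \<open>phi\<close> represents \<open>B\<close>: where \<open>B\<close> acts by \<open>g\<close>, follow the permutations along \<open>g\<close>.\<close>

definition transition :: "(letter list \<times> 'x) set \<Rightarrow> nat \<Rightarrow> nat" where
  "transition B i = (if i < d \<and> (\<exists>g. hit B i g) then t (THE g. hit B i g) i else d)"

lemma t_permutes: "g \<in> carrier (free_group r) \<Longrightarrow> t g permutes {..<d}"
  using perm by (intro word_permutes) (auto simp: free_group_def)

lemma t_mult:
  assumes "v \<in> carrier (free_group r)" "w \<in> carrier (free_group r)"
  shows "t (foldr push v w) i = t v (t w i)"
proof (rule foldr_push_act)
  fix a i assume "a \<in> set v \<union> set w"
  then have "fst a < r" using assms by (auto simp: free_group_def)
  then show "letter_perm \<sigma> a (letter_perm \<sigma> (flip a) i) = i"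
    using permutes_bij[OF perm] by (intro letter_perm_flip) blast
qed

lemma t_less: "g \<in> carrier (free_group r) \<Longrightarrow> i < d \<Longrightarrow> t g i < d"
  using permutes_in_image[OF t_permutes] by (metis lessThan_iff)

lemma cell_sets: "g \<in> carrier (free_group r) \<Longrightarrow> cell g i j \<in> sets M"
proof -
  assume g: "g \<in> carrier (free_group r)"
  have "cell g i j = {x \<in> space M. \<pi> x = lbl i} \<inter> {x \<in> space M. \<pi> (\<alpha> g x) = lbl j}"
    by (auto simp: cell_def)
  then show ?thesis using label_set label_sets[OF label_set g] by simp
qed

lemma phi_linear: "phi \<in> linear_maps \<G> d"
  unfolding linear_maps_def
proof (intro CollectI conjI ballI allI)
  let ?V = "vn_span \<G> (inv_semigroup \<G>)"
  show "phi \<in> ?V \<rightarrow>\<^sub>E carrier_mat d d" by (simp add: phi_def)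
  have sub: "op_add N S T \<in> ?V" "op_scale N c S \<in> ?V" if "S \<in> ?V" "T \<in> ?V" for S T c
    using that unfolding vn_span_def hull_def op_subspace_def by blast+
  have v: "slab_vect [] (cell g i j) \<in> L2 N" "slab_vect g (cell g i j) \<in> L2 N" if "g \<in> K" for g i j
    using slab_vect_in_L2[OF one_closed cell_sets] slab_vect_in_L2[OF W_carrier cell_sets] W_carrier that
    by (auto simp: one_eq)
  have bd: "T a \<in> L2 N" if "T \<in> ?V" "a \<in> L2 N" for T a
    using that vn_span_bounded_ops bounded_opsD(1) by blast
  fix T assume T: "T \<in> ?V"
  show "phi (op_scale N c T) = c \<cdot>\<^sub>m phi T" for c
  proof (rule eq_matI)
    fix j i assume "j < dim_row (c \<cdot>\<^sub>m phi T)" "i < dim_col (c \<cdot>\<^sub>m phi T)"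
    then have ij: "j < d" "i < d" using T by (auto simp: phi_def)
    have "l2_inner N (op_scale N c T (slab_vect [] (cell g i j))) (slab_vect g (cell g i j))
      = c * l2_inner N (T (slab_vect [] (cell g i j))) (slab_vect g (cell g i j))" if g: "g \<in> K" for g
      using v[OF g] bd[OF T v(1)[OF g]] by (simp add: op_scale_def l2_inner_scale)
    then show "phi (op_scale N c T) $$ (j, i) = (c \<cdot>\<^sub>m phi T) $$ (j, i)"
      using ij T sub(2)[OF T T] by (simp add: phi_def sum_distrib_left)
  qed (use T sub(2)[OF T T] in \<open>auto simp: phi_def\<close>)
  fix S assume S: "S \<in> ?V"
  show "phi (op_add N S T) = phi S + phi T"
  proof (rule eq_matI)
    fix j i assume "j < dim_row (phi S + phi T)" "i < dim_col (phi S + phi T)"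
    then have ij: "j < d" "i < d" using T by (auto simp: phi_def)
    have "l2_inner N (op_add N S T (slab_vect [] (cell g i j))) (slab_vect g (cell g i j))
      = l2_inner N (S (slab_vect [] (cell g i j))) (slab_vect g (cell g i j))
        + l2_inner N (T (slab_vect [] (cell g i j))) (slab_vect g (cell g i j))" if g: "g \<in> K" for g
      using v[OF g] bd[OF T v(1)[OF g]] bd[OF S v(1)[OF g]] by (simp add: op_add_def l2_inner_add)
    then show "phi (op_add N S T) $$ (j, i) = (phi S + phi T) $$ (j, i)"
      using ij T S sub(1)[OF S T] by (simp add: phi_def add_divide_distrib sum.distrib)
  qed (use S T sub(1)[OF S T] in \<open>auto simp: phi_def\<close>)
qed

lemma positive_measure_point:
  assumes "0 < measure M A"
  obtains x where "x \<in> A"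
proof -
  have "A \<noteq> {}" using assms by (metis less_irrefl measure_empty)
  then show ?thesis using that by blast
qed

lemma hitE:
  assumes "hit B i g"
  obtains x where "g \<in> K" "x \<in> space M" "\<pi> x = lbl i" "\<pi> (\<alpha> g x) = lbl (t g i)" "(g, x) \<in> B"
proof -
  obtain x where "x \<in> cell g i (t g i) \<inter> section_at B g"
    using assms positive_measure_point unfolding hit_def by blast
  then show ?thesis using that[of x] assms by (simp add: hit_def cell_def section_at_def)
qed

lemma saturatedD:
  "saturated A \<Longrightarrow> x \<in> A \<Longrightarrow> x \<in> space M \<Longrightarrow> y \<in> space M \<Longrightarrow> \<pi> x = \<pi> y \<Longrightarrow> y \<in> A"
  unfolding saturated_def by blast

lemma determinedD:
  assumes "determined B"
  shows "bisection B" "g \<in> K \<Longrightarrow> saturated (section_at B g)"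
    "g \<in> K \<Longrightarrow> saturated (section_at (binv B) (inv\<^bsub>free_group r\<^esub> g))"
  using assms by (simp_all add: determined_def)

lemma hit_transfer:
  assumes B: "determined B" and h: "hit B i g" and y: "y \<in> space M" "\<pi> y = lbl i"
  shows "(g, y) \<in> B"
proof -
  obtain x where x: "g \<in> K" "x \<in> space M" "\<pi> x = lbl i" "\<pi> (\<alpha> g x) = lbl (t g i)" "(g, x) \<in> B"
    by (rule hitE[OF h])
  have "x \<in> section_at B g" using x(2,5) by (simp add: section_at_def)
  moreover have "\<pi> x = \<pi> y" using x(3) y(2) by simp
  ultimately have "y \<in> section_at B g"
    using determinedD(2)[OF B x(1)] x(2) y(1) saturatedD by blast
  then show ?thesis by (simp add: section_at_def)
qed

lemma hit_unique:
  assumes B: "determined B" and h: "hit B i g" "hit B i g'"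
  shows "g = g'"
proof -
  obtain x where x: "g \<in> K" "x \<in> space M" "\<pi> x = lbl i" "\<pi> (\<alpha> g x) = lbl (t g i)" "(g, x) \<in> B"
    by (rule hitE[OF h(1)])
  have "(g', x) \<in> B" by (rule hit_transfer[OF B h(2) x(2,3)])
  then show ?thesis by (rule bisectionD(2)[OF determinedD(1)[OF B] x(5)])
qed

lemma transition_hit:
  assumes "determined B" "hit B i g" "i < d"
  shows "transition B i = t g i"
proof -
  have "(THE g. hit B i g) = g"
    by (rule the_equality[of "hit B i", OF assms(2)]) (rule hit_unique[OF assms(1) _ assms(2)])
  moreover have "i < d \<and> (\<exists>g. hit B i g)" using assms by blast
  ultimately show ?thesis unfolding transition_def by simp
qed

lemma transition_partial_injection:
  assumes B: "determined B"
  shows "transition B \<in> partial_injections d"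
proof (rule partial_injectionsI)
  have hc: "g \<in> carrier (free_group r)" if "hit B i g" for i g using that W_carrier by (auto simp: hit_def)
  show "transition B i \<le> d" for i
  proof (cases "i < d \<and> (\<exists>g. hit B i g)")
    case True
    then obtain g where g: "hit B i g" "i < d" by blast
    show ?thesis unfolding transition_hit[OF B g] using t_less[OF hc[OF g(1)] g(2)] by (rule less_imp_le)
  next
    case False
    then show ?thesis unfolding transition_def by (simp only: if_False)
  qed
  show "transition B i = d" if "i \<ge> d" for i using that by (simp add: transition_def)
  fix i j assume ij: "i < d" "j < d" "transition B i < d" "transition B i = transition B j"
  have ex: "\<exists>g. hit B i g" if "transition B i < d" for i
    using that unfolding transition_def by (cases "\<exists>g. hit B i g") auto
  obtain g where g: "hit B i g" using ex[OF ij(3)] by blast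
  obtain g' where g': "hit B j g'" using ex[of j] ij(3,4) by auto
  have eq: "t g i = t g' j" using ij(4) transition_hit[OF B g ij(1)] transition_hit[OF B g' ij(2)] by simp
  obtain x where x0: "g \<in> K" "x \<in> space M" "\<pi> x = lbl i" "\<pi> (\<alpha> g x) = lbl (t g i)" "(g, x) \<in> B"
    by (rule hitE[OF g])
  note x = x0(1,2,4,5)
  obtain x' where x0': "g' \<in> K" "x' \<in> space M" "\<pi> x' = lbl j" "\<pi> (\<alpha> g' x') = lbl (t g' j)" "(g', x') \<in> B"
    by (rule hitE[OF g'])
  note x' = x0'(1,2,4,5)
  let ?i = "\<lambda>g. inv\<^bsub>free_group r\<^esub> g"
  note c = hc[OF g] and c' = hc[OF g']
  have s: "\<alpha> g x \<in> space M" "\<alpha> g' x' \<in> space M" using act_space[OF c x(2)] act_space[OF c' x'(2)] .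
  have "\<alpha> g x \<in> section_at (binv B) (?i g)"
    using x(2,4) c s by (simp add: section_at_def binv_def act_inv)
  moreover have "\<pi> (\<alpha> g x) = \<pi> (\<alpha> g' x')" using x(3) x'(3) eq by simp
  ultimately have "\<alpha> g' x' \<in> section_at (binv B) (?i g)"
    using determinedD(3)[OF B x(1)] s saturatedD by blast
  moreover have "\<alpha> g' x' \<in> section_at (binv B) (?i g')"
    using x'(2,4) c' s by (simp add: section_at_def binv_def act_inv)
  moreover have "bisection (binv B)" by (rule bisection_binv[OF determinedD(1)[OF B]])
  ultimately have "?i g = ?i g'" using bisectionD(2)[of "binv B" "?i g" "\<alpha> g' x'" "?i g'"] by (simp add: section_at_def)
  then have "g = g'" using c c' by (metis inv_inv)
  then show "i = j" using eq permutes_inj[OF t_permutes[OF c]] by (simp add: inj_eq)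
qed

lemma phi_bis_op:
  assumes B: "determined B"
  shows "phi (bis_op \<G> B) = pmat d (transition B)"
proof (rule eq_matI)
  have bB: "bisection B" using B by (simp add: determined_def)
  note V = bis_op_in_vn_span[OF bB]
  fix j i assume "j < dim_row (pmat d (transition B))" "i < dim_col (pmat d (transition B))"
  then have ij: "j < d" "i < d" by (auto simp: pmat_def)
  have entry: "l2_inner N (bis_op \<G> B (slab_vect [] (cell g i j))) (slab_vect g (cell g i j))
      / of_real (measure M (cell g i j)) = (if hit B i g then 1 else 0)" if g: "g \<in> K" "t g i = j" for g
  proof -
    have "l2_inner N (bis_op \<G> B (slab_vect [] (cell g i j))) (slab_vect g (cell g i j))
      = of_real (measure M (cell g i j \<inter> section_at B g))"
      using inner_bis_op_slab[OF bB W_carrier[OF g(1)] cell_sets[OF W_carrier[OF g(1)]]] by (simp add: one_eq)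
    moreover have "cell g i j \<inter> section_at B g = {} \<or> cell g i j \<inter> section_at B g = cell g i j"
    proof (rule disjCI)
      assume "cell g i j \<inter> section_at B g \<noteq> cell g i j"
      then obtain y where y: "y \<in> cell g i j" "y \<notin> section_at B g" by blast
      have "x \<notin> section_at B g" if x: "x \<in> cell g i j" for x
      proof
        assume "x \<in> section_at B g"
        moreover have "x \<in> space M" "y \<in> space M" "\<pi> x = \<pi> y" using x y(1) by (simp_all add: cell_def)
        ultimately show False using determinedD(2)[OF B g(1)] saturatedD y(2) by blast
      qed
      then show "cell g i j \<inter> section_at B g = {}" by blast
    qed
    ultimately show ?thesis using g by (auto simp: hit_def zero_less_measure_iff)
  qed
  have "phi (bis_op \<G> B) $$ (j, i) = (\<Sum>g\<in>{g \<in> K. t g i = j}. if hit B i g then 1 else 0)"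
    using ij V entry by (simp add: phi_def)
  also have "\<dots> = (if transition B i = j then 1 else 0)"
  proof (cases "\<exists>g. hit B i g")
    case True
    then obtain g where g: "hit B i g" by blast
    then have hg: "hit B i g' \<longleftrightarrow> g' = g" for g' using hit_unique[OF B _ g, of g'] by blast
    moreover have "finite {g \<in> K. t g i = j}" using finite_short_words by simp
    ultimately have "(\<Sum>g\<in>{g \<in> K. t g i = j}. if hit B i g then 1 else 0 :: complex)
      = (if g \<in> {g \<in> K. t g i = j} then 1 else 0)" unfolding hg by (simp add: sum.delta')
    then show ?thesis using transition_hit[OF B g ij(2)] g by (simp add: hit_def)
  next
    case False
    then have "transition B i = d" unfolding transition_def by (simp only: simp_thms if_False)
    then show ?thesis using False ij by (simp add: sum.neutral)
  qed
  also have "\<dots> = pmat d (transition B) $$ (j, i)" using ij by (simp add: index_pmat)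
  finally show "phi (bis_op \<G> B) $$ (j, i) = pmat d (transition B) $$ (j, i)" .
qed (use bis_op_in_vn_span B in \<open>auto simp: phi_def pmat_def determined_def\<close>)

text \<open>The points of \<open>X\<close> whose itinerary along short words agrees with the labels met from \<open>i\<close>.\<close>

definition shadow :: "nat \<Rightarrow> 'x set" where
  "shadow i = {x \<in> space M. \<forall>g\<in>W m. \<pi> (\<alpha> g x) = lbl (t g i)}"

lemma W_K: "W m \<subseteq> K" by (rule W_mono) simp

lemma shadow_sets: "shadow i \<in> sets M"
proof -
  have "shadow i = (\<Inter>g\<in>W m. {x \<in> space M. \<pi> (\<alpha> g x) = lbl (t g i)})"
    using Nil_short_words by (auto simp: shadow_def)
  also have "\<dots> \<in> sets M"
    by (intro sets.finite_INT finite_short_words label_sets label_set W_carrier)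
       (use Nil_short_words in auto)
  finally show ?thesis .
qed

text \<open>
  At a point \<open>x\<close> shadowed by \<open>i\<close> the permutations imitate the groupoid. The label of \<open>\<alpha> v x\<close> determines by
  which word, if any, \<open>B\<close> acts there, and the translate of the shadow by \<open>v\<close>, which has positive measure,
  consists of points with this label and so makes \<open>t v i\<close> a hit.
\<close>

lemma transition_shadow:
  assumes B: "determined B" and i: "i < d" "0 < measure M (shadow i)" and x: "x \<in> shadow i" and v: "v \<in> W m"
  shows "(g, \<alpha> v x) \<in> B \<Longrightarrow> g \<in> K \<Longrightarrow> foldr push g v \<in> W m \<Longrightarrow> transition B (t v i) = t (foldr push g v) i"
    and "(\<And>g. (g, \<alpha> v x) \<notin> B) \<Longrightarrow> transition B (t v i) = d"
proof -
  note vc = W_carrier[OF v]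
  have xs: "x \<in> space M" "\<pi> (\<alpha> v x) = lbl (t v i)" using x v by (auto simp: shadow_def)
  have vx: "\<alpha> v x \<in> space M" by (rule act_space[OF vc xs(1)])
  show "transition B (t v i) = d" if none: "\<And>g. (g, \<alpha> v x) \<notin> B"
  proof -
    have "\<not> hit B (t v i) g" for g using hit_transfer[OF B _ vx xs(2), of g] none[of g] by blast
    then have "\<not> (t v i < d \<and> (\<exists>g. hit B (t v i) g))" by blast
    then show ?thesis unfolding transition_def by (rule if_not_P)
  qed
  assume g: "(g, \<alpha> v x) \<in> B" "g \<in> K" "foldr push g v \<in> W m"
  note gc = W_carrier[OF g(2)]
  let ?v = "inv\<^bsub>free_group r\<^esub> v"
  let ?A = "{y \<in> space M. \<alpha> ?v y \<in> shadow i}"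
  have "?A \<subseteq> cell g (t v i) (t g (t v i)) \<inter> section_at B g"
  proof
    fix y assume y: "y \<in> ?A"
    define z where "z = \<alpha> ?v y"
    have z: "z \<in> space M" "\<And>h. h \<in> W m \<Longrightarrow> \<pi> (\<alpha> h z) = lbl (t h i)" using y by (auto simp: z_def shadow_def)
    have yz: "y = \<alpha> v z" using y act_inv'[OF vc] by (simp add: z_def)
    have 1: "\<pi> y = lbl (t v i)" using z(2)[OF v] yz by simp
    have "\<pi> (\<alpha> g y) = \<pi> (\<alpha> (foldr push g v) z)" using act_push_mult[OF gc vc z(1)] yz by simp
    also have "\<dots> = lbl (t g (t v i))" using z(2)[OF g(3)] t_mult[OF gc vc] by simp
    finally have 2: "\<pi> (\<alpha> g y) = lbl (t g (t v i))" .
    have "\<alpha> v x \<in> section_at B g" using g(1) vx by (simp add: section_at_def)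
    moreover have "y \<in> space M" "\<pi> (\<alpha> v x) = \<pi> y" using y 1 xs(2) by simp_all
    ultimately have "y \<in> section_at B g" using determinedD(2)[OF B g(2)] vx saturatedD by blast
    then show "y \<in> cell g (t v i) (t g (t v i)) \<inter> section_at B g" using 1 2 y by (simp add: cell_def)
  qed
  moreover have "bisection B" using B by (simp add: determined_def)
  then have "section_at B g \<in> sets M" using section_at_sets[OF bisectionD(1) gc] by blast
  ultimately have "measure M ?A \<le> measure M (cell g (t v i) (t g (t v i)) \<inter> section_at B g)"
    using cell_sets[OF gc] by (intro finite_measure_mono) auto
  moreover have "measure M ?A = measure M (shadow i)" using measure_act[OF inv_closed[OF vc] shadow_sets] by simp
  ultimately have "hit B (t v i) g" using i g(2) by (simp add: hit_def)
  then have "transition B (t v i) = t g (t v i)" by (rule transition_hit[OF B _ t_less[OF vc i(1)]])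
  then show "transition B (t v i) = t (foldr push g v) i" using t_mult[OF gc vc] by simp
qed

end

context labelled_permutations
begin

text \<open>
  Applying the factors one after another to \<open>i\<close> follows the arrows of the product starting at a
  point \<open>x\<close> shadowed by \<open>i\<close>, provided that all partial products act on \<open>x\<close> by short words. Comparing with the
  transition of the product itself gives approximate multiplicativity.
\<close>

lemma foldr_transition_shadow:
  assumes det: "\<And>B. B \<in> set Bs \<Longrightarrow> determined B"
    and short: "\<And>As Cs g. Bs = As @ Cs \<Longrightarrow> (g, x) \<in> bprod Cs \<Longrightarrow> g \<in> W m"
    and i: "i < d" "0 < measure M (shadow i)" and x: "x \<in> shadow i"
  shows "(\<forall>g. (g, x) \<in> bprod Bs \<longrightarrow> foldr (\<lambda>B. (\<circ>) (transition B)) Bs (\<lambda>i. min i d) i = t g i) \<and>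
    ((\<forall>g. (g, x) \<notin> bprod Bs) \<longrightarrow> foldr (\<lambda>B. (\<circ>) (transition B)) Bs (\<lambda>i. min i d) i = d)"
  using det short
proof (induction Bs)
  case Nil
  have "x \<in> space M" using x by (simp add: shadow_def)
  then show ?case using i by (auto simp: bprod_simps slab_def one_eq)
next
  case (Cons B Bs)
  let ?F = "\<lambda>Bs. foldr (\<lambda>B. (\<circ>) (transition B)) Bs (\<lambda>i. min i d)"
  have IH: "(\<forall>g. (g, x) \<in> bprod Bs \<longrightarrow> ?F Bs i = t g i) \<and> ((\<forall>g. (g, x) \<notin> bprod Bs) \<longrightarrow> ?F Bs i = d)"
  proof (rule Cons.IH)
    show "determined C" if "C \<in> set Bs" for C using Cons.prems(1)[of C] that by simp
    show "g \<in> W m" if "Bs = As @ Cs" "(g, x) \<in> bprod Cs" for As Cs g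
      using Cons.prems(2)[of "B # As" Cs g] that by simp
  qed
  have detB: "determined B" using Cons.prems(1) by simp
  have bB: "bisection B" by (rule determinedD(1)[OF detB])
  have bBs: "bisection (bprod Bs)"
    by (rule bisection_bprod) (use Cons.prems(1) determinedD(1) in auto)
  have F: "?F (B # Bs) i = transition B (?F Bs i)" by simp
  have mem: "(g, x) \<in> bprod (B # Bs) \<longleftrightarrow> (\<exists>k h. (k, x) \<in> bprod Bs \<and> (h, \<alpha> k x) \<in> B \<and> g = foldr push h k)" for g
    using bmult_iff[OF bB bBs] by (simp add: bprod_simps mult_eq)
  show ?case
  proof (cases "\<exists>k. (k, x) \<in> bprod Bs")
    case False
    then have "?F Bs i = d" using IH by blast
    then have "?F (B # Bs) i = d" using F partial_injectionsD(2)[OF transition_partial_injection[OF detB], of d] by simp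
    moreover have "(g, x) \<notin> bprod (B # Bs)" for g using False mem by blast
    ultimately show ?thesis by blast
  next
    case True
    then obtain k where k: "(k, x) \<in> bprod Bs" by blast
    have kW: "k \<in> W m" by (rule Cons.prems(2)[of "[B]" Bs, OF _ k]) simp
    note kc = W_carrier[OF kW]
    have Fk: "?F Bs i = t k i" using IH k by blast
    have uniq: "k' = k" if "(k', x) \<in> bprod Bs" for k' by (rule bisectionD(2)[OF bBs that k])
    show ?thesis
    proof (cases "\<exists>h. (h, \<alpha> k x) \<in> B")
      case True
      then obtain h where h: "(h, \<alpha> k x) \<in> B" by blast
      note hc = bisectionD(4)[OF bB h]
      have gm: "(foldr push h k, x) \<in> bprod (B # Bs)" using mem k h by blast
      have gW: "foldr push h k \<in> W m" by (rule Cons.prems(2)[of "[]" "B # Bs", OF _ gm]) simp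
      have "h = foldr push (foldr push h k) (inv\<^bsub>free_group r\<^esub> k)"
      proof -
        have "h = (h \<otimes>\<^bsub>free_group r\<^esub> k) \<otimes>\<^bsub>free_group r\<^esub> inv\<^bsub>free_group r\<^esub> k"
          using hc kc by (simp add: m_assoc)
        then show ?thesis by (simp only: mult_eq)
      qed
      then have hK: "h \<in> K" using mult_short_words[OF gW inv_W[OF kW]] by (simp add: mult_2)
      have tr: "transition B (t k i) = t (foldr push h k) i"
        by (rule transition_shadow(1)[OF detB i x kW h hK gW])
      have "bisection (bprod (B # Bs))" unfolding bprod_simps by (rule bisection_bmult[OF bB bBs])
      then have uniq': "g = foldr push h k" if "(g, x) \<in> bprod (B # Bs)" for g
        by (rule bisectionD(2)[OF _ that gm])
      have "?F (B # Bs) i = t (foldr push h k) i" unfolding F Fk tr ..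
      then have "?F (B # Bs) i = t g i" if "(g, x) \<in> bprod (B # Bs)" for g using uniq'[OF that] by simp
      then show ?thesis using gm by blast
    next
      case False
      then have "transition B (t k i) = d" by (intro transition_shadow(2)[OF detB i x kW]) blast
      moreover have "(g, x) \<notin> bprod (B # Bs)" for g using False mem uniq by blast
      moreover from \<open>transition B (t k i) = d\<close> have "?F (B # Bs) i = d" unfolding F Fk .
      ultimately show ?thesis by blast
    qed
  qed
qed

lemma determined_slab:
  assumes g: "g \<in> carrier (free_group r)"
  shows "determined (slab g (space M))"
  unfolding determined_def
proof (intro conjI ballI)
  show "bisection (slab g (space M))" by (rule bisection_slab[OF g sets.top])
  fix h assume "h \<in> K"
  then have h: "h \<in> carrier (free_group r)" by (rule W_carrier)
  have "section_at (slab g (space M)) h = (if h = g then space M else {})"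
    by (auto simp: section_at_def slab_def)
  then show "saturated (section_at (slab g (space M)) h)" by (simp add: saturated_def)
  have "section_at (binv (slab g (space M))) (inv\<^bsub>free_group r\<^esub> h) = (if h = g then space M else {})"
    using h act_space[OF inv_closed[OF h]] by (auto simp: section_at_def slab_def binv_def)
  then show "saturated (section_at (binv (slab g (space M))) (inv\<^bsub>free_group r\<^esub> h))" by (simp add: saturated_def)
qed

lemma transition_generator:
  assumes k: "k < r" and i: "i < d"
    and pos: "0 < measure M {x \<in> space M. \<pi> x = lbl i \<and> \<pi> (\<alpha> (gen k) x) = lbl (\<sigma> k i)}"
  shows "transition (slab (gen k) (space M)) i = \<sigma> k i"
proof -
  have t: "t (gen k) i = \<sigma> k i" by (simp add: letter_perm_def)
  have "gen k \<in> K" using m1 k by (simp add: short_words_def reduced_def)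
  moreover have "cell (gen k) i (\<sigma> k i) \<inter> section_at (slab (gen k) (space M)) (gen k) = cell (gen k) i (\<sigma> k i)"
    by (auto simp: cell_def section_at_def slab_def)
  ultimately have "hit (slab (gen k) (space M)) i (gen k)"
    using pos t unfolding hit_def by (simp add: cell_def)
  from transition_hit[OF determined_slab[OF gen_carrier[OF k]] this i] show ?thesis using t by simp
qed

lemma shadow_label:
  assumes "x \<in> shadow i"
  shows "x \<in> space M" "\<pi> x = lbl i"
proof -
  show x: "x \<in> space M" using assms by (simp add: shadow_def)
  have "\<pi> (\<alpha> [] x) = lbl (t [] i)" using assms Nil_short_words unfolding shadow_def by blast
  then show "\<pi> x = lbl i" using act_one[OF x] by (simp add: one_eq)
qed

text \<open>
  At a good index multiplicativity holds exactly, and a fixed point of the transition of a product comes from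
  the empty word, because short nontrivial words move \<open>i\<close>. Hence the trace counts the
  indices whose label lies in the part of \<open>X\<close> where the product acts trivially, and \<open>R\<close> names this set of indices. The remaining indices
  number at most \<open>b\<close>, and the label frequencies are off by at most \<open>c\<close>.
\<close>

lemma phi_in_SA:
  fixes F :: "(letter list \<times> 'x) oper set" and Bs :: "(letter list \<times> 'x) oper \<Rightarrow> (letter list \<times> 'x) set"
  defines "F' \<equiv> F \<union> adjoint_set N F" and "P \<equiv> \<lambda>ss. bprod (map Bs ss)"
  assumes Bs: "\<And>s. s \<in> F' \<Longrightarrow> determined (Bs s) \<and> bis_op \<G> (Bs s) = s"
    and P: "\<And>ss. set ss \<subseteq> F' \<Longrightarrow> length ss \<le> n \<Longrightarrow> determined (P ss)"
    and bad: "real (card {i. i < d \<and> \<not> (0 < measure M (shadow i) \<and>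
       (\<exists>x\<in>shadow i. \<forall>ss g. set ss \<subseteq> F' \<longrightarrow> length ss \<le> n \<longrightarrow> (g, x) \<in> P ss \<longrightarrow> g \<in> W m) \<and>
       (\<forall>g\<in>W m. g \<noteq> [] \<longrightarrow> t g i \<noteq> i))}) \<le> b"
    and R: "\<And>ss i x. set ss \<subseteq> F' \<Longrightarrow> length ss \<le> n \<Longrightarrow> x \<in> space M \<Longrightarrow> \<pi> x = lbl i \<Longrightarrow>
       x \<in> section_at (P ss) [] \<longleftrightarrow> R ss i"
    and freq: "\<And>ss. set ss \<subseteq> F' \<Longrightarrow> length ss \<le> n \<Longrightarrow>
       \<bar>real (card {i. i < d \<and> R ss i}) - real d * measure M (section_at (P ss) [])\<bar> \<le> c"
    and \<delta>: "0 < \<delta>" "2 * b < real d * \<delta>\<^sup>2" "b + c < real d * \<delta>" and d: "0 < d"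
  shows "phi \<in> SA \<G> F n \<delta> d"
proof -
  define good where "good i \<longleftrightarrow> (0 < measure M (shadow i) \<and>
       (\<exists>x\<in>shadow i. \<forall>ss g. set ss \<subseteq> F' \<longrightarrow> length ss \<le> n \<longrightarrow> (g, x) \<in> P ss \<longrightarrow> g \<in> W m) \<and>
       (\<forall>g\<in>W m. g \<noteq> [] \<longrightarrow> t g i \<noteq> i))" for i
  have bad': "real (card {i. i < d \<and> \<not> good i}) \<le> b" using bad by (simp only: good_def)
  have opP: "op_prod N ss = bis_op \<G> (P ss)" if "set ss \<subseteq> F'" for ss
  proof -
    have "map (bis_op \<G>) (map Bs ss) = ss" using Bs that by (simp add: map_idI subset_iff)
    then show ?thesis
      using op_prod_bis_op[of "map Bs ss"] Bs that determinedD(1) by (auto simp: P_def subset_iff)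
  qed
  have phiP: "phi (op_prod N ss) = pmat d (transition (P ss))" if "set ss \<subseteq> F'" "length ss \<le> n" for ss
    using opP[OF that(1)] phi_bis_op[OF P[OF that]] by simp
  have phis: "phi s = pmat d (transition (Bs s))" if "s \<in> F'" for s
    using Bs[OF that] phi_bis_op by metis
  have key: "\<exists>x\<in>shadow i. (\<forall>g. (g, x) \<in> P ss \<longrightarrow> g \<in> W m \<and> transition (P ss) i = t g i \<and>
        foldr (\<lambda>s. (\<circ>) (transition (Bs s))) ss (\<lambda>i. min i d) i = t g i) \<and>
      ((\<forall>g. (g, x) \<notin> P ss) \<longrightarrow> transition (P ss) i = d \<and>
        foldr (\<lambda>s. (\<circ>) (transition (Bs s))) ss (\<lambda>i. min i d) i = d)"
    if ss: "set ss \<subseteq> F'" "length ss \<le> n" and i: "i < d" "good i" for ss i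
  proof -
    obtain x where x: "x \<in> shadow i"
      "\<And>ss g. set ss \<subseteq> F' \<Longrightarrow> length ss \<le> n \<Longrightarrow> (g, x) \<in> P ss \<Longrightarrow> g \<in> W m"
      using i(2) unfolding good_def by blast
    have pos: "0 < measure M (shadow i)" using i(2) by (simp add: good_def)
    have xs: "x \<in> space M" using x(1) by (simp add: shadow_def)
    have ax: "\<alpha> [] x = x" using act_one[OF xs] by (simp add: one_eq)
    have fold: "foldr (\<lambda>B. (\<circ>) (transition B)) (map Bs ss) = foldr (\<lambda>s. (\<circ>) (transition (Bs s))) ss"
      by (induction ss) simp_all
    have A: "(\<forall>g. (g, x) \<in> bprod (map Bs ss) \<longrightarrow> foldr (\<lambda>B. (\<circ>) (transition B)) (map Bs ss) (\<lambda>i. min i d) i = t g i) \<and>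
      ((\<forall>g. (g, x) \<notin> bprod (map Bs ss)) \<longrightarrow> foldr (\<lambda>B. (\<circ>) (transition B)) (map Bs ss) (\<lambda>i. min i d) i = d)"
    proof (rule foldr_transition_shadow[OF _ _ i(1) pos x(1)])
      show "determined B" if "B \<in> set (map Bs ss)" for B using that Bs ss by auto
      fix As Cs g assume *: "map Bs ss = As @ Cs" "(g, x) \<in> bprod Cs"
      have "Cs = map Bs (drop (length As) ss)" using *(1) by (simp add: drop_map[symmetric])
      then have "(g, x) \<in> P (drop (length As) ss)" using *(2) by (simp add: P_def)
      moreover have "set (drop (length As) ss) \<subseteq> F'"
        using ss(1) set_drop_subset[of "length As" ss] by (rule order_trans[rotated])
      moreover have "length (drop (length As) ss) \<le> n" using ss(2) by simp
      ultimately show "g \<in> W m" using x(2) by simp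
    qed
    have B: "transition (P ss) i = t g i" if "(g, x) \<in> P ss" for g
    proof -
      have gW: "g \<in> W m" by (rule x(2)[OF ss that])
      have gg: "foldr push g [] = g" using gW by (simp add: foldr_push_Nil short_words_def)
      show ?thesis
        using transition_shadow(1)[OF P[OF ss] i(1) pos x(1) Nil_short_words, of g] that gW gg W_K ax by auto
    qed
    have C: "transition (P ss) i = d" if "\<And>g. (g, x) \<notin> P ss"
      using transition_shadow(2)[OF P[OF ss] i(1) pos x(1) Nil_short_words] that ax by simp
    show ?thesis
    proof (rule bexI[OF _ x(1)], intro conjI allI impI)
      fix g assume g: "(g, x) \<in> P ss"
      show "g \<in> W m" by (rule x(2)[OF ss g])
      show "transition (P ss) i = t g i" by (rule B[OF g])
      show "foldr (\<lambda>s. (\<circ>) (transition (Bs s))) ss (\<lambda>i. min i d) i = t g i"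
        using A g unfolding fold P_def by blast
    next
      assume n: "\<forall>g. (g, x) \<notin> P ss"
      show "transition (P ss) i = d" using C n by blast
      show "foldr (\<lambda>s. (\<circ>) (transition (Bs s))) ss (\<lambda>i. min i d) i = d"
        using A n unfolding fold P_def by blast
    qed
  qed
  have mult: "hs_norm (phi (op_prod N ss) - mat_prod d (map phi ss)) < \<delta>"
    if ss: "set ss \<subseteq> F'" "length ss \<le> n" for ss
  proof -
    let ?f = "transition (P ss)" and ?g = "foldr (\<lambda>s. (\<circ>) (transition (Bs s))) ss (\<lambda>i. min i d)"
    have mp: "map phi ss = map (\<lambda>s. pmat d (transition (Bs s))) ss"
      by (rule map_cong[OF refl]) (use phis ss(1) in blast)
    have "\<forall>s\<in>set ss. transition (Bs s) \<in> partial_injections d"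
      using Bs ss(1) transition_partial_injection by blast
    from mat_prod_pmat[OF this] have m: "mat_prod d (map phi ss) = pmat d ?g" "?g \<in> partial_injections d"
      unfolding mp by blast+
    note pf = transition_partial_injection[OF P[OF ss]]
    have "disagreements d ?f ?g \<subseteq> {i. i < d \<and> \<not> good i}"
    proof
      fix i assume "i \<in> disagreements d ?f ?g"
      then have i: "i < d" "?f i \<noteq> ?g i" by (auto simp: disagreements_def)
      have "?f i = ?g i" if g: "good i"
      proof -
        obtain x where x: "\<forall>g. (g, x) \<in> P ss \<longrightarrow> g \<in> W m \<and> ?f i = t g i \<and> ?g i = t g i"
          "(\<forall>g. (g, x) \<notin> P ss) \<longrightarrow> ?f i = d \<and> ?g i = d"
          using key[OF ss i(1) g] by blast
        show ?thesis
        proof (cases "\<exists>g. (g, x) \<in> P ss")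
          case True
          then obtain g where "(g, x) \<in> P ss" by blast
          then have "?f i = t g i" "?g i = t g i" using x(1) by blast+
          then show ?thesis by (rule trans[OF _ sym])
        next
          case False
          then have "?f i = d" "?g i = d" using x(2) by blast+
          then show ?thesis by (rule trans[OF _ sym])
        qed
      qed
      then show "i \<in> {i. i < d \<and> \<not> good i}" using i by blast
    qed
    then have "card (disagreements d ?f ?g) \<le> card {i. i < d \<and> \<not> good i}" by (intro card_mono) auto
    then have "2 * real (card (disagreements d ?f ?g)) \<le> 2 * b" using bad' by linarith
    moreover have "real d * (hs_norm (pmat d ?f - pmat d ?g))\<^sup>2 \<le> 2 * real (card (disagreements d ?f ?g))"
      by (rule hs_norm_pmat_diff(2)[OF partial_injectionsD(1)[OF pf] partial_injectionsD(1)[OF m(2)] d])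
    ultimately have "real d * (hs_norm (pmat d ?f - pmat d ?g))\<^sup>2 < real d * \<delta>\<^sup>2" using \<delta> by linarith
    then have "(hs_norm (pmat d ?f - pmat d ?g))\<^sup>2 < \<delta>\<^sup>2" using d by simp
    then have "hs_norm (pmat d ?f - pmat d ?g) < \<delta>"
      by (rule power_less_imp_less_base) (rule less_imp_le[OF \<delta>(1)])
    then show ?thesis unfolding phiP[OF ss] m(1) .
  qed
  have trace: "cmod (ntrace (phi (op_prod N ss)) - vn_trace \<G> (op_prod N ss)) < \<delta>"
    if ss: "set ss \<subseteq> F'" "length ss \<le> n" for ss
  proof -
    let ?f = "transition (P ss)"
    let ?A = "{i. i < d \<and> ?f i = i}" and ?B = "{i. i < d \<and> R ss i}"
      and ?X = "{i. i < d \<and> \<not> good i}"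
    have iff: "?f i = i \<longleftrightarrow> R ss i" if i: "i < d" "good i" for i
    proof -
      obtain x where x: "x \<in> shadow i" "\<forall>g. (g, x) \<in> P ss \<longrightarrow> g \<in> W m \<and> ?f i = t g i"
          "(\<forall>g. (g, x) \<notin> P ss) \<longrightarrow> ?f i = d"
        using key[OF ss i] by blast
      have xs: "x \<in> space M" "\<pi> x = lbl i" using shadow_label[OF x(1)] .
      have free: "t g i \<noteq> i" if "g \<in> W m" "g \<noteq> []" for g using i(2) that by (simp add: good_def)
      have "?f i = i \<longleftrightarrow> ([], x) \<in> P ss"
      proof
        assume fi: "?f i = i"
        then obtain g where g: "(g, x) \<in> P ss" using x(3) i(1) by fastforce
        then have "g \<in> W m" "t g i = i" using x(2) fi by auto
        then have "g = []" using free by blast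
        then show "([], x) \<in> P ss" using g by simp
      next
        assume "([], x) \<in> P ss"
        then show "?f i = i" using x(2) by auto
      qed
      also have "\<dots> \<longleftrightarrow> x \<in> section_at (P ss) []" using xs by (simp add: section_at_def)
      also have "\<dots> \<longleftrightarrow> R ss i" by (rule R[OF ss xs])
      finally show ?thesis .
    qed
    have "card ?A \<le> card (?B \<union> ?X)" "card ?B \<le> card (?A \<union> ?X)"
      by (intro card_mono; use iff in auto)+
    moreover have "card (?B \<union> ?X) \<le> card ?B + card ?X" "card (?A \<union> ?X) \<le> card ?A + card ?X"
      by (rule card_Un_le)+
    ultimately have "\<bar>real (card ?A) - real (card ?B)\<bar> \<le> b" using bad' by linarith
    then have "\<bar>real (card ?A) - real d * measure M (section_at (P ss) [])\<bar> \<le> b + c"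
      using freq[OF ss] by linarith
    then have "\<bar>real (card ?A) - real d * measure M (section_at (P ss) [])\<bar> < real d * \<delta>" using \<delta> by linarith
    moreover have "real (card ?A) - real d * measure M (section_at (P ss) [])
      = real d * (real (card ?A) / real d - measure M (section_at (P ss) []))"
      using d by (simp add: field_simps)
    ultimately have "real d * \<bar>real (card ?A) / real d - measure M (section_at (P ss) [])\<bar> < real d * \<delta>"
      by (simp add: abs_mult)
    then have lt: "\<bar>real (card ?A) / real d - measure M (section_at (P ss) [])\<bar> < \<delta>" using d by simp
    have "ntrace (phi (op_prod N ss)) - vn_trace \<G> (op_prod N ss)
      = of_real (real (card ?A) / real d - measure M (section_at (P ss) []))"
      using vn_trace_bis_op[OF determinedD(1)[OF P[OF ss]]] phiP[OF ss] opP[OF ss(1)]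
      by (simp add: ntrace_pmat one_eq)
    then show ?thesis using lt by (simp only: norm_of_real)
  qed
  have pp: "phi (op_prod N ss) \<in> partial_perm_mats d" if ss: "set ss \<subseteq> F'" "length ss \<le> n" for ss
    using phiP[OF ss] transition_partial_injection[OF P[OF ss]] by (auto simp: partial_perm_mats_eq)
  have pl: "\<exists>ss. s = op_prod N ss \<and> set ss \<subseteq> F' \<and> length ss \<le> n" if "s \<in> powers_le N F' n" for s
    using that by (auto simp: powers_le_def powers_def)
  show ?thesis
    unfolding SA_def Let_def F'_def[symmetric]
  proof (intro CollectI conjI allI impI ballI phi_linear)
    fix ss assume "set ss \<subseteq> F' \<and> 1 \<le> length ss \<and> length ss \<le> n"
    then show "hs_norm (phi (op_prod N ss) - mat_prod d (map phi ss)) < \<delta>" by (intro mult) auto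
  next
    show "phi ` powers_le N F' n \<subseteq> partial_perm_mats d" using pl pp by blast
  next
    fix s assume "s \<in> powers_le N F' n"
    then obtain ss where "s = op_prod N ss" "set ss \<subseteq> F'" "length ss \<le> n" using pl by blast
    then show "cmod (ntrace (phi s) - vn_trace \<G> s) < \<delta>" using trace by blast
  qed
qed

end

lemma log_card_ge:
  assumes "finite P" "P \<noteq> {}" "inj_on f P" "f ` P \<subseteq> A"
  shows "ereal (ln (real (card P))) \<le> log_card A"
proof (cases "finite A")
  case True
  have "card P \<le> card A" using assms True by (intro card_inj_on_le)
  moreover have "0 < card P" using assms by (simp add: card_gt_0_iff)
  moreover have "A \<noteq> {}" using assms by blast
  ultimately show ?thesis using True by (simp add: log_card_def)
qed (simp add: log_card_def)

context free_pmp_action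
begin

definition gen_ops :: "(letter list \<times> 'x) oper set" where
  "gen_ops = (\<lambda>k. bis_op \<G> (slab (gen k) (space M))) ` {..<r}"

text \<open>
  The labels are chosen so that all products of at most \<open>n\<close> elements of \<open>F\<close> and their adjoints are determined by them, and also
  membership in the tail, where long words occur. Every choice of one permutation from each \<open>S k\<close> then gives
  an approximation, and the choice can be read off from the images of the generators: the transition of a
  generator is its permutation outside the fixed set \<open>Z\<close>, on which all choices coincide.
\<close>

theorem many_sofic_approximations:
  assumes F: "finite F" "F \<subseteq> inv_semigroup \<G>" and \<delta>: "0 < \<delta>"
  obtains C D :: nat where "1 \<le> C" "\<And>d. d \<ge> D \<Longrightarrow>
    ereal (real r * (ln (fact d) - real d * ln (real C))) \<le> log_card (restrictions gen_ops (SA \<G> F n \<delta> d))"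
proof -
  define F' where "F' = F \<union> adjoint_set N F"
  have finF': "finite F'" using F by (simp add: F'_def adjoint_set_def)
  have "F' \<subseteq> inv_semigroup \<G>" using F adjoint_set_inv_semigroup[OF F(2)] by (simp add: F'_def)
  then have "\<forall>s\<in>F'. \<exists>B. bisection B \<and> bis_op \<G> B = s" by (auto simp: inv_semigroup_eq)
  from bchoice[OF this] obtain Bs where Bs: "\<And>s. s \<in> F' \<Longrightarrow> bisection (Bs s) \<and> bis_op \<G> (Bs s) = s" by blast
  define P where "P ss = bprod (map Bs ss)" for ss
  define LL where "LL = {ss. set ss \<subseteq> F' \<and> length ss \<le> n}"
  have finLL: "finite LL" unfolding LL_def by (rule finite_lists_length_le[OF finF'])
  have bisP: "bisection (P ss)" if "ss \<in> LL" for ss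
    unfolding P_def by (rule bisection_bprod) (use that Bs in \<open>auto simp: LL_def\<close>)
  define \<B> where "\<B> = P ` LL \<union> Bs ` F'"
  have fin\<B>: "finite \<B>" using finLL finF' by (simp add: \<B>_def)
  have bis\<B>: "bisection B" if "B \<in> \<B>" for B using that bisP Bs by (auto simp: \<B>_def)
  define \<epsilon> where "\<epsilon> = min (\<delta>\<^sup>2 / 4) (\<delta> / 2)"
  have \<epsilon>: "0 < \<epsilon>" "\<epsilon> \<le> \<delta>\<^sup>2 / 4" "\<epsilon> \<le> \<delta> / 2" using \<delta> by (simp_all add: \<epsilon>_def)
  obtain m where m: "m \<ge> 1" "measure M (tail \<B> m) < \<epsilon>" by (rule ex_small_tail[OF fin\<B> bis\<B> \<epsilon>(1)])
  let ?K = "W (2 * m)" and ?T = "tail \<B> m"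
  \<comment> \<open>The label of a point is the set of members of \<open>SS\<close> that contain it.\<close>
  define SS where "SS = insert ?T ((\<lambda>(B, g). section_at B g) ` (\<B> \<times> ?K)
    \<union> (\<lambda>(B, g). section_at (binv B) (inv\<^bsub>free_group r\<^esub> g)) ` (\<B> \<times> ?K))"
  have SS1: "section_at B g \<in> SS" if "B \<in> \<B>" "g \<in> ?K" for B g
    unfolding SS_def by (intro insertI2 UnI1 image_eqI[of _ _ "(B, g)"]) (use that in simp_all)
  have SS2: "section_at (binv B) (inv\<^bsub>free_group r\<^esub> g) \<in> SS" if "B \<in> \<B>" "g \<in> ?K" for B g
    unfolding SS_def by (intro insertI2 UnI2 image_eqI[of _ _ "(B, g)"]) (use that in simp_all)
  have finSS: "finite SS" using fin\<B> finite_short_words by (simp add: SS_def)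
  have SS_sets: "A \<in> sets M" if "A \<in> SS" for A
    using that tail_sets[OF fin\<B> bis\<B>] section_at_sets[OF bisectionD(1)] bis\<B> bisection_binv W_carrier
    by (auto simp: SS_def)
  define \<pi> where "\<pi> x = {A \<in> SS. x \<in> A}" for x
  have \<pi>: "\<pi> x \<in> Pow SS" for x by (auto simp: \<pi>_def)
  have \<pi>_sets: "{x \<in> space M. \<pi> x = c} \<in> sets M" for c
  proof (cases "c \<subseteq> SS")
    case True
    have "{x \<in> space M. \<pi> x = c} = {x \<in> space M. \<forall>A\<in>SS. x \<in> A \<longleftrightarrow> A \<in> c}"
      using True by (auto simp: \<pi>_def)
    also have "\<dots> \<in> sets M"
    proof (rule sets.sets_Collect_finite_All'[OF _ finSS])
      show "SS \<noteq> {}" by (simp add: SS_def)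
      fix A assume "A \<in> SS"
      then have A: "A \<in> sets M" by (rule SS_sets)
      then show "{x \<in> space M. (x \<in> A) = (A \<in> c)} \<in> sets M" by (cases "A \<in> c") (simp_all add: Collect_conj_eq, measurable)
    qed
    finally show ?thesis .
  next
    case False
    then have "{x \<in> space M. \<pi> x = c} = {}" by (auto simp: \<pi>_def)
    then show ?thesis by (metis sets.empty_sets)
  qed
  have finP: "finite (Pow SS)" using finSS by simp
  obtain C0 :: nat where C0: "\<And>d. \<exists>lbl Z S. Z \<subseteq> {..<d} \<and> card Z \<le> C0 \<and>
    (\<forall>i. lbl i \<in> Pow SS) \<and>
    (\<forall>c\<in>Pow SS. \<bar>real (card {i. i < d \<and> lbl i = c}) - real d * measure M {x \<in> space M. \<pi> x = c}\<bar> \<le> real C0) \<and>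
    (\<forall>k<r. (\<forall>\<sigma>\<in>S k. \<sigma> permutes {..<d} \<and>
         (\<forall>i\<in>{..<d} - Z. 0 < measure M {x \<in> space M. \<pi> x = lbl i \<and> \<pi> (\<alpha> (gen k) x) = lbl (\<sigma> i)})) \<and>
       (\<forall>\<sigma>\<in>S k. \<forall>\<sigma>'\<in>S k. \<forall>i\<in>Z. \<sigma> i = \<sigma>' i) \<and> fact d \<le> card (S k) * C0 ^ d) \<and>
    (\<forall>\<sigma>. (\<forall>k<r. \<sigma> k \<in> S k) \<longrightarrow> (\<exists>Bad\<subseteq>{..<d}. card Bad \<le> C0 \<and> (\<forall>i\<in>{..<d} - Bad.
        0 < measure M {x \<in> space M. \<forall>g\<in>W m. \<pi> (\<alpha> g x) = lbl (foldr (letter_perm \<sigma>) g i)} \<and>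
        (\<forall>g\<in>W m. g \<noteq> [] \<longrightarrow> foldr (letter_perm \<sigma>) g i \<noteq> i))))"
    by (rule ex_sofic_models[OF finP \<pi> \<pi>_sets m(1)]) (rule that)
  define C1 where "C1 = real (card (Pow SS) * C0)"
  have C1: "0 \<le> C1" by (simp add: C1_def)
  define B0 where "B0 = real C0 + 2 * C1"
  obtain D0 :: nat where D0: "real D0 > 4 * B0 / \<delta>\<^sup>2 + 2 * B0 / \<delta>" using reals_Archimedean2 by blast
  show ?thesis
  proof (rule that[of "C0 + 1" "max D0 1"])
    fix d assume "max D0 1 \<le> d"
    then have d: "0 < d" "D0 \<le> d" by auto
    have B0: "0 \<le> B0" using C1 by (simp add: B0_def)
    have dd: "4 * B0 / \<delta>\<^sup>2 + 2 * B0 / \<delta> < real d" using D0 d(2) by linarith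
    have nn: "0 \<le> 4 * B0 / \<delta>\<^sup>2" "0 \<le> 2 * B0 / \<delta>" using B0 \<delta> by auto
    have d1: "2 * B0 < real d * \<delta>\<^sup>2 / 2"
    proof -
      have "4 * B0 / \<delta>\<^sup>2 < real d" using dd nn by linarith
      then show ?thesis using \<delta> by (simp add: pos_divide_less_eq)
    qed
    have d2: "B0 < real d * \<delta> / 2"
    proof -
      have "2 * B0 / \<delta> < real d" using dd nn by linarith
      then show ?thesis using \<delta> by (simp add: pos_divide_less_eq)
    qed
    obtain lbl Z S where mod: "Z \<subseteq> {..<d}" "card Z \<le> C0" "\<forall>i. lbl i \<in> Pow SS"
      "\<forall>c\<in>Pow SS. \<bar>real (card {i. i < d \<and> lbl i = c}) - real d * measure M {x \<in> space M. \<pi> x = c}\<bar> \<le> real C0"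
      "\<forall>k<r. (\<forall>\<sigma>\<in>S k. \<sigma> permutes {..<d} \<and>
         (\<forall>i\<in>{..<d} - Z. 0 < measure M {x \<in> space M. \<pi> x = lbl i \<and> \<pi> (\<alpha> (gen k) x) = lbl (\<sigma> i)})) \<and>
       (\<forall>\<sigma>\<in>S k. \<forall>\<sigma>'\<in>S k. \<forall>i\<in>Z. \<sigma> i = \<sigma>' i) \<and> fact d \<le> card (S k) * C0 ^ d"
      "\<forall>\<sigma>. (\<forall>k<r. \<sigma> k \<in> S k) \<longrightarrow> (\<exists>Bad\<subseteq>{..<d}. card Bad \<le> C0 \<and> (\<forall>i\<in>{..<d} - Bad.
        0 < measure M {x \<in> space M. \<forall>g\<in>W m. \<pi> (\<alpha> g x) = lbl (foldr (letter_perm \<sigma>) g i)} \<and>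
        (\<forall>g\<in>W m. g \<noteq> [] \<longrightarrow> foldr (letter_perm \<sigma>) g i \<noteq> i)))"
      using C0[of d] by (elim exE conjE) (rule that)
    have Sperm: "\<sigma> permutes {..<d}" if "k < r" "\<sigma> \<in> S k" for k \<sigma> using mod(5) that by blast
    have freqA: "\<bar>real (card {i. i < d \<and> A \<in> lbl i}) - real d * measure M A\<bar> \<le> C1" if A: "A \<in> SS" for A
    proof -
      let ?I = "{c \<in> Pow SS. A \<in> c}"
      have fI: "finite ?I" using finP by simp
      have "{i. i < d \<and> A \<in> lbl i} = (\<Union>c\<in>?I. {i. i < d \<and> lbl i = c})" using mod(3) by blast
      moreover have "card (\<Union>c\<in>?I. {i. i < d \<and> lbl i = c}) = (\<Sum>c\<in>?I. card {i. i < d \<and> lbl i = c})"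
        by (rule card_UN_disjoint[OF fI]) auto
      ultimately have 1: "card {i. i < d \<and> A \<in> lbl i} = (\<Sum>c\<in>?I. card {i. i < d \<and> lbl i = c})" by simp
      have 2: "(\<Sum>c\<in>?I. measure M {x \<in> space M. \<pi> x = c}) = measure M A"
      proof -
        have "(\<Sum>c\<in>?I. measure M {x \<in> space M. \<pi> x = c}) = measure M (\<Union>c\<in>?I. {x \<in> space M. \<pi> x = c})"
        proof (rule finite_measure_finite_Union[symmetric, OF fI])
          show "(\<lambda>c. {x \<in> space M. \<pi> x = c}) ` ?I \<subseteq> sets M" by (rule image_subsetI) (rule \<pi>_sets)
          show "disjoint_family_on (\<lambda>c. {x \<in> space M. \<pi> x = c}) ?I" unfolding disjoint_family_on_def by blast
        qed
        also have "(\<Union>c\<in>?I. {x \<in> space M. \<pi> x = c}) = A"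
        proof (intro Set.set_eqI iffI)
          fix x assume "x \<in> (\<Union>c\<in>?I. {x \<in> space M. \<pi> x = c})"
          then have "A \<in> \<pi> x" by blast
          then show "x \<in> A" by (simp add: \<pi>_def)
        next
          fix x assume x: "x \<in> A"
          then have "A \<in> \<pi> x" using A by (simp add: \<pi>_def)
          then have "\<pi> x \<in> ?I" using \<pi>[of x] by blast
          moreover have "x \<in> space M" using sets.sets_into_space[OF SS_sets[OF A]] x by blast
          ultimately show "x \<in> (\<Union>c\<in>?I. {x \<in> space M. \<pi> x = c})" by blast
        qed
        finally show ?thesis .
      qed
      have "\<bar>real (card {i. i < d \<and> A \<in> lbl i}) - real d * measure M A\<bar>
        = \<bar>\<Sum>c\<in>?I. real (card {i. i < d \<and> lbl i = c}) - real d * measure M {x \<in> space M. \<pi> x = c}\<bar>"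
        unfolding 1 2[symmetric] by (simp add: sum_subtractf sum_distrib_left)
      also have "\<dots> \<le> (\<Sum>c\<in>?I. \<bar>real (card {i. i < d \<and> lbl i = c}) - real d * measure M {x \<in> space M. \<pi> x = c}\<bar>)"
        by (rule sum_abs)
      also have "\<dots> \<le> (\<Sum>c\<in>?I. real C0)" by (intro sum_mono) (use mod(4) in blast)
      also have "\<dots> = real (card ?I * C0)" by simp
      also have "\<dots> \<le> C1" unfolding C1_def by (intro of_nat_mono mult_right_mono card_mono finP) auto
      finally show ?thesis .
    qed

    define \<Sigma> where "\<Sigma> = (\<Pi>\<^sub>E k\<in>{..<r}. S k)"
    have finS: "finite (S k)" if "k < r" for k
      by (rule finite_subset[OF _ finite_permutations[OF finite_lessThan[of d]]]) (use Sperm[OF that] in blast)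
    have loc: "labelled_permutations r M \<alpha> \<pi> d m \<sigma>" if "\<sigma> \<in> \<Sigma>" for \<sigma>
      by unfold_locales (use \<pi>_sets m(1) Sperm that in \<open>auto simp: \<Sigma>_def\<close>)
    define \<Phi> where "\<Phi> \<sigma> = labelled_permutations.phi r M \<alpha> \<pi> lbl d m \<sigma>" for \<sigma>
    have inSA: "\<Phi> \<sigma> \<in> SA \<G> F n \<delta> d" if \<sigma>: "\<sigma> \<in> \<Sigma>" for \<sigma>
    proof -
      interpret L: labelled_permutations r M \<alpha> \<pi> lbl d m \<sigma> by (rule loc[OF \<sigma>])
      have sat: "L.saturated A" if A: "A \<in> SS" for A
        unfolding L.saturated_def
      proof (intro ballI impI)
        fix x y assume "\<pi> x = \<pi> y" "x \<in> A"
        then have "A \<in> \<pi> y" using A by (auto simp: \<pi>_def)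
        then show "y \<in> A" by (simp add: \<pi>_def)
      qed
      have det: "L.determined B" if B: "B \<in> \<B>" for B
        unfolding L.determined_def using bis\<B>[OF B] sat[OF SS1[OF B]] sat[OF SS2[OF B]] by blast
      have "\<forall>k<r. \<sigma> k \<in> S k" using \<sigma> by (auto simp: \<Sigma>_def)
      from mod(6)[THEN spec, THEN mp, OF this, folded L.shadow_def] obtain Bad
        where Bad: "Bad \<subseteq> {..<d}" "card Bad \<le> C0"
        "\<forall>i\<in>{..<d} - Bad. 0 < measure M (L.shadow i) \<and> (\<forall>g\<in>W m. g \<noteq> [] \<longrightarrow> L.t g i \<noteq> i)"
        by blast
      define b where "b = real C0 + (real d * measure M ?T + C1)"
      have secSS: "section_at (P ss) [] \<in> SS" if "set ss \<subseteq> F'" "length ss \<le> n" for ss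
        by (rule SS1[OF _ Nil_short_words]) (use that in \<open>simp add: \<B>_def LL_def\<close>)
      have "L.phi \<in> SA \<G> F n \<delta> d"
      proof (rule L.phi_in_SA[where F = F and n = n and Bs = Bs and b = b and c = C1 and R = "\<lambda>ss i. section_at (P ss) [] \<in> lbl i",
            folded F'_def P_def])
        show "L.determined (Bs s) \<and> bis_op \<G> (Bs s) = s" if "s \<in> F'" for s
          using Bs[OF that] det that by (auto simp: \<B>_def)
        show "L.determined (P ss)" if "set ss \<subseteq> F'" "length ss \<le> n" for ss
          using det that by (auto simp: \<B>_def LL_def)
        show "\<bar>real (card {i. i < d \<and> section_at (P ss) [] \<in> lbl i}) - real d * measure M (section_at (P ss) [])\<bar> \<le> C1"
          if "set ss \<subseteq> F'" "length ss \<le> n" for ss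
          by (rule freqA[OF secSS[OF that]])
        show "x \<in> section_at (P ss) [] \<longleftrightarrow> section_at (P ss) [] \<in> lbl i"
          if "set ss \<subseteq> F'" "length ss \<le> n" "x \<in> space M" "\<pi> x = lbl i" for ss i x
          using secSS[OF that(1,2)] that(4)[symmetric] by (simp add: \<pi>_def)
        show "real (card {i. i < d \<and> \<not> (0 < measure M (L.shadow i) \<and>
           (\<exists>x\<in>L.shadow i. \<forall>ss g. set ss \<subseteq> F' \<longrightarrow> length ss \<le> n \<longrightarrow> (g, x) \<in> P ss \<longrightarrow> g \<in> W m) \<and>
           (\<forall>g\<in>W m. g \<noteq> [] \<longrightarrow> L.t g i \<noteq> i))}) \<le> b" (is "real (card ?X) \<le> b")
        proof -
          have "?X \<subseteq> Bad \<union> {i. i < d \<and> ?T \<in> lbl i}"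
          proof
            fix i assume i: "i \<in> ?X"
            show "i \<in> Bad \<union> {i. i < d \<and> ?T \<in> lbl i}"
            proof (rule ccontr)
              assume n: "i \<notin> Bad \<union> {i. i < d \<and> ?T \<in> lbl i}"
              then have good: "0 < measure M (L.shadow i)" "\<forall>g\<in>W m. g \<noteq> [] \<longrightarrow> L.t g i \<noteq> i"
                using Bad(3)[THEN bspec, of i] i by simp_all
              obtain x where x: "x \<in> L.shadow i" by (rule L.positive_measure_point[OF good(1)])
              have xs: "x \<in> space M" "\<pi> x = lbl i" using L.shadow_label[OF x] .
              have "?T \<in> SS" by (simp add: SS_def)
              then have "x \<in> ?T \<longleftrightarrow> ?T \<in> \<pi> x" by (simp add: \<pi>_def)
              then have "x \<notin> ?T" using xs(2) n i by simp
              have short: "g \<in> W m" if ss: "set ss \<subseteq> F'" "length ss \<le> n" "(g, x) \<in> P ss" for ss g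
              proof (rule ccontr)
                assume "g \<notin> W m"
                moreover have "P ss \<in> \<B>" using ss(1,2) by (simp add: \<B>_def LL_def)
                ultimately have "x \<in> ?T" using xs(1) ss(3) unfolding tail_def by blast
                then show False using \<open>x \<notin> ?T\<close> by simp
              qed
              have "\<exists>x\<in>L.shadow i. \<forall>ss g. set ss \<subseteq> F' \<longrightarrow> length ss \<le> n \<longrightarrow> (g, x) \<in> P ss \<longrightarrow> g \<in> W m"
                using x short by (intro bexI[of _ x]) simp_all
              with good have "0 < measure M (L.shadow i) \<and>
                (\<exists>x\<in>L.shadow i. \<forall>ss g. set ss \<subseteq> F' \<longrightarrow> length ss \<le> n \<longrightarrow> (g, x) \<in> P ss \<longrightarrow> g \<in> W m) \<and>
                (\<forall>g\<in>W m. g \<noteq> [] \<longrightarrow> L.t g i \<noteq> i)" by (intro conjI)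
              then show False by (rule notE[OF conjunct2[OF i[unfolded mem_Collect_eq]]])
            qed
          qed
          then have "card ?X \<le> card (Bad \<union> {i. i < d \<and> ?T \<in> lbl i})"
            using finite_subset[OF Bad(1)] by (intro card_mono) auto
          also have "\<dots> \<le> card Bad + card {i. i < d \<and> ?T \<in> lbl i}" by (rule card_Un_le)
          finally have "real (card ?X) \<le> real C0 + real (card {i. i < d \<and> ?T \<in> lbl i})" using Bad(2) by linarith
          moreover have "?T \<in> SS" by (simp add: SS_def)
          ultimately show ?thesis using freqA[of ?T] unfolding b_def by linarith
        qed
        have dT: "real d * measure M ?T \<le> real d * \<epsilon>" using m(2) by (intro mult_left_mono) auto
        have "real d * \<epsilon> \<le> real d * (\<delta>\<^sup>2 / 4)" "real d * \<epsilon> \<le> real d * (\<delta> / 2)"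
          using \<epsilon> by (intro mult_left_mono; simp)+
        then have "real d * \<epsilon> \<le> real d * \<delta>\<^sup>2 / 4" "real d * \<epsilon> \<le> real d * \<delta> / 2" by simp_all
        then have "real d * measure M ?T \<le> real d * \<delta>\<^sup>2 / 4" "real d * measure M ?T \<le> real d * \<delta> / 2"
          using dT by auto
        note Tb = this
        have lin: "2 * (c + (x + e)) < y \<and> c + (x + e) + e < z"
          if "x \<le> y / 4" "x \<le> z / 2" "2 * (c + 2 * e) < y / 2" "c + 2 * e < z / 2" "0 \<le> e" for c e x y z :: real
          using that by (intro conjI) argo+
        note lin' = lin[OF Tb d1[unfolded B0_def] d2[unfolded B0_def] C1]
        show "2 * b < real d * \<delta>\<^sup>2" "b + C1 < real d * \<delta>"
          unfolding b_def using lin' by blast+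
      qed (use \<delta> d in auto)
      then show ?thesis by (simp add: \<Phi>_def)
    qed
    have inj: "inj_on (\<lambda>\<sigma>. restrict (\<Phi> \<sigma>) gen_ops) \<Sigma>"
    proof (rule inj_onI)
      fix \<sigma> \<tau> assume st: "\<sigma> \<in> \<Sigma>" "\<tau> \<in> \<Sigma>" and eq: "restrict (\<Phi> \<sigma>) gen_ops = restrict (\<Phi> \<tau>) gen_ops"
      let ?U = "\<lambda>k. slab (gen k) (space M)"
      have tr: "\<exists>f\<in>partial_injections d. \<Phi> \<rho> (bis_op \<G> (?U k)) = pmat d f \<and> (\<forall>i\<in>{..<d} - Z. f i = \<rho> k i)"
        if \<rho>: "\<rho> \<in> \<Sigma>" and k: "k < r" for \<rho> k
      proof -
        interpret L: labelled_permutations r M \<alpha> \<pi> lbl d m \<rho> by (rule loc[OF \<rho>])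
        note det = L.determined_slab[OF gen_carrier[OF k]]
        have "\<rho> k \<in> S k" using \<rho> k by (auto simp: \<Sigma>_def)
        with k mod(5) have pos: "\<forall>i\<in>{..<d} - Z.
            0 < measure M {x \<in> space M. \<pi> x = lbl i \<and> \<pi> (\<alpha> (gen k) x) = lbl (\<rho> k i)}"
          by blast
        have "L.transition (?U k) i = \<rho> k i" if i: "i \<in> {..<d} - Z" for i
          using L.transition_generator[OF k _ pos[THEN bspec, OF i]] i by simp
        moreover have "\<Phi> \<rho> (bis_op \<G> (?U k)) = pmat d (L.transition (?U k))"
          unfolding \<Phi>_def by (rule L.phi_bis_op[OF det])
        ultimately show ?thesis using L.transition_partial_injection[OF det]
          by (intro bexI[of _ "L.transition (?U k)"]) simp_all
      qed
      have "\<sigma> k = \<tau> k" if k: "k < r" for k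
      proof
        fix i
        have sk: "\<sigma> k \<in> S k" "\<tau> k \<in> S k" using st k by (auto simp: \<Sigma>_def)
        obtain f where f: "f \<in> partial_injections d" "\<Phi> \<sigma> (bis_op \<G> (?U k)) = pmat d f"
          "\<forall>i\<in>{..<d} - Z. f i = \<sigma> k i" using tr[OF st(1) k] by blast
        obtain g where g: "g \<in> partial_injections d" "\<Phi> \<tau> (bis_op \<G> (?U k)) = pmat d g"
          "\<forall>i\<in>{..<d} - Z. g i = \<tau> k i" using tr[OF st(2) k] by blast
        have "bis_op \<G> (?U k) \<in> gen_ops" using k by (auto simp: gen_ops_def)
        then have "\<Phi> \<sigma> (bis_op \<G> (?U k)) = \<Phi> \<tau> (bis_op \<G> (?U k))"
          using fun_cong[OF eq, of "bis_op \<G> (?U k)"] by simp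
        then have fg: "f = g" using pmat_eqD[OF f(1) g(1)] f(2) g(2) by simp
        consider "i \<in> {..<d} - Z" | "i \<in> Z" | "i \<notin> {..<d}" by blast
        then show "\<sigma> k i = \<tau> k i"
        proof cases
          case 1 then show ?thesis using f(3) g(3) fg by simp
        next
          case 2 then show ?thesis using mod(5) k sk by blast
        next
          case 3 then show ?thesis
            using permutes_not_in[OF Sperm[OF k sk(1)]] permutes_not_in[OF Sperm[OF k sk(2)]] by simp
        qed
      qed
      then show "\<sigma> = \<tau>" using st unfolding \<Sigma>_def by (intro PiE_ext[of \<sigma> "{..<r}" S \<tau>]) simp_all
    qed
    have card\<Sigma>: "card \<Sigma> = (\<Prod>k<r. card (S k))" by (simp add: \<Sigma>_def card_PiE)
    have Spos: "0 < card (S k)" "ln (fact d) - real d * ln (real (C0 + 1)) \<le> ln (real (card (S k)))" if "k < r" for k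
    proof -
      have le: "fact d \<le> card (S k) * (C0 + 1) ^ d"
      proof -
        have "fact d \<le> card (S k) * C0 ^ d" using mod(5) that by blast
        also have "\<dots> \<le> card (S k) * (C0 + 1) ^ d" by (intro mult_left_mono power_mono) auto
        finally show ?thesis .
      qed
      show pos: "0 < card (S k)"
      proof (rule ccontr)
        assume "\<not> 0 < card (S k)"
        then have "(fact d :: nat) \<le> 0" using le by simp
        then show False by simp
      qed
      have "real (fact d) \<le> real (card (S k) * (C0 + 1) ^ d)" using le by (rule of_nat_mono)
      then have "fact d \<le> real (card (S k)) * real (C0 + 1) ^ d" by (simp only: of_nat_fact of_nat_mult of_nat_power)
      then have "ln (fact d) \<le> ln (real (card (S k)) * real (C0 + 1) ^ d)"
        using pos by (subst ln_le_cancel_iff) auto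
      also have "\<dots> = ln (real (card (S k))) + real d * ln (real (C0 + 1))"
        using pos by (subst ln_mult) (auto simp: ln_realpow)
      finally show "ln (fact d) - real d * ln (real (C0 + 1)) \<le> ln (real (card (S k)))" by simp
    qed
    have "real r * (ln (fact d) - real d * ln (real (C0 + 1))) = (\<Sum>k<r. ln (fact d) - real d * ln (real (C0 + 1)))"
      by simp
    also have "\<dots> \<le> (\<Sum>k<r. ln (real (card (S k))))" by (rule sum_mono) (use Spos in auto)
    also have "\<dots> = ln (real (card \<Sigma>))"
      unfolding card\<Sigma> of_nat_prod using Spos(1) by (subst ln_prod) auto
    finally have "ereal (real r * (ln (fact d) - real d * ln (real (C0 + 1)))) \<le> ereal (ln (real (card \<Sigma>)))" by simp
    also have "\<dots> \<le> log_card (restrictions gen_ops (SA \<G> F n \<delta> d))"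
    proof (rule log_card_ge[OF _ _ inj])
      show "finite \<Sigma>" unfolding \<Sigma>_def by (intro finite_PiE) (use finS in auto)
      have "0 < card \<Sigma>" unfolding card\<Sigma> using Spos(1) by (intro prod_pos) simp
      then show "\<Sigma> \<noteq> {}" by auto
      show "(\<lambda>\<sigma>. restrict (\<Phi> \<sigma>) gen_ops) ` \<Sigma> \<subseteq> restrictions gen_ops (SA \<G> F n \<delta> d)"
        using inSA by (auto simp: restrictions_def)
    qed
    finally show "ereal (real r * (ln (fact d) - real d * ln (real (C0 + 1))))
      \<le> log_card (restrictions gen_ops (SA \<G> F n \<delta> d))" .
  qed simp
qed

end

section \<open>Decoding a partial injection from the generators\<close>

lemma disagreements_comp:
  assumes f: "f d = d" "f' d = d" and g: "g \<in> partial_injections d"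
  shows "card (disagreements d (f \<circ> g) (f' \<circ> g)) \<le> card (disagreements d f f')"
proof (rule card_inj_on_le[of g])
  have lt: "g i < d" if i: "i \<in> disagreements d (f \<circ> g) (f' \<circ> g)" for i
  proof (rule ccontr)
    assume "\<not> g i < d"
    then have "g i = d" using partial_injectionsD(1)[OF g, of i] by simp
    then show False using i f by (simp add: disagreements_def)
  qed
  show "inj_on g (disagreements d (f \<circ> g) (f' \<circ> g))"
    using lt partial_injectionsD(3)[OF g] by (intro inj_onI) blast
  show "g ` disagreements d (f \<circ> g) (f' \<circ> g) \<subseteq> disagreements d f f'"
  proof
    fix j assume "j \<in> g ` disagreements d (f \<circ> g) (f' \<circ> g)"
    then obtain i where i: "j = g i" "i \<in> disagreements d (f \<circ> g) (f' \<circ> g)" by blast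
    then show "j \<in> disagreements d f f'" using lt[OF i(2)] by (simp add: disagreements_def)
  qed
qed (simp add: disagreements_def)

definition partial_inverse :: "nat \<Rightarrow> (nat \<Rightarrow> nat) \<Rightarrow> nat \<Rightarrow> nat" where
  "partial_inverse d f j = (if j < d \<and> (\<exists>i<d. f i = j) then THE i. i < d \<and> f i = j else d)"

lemma partial_inverse_eq:
  assumes "f \<in> partial_injections d" "i < d" "f i < d"
  shows "partial_inverse d f (f i) = i"
proof -
  have "(THE k. k < d \<and> f k = f i) = i"
  proof (rule the_equality)
    fix k assume "k < d \<and> f k = f i"
    then show "k = i" using partial_injectionsD(3)[OF assms(1,3), of k] by simp
  qed (use assms in simp)
  then show ?thesis using assms by (auto simp: partial_inverse_def)
qed

lemma partial_inverse_d: "partial_inverse d f d = d"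
  by (simp add: partial_inverse_def)

text \<open>
  The composite of partial maps along a word. In \<open>decode\<close> it is fed with the partial injections of the generators and their
  inverses.
\<close>

definition chain :: "nat \<Rightarrow> (letter \<Rightarrow> nat \<Rightarrow> nat) \<Rightarrow> letter list \<Rightarrow> nat \<Rightarrow> nat" where
  "chain d h w = foldr (\<lambda>a. (\<circ>) (h a)) w (\<lambda>i. min i d)"

lemma chain_simps: "chain d h [] = (\<lambda>i. min i d)" "chain d h (a # w) = h a \<circ> chain d h w"
  by (simp_all add: chain_def)

lemma chain_partial_injections:
  "(\<And>a. a \<in> set w \<Longrightarrow> h a \<in> partial_injections d) \<Longrightarrow> chain d h w \<in> partial_injections d"
  by (induction w) (simp_all add: chain_simps min_partial_injections comp_partial_injections)

lemma card_disagreements_chain: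
  assumes "\<And>a. a \<in> set w \<Longrightarrow> h a \<in> partial_injections d"
    and "\<And>a. a \<in> set w \<Longrightarrow> h' a d = d"
    and "\<And>a. a \<in> set w \<Longrightarrow> real (card (disagreements d (h a) (h' a))) \<le> \<kappa>"
  shows "real (card (disagreements d (chain d h w) (chain d h' w))) \<le> real (length w) * \<kappa>"
  using assms
proof (induction w)
  case (Cons a w)
  let ?D = "disagreements d"
  have "?D (chain d h (a # w)) (chain d h' (a # w))
    \<subseteq> ?D (h a \<circ> chain d h w) (h' a \<circ> chain d h w) \<union> ?D (chain d h w) (chain d h' w)"
    by (auto simp: disagreements_def chain_simps)
  then have "card (?D (chain d h (a # w)) (chain d h' (a # w)))
    \<le> card (?D (h a \<circ> chain d h w) (h' a \<circ> chain d h w) \<union> ?D (chain d h w) (chain d h' w))"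
    by (intro card_mono) (simp_all add: disagreements_def)
  also have "\<dots> \<le> card (?D (h a \<circ> chain d h w) (h' a \<circ> chain d h w)) + card (?D (chain d h w) (chain d h' w))"
    by (rule card_Un_le)
  finally have "real (card (?D (chain d h (a # w)) (chain d h' (a # w))))
    \<le> real (card (?D (h a \<circ> chain d h w) (h' a \<circ> chain d h w))) + real (card (?D (chain d h w) (chain d h' w)))"
    by linarith
  moreover have "card (?D (h a \<circ> chain d h w) (h' a \<circ> chain d h w)) \<le> card (?D (h a) (h' a))"
  proof (rule disagreements_comp)
    show "h a d = d" using partial_injectionsD(2)[OF Cons.prems(1)[of a], of d] by simp
    show "h' a d = d" using Cons.prems(2)[of a] by simp
    show "chain d h w \<in> partial_injections d" by (rule chain_partial_injections) (use Cons.prems(1) in auto)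
  qed
  moreover have "real (card (?D (h a) (h' a))) \<le> \<kappa>" using Cons.prems(3)[of a] by simp
  moreover have "real (card (?D (chain d h w) (chain d h' w))) \<le> real (length w) * \<kappa>"
    by (rule Cons.IH) (use Cons.prems in auto)
  ultimately show ?case by (simp add: algebra_simps)
qed (simp add: chain_simps disagreements_def)

definition signed :: "nat \<Rightarrow> (nat \<Rightarrow> nat \<Rightarrow> nat) \<Rightarrow> letter \<Rightarrow> nat \<Rightarrow> nat" where
  "signed d a l = (if snd l then a (fst l) else partial_inverse d (a (fst l)))"

text \<open>
  The guess for the partial injection of a bisection: \<open>A None\<close> is the set of indices where it should
  be undefined, and on \<open>A (Some w)\<close> it should follow the word \<open>w\<close>. Overlaps are resolved arbitrarily,
  and an index outside all these sets is treated as undefined; few indices are affected.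
\<close>

definition decode :: "nat \<Rightarrow> letter list set \<Rightarrow> (nat \<Rightarrow> nat \<Rightarrow> nat) \<Rightarrow> (letter list option \<Rightarrow> nat set) \<Rightarrow> nat \<Rightarrow> nat" where
  "decode d V a A i = (if i \<in> A None then d
     else if \<exists>w\<in>V. i \<in> A (Some w) then chain d (signed d a) (SOME w. w \<in> V \<and> i \<in> A (Some w)) i else d)"

text \<open>
  There are three sources of error: indices that no set \<open>A\<close> covers, wrong guesses about \<open>f\<close> on the sets \<open>A\<close>, and the discrepancy
  between \<open>h\<close> and the maps \<open>signed d a\<close>, which accumulates once per letter of a word.
\<close>

lemma card_disagreements_decode:
  assumes V: "finite V" "\<And>w. w \<in> V \<Longrightarrow> length w \<le> m"
    and h: "\<And>w l. w \<in> V \<Longrightarrow> l \<in> set w \<Longrightarrow> h l \<in> partial_injections d"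
    and a: "\<And>w l. w \<in> V \<Longrightarrow> l \<in> set w \<Longrightarrow> signed d a l d = d \<and> real (card (disagreements d (h l) (signed d a l))) \<le> \<kappa>"
    and None: "real (card {i. i < d \<and> i \<in> A None \<and> f i \<noteq> d}) \<le> \<kappa>"
    and Some: "\<And>w. w \<in> V \<Longrightarrow> real (card {i. i < d \<and> i \<in> A (Some w) \<and> f i \<noteq> chain d h w i}) \<le> \<kappa>"
    and cover: "real (card {i. i < d \<and> i \<notin> A None \<and> (\<forall>w\<in>V. i \<notin> A (Some w))}) \<le> U"
    and \<kappa>: "0 \<le> \<kappa>"
  shows "real (card (disagreements d f (decode d V a A))) \<le> U + \<kappa> + real (card V) * (real m + 1) * \<kappa>"
proof -
  let ?c = "chain d (signed d a)"
  define X0 where "X0 = {i. i < d \<and> i \<notin> A None \<and> (\<forall>w\<in>V. i \<notin> A (Some w))}"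
  define X1 where "X1 = {i. i < d \<and> i \<in> A None \<and> f i \<noteq> d}"
  define Y where "Y w = {i. i < d \<and> i \<in> A (Some w) \<and> f i \<noteq> chain d h w i} \<union> disagreements d (chain d h w) (?c w)" for w
  have fin: "finite X0" "finite X1" "finite (Y w)" for w
    by (simp_all add: X0_def X1_def Y_def disagreements_def)
  have sub: "disagreements d f (decode d V a A) \<subseteq> X0 \<union> X1 \<union> (\<Union>w\<in>V. Y w)"
  proof
    fix i assume "i \<in> disagreements d f (decode d V a A)"
    then have i: "i < d" "f i \<noteq> decode d V a A i" by (auto simp: disagreements_def)
    show "i \<in> X0 \<union> X1 \<union> (\<Union>w\<in>V. Y w)"
    proof (cases "i \<in> A None")
      case True
      then show ?thesis using i by (simp add: decode_def X1_def)
    next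
      case False
      show ?thesis
      proof (cases "\<exists>w\<in>V. i \<in> A (Some w)")
        case True
        define w where "w = (SOME w. w \<in> V \<and> i \<in> A (Some w))"
        have w: "w \<in> V \<and> i \<in> A (Some w)" unfolding w_def by (rule someI_ex) (use True in blast)
        have "decode d V a A i = ?c w i" using False True by (simp add: decode_def w_def)
        then have "i \<in> Y w" using i w by (auto simp: Y_def disagreements_def)
        then show ?thesis using w by blast
      next
        case False
        then show ?thesis using i \<open>i \<notin> A None\<close> by (simp add: X0_def)
      qed
    qed
  qed
  have Yc: "real (card (Y w)) \<le> (real m + 1) * \<kappa>" if w: "w \<in> V" for w
  proof -
    have "card (Y w) \<le> card {i. i < d \<and> i \<in> A (Some w) \<and> f i \<noteq> chain d h w i} + card (disagreements d (chain d h w) (?c w))"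
      unfolding Y_def by (rule card_Un_le)
    moreover have "real (card (disagreements d (chain d h w) (?c w))) \<le> real (length w) * \<kappa>"
      by (rule card_disagreements_chain) (use h[OF w] a[OF w] in auto)
    moreover have "real (length w) * \<kappa> \<le> real m * \<kappa>" using V(2)[OF w] \<kappa> by (intro mult_right_mono) auto
    ultimately have "real (card (Y w)) \<le> \<kappa> + real m * \<kappa>" using Some[OF w] by linarith
    then show ?thesis by (simp add: algebra_simps)
  qed
  have "card (disagreements d f (decode d V a A)) \<le> card (X0 \<union> X1 \<union> (\<Union>w\<in>V. Y w))"
    using fin V(1) by (intro card_mono sub) auto
  also have "\<dots> \<le> card (X0 \<union> X1) + card (\<Union>w\<in>V. Y w)" by (rule card_Un_le)
  also have "\<dots> \<le> card X0 + card X1 + (\<Sum>w\<in>V. card (Y w))"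
    by (intro add_mono card_Un_le card_UN_le V(1))
  finally have "real (card (disagreements d f (decode d V a A))) \<le> real (card X0 + card X1 + (\<Sum>w\<in>V. card (Y w)))"
    by (rule of_nat_mono)
  also have "\<dots> = real (card X0) + real (card X1) + (\<Sum>w\<in>V. real (card (Y w)))" by simp
  also have "\<dots> \<le> U + \<kappa> + (\<Sum>w\<in>V. (real m + 1) * \<kappa>)"
    using cover None by (intro add_mono sum_mono Yc) (simp_all add: X0_def X1_def)
  finally show ?thesis by (simp add: mult.assoc)
qed

text \<open>The inclusion-exclusion inequality of second order, with every overlap counted twice.\<close>

lemma sum_card_le_card_UN:
  assumes "finite J" "\<And>j. j \<in> J \<Longrightarrow> finite (S j)"
  shows "(\<Sum>j\<in>J. card (S j)) \<le> card (\<Union>j\<in>J. S j) + (\<Sum>j\<in>J. \<Sum>j'\<in>J - {j}. card (S j \<inter> S j'))"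
  using assms
proof (induction J rule: finite_induct)
  case (insert k J)
  let ?o = "\<lambda>J. \<Sum>j\<in>J. \<Sum>j'\<in>J - {j}. card (S j \<inter> S j')"
  have fJ: "finite (\<Union>j\<in>J. S j)" "finite (S k)" using insert by auto
  have IH: "(\<Sum>j\<in>J. card (S j)) \<le> card (\<Union>j\<in>J. S j) + ?o J" using insert.IH insert.prems by simp
  have "card (S k) + card (\<Union>j\<in>J. S j) = card (S k \<union> (\<Union>j\<in>J. S j)) + card (S k \<inter> (\<Union>j\<in>J. S j))"
    by (rule card_Un_Int[OF fJ(2,1)])
  moreover have "card (S k \<inter> (\<Union>j\<in>J. S j)) \<le> (\<Sum>j\<in>J. card (S k \<inter> S j))"
  proof -
    have "S k \<inter> (\<Union>j\<in>J. S j) = (\<Union>j\<in>J. S k \<inter> S j)" by blast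
    then show ?thesis using card_UN_le[OF insert.hyps(1), of "\<lambda>j. S k \<inter> S j"] by simp
  qed
  moreover have "(\<Sum>j\<in>J. card (S k \<inter> S j)) + ?o J \<le> ?o (insert k J)"
  proof -
    have "insert k J - {k} = J" using insert.hyps by auto
    moreover have "?o J \<le> (\<Sum>j\<in>J. \<Sum>j'\<in>insert k J - {j}. card (S j \<inter> S j'))"
      using insert.hyps by (intro sum_mono sum_mono2) auto
    ultimately show ?thesis using insert.hyps by simp
  qed
  ultimately show ?case using IH insert.hyps by simp
qed simp

lemma finite_partial_injections: "finite (partial_injections d)" and
  card_partial_injections_le: "card (partial_injections d) \<le> (d + 1) ^ d"
proof -
  have inj: "inj_on (\<lambda>f. restrict f {..<d}) (partial_injections d)"
  proof (rule inj_onI)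
    fix f g assume fg: "f \<in> partial_injections d" "g \<in> partial_injections d"
      and eq: "restrict f {..<d} = restrict g {..<d}"
    show "f = g"
    proof
      fix i show "f i = g i"
      proof (cases "i < d")
        case True then show ?thesis using fun_cong[OF eq, of i] by simp
      next
        case False then show ?thesis
          using partial_injectionsD(2)[OF fg(1), of i] partial_injectionsD(2)[OF fg(2), of i] by simp
      qed
    qed
  qed
  have img: "(\<lambda>f. restrict f {..<d}) ` partial_injections d \<subseteq> {..<d} \<rightarrow>\<^sub>E {..d}"
  proof (rule image_subsetI)
    fix f assume "f \<in> partial_injections d"
    from partial_injectionsD(1)[OF this] show "restrict f {..<d} \<in> {..<d} \<rightarrow>\<^sub>E {..d}" by simp
  qed
  have fin: "finite ({..<d} \<rightarrow>\<^sub>E {..d})" by (simp add: finite_PiE)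
  show "finite (partial_injections d)" by (rule inj_on_finite[OF inj img fin])
  have "card (partial_injections d) \<le> card ({..<d} \<rightarrow>\<^sub>E {..d})" by (rule card_inj_on_le[OF inj img fin])
  then show "card (partial_injections d) \<le> (d + 1) ^ d" by (simp add: card_PiE)
qed

text \<open>A member is recovered from its disagreement set and its values there.\<close>

lemma card_hamming_ball_le:
  "card {f \<in> partial_injections d. card (disagreements d f h) \<le> b} \<le> 2 ^ d * (d + 1) ^ b"
proof -
  let ?B = "{f \<in> partial_injections d. card (disagreements d f h) \<le> b}"
  let ?Z = "{Z \<in> Pow {..<d}. card Z \<le> b}"
  let ?S = "SIGMA Z:?Z. Z \<rightarrow>\<^sub>E {..d}"
  define enc where "enc f = (disagreements d f h, restrict f (disagreements d f h))" for f
  have fZ: "finite ?Z" by simp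
  have finZ: "finite Z" if "Z \<in> ?Z" for Z using that finite_subset by auto
  have "inj_on enc ?B"
  proof (rule inj_onI)
    fix f g assume fg: "f \<in> ?B" "g \<in> ?B" and eq: "enc f = enc g"
    have D: "disagreements d f h = disagreements d g h" and
      r: "restrict f (disagreements d f h) = restrict g (disagreements d f h)"
      using eq by (auto simp: enc_def)
    show "f = g"
    proof
      fix i
      have fg': "f \<in> partial_injections d" "g \<in> partial_injections d" using fg by auto
      consider "i \<ge> d" | "i \<in> disagreements d f h" | "i < d" "i \<notin> disagreements d f h"
        by (cases "i < d") auto
      then show "f i = g i"
      proof cases
        case 1 then show ?thesis using partial_injectionsD(2)[OF fg'(1)] partial_injectionsD(2)[OF fg'(2)] by simp
      next
        case 2 then show ?thesis using fun_cong[OF r, of i] by simp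
      next
        case 3
        then have "f i = h i" by (simp add: disagreements_def)
        moreover have "g i = h i" using 3 unfolding D by (simp add: disagreements_def)
        ultimately show ?thesis by simp
      qed
    qed
  qed
  moreover have "enc ` ?B \<subseteq> ?S"
  proof
    fix p assume "p \<in> enc ` ?B"
    then obtain f where f: "f \<in> partial_injections d" "card (disagreements d f h) \<le> b" "p = enc f" by blast
    have "restrict f (disagreements d f h) \<in> disagreements d f h \<rightarrow>\<^sub>E {..d}"
      using partial_injectionsD(1)[OF f(1)] by simp
    moreover have "disagreements d f h \<in> ?Z" using f(2) by (auto simp: disagreements_def)
    ultimately show "p \<in> ?S" using f(3) by (simp add: enc_def)
  qed
  moreover have "finite ?S"
    by (rule finite_SigmaI[OF fZ]) (use finZ in \<open>blast intro: finite_PiE finite_atMost\<close>)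
  ultimately have "card ?B \<le> card ?S" by (rule card_inj_on_le)
  also have "\<dots> = (\<Sum>Z\<in>?Z. card (Z \<rightarrow>\<^sub>E {..d}))"
    by (rule card_SigmaI[OF fZ]) (use finZ in \<open>blast intro: finite_PiE finite_atMost\<close>)
  also have "\<dots> = (\<Sum>Z\<in>?Z. (d + 1) ^ card Z)"
  proof (rule sum.cong[OF refl])
    fix Z assume "Z \<in> ?Z"
    then have "finite Z" by (rule finZ)
    then show "card (Z \<rightarrow>\<^sub>E {..d}) = (d + 1) ^ card Z" by (simp add: card_PiE)
  qed
  also have "\<dots> \<le> (\<Sum>Z\<in>?Z. (d + 1) ^ b)" by (intro sum_mono power_increasing) auto
  also have "\<dots> = card ?Z * (d + 1) ^ b" by simp
  also have "\<dots> \<le> card (Pow {..<d}) * (d + 1) ^ b" by (intro mult_right_mono card_mono) auto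
  finally show ?thesis by (simp add: card_Pow)
qed

context free_pmp_action
begin

lemma bmult_unit: "bisection B \<Longrightarrow> bmult B (slab [] (space M)) = B"
proof (intro Set.set_eqI)
  fix p :: "letter list \<times> 'x" assume B: "bisection B"
  obtain g x where p: "p = (g, x)" by (cases p)
  have U: "bisection (slab [] (space M))" using bisection_slab[OF one_closed sets.top] by (simp add: one_eq)
  show "p \<in> bmult B (slab [] (space M)) \<longleftrightarrow> p \<in> B"
  proof
    assume "p \<in> bmult B (slab [] (space M))"
    then obtain h where h: "(h, \<alpha> [] x) \<in> B" "g = foldr push h []" "x \<in> space M"
      unfolding p bmult_iff[OF B U] by (auto simp: slab_def mult_eq)
    have "\<alpha> [] x = x" using act_one[OF h(3)] by (simp add: one_eq)
    moreover have "reduced h" using bisectionD(4)[OF B h(1)] by (simp add: free_group_def)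
    ultimately show "p \<in> B" using h p by (simp add: foldr_push_Nil)
  next
    assume "p \<in> B"
    then have B': "(g, x) \<in> B" by (simp add: p)
    then have x: "x \<in> space M" "reduced g" using bisectionD(4,5)[OF B B'] by (auto simp: free_group_def)
    have "\<alpha> [] x = x" using act_one[OF x(1)] by (simp add: one_eq)
    then show "p \<in> bmult B (slab [] (space M))"
      unfolding p bmult_iff[OF B U] using B' x by (auto simp: slab_def mult_eq foldr_push_Nil intro!: exI[of _ g])
  qed
qed

lemma bprod_one: "bisection B \<Longrightarrow> bprod [B] = B"
  using bmult_unit by (simp add: bprod_simps one_eq)

lemma bprod_two: "bisection B \<Longrightarrow> bisection C \<Longrightarrow> bprod [B, C] = bmult B C"
  using bprod_one by (simp add: bprod_simps)

lemma bisection_slab_W: "w \<in> W m \<Longrightarrow> A \<in> sets M \<Longrightarrow> bisection (slab w A)"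
  by (intro bisection_slab W_carrier)

lemma bmult_slab:
  assumes "v \<in> carrier (free_group r)" "w \<in> carrier (free_group r)" "A \<in> sets M"
  shows "bmult (slab v (space M)) (slab w A) = slab (foldr push v w) A"
proof (rule Set.set_eqI)
  fix p :: "letter list \<times> 'x"
  obtain g x where p: "p = (g, x)" by (cases p)
  have b: "bisection (slab v (space M))" "bisection (slab w A)" using assms by (auto intro: bisection_slab)
  have "\<alpha> w x \<in> space M" if "x \<in> A" using that sets.sets_into_space[OF assms(3)] act_space[OF assms(2)] by blast
  then show "p \<in> bmult (slab v (space M)) (slab w A) \<longleftrightarrow> p \<in> slab (foldr push v w) A"
    unfolding p bmult_iff[OF b] by (auto simp: slab_def mult_eq)
qed

text \<open>
  The graph of a word of length at most \<open>m\<close> over a set is a product of at most \<open>m + 1\<close> operators from \<open>F\<close>, so approximate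
  multiplicativity applies to it.
\<close>

lemma bprod_word:
  assumes "w \<in> W m" "A \<in> sets M"
  shows "bprod (map (\<lambda>a. slab [a] (space M)) w @ [slab [] A]) = slab w A"
  using assms(1)
proof (induction w)
  case Nil
  then show ?case using bprod_one[OF bisection_slab_W[OF Nil_short_words assms(2)]] by simp
next
  case (Cons a w)
  note w = short_words_ConsD[OF Cons.prems]
  have "bprod (map (\<lambda>a. slab [a] (space M)) (a # w) @ [slab [] A]) = bmult (slab [a] (space M)) (slab w A)"
    using Cons.IH w by (simp add: bprod_simps)
  also have "\<dots> = slab (foldr push [a] w) A"
    using w by (intro bmult_slab letter_carrier W_carrier assms(2)) auto
  finally show ?case using w by simp
qed

definition partial_map :: "nat \<Rightarrow> ((letter list \<times> 'x) oper \<Rightarrow> complex mat) \<Rightarrow> (letter list \<times> 'x) set \<Rightarrow> nat \<Rightarrow> nat" where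
  "partial_map d \<phi> B = (SOME f. f \<in> partial_injections d \<and> \<phi> (bis_op \<G> B) = pmat d f)"

text \<open>
  The three conditions defining \<open>SA\<close>, restated for partial injections: norms become numbers of disagreements,
  and traces become numbers of fixed points.
\<close>

lemma SA_product:
  fixes Cs :: "(letter list \<times> 'x) set list"
  assumes \<phi>: "\<phi> \<in> SA \<G> F n \<delta> d" and \<delta>: "0 < \<delta>" and d: "0 < d"
    and Cs: "\<And>C. C \<in> set Cs \<Longrightarrow> bisection C \<and> bis_op \<G> C \<in> F" "1 \<le> length Cs" "length Cs \<le> n"
  defines "g \<equiv> partial_map d \<phi>"
  shows "g (bprod Cs) \<in> partial_injections d" "\<phi> (bis_op \<G> (bprod Cs)) = pmat d (g (bprod Cs))"
    "real (card (disagreements d (g (bprod Cs)) (foldr (\<lambda>C. (\<circ>) (g C)) Cs (\<lambda>i. min i d)))) \<le> real d * \<delta>\<^sup>2"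
    "\<bar>real (card {i. i < d \<and> g (bprod Cs) i = i}) - real d * measure M (section_at (bprod Cs) [])\<bar> \<le> real d * \<delta>"
proof -
  let ?F = "F \<union> adjoint_set N F"
  have SA: "\<And>ss. set ss \<subseteq> ?F \<Longrightarrow> 1 \<le> length ss \<Longrightarrow> length ss \<le> n \<Longrightarrow>
      hs_norm (\<phi> (op_prod N ss) - mat_prod d (map \<phi> ss)) < \<delta>"
    "\<phi> ` powers_le N ?F n \<subseteq> partial_perm_mats d"
    "\<And>s. s \<in> powers_le N ?F n \<Longrightarrow> cmod (ntrace (\<phi> s) - vn_trace \<G> s) < \<delta>"
    using \<phi> unfolding SA_def Let_def by blast+
  have pw: "bis_op \<G> (bprod Ds) \<in> powers_le N ?F n"
    if Ds: "\<And>C. C \<in> set Ds \<Longrightarrow> bisection C \<and> bis_op \<G> C \<in> F" "1 \<le> length Ds" "length Ds \<le> n" for Ds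
  proof -
    have "op_prod N (map (bis_op \<G>) Ds) = bis_op \<G> (bprod Ds)" using Ds(1) by (intro op_prod_bis_op) blast
    moreover have "set (map (bis_op \<G>) Ds) \<subseteq> ?F" using Ds(1) by auto
    ultimately have "bis_op \<G> (bprod Ds) \<in> powers N ?F (length Ds)"
      unfolding powers_def by (intro CollectI exI[of _ "map (bis_op \<G>) Ds"]) simp
    then show ?thesis unfolding powers_le_def using Ds(2,3) by (intro UN_I[of "length Ds"]) auto
  qed
  have gPI: "g (bprod Ds) \<in> partial_injections d \<and> \<phi> (bis_op \<G> (bprod Ds)) = pmat d (g (bprod Ds))"
    if Ds: "\<And>C. C \<in> set Ds \<Longrightarrow> bisection C \<and> bis_op \<G> C \<in> F" "1 \<le> length Ds" "length Ds \<le> n" for Ds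
  proof -
    have "\<phi> (bis_op \<G> (bprod Ds)) \<in> partial_perm_mats d" using pw[OF Ds] SA(2) by blast
    then have "\<exists>f. f \<in> partial_injections d \<and> \<phi> (bis_op \<G> (bprod Ds)) = pmat d f"
      by (auto simp: partial_perm_mats_eq)
    then show ?thesis unfolding g_def partial_map_def by (rule someI_ex)
  qed
  show 1: "g (bprod Cs) \<in> partial_injections d" and 2: "\<phi> (bis_op \<G> (bprod Cs)) = pmat d (g (bprod Cs))"
    using gPI[OF Cs] by blast+
  have gC: "g C \<in> partial_injections d \<and> \<phi> (bis_op \<G> C) = pmat d (g C)" if C: "C \<in> set Cs" for C
  proof -
    have "bprod [C] = C" by (rule bprod_one) (use Cs(1)[OF C] in blast)
    then show ?thesis using gPI[of "[C]"] Cs(1)[OF C] Cs(2,3) by simp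
  qed
  let ?f = "foldr (\<lambda>C. (\<circ>) (g C)) Cs (\<lambda>i. min i d)"
  have mp: "map \<phi> (map (bis_op \<G>) Cs) = map (\<lambda>C. pmat d (g C)) Cs" using gC by simp
  have "\<forall>C\<in>set Cs. g C \<in> partial_injections d" using gC by blast
  from mat_prod_pmat[OF this] have m: "mat_prod d (map (\<lambda>C. pmat d (g C)) Cs) = pmat d ?f" "?f \<in> partial_injections d"
    by blast+
  have op: "op_prod N (map (bis_op \<G>) Cs) = bis_op \<G> (bprod Cs)" using Cs(1) by (intro op_prod_bis_op) blast
  have "hs_norm (\<phi> (op_prod N (map (bis_op \<G>) Cs)) - mat_prod d (map \<phi> (map (bis_op \<G>) Cs))) < \<delta>"
    by (rule SA(1)) (use Cs in auto)
  then have hs: "hs_norm (pmat d (g (bprod Cs)) - pmat d ?f) < \<delta>" unfolding op mp m(1) 2 .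
  have nn: "0 \<le> hs_norm (pmat d (g (bprod Cs)) - pmat d ?f)"
    by (rule hs_norm_nonneg[where d = d]) (rule minus_carrier_mat, simp)
  have "(hs_norm (pmat d (g (bprod Cs)) - pmat d ?f))\<^sup>2 \<le> \<delta>\<^sup>2"
    by (rule power_mono[OF less_imp_le[OF hs] nn])
  then have "real d * (hs_norm (pmat d (g (bprod Cs)) - pmat d ?f))\<^sup>2 \<le> real d * \<delta>\<^sup>2"
    by (rule mult_left_mono) simp
  with hs_norm_pmat_diff(1)[OF partial_injectionsD(1)[OF 1] partial_injectionsD(1)[OF m(2)] d]
  show "real (card (disagreements d (g (bprod Cs)) ?f)) \<le> real d * \<delta>\<^sup>2" by (rule order_trans)
  have bP: "bisection (bprod Cs)" using Cs(1) by (intro bisection_bprod) blast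
  let ?t = "real (card {i. i < d \<and> g (bprod Cs) i = i}) / real d - measure M (section_at (bprod Cs) [])"
  have "ntrace (\<phi> (bis_op \<G> (bprod Cs))) - vn_trace \<G> (bis_op \<G> (bprod Cs)) = of_real ?t"
    unfolding 2 ntrace_pmat vn_trace_bis_op[OF bP] by (simp add: one_eq)
  then have "\<bar>?t\<bar> < \<delta>" using SA(3)[OF pw[OF Cs]] by (simp only: norm_of_real)
  then have "real d * \<bar>?t\<bar> \<le> real d * \<delta>" by (intro mult_left_mono) auto
  moreover have "real d * \<bar>?t\<bar> = \<bar>real d * ?t\<bar>" by (simp add: abs_mult)
  moreover have "real d * ?t = real (card {i. i < d \<and> g (bprod Cs) i = i}) - real d * measure M (section_at (bprod Cs) [])"
    using d by (simp add: field_simps)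
  ultimately show "\<bar>real (card {i. i < d \<and> g (bprod Cs) i = i}) - real d * measure M (section_at (bprod Cs) [])\<bar>
    \<le> real d * \<delta>" by simp
qed

end

lemma pmat_empty: "pmat d (\<lambda>i. d) = 0\<^sub>m d d" "(\<lambda>i. d) \<in> partial_injections d"
  by (rule eq_matI) (auto simp: pmat_def intro: partial_injectionsI)

lemma foldr_comp_cong:
  "f i = f' i \<Longrightarrow> foldr (\<lambda>a. (\<circ>) (h a)) w f i = foldr (\<lambda>a. (\<circ>) (h a)) w f' i"
  by (induction w) simp_all

context free_pmp_action
begin

lemma section_at_slab: "A \<in> sets M \<Longrightarrow> section_at (slab g A) g = A"
  using sets.sets_into_space by (auto simp: section_at_def slab_def)

text \<open>The part of \<open>X\<close> on which \<open>B\<close> acts by a given word; \<open>None\<close> stands for the part on which \<open>B\<close> is undefined.\<close>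

definition piece :: "(letter list \<times> 'x) set \<Rightarrow> letter list option \<Rightarrow> 'x set" where
  "piece B j = (case j of Some w \<Rightarrow> section_at B w
     | None \<Rightarrow> space M - (\<Union>g\<in>carrier (free_group r). section_at B g))"

lemma piece_sets:
  assumes B: "bisection B" and j: "j \<in> insert None (Some ` W m)"
  shows "piece B j \<in> sets M"
proof (cases j)
  case None
  have "(\<Union>g\<in>carrier (free_group r). section_at B g) \<in> sets M"
    by (rule sets.countable_UN'[OF countable_carrier])
       (rule image_subsetI, rule section_at_sets[OF bisectionD(1)[OF B]])
  then show ?thesis using None by (simp add: piece_def)
next
  case (Some w)
  then have "w \<in> W m" using j by auto
  then show ?thesis using Some section_at_sets[OF bisectionD(1)[OF B] W_carrier] by (simp add: piece_def)
qed

lemma piece_disjoint: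
  assumes B: "bisection B" and j: "j \<in> insert None (Some ` W m)" "j' \<in> insert None (Some ` W m)" "j \<noteq> j'"
  shows "piece B j \<inter> piece B j' = {}"
proof -
  have *: "piece B None \<inter> piece B (Some w) = {}" if "Some w \<in> insert None (Some ` W m)" for w
    using that W_carrier[of w m] by (auto simp: piece_def)
  have **: "piece B (Some v) \<inter> piece B (Some w) = {}" if "v \<noteq> w" for v w
    using that bisectionD(2)[OF B] unfolding piece_def section_at_def option.case by blast
  show ?thesis
  proof (cases j; cases j')
    fix w assume "j = None" "j' = Some w" then show ?thesis using * j by simp
  next
    fix w assume "j = Some w" "j' = None" then show ?thesis using * j by (simp add: Int_commute)
  next
    fix v w assume "j = Some v" "j' = Some w" then show ?thesis using ** j by simp
  qed (use j in simp)
qed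

lemma bmult_piece_None: "bisection B \<Longrightarrow> bmult B (slab [] (piece B None)) = {}"
proof -
  assume B: "bisection B"
  have P: "bisection (slab [] (piece B None))"
    by (rule bisection_slab_W[OF Nil_short_words piece_sets[OF B]]) simp
  have "(g, x) \<notin> bmult B (slab [] (piece B None))" for g x
  proof
    assume "(g, x) \<in> bmult B (slab [] (piece B None))"
    then obtain h where h: "(h, \<alpha> [] x) \<in> B" "x \<in> piece B None"
      unfolding bmult_iff[OF B P] by (auto simp: slab_def)
    have x: "x \<in> space M" using h(2) by (simp add: piece_def)
    have "(h, x) \<in> B" using h(1) act_one[OF x] by (simp add: one_eq)
    then have "x \<in> section_at B h" "h \<in> carrier (free_group r)" using x bisectionD(4)[OF B] by (auto simp: section_at_def)
    then show False using h(2) by (auto simp: piece_def)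
  qed
  then show ?thesis by auto
qed

lemma bmult_piece_Some:
  assumes B: "bisection B" and w: "w \<in> W m"
  shows "bmult B (slab [] (piece B (Some w))) = slab w (piece B (Some w))"
proof (rule Set.set_eqI)
  fix p :: "letter list \<times> 'x"
  obtain g x where p: "p = (g, x)" by (cases p)
  have P: "bisection (slab [] (piece B (Some w)))"
    by (rule bisection_slab_W[OF Nil_short_words piece_sets[OF B]]) (use w in blast)
  have mem: "(g, x) \<in> bmult B (slab [] (piece B (Some w))) \<longleftrightarrow>
      x \<in> piece B (Some w) \<and> (\<exists>h. (h, \<alpha> [] x) \<in> B \<and> g = foldr push h [])"
    unfolding bmult_iff[OF B P] by (auto simp: slab_def mult_eq)
  show "p \<in> bmult B (slab [] (piece B (Some w))) \<longleftrightarrow> p \<in> slab w (piece B (Some w))"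
  proof (cases "x \<in> piece B (Some w)")
    case True
    then have x: "x \<in> space M" "(w, x) \<in> B" by (auto simp: piece_def section_at_def)
    have a: "\<alpha> [] x = x" using act_one[OF x(1)] by (simp add: one_eq)
    have "foldr push h [] = h" if "(h, x) \<in> B" for h
      using bisectionD(4)[OF B that] by (simp add: foldr_push_Nil free_group_def)
    then have "(\<exists>h. (h, \<alpha> [] x) \<in> B \<and> g = foldr push h []) \<longleftrightarrow> g = w"
      unfolding a using x(2) bisectionD(2)[OF B _ x(2)] by metis
    then show ?thesis unfolding p mem using True by (simp add: slab_def)
  next
    case False
    then show ?thesis unfolding p mem by (simp add: slab_def)
  qed
qed

lemma bmult_disjoint:
  assumes A: "A \<in> sets M" "A' \<in> sets M" "A \<inter> A' = {}"
  shows "bmult (slab [] A) (slab [] A') = {}"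
proof -
  have b: "bisection (slab [] A)" "bisection (slab [] A')"
    using bisection_slab_W[OF Nil_short_words] A by blast+
  have "(g, x) \<notin> bmult (slab [] A) (slab [] A')" for g x
  proof
    assume "(g, x) \<in> bmult (slab [] A) (slab [] A')"
    then have "x \<in> A'" "\<alpha> [] x \<in> A" unfolding bmult_iff[OF b] by (auto simp: slab_def)
    moreover have "x \<in> space M" using calculation(1) A(2) sets.sets_into_space by blast
    ultimately show False using act_one[of x] A(3) by (auto simp: one_eq)
  qed
  then show ?thesis by auto
qed

text \<open>What the pieces of short words leave uncovered lies in the tail.\<close>

lemma measure_pieces:
  assumes B: "bisection B" "B \<in> \<B>" and tail: "tail \<B> m \<in> sets M"
  shows "1 \<le> (\<Sum>j\<in>insert None (Some ` W m). measure M (piece B j)) + measure M (tail \<B> m)"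
proof -
  let ?J = "insert None (Some ` W m)"
  have fJ: "finite ?J" using finite_short_words by simp
  have ps: "piece B ` ?J \<subseteq> sets M" by (rule image_subsetI) (rule piece_sets[OF B(1)])
  have U: "(\<Union>j\<in>?J. piece B j) \<in> sets M" by (rule sets.finite_UN[OF fJ piece_sets[OF B(1)]])
  have sub: "space M - (\<Union>j\<in>?J. piece B j) \<subseteq> tail \<B> m"
  proof
    fix x assume x: "x \<in> space M - (\<Union>j\<in>?J. piece B j)"
    then have "x \<notin> piece B None" by blast
    then obtain g where g: "(g, x) \<in> B" using x by (auto simp: piece_def section_at_def)
    have "g \<notin> W m"
    proof
      assume "g \<in> W m"
      then have "x \<in> piece B (Some g)" "Some g \<in> ?J" using g x by (auto simp: piece_def section_at_def)
      then show False using x by blast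
    qed
    then show "x \<in> tail \<B> m" using g x B(2) unfolding tail_def by blast
  qed
  have "measure M (\<Union>j\<in>?J. piece B j) + measure M (space M - (\<Union>j\<in>?J. piece B j)) = 1"
    using prob_compl[OF U] by simp
  moreover have "measure M (\<Union>j\<in>?J. piece B j) \<le> (\<Sum>j\<in>?J. measure M (piece B j))"
    by (rule finite_measure_subadditive_finite[OF fJ ps])
  moreover have "measure M (space M - (\<Union>j\<in>?J. piece B j)) \<le> measure M (tail \<B> m)"
    by (rule finite_measure_mono[OF sub tail])
  ultimately show ?thesis by linarith
qed

text \<open>
  On the piece of a word \<open>w\<close> the bisection \<open>B\<close> agrees with \<open>w\<close>. So the image of \<open>B\<close> times the projection onto the piece nearly equals both
  the image of \<open>B\<close> and the composite of the generators along \<open>w\<close> on the indices fixed by the projection. The trace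
  condition gives the sizes of these fixed point sets, and disjoint pieces have almost disjoint fixed point sets, so that they cover
  nearly all indices. Replacing the images of inverse letters by inverses of the images of letters is a further
  error that the trace of the identity controls.
\<close>

lemma decode_bisection:
  fixes \<phi> :: "(letter list \<times> 'x) oper \<Rightarrow> complex mat" and d :: nat
  defines "g \<equiv> partial_map d \<phi>"
  defines "Fix \<equiv> \<lambda>B j. {i. i < d \<and> g (slab [] (piece B j)) i = i}"
  assumes \<phi>: "\<phi> \<in> SA \<G> F (m + 2) \<delta> d" and \<delta>: "0 < \<delta>" "\<delta> \<le> 1" and d: "0 < d"
    and B: "bisection B" "bis_op \<G> B \<in> F"
    and letters: "\<And>l. fst l < r \<Longrightarrow> bis_op \<G> (slab [l] (space M)) \<in> F"
    and pieces: "\<And>j. j \<in> insert None (Some ` W m) \<Longrightarrow> bis_op \<G> (slab [] (piece B j)) \<in> F"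
    and a: "\<And>k. k < r \<Longrightarrow> a k = g (slab [(k, True)] (space M))"
    and A: "\<And>j. j \<in> insert None (Some ` W m) \<Longrightarrow> A j = Fix B j"
    and \<epsilon>: "1 - \<epsilon> \<le> (\<Sum>j\<in>insert None (Some ` W m). measure M (piece B j))"
  shows "real (card (disagreements d (g B) (decode d (W m) a A)))
    \<le> real d * (\<epsilon> + \<delta> * (2 * (real (card (W m)) + 1)\<^sup>2 + 2 + 2 * real (card (W m)) * (real m + 1)))"
proof -
  let ?J = "insert None (Some ` W m)" and ?u = "\<lambda>l. slab [l] (space M)" and ?P = "\<lambda>j. slab [] (piece B j)"
  define h where "h l = g (?u l)" for l
  define \<kappa> where "\<kappa> = 2 * \<delta> * real d"
  have dsq: "real d * \<delta>\<^sup>2 \<le> real d * \<delta>"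
    using \<delta> by (intro mult_left_mono) (simp_all add: power2_eq_square mult_left_le)
  have bP: "bisection (?P j)" if "j \<in> ?J" for j
    by (rule bisection_slab_W[OF Nil_short_words piece_sets[OF B(1) that]])
  have bu: "bisection (?u l)" if "fst l < r" for l
    by (rule bisection_slab[OF letter_carrier[OF that] sets.top])
  note prod = SA_product[OF \<phi> \<delta>(1) d, folded g_def]
  have one: "g C \<in> partial_injections d \<and> \<phi> (bis_op \<G> C) = pmat d (g C)"
    if "bisection C" "bis_op \<G> C \<in> F" for C
    using prod(1,2)[of "[C]"] that bprod_one[OF that(1)] by simp
  have two: "real (card (disagreements d (g (bmult C C')) (g C \<circ> (g C' \<circ> (\<lambda>i. min i d))))) \<le> real d * \<delta>"
      "g (bmult C C') \<in> partial_injections d" "\<phi> (bis_op \<G> (bmult C C')) = pmat d (g (bmult C C'))"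
    if "bisection C" "bis_op \<G> C \<in> F" "bisection C'" "bis_op \<G> C' \<in> F" for C C'
  proof -
    have eq: "bprod [C, C'] = bmult C C'" by (rule bprod_two[OF that(1,3)])
    have all: "\<And>D. D \<in> set [C, C'] \<Longrightarrow> bisection D \<and> bis_op \<G> D \<in> F" using that by auto
    show "g (bmult C C') \<in> partial_injections d" "\<phi> (bis_op \<G> (bmult C C')) = pmat d (g (bmult C C'))"
      using prod(1,2)[of "[C, C']", OF all] eq by simp_all
    show "real (card (disagreements d (g (bmult C C')) (g C \<circ> (g C' \<circ> (\<lambda>i. min i d))))) \<le> real d * \<delta>"
      using prod(3)[of "[C, C']", OF all] eq dsq by simp
  qed
  have tr: "\<bar>real (card {i. i < d \<and> g (slab [] S) i = i}) - real d * measure M S\<bar> \<le> real d * \<delta>"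
    if "S \<in> sets M" "bprod Cs = slab [] S" "\<And>C. C \<in> set Cs \<Longrightarrow> bisection C \<and> bis_op \<G> C \<in> F"
      "1 \<le> length Cs" "length Cs \<le> m + 2" for S Cs
    using prod(4)[OF that(3,4,5)] that(2) section_at_slab[OF that(1)] by simp
  have zero: "g {} = (\<lambda>i. d)"
    if "g {} \<in> partial_injections d" "\<phi> (bis_op \<G> {}) = pmat d (g {})"
  proof (rule pmat_eqD[OF that(1) pmat_empty(2)])
    have "\<phi> \<in> linear_maps \<G> d" using \<phi> by (simp add: SA_def)
    then show "pmat d (g {}) = pmat d (\<lambda>i. d)" using linear_maps_zero that(2) by (simp add: pmat_empty)
  qed
  have hPI: "h l \<in> partial_injections d" if "fst l < r" for l
    using one[OF bu[OF that] letters[OF that]] by (simp add: h_def)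
  have Wl: "fst l < r" if "w \<in> W m" "l \<in> set w" for w l
    using that by (auto simp: short_words_def)
  have inverse: "signed d a l d = d \<and> real (card (disagreements d (h l) (signed d a l))) \<le> \<kappa>" if l: "fst l < r" for l
  proof (cases "snd l")
    case True
    then have "l = (fst l, True)" by (cases l) auto
    then have "signed d a l = h l" using a[OF l] True by (simp add: signed_def h_def)
    moreover have "h l d = d" using partial_injectionsD(2)[OF hPI[OF l], of d] by simp
    moreover have "0 \<le> \<kappa>" using \<delta> by (simp add: \<kappa>_def)
    ultimately show ?thesis by (simp add: disagreements_def)
  next
    case False
    define k where "k = fst l"
    have lk: "l = (k, False)" using False by (cases l) (auto simp: k_def)
    have k: "k < r" using l by (simp add: k_def)
    let ?f = "h (k, True)"
    have fPI: "?f \<in> partial_injections d" by (rule hPI) (simp add: k)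
    have s: "signed d a l = partial_inverse d ?f" using a[OF k] by (simp add: signed_def lk h_def)
    let ?I = "slab [] (space M)"
    have bm: "bmult (?u (k, True)) (?u l) = ?I"
      using bmult_slab[OF letter_carrier letter_carrier sets.top, of "(k, True)" l] k l by (simp add: lk flip_def)
    let ?D = "disagreements d (g ?I) (?f \<circ> (h l \<circ> (\<lambda>i. min i d)))"
    have D: "real (card ?D) \<le> real d * \<delta>"
      using two(1)[OF bu letters bu letters, of "(k, True)" l] k l bm by (simp add: h_def)
    have "bprod [?u (k, True), ?u l] = ?I" using bprod_two[OF bu bu, of "(k, True)" l] bm k l by simp
    then have "\<bar>real (card {i. i < d \<and> g ?I i = i}) - real d * measure M (space M)\<bar> \<le> real d * \<delta>"
      by (rule tr[OF sets.top])
        (use bu[of "(k, True)"] bu[OF l] letters[of "(k, True)"] letters[OF l] k in auto)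
    then have fixed: "real d - real d * \<delta> \<le> real (card {i. i < d \<and> g ?I i = i})" using prob_space by simp
    have un: "{..<d} = {i. i < d \<and> g ?I i = i} \<union> {i. i < d \<and> g ?I i \<noteq> i}" by blast
    have "card {..<d} = card {i. i < d \<and> g ?I i = i} + card {i. i < d \<and> g ?I i \<noteq> i}"
      unfolding un by (rule card_Un_disjoint) auto
    then have nf: "real (card {i. i < d \<and> g ?I i \<noteq> i}) \<le> real d * \<delta>" using fixed by simp
    have "disagreements d (h l) (partial_inverse d ?f) \<subseteq> ?D \<union> {i. i < d \<and> g ?I i \<noteq> i}"
    proof
      fix i assume i: "i \<in> disagreements d (h l) (partial_inverse d ?f)"
      then have id: "i < d" "h l i \<noteq> partial_inverse d ?f i" by (auto simp: disagreements_def)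
      show "i \<in> ?D \<union> {i. i < d \<and> g ?I i \<noteq> i}"
      proof (rule ccontr)
        assume "i \<notin> ?D \<union> {i. i < d \<and> g ?I i \<noteq> i}"
        then have e: "?f (h l i) = i" using id(1) by (simp add: disagreements_def)
        have "h l i < d"
        proof (rule ccontr)
          assume "\<not> h l i < d"
          then have "?f (h l i) = d" using partial_injectionsD(2)[OF fPI] by simp
          then show False using e id(1) by simp
        qed
        then have "partial_inverse d ?f (?f (h l i)) = h l i" using e id(1) by (intro partial_inverse_eq[OF fPI]) simp_all
        then show False using e id(2) by simp
      qed
    qed
    then have "card (disagreements d (h l) (partial_inverse d ?f)) \<le> card (?D \<union> {i. i < d \<and> g ?I i \<noteq> i})"
      by (intro card_mono) (simp_all add: disagreements_def)
    also have "\<dots> \<le> card ?D + card {i. i < d \<and> g ?I i \<noteq> i}" by (rule card_Un_le)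
    finally have "real (card (disagreements d (h l) (partial_inverse d ?f))) \<le> real d * \<delta> + real d * \<delta>"
      using D nf by linarith
    then show ?thesis unfolding s by (simp add: partial_inverse_d \<kappa>_def algebra_simps)
  qed
  have none: "real (card {i. i < d \<and> i \<in> A None \<and> g B i \<noteq> d}) \<le> \<kappa>"
  proof -
    have N: "None \<in> ?J" by simp
    note t = two[OF B bP[OF N] pieces[OF N]]
    have e: "bmult B (?P None) = {}" by (rule bmult_piece_None[OF B(1)])
    have z: "g {} = (\<lambda>i. d)" using zero t(2,3) unfolding e by blast
    have "{i. i < d \<and> i \<in> A None \<and> g B i \<noteq> d} \<subseteq> disagreements d (g {}) (g B \<circ> (g (?P None) \<circ> (\<lambda>i. min i d)))"
      unfolding z A[OF N] Fix_def by (auto simp: disagreements_def)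
    then have "card {i. i < d \<and> i \<in> A None \<and> g B i \<noteq> d} \<le> card (disagreements d (g {}) (g B \<circ> (g (?P None) \<circ> (\<lambda>i. min i d))))"
      by (intro card_mono) (simp_all add: disagreements_def)
    moreover have "real d * \<delta> \<le> \<kappa>" using \<delta> by (simp add: \<kappa>_def)
    ultimately show ?thesis using t(1) unfolding e by linarith
  qed
  have some: "real (card {i. i < d \<and> i \<in> A (Some w) \<and> g B i \<noteq> chain d h w i}) \<le> \<kappa>" if w: "w \<in> W m" for w
  proof -
    have J: "Some w \<in> ?J" using w by simp
    let ?Cs = "map ?u w @ [?P (Some w)]"
    let ?f = "foldr (\<lambda>C. (\<circ>) (g C)) ?Cs (\<lambda>i. min i d)"
    have len: "length ?Cs \<le> m + 2" using w by (simp add: short_words_def)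
    have all: "bisection C \<and> bis_op \<G> C \<in> F" if "C \<in> set ?Cs" for C
      using that bP[OF J] pieces[OF J] bu letters Wl[OF w] by auto
    have "bprod ?Cs = slab w (piece B (Some w))" by (rule bprod_word[OF w piece_sets[OF B(1) J]])
    then have D1: "real (card (disagreements d (g (slab w (piece B (Some w)))) ?f)) \<le> real d * \<delta>"
      using prod(3)[OF all _ len] dsq by simp
    have D2: "real (card (disagreements d (g (slab w (piece B (Some w)))) (g B \<circ> (g (?P (Some w)) \<circ> (\<lambda>i. min i d))))) \<le> real d * \<delta>"
      using two(1)[OF B bP[OF J] pieces[OF J]] bmult_piece_Some[OF B(1) w] by simp
    let ?X = "disagreements d (g (slab w (piece B (Some w)))) ?f"
      and ?Y = "disagreements d (g (slab w (piece B (Some w)))) (g B \<circ> (g (?P (Some w)) \<circ> (\<lambda>i. min i d)))"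
    have "{i. i < d \<and> i \<in> A (Some w) \<and> g B i \<noteq> chain d h w i} \<subseteq> ?X \<union> ?Y"
    proof
      fix i assume "i \<in> {i. i < d \<and> i \<in> A (Some w) \<and> g B i \<noteq> chain d h w i}"
      then have i: "i < d" "g (?P (Some w)) i = i" "g B i \<noteq> chain d h w i"
        using A[OF J] by (auto simp: Fix_def)
      have "?f i = foldr (\<lambda>l. (\<circ>) (h l)) w (g (?P (Some w)) \<circ> (\<lambda>i. min i d)) i"
        by (simp add: foldr_map h_def comp_def)
      also have "\<dots> = chain d h w i"
        unfolding chain_def by (rule foldr_comp_cong) (use i in simp)
      finally have "?f i = chain d h w i" .
      then show "i \<in> ?X \<union> ?Y" using i by (auto simp: disagreements_def)
    qed
    then have "card {i. i < d \<and> i \<in> A (Some w) \<and> g B i \<noteq> chain d h w i} \<le> card (?X \<union> ?Y)"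
      by (intro card_mono) (simp_all add: disagreements_def)
    also have "\<dots> \<le> card ?X + card ?Y" by (rule card_Un_le)
    finally show ?thesis using D1 D2 by (simp add: \<kappa>_def algebra_simps)
  qed
  define n where "n = real (card (W m)) + 1"
  have cJ: "real (card ?J) = n"
    using finite_short_words by (simp add: n_def card_image)
  have n1: "1 \<le> n" by (simp add: n_def)
  have fJ: "finite ?J" using finite_short_words by simp
  have cover: "real (card {i. i < d \<and> i \<notin> A None \<and> (\<forall>w\<in>W m. i \<notin> A (Some w))}) \<le> real d * (\<epsilon> + 2 * n\<^sup>2 * \<delta>)"
  proof -
    let ?S = "\<lambda>j. Fix B j"
    have fS: "finite (?S j)" for j by (simp add: Fix_def)
    have lower: "real d * measure M (piece B j) - real d * \<delta> \<le> real (card (?S j))" if j: "j \<in> ?J" for j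
      using tr[OF piece_sets[OF B(1) j] bprod_one[OF bP[OF j]]] bP[OF j] pieces[OF j] by (simp add: Fix_def)
    have ov: "real (card (?S j \<inter> ?S j')) \<le> real d * \<delta>" if j: "j \<in> ?J" "j' \<in> ?J" "j \<noteq> j'" for j j'
    proof -
      note t = two[OF bP[OF j(1)] pieces[OF j(1)] bP[OF j(2)] pieces[OF j(2)]]
      have e: "bmult (?P j) (?P j') = {}"
        by (rule bmult_disjoint[OF piece_sets[OF B(1) j(1)] piece_sets[OF B(1) j(2)] piece_disjoint[OF B(1) j]])
      have z: "g {} = (\<lambda>i. d)" using zero t(2,3) unfolding e by blast
      have "?S j \<inter> ?S j' \<subseteq> disagreements d (g {}) (g (?P j) \<circ> (g (?P j') \<circ> (\<lambda>i. min i d)))"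
        unfolding z Fix_def by (auto simp: disagreements_def)
      then have "card (?S j \<inter> ?S j') \<le> card (disagreements d (g {}) (g (?P j) \<circ> (g (?P j') \<circ> (\<lambda>i. min i d))))"
        by (intro card_mono) (simp_all add: disagreements_def)
      then show ?thesis using t(1) unfolding e by linarith
    qed
    have "real (\<Sum>j\<in>?J. \<Sum>j'\<in>?J - {j}. card (?S j \<inter> ?S j')) = (\<Sum>j\<in>?J. \<Sum>j'\<in>?J - {j}. real (card (?S j \<inter> ?S j')))"
      by simp
    also have "\<dots> \<le> (\<Sum>j\<in>?J. \<Sum>j'\<in>?J - {j}. real d * \<delta>)" by (intro sum_mono ov) auto
    also have "\<dots> \<le> (\<Sum>j\<in>?J. \<Sum>j'\<in>?J. real d * \<delta>)"
      using \<delta> fJ by (intro sum_mono sum_mono2) auto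
    also have "\<dots> = n * (n * (real d * \<delta>))" by (simp only: sum_constant cJ)
    finally have o: "real (\<Sum>j\<in>?J. \<Sum>j'\<in>?J - {j}. card (?S j \<inter> ?S j')) \<le> n * (n * (real d * \<delta>))" .
    have "real d * (1 - \<epsilon>) - n * (real d * \<delta>) \<le> real d * (\<Sum>j\<in>?J. measure M (piece B j)) - n * (real d * \<delta>)"
      using \<epsilon> by (intro diff_right_mono mult_left_mono) auto
    also have "\<dots> = (\<Sum>j\<in>?J. real d * measure M (piece B j) - real d * \<delta>)"
      by (simp only: sum_subtractf sum_distrib_left sum_constant cJ)
    also have "\<dots> \<le> (\<Sum>j\<in>?J. real (card (?S j)))" by (rule sum_mono[OF lower])
    also have "\<dots> = real (\<Sum>j\<in>?J. card (?S j))" by simp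
    also have "\<dots> \<le> real (card (\<Union>j\<in>?J. ?S j) + (\<Sum>j\<in>?J. \<Sum>j'\<in>?J - {j}. card (?S j \<inter> ?S j')))"
      by (rule of_nat_mono) (rule sum_card_le_card_UN[OF fJ fS])
    finally have c: "real d * (1 - \<epsilon>) - n * (real d * \<delta>) \<le> real (card (\<Union>j\<in>?J. ?S j)) + n * (n * (real d * \<delta>))"
      using o by simp
    let ?X = "{i. i < d \<and> i \<notin> A None \<and> (\<forall>w\<in>W m. i \<notin> A (Some w))}"
    have AJ: "A None = Fix B None" "\<And>w. w \<in> W m \<Longrightarrow> A (Some w) = Fix B (Some w)" using A by auto
    have "card {..<d} = card ((\<Union>j\<in>?J. ?S j) \<union> ?X)"
    proof (rule arg_cong[where f = card], intro subset_antisym subsetI)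
      fix i assume i: "i \<in> {..<d}"
      show "i \<in> (\<Union>j\<in>?J. ?S j) \<union> ?X" using i AJ by auto
    next
      fix i assume "i \<in> (\<Union>j\<in>?J. ?S j) \<union> ?X"
      then show "i \<in> {..<d}" by (auto simp: Fix_def)
    qed
    also have "\<dots> = card (\<Union>j\<in>?J. ?S j) + card ?X"
    proof (rule card_Un_disjoint)
      show "finite (\<Union>j\<in>?J. ?S j)" using fJ fS by blast
      show "(\<Union>j\<in>?J. ?S j) \<inter> ?X = {}"
      proof (rule equals0I)
        fix i assume i: "i \<in> (\<Union>j\<in>?J. ?S j) \<inter> ?X"
        then obtain j where j: "j \<in> ?J" "i \<in> Fix B j" by blast
        have "i \<in> A j" using A[OF j(1)] j(2) by simp
        then show False using i j(1) by (cases j) auto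
      qed
    qed simp
    finally have "real (card ?X) = real d - real (card (\<Union>j\<in>?J. ?S j))" by simp
    also have "\<dots> \<le> real d * \<epsilon> + (n + n * n) * (real d * \<delta>)" using c by (simp add: algebra_simps)
    also have "\<dots> \<le> real d * \<epsilon> + (2 * n\<^sup>2) * (real d * \<delta>)"
    proof (intro add_left_mono mult_right_mono)
      have "n * 1 \<le> n * n" using n1 by (intro mult_left_mono) auto
      then show "n + n * n \<le> 2 * n\<^sup>2" by (simp add: power2_eq_square)
    qed (use \<delta> in simp)
    finally show ?thesis by (simp add: algebra_simps)
  qed
  have "real (card (disagreements d (g B) (decode d (W m) a A)))
    \<le> real d * (\<epsilon> + 2 * n\<^sup>2 * \<delta>) + \<kappa> + real (card (W m)) * (real m + 1) * \<kappa>"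
  proof (rule card_disagreements_decode[OF finite_short_words _ _ _ none some cover])
    show "length w \<le> m" if "w \<in> W m" for w using that by (simp add: short_words_def)
    show "h l \<in> partial_injections d" if "w \<in> W m" "l \<in> set w" for w l by (rule hPI[OF Wl[OF that]])
    show "signed d a l d = d \<and> real (card (disagreements d (h l) (signed d a l))) \<le> \<kappa>"
      if "w \<in> W m" "l \<in> set w" for w l by (rule inverse[OF Wl[OF that]])
    show "0 \<le> \<kappa>" using \<delta> by (simp add: \<kappa>_def)
  qed
  also have "\<dots> = real d * (\<epsilon> + \<delta> * (2 * (real (card (W m)) + 1)\<^sup>2 + 2 + 2 * real (card (W m)) * (real m + 1)))"
    unfolding \<kappa>_def n_def by (simp only: ring_distribs mult_ac add_ac power2_eq_square mult_1_left mult_1_right)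
  finally show ?thesis .
qed

end

section \<open>Counting sofic approximations\<close>

lemma ln_fact_ge: "real d * ln (real d) - real d \<le> ln (fact d)"
proof (cases "d = 0")
  case False
  have "summable (\<lambda>n. real d ^ n /\<^sub>R fact n)" by (rule summable_exp_generic)
  then have "(\<Sum>n\<in>{d}. real d ^ n /\<^sub>R fact n) \<le> exp (real d)"
    unfolding exp_def by (rule sum_le_suminf) auto
  then have "real d ^ d / fact d \<le> exp (real d)" by (simp add: divide_inverse mult.commute)
  then have "ln (real d ^ d / fact d) \<le> real d"
    using False ln_le_cancel_iff[of "real d ^ d / fact d" "exp (real d)"] by simp
  then show ?thesis using False by (simp add: ln_div ln_realpow)
qed simp

context free_pmp_action
begin

text \<open>
  An approximating map restricted to \<open>E\<close> is given by \<open>r\<close> partial injections for the generators, by one subset of \<open>{..<d}\<close> for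
  each element of \<open>E\<close> and each of its finitely many pieces, and by a correction of the decoded
  partial injections on at most \<open>\<beta> d\<close> indices.
\<close>

theorem few_sofic_approximations:
  assumes E: "finite E" "E \<subseteq> inv_semigroup \<G>" and \<beta>: "0 < \<beta>"
  obtains F n \<delta> c where "finite F" "F \<subseteq> inv_semigroup \<G>" "1 \<le> n" "0 < \<delta>"
    "\<And>d. 1 \<le> d \<Longrightarrow> log_card (restrictions E (SA \<G> F n \<delta> d))
      \<le> ereal (real r * real d * ln (real d + 1) + c * real d + real (card E) * \<beta> * real d * ln (real d + 1))"
proof -
  have "\<forall>s\<in>E. \<exists>B. bisection B \<and> bis_op \<G> B = s" using E(2) by (auto simp: inv_semigroup_eq)
  from bchoice[OF this] obtain Bs where Bs: "\<And>s. s \<in> E \<Longrightarrow> bisection (Bs s)" "\<And>s. s \<in> E \<Longrightarrow> bis_op \<G> (Bs s) = s"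
    by blast
  have fB: "finite (Bs ` E)" "\<And>B. B \<in> Bs ` E \<Longrightarrow> bisection B" using E Bs by auto
  define \<epsilon> where "\<epsilon> = \<beta> / 2"
  have \<epsilon>: "0 < \<epsilon>" using \<beta> by (simp add: \<epsilon>_def)
  obtain m where m: "measure M (tail (Bs ` E) m) < \<epsilon>" by (rule ex_small_tail[OF fB \<epsilon>])
  let ?J = "insert None (Some ` W m)"
  have fJ: "finite ?J" using finite_short_words by simp
  define Q where "Q = 2 * (real (card (W m)) + 1)\<^sup>2 + 2 + 2 * real (card (W m)) * (real m + 1)"
  have Q: "0 < Q" by (simp add: Q_def add_nonneg_pos add_pos_nonneg)
  define \<delta> where "\<delta> = min 1 (\<epsilon> / Q)"
  have \<delta>: "0 < \<delta>" "\<delta> \<le> 1" using \<epsilon> Q by (simp_all add: \<delta>_def)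
  have "\<delta> * Q \<le> \<epsilon> / Q * Q" using Q by (intro mult_right_mono) (simp_all add: \<delta>_def)
  then have \<delta>Q: "\<epsilon> + \<delta> * Q \<le> \<beta>" using Q by (simp add: \<epsilon>_def)
  define F where "F = E \<union> (\<lambda>l. bis_op \<G> (slab [l] (space M))) ` ({..<r} \<times> UNIV)
    \<union> (\<lambda>(s, j). bis_op \<G> (slab [] (piece (Bs s) j))) ` (E \<times> ?J)"
  have finF: "finite F" using E fJ by (simp add: F_def)
  have bl: "bisection (slab [l] (space M))" if "l \<in> {..<r} \<times> UNIV" for l
    by (rule bisection_slab[OF letter_carrier sets.top]) (use that in auto)
  have bp: "bisection (slab [] (piece (Bs s) j))" if "s \<in> E" "j \<in> ?J" for s j
    by (rule bisection_slab_W[OF Nil_short_words piece_sets[OF Bs(1)[OF that(1)] that(2)]])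
  have FI: "F \<subseteq> inv_semigroup \<G>"
    unfolding F_def
  proof (intro Un_least image_subsetI E(2))
    have in_semigroup: "bis_op \<G> B \<in> inv_semigroup \<G>" if "bisection B" for B
      unfolding inv_semigroup_eq using that by (intro image_eqI[OF refl]) simp
    show "bis_op \<G> (slab [l] (space M)) \<in> inv_semigroup \<G>" if "l \<in> {..<r} \<times> UNIV" for l
      by (rule in_semigroup[OF bl[OF that]])
    show "(\<lambda>(s, j). bis_op \<G> (slab [] (piece (Bs s) j))) p \<in> inv_semigroup \<G>" if "p \<in> E \<times> ?J" for p
      using in_semigroup[OF bp[of "fst p" "snd p"]] that by (simp add: case_prod_unfold mem_Times_iff)
  qed
  have lF: "bis_op \<G> (slab [l] (space M)) \<in> F" if "fst l < r" for l
    unfolding F_def using that by (intro UnI1 UnI2 image_eqI[of _ _ l]) (auto simp: mem_Times_iff)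
  have pF: "bis_op \<G> (slab [] (piece (Bs s) j)) \<in> F" if "s \<in> E" "j \<in> ?J" for s j
    unfolding F_def using that by (intro UnI2 image_eqI[of _ _ "(s, j)"]) auto
  define e where "e = card E"
  define c where "c = real (e * card ?J + e) * ln 2"
  have main: "log_card (restrictions E (SA \<G> F (m + 2) \<delta> d))
      \<le> ereal (real r * real d * ln (real d + 1) + c * real d + real (card E) * \<beta> * real d * ln (real d + 1))"
    if d: "1 \<le> d" for d
  proof -
    define b where "b = nat \<lfloor>\<beta> * real d\<rfloor>"
    \<comment> \<open>The data for decoding: generators, and fixed point sets of the projections onto the pieces.\<close>
    define Par where "Par = (\<Pi>\<^sub>E k\<in>{..<r}. partial_injections d) \<times> (\<Pi>\<^sub>E p\<in>E \<times> ?J. Pow {..<d})"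
    define Ball where "Ball p s = {f \<in> partial_injections d.
      card (disagreements d f (decode d (W m) (fst p) (\<lambda>j. snd p (s, j)))) \<le> b}" for p :: "(nat \<Rightarrow> nat \<Rightarrow> nat) \<times> ((letter list \<times> 'x) oper \<times> letter list option \<Rightarrow> nat set)" and s
    define mats where "mats f = (\<lambda>s\<in>E. pmat d (f s))" for f :: "(letter list \<times> 'x) oper \<Rightarrow> nat \<Rightarrow> nat"
    have finBall: "finite (Ball p s)" for p s
      by (rule finite_subset[OF _ finite_partial_injections[of d]]) (auto simp: Ball_def)
    have finPar: "finite Par"
      unfolding Par_def using E(1) fJ
      by (intro finite_cartesian_product finite_PiE finite_partial_injections) auto
    have sub: "restrictions E (SA \<G> F (m + 2) \<delta> d) \<subseteq> (\<Union>p\<in>Par. mats ` (\<Pi>\<^sub>E s\<in>E. Ball p s))"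
    proof
      fix \<psi> assume "\<psi> \<in> restrictions E (SA \<G> F (m + 2) \<delta> d)"
      then obtain \<phi> where \<phi>: "\<phi> \<in> SA \<G> F (m + 2) \<delta> d" and \<psi>: "\<psi> = restrict \<phi> E"
        by (auto simp: restrictions_def)
      define g where "g = partial_map d \<phi>"
      have one: "g C \<in> partial_injections d \<and> \<phi> (bis_op \<G> C) = pmat d (g C)"
        if "bisection C" "bis_op \<G> C \<in> F" for C
        using SA_product(1,2)[OF \<phi> \<delta>(1), of "[C]"] d that bprod_one[OF that(1)] by (simp add: g_def)
      define a where "a = (\<lambda>k\<in>{..<r}. g (slab [(k, True)] (space M)))"
      define A where "A = (\<lambda>p\<in>E \<times> ?J. {i. i < d \<and> g (slab [] (piece (Bs (fst p)) (snd p))) i = i})"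
      have "a \<in> (\<Pi>\<^sub>E k\<in>{..<r}. partial_injections d)"
        using one bl lF by (simp add: a_def)
      moreover have "A \<in> (\<Pi>\<^sub>E p\<in>E \<times> ?J. Pow {..<d})"
        unfolding A_def by (rule restrict_PiE_iff[THEN iffD2]) auto
      ultimately have par: "(a, A) \<in> Par" by (simp add: Par_def)
      have close: "g (Bs s) \<in> Ball (a, A) s" if s: "s \<in> E" for s
      proof -
        have sF: "bis_op \<G> (Bs s) \<in> F" using s Bs(2)[OF s] by (simp add: F_def)
        have "real (card (disagreements d (g (Bs s)) (decode d (W m) a (\<lambda>j. A (s, j)))))
          \<le> real d * (\<epsilon> + \<delta> * Q)"
          unfolding Q_def g_def
        proof (rule decode_bisection[OF \<phi> \<delta> _ Bs(1)[OF s] sF lF])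
          show "0 < d" using d by simp
          show "bis_op \<G> (slab [] (piece (Bs s) j)) \<in> F" if "j \<in> ?J" for j by (rule pF[OF s that])
          show "a k = partial_map d \<phi> (slab [(k, True)] (space M))" if "k < r" for k
            using that by (simp add: a_def g_def)
          show "A (s, j) = {i. i < d \<and> partial_map d \<phi> (slab [] (piece (Bs s) j)) i = i}" if "j \<in> ?J" for j
            using that s by (simp add: A_def g_def)
          show "1 - \<epsilon> \<le> (\<Sum>j\<in>?J. measure M (piece (Bs s) j))"
          proof -
            have "tail (Bs ` E) m \<in> sets M" by (rule tail_sets[OF fB])
            from measure_pieces[OF Bs(1)[OF s] imageI[OF s] this] m show ?thesis by linarith
          qed
        qed
        also have "\<dots> \<le> \<beta> * real d" using mult_left_mono[OF \<delta>Q, of "real d"] by (simp add: mult.commute)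
        finally have "card (disagreements d (g (Bs s)) (decode d (W m) a (\<lambda>j. A (s, j)))) \<le> b"
          unfolding b_def by linarith
        then show ?thesis using one[OF Bs(1)[OF s] sF] by (simp add: Ball_def)
      qed
      have "\<psi> = mats (\<lambda>s\<in>E. g (Bs s))"
        unfolding \<psi> mats_def
      proof (rule restrict_ext)
        fix s assume s: "s \<in> E"
        have "bis_op \<G> (Bs s) \<in> F" using s Bs(2)[OF s] by (simp add: F_def)
        from one[OF Bs(1)[OF s] this] show "\<phi> s = pmat d ((\<lambda>s\<in>E. g (Bs s)) s)" using Bs(2)[OF s] s by simp
      qed
      moreover have "(\<lambda>s\<in>E. g (Bs s)) \<in> (\<Pi>\<^sub>E s\<in>E. Ball (a, A) s)" using close by simp
      ultimately show "\<psi> \<in> (\<Union>p\<in>Par. mats ` (\<Pi>\<^sub>E s\<in>E. Ball p s))" using par by blast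
    qed
    have finU: "finite (\<Union>p\<in>Par. mats ` (\<Pi>\<^sub>E s\<in>E. Ball p s))"
      using finPar E(1) finBall by (intro finite_UN_I finite_imageI finite_PiE)
    let ?K = "((d + 1) ^ d) ^ r * (2 ^ d) ^ (e * card ?J) * (2 ^ d * (d + 1) ^ b) ^ e"
    have "card (restrictions E (SA \<G> F (m + 2) \<delta> d)) \<le> card (\<Union>p\<in>Par. mats ` (\<Pi>\<^sub>E s\<in>E. Ball p s))"
      by (rule card_mono[OF finU sub])
    also have "\<dots> \<le> (\<Sum>p\<in>Par. card (mats ` (\<Pi>\<^sub>E s\<in>E. Ball p s)))" by (rule card_UN_le[OF finPar])
    also have "\<dots> \<le> (\<Sum>p\<in>Par. (2 ^ d * (d + 1) ^ b) ^ e)"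
    proof (rule sum_mono)
      fix p
      have "card (mats ` (\<Pi>\<^sub>E s\<in>E. Ball p s)) \<le> card (\<Pi>\<^sub>E s\<in>E. Ball p s)"
        by (rule card_image_le) (use E(1) finBall in \<open>intro finite_PiE\<close>)
      also have "\<dots> = (\<Prod>s\<in>E. card (Ball p s))" by (rule card_PiE[OF E(1)])
      also have "\<dots> \<le> (\<Prod>s\<in>E. 2 ^ d * (d + 1) ^ b)"
        unfolding Ball_def by (intro prod_mono conjI card_hamming_ball_le) simp_all
      also have "\<dots> = (2 ^ d * (d + 1) ^ b) ^ e" unfolding e_def by (rule prod_constant)
      finally show "card (mats ` (\<Pi>\<^sub>E s\<in>E. Ball p s)) \<le> (2 ^ d * (d + 1) ^ b) ^ e" .
    qed
    also have "\<dots> = card Par * (2 ^ d * (d + 1) ^ b) ^ e" by simp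
    also have "\<dots> \<le> ?K"
    proof (rule mult_right_mono)
      have "card Par = card (partial_injections d) ^ r * (2 ^ d) ^ (e * card ?J)"
        unfolding Par_def card_cartesian_product
        using E(1) fJ by (simp add: card_PiE card_cartesian_product e_def card_Pow)
      also have "\<dots> \<le> ((d + 1) ^ d) ^ r * (2 ^ d) ^ (e * card ?J)"
        by (intro mult_right_mono power_mono card_partial_injections_le) auto
      finally show "card Par \<le> ((d + 1) ^ d) ^ r * (2 ^ d) ^ (e * card ?J)" .
    qed simp
    finally have K: "card (restrictions E (SA \<G> F (m + 2) \<delta> d)) \<le> ?K" .
    have lnK: "ln (real ?K) \<le> real r * real d * ln (real d + 1) + c * real d + real (card E) * \<beta> * real d * ln (real d + 1)"
    proof -
      let ?L = "ln (real d + 1)"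
      have p: "ln (real (x ^ k)) = real k * ln (real x)" if "0 < x" for x k :: nat
        using that by (simp add: ln_realpow)
      have mul: "ln (real (x * y)) = ln (real x) + ln (real y)" if "0 < x" "0 < y" for x y :: nat
        using that by (simp add: ln_mult)
      have L: "ln (real (d + 1)) = ?L" by (simp add: add.commute)
      have pos: "0 < (d + 1) ^ d" "0 < ((d + 1) ^ d) ^ r" "(0::nat) < 2 ^ d" "(0::nat) < (2 ^ d) ^ (e * card ?J)"
        "0 < (d + 1) ^ b" "0 < 2 ^ d * (d + 1) ^ b" "0 < (2 ^ d * (d + 1) ^ b) ^ e" "0 < d + 1" by simp_all
      have "ln (real ?K) = ln (real (((d + 1) ^ d) ^ r)) + ln (real ((2 ^ d) ^ (e * card ?J))) + ln (real ((2 ^ d * (d + 1) ^ b) ^ e))"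
        using pos by (simp only: mul nat_0_less_mult_iff simp_thms)
      also have "ln (real (((d + 1) ^ d) ^ r)) = real r * (real d * ?L)"
        using pos by (simp only: p L)
      also have "ln (real ((2 ^ d) ^ (e * card ?J))) = real (e * card ?J) * (real d * ln 2)"
        using pos p[of 2 d] by (simp only: p) simp
      also have "ln (real ((2 ^ d * (d + 1) ^ b) ^ e)) = real e * (real d * ln 2 + real b * ?L)"
        using pos p[of 2 d] by (simp only: p mul L) simp
      finally have "ln (real ?K) = real r * (real d * ?L) + real (e * card ?J) * (real d * ln 2) + real e * (real d * ln 2 + real b * ?L)" .
      moreover have "real e * (real b * ?L) \<le> real e * ((\<beta> * real d) * ?L)"
        using \<beta> by (intro mult_left_mono mult_right_mono) (simp_all add: b_def of_nat_floor)
      ultimately show ?thesis by (simp add: c_def e_def algebra_simps)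
    qed
    have finR: "finite (restrictions E (SA \<G> F (m + 2) \<delta> d))" by (rule finite_subset[OF sub finU])
    show ?thesis
    proof (cases "restrictions E (SA \<G> F (m + 2) \<delta> d) = {}")
      case True
      then show ?thesis by (simp add: log_card_def)
    next
      case False
      then have "0 < card (restrictions E (SA \<G> F (m + 2) \<delta> d))" using finR by (simp add: card_gt_0_iff)
      have ln_mono: "ln (real x) \<le> ln (real y)" if "0 < x" "x \<le> y" for x y :: nat
        using that by simp
      have "log_card (restrictions E (SA \<G> F (m + 2) \<delta> d)) = ereal (ln (real (card (restrictions E (SA \<G> F (m + 2) \<delta> d)))))"
        using False finR by (simp only: log_card_def if_False not_True_eq_False)
      also have "\<dots> \<le> ereal (real r * real d * ln (real d + 1) + c * real d + real (card E) * \<beta> * real d * ln (real d + 1))"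
        unfolding ereal_less_eq(3) by (rule order_trans[OF ln_mono[OF \<open>0 < card _\<close> K] lnK])
      finally show ?thesis .
    qed
  qed
  show ?thesis by (rule that[OF finF FI _ \<delta>(1) main]) simp_all
qed

text \<open>The operators of the generators are a set \<open>E\<close> witnessing the supremum, since \<open>log d! / (d log d)\<close> tends to \<open>1\<close>.\<close>

lemma lower_sofic_dim_ge: "ereal (real r) \<le> lower_sofic_dim \<G>"
proof -
  have E: "finite gen_ops" "gen_ops \<subseteq> inv_semigroup \<G>"
    unfolding gen_ops_def inv_semigroup_eq using bisection_slab[OF gen_carrier sets.top] by auto
  have "ereal (real r) \<le> sofic_rate (\<lambda>a. liminf a) \<G> gen_ops F n \<delta>"
    if F: "finite F" "F \<subseteq> inv_semigroup \<G>" and \<delta>: "0 < \<delta>" for F n \<delta>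
  proof -
    obtain C D :: nat where C: "1 \<le> C" and CD: "\<And>d. d \<ge> D \<Longrightarrow>
      ereal (real r * (ln (fact d) - real d * ln (real C))) \<le> log_card (restrictions gen_ops (SA \<G> F n \<delta> d))"
      by (rule many_sofic_approximations[where n = n, OF F \<delta> that])
    define c where "c = ln (real C)"
    let ?lo = "\<lambda>d::nat. real r * (real d * ln (real d) - real d - real d * c) / (real d * ln (real d))"
    have "?lo \<longlonglongrightarrow> real r" by real_asymp
    then have "(\<lambda>d. ereal (?lo d)) \<longlonglongrightarrow> ereal (real r)" by simp
    then have "ereal (real r) = liminf (\<lambda>d. ereal (?lo d))"
      by (rule lim_imp_Liminf[OF trivial_limit_sequentially, symmetric])
    also have "\<dots> \<le> liminf (\<lambda>d. ereal (1 / (real d * ln (real d))) * log_card (restrictions gen_ops (SA \<G> F n \<delta> d)))"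
    proof (rule Liminf_mono)
      show "\<forall>\<^sub>F d in sequentially. ereal (?lo d)
        \<le> ereal (1 / (real d * ln (real d))) * log_card (restrictions gen_ops (SA \<G> F n \<delta> d))"
        using eventually_ge_at_top[of "max D 2"]
      proof eventually_elim
        fix d assume "max D 2 \<le> d"
        then have d: "D \<le> d" "2 \<le> d" by auto
        then have pos: "0 < real d * ln (real d)" by simp
        from ln_fact_ge[of d] have "real r * (real d * ln (real d) - real d - real d * c) \<le> real r * (ln (fact d) - real d * c)"
          by (intro mult_left_mono) auto
        then have "ereal (?lo d) \<le> ereal (1 / (real d * ln (real d))) * ereal (real r * (ln (fact d) - real d * c))"
          using pos by (simp add: divide_right_mono)
        also have "\<dots> \<le> ereal (1 / (real d * ln (real d))) * log_card (restrictions gen_ops (SA \<G> F n \<delta> d))"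
          using CD[OF d(1)] pos by (intro ereal_mult_left_mono) (simp_all add: c_def)
        finally show "ereal (?lo d)
          \<le> ereal (1 / (real d * ln (real d))) * log_card (restrictions gen_ops (SA \<G> F n \<delta> d))" .
      qed
    qed
    finally show ?thesis by (simp add: sofic_rate_def)
  qed
  then have "ereal (real r) \<le> (INF F\<in>{F. finite F \<and> F \<subseteq> inv_semigroup \<G>}. sofic_rate_inf (\<lambda>a. liminf a) \<G> gen_ops F)"
    unfolding sofic_rate_inf_def by (intro INF_greatest) auto
  also have "\<dots> \<le> lower_sofic_dim \<G>"
    unfolding lower_sofic_dim_def sofic_dim_wrt_def by (rule SUP_upper) (use E in blast)
  finally show ?thesis .
qed

lemma sofic_dim_le: "sofic_dim \<G> \<le> ereal (real r)"
  unfolding sofic_dim_def sofic_dim_wrt_def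
proof (rule SUP_least)
  fix E assume "E \<in> {E. finite E \<and> E \<subseteq> inv_semigroup \<G>}"
  then have E: "finite E" "E \<subseteq> inv_semigroup \<G>" by auto
  let ?I = "INF F\<in>{F. finite F \<and> F \<subseteq> inv_semigroup \<G>}. sofic_rate_inf (\<lambda>a. limsup a) \<G> E F"
  have le: "?I \<le> ereal (real r + real (card E) * \<beta>)" if \<beta>: "0 < \<beta>" for \<beta>
  proof -
    obtain F n \<delta> c where F: "finite F" "F \<subseteq> inv_semigroup \<G>" "1 \<le> n" "0 < \<delta>"
      and up: "\<And>d. 1 \<le> d \<Longrightarrow> log_card (restrictions E (SA \<G> F n \<delta> d))
        \<le> ereal (real r * real d * ln (real d + 1) + c * real d + real (card E) * \<beta> * real d * ln (real d + 1))"
      by (rule few_sofic_approximations[OF E \<beta> that])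
    define q where "q = real (card E) * \<beta>"
    let ?up = "\<lambda>d::nat. (real r * real d * ln (real d + 1) + c * real d + q * real d * ln (real d + 1)) / (real d * ln (real d))"
    have "?I \<le> sofic_rate_inf (\<lambda>a. limsup a) \<G> E F" by (rule INF_lower) (use F in blast)
    also have "\<dots> \<le> sofic_rate (\<lambda>a. limsup a) \<G> E F n \<delta>"
      unfolding sofic_rate_inf_def by (rule INF_lower2[of n], use F in simp, rule INF_lower, use F in simp)
    also have "\<dots> \<le> limsup (\<lambda>d. ereal (?up d))"
      unfolding sofic_rate_def
    proof (rule Limsup_mono)
      show "\<forall>\<^sub>F d in sequentially. ereal (1 / (real d * ln (real d))) * log_card (restrictions E (SA \<G> F n \<delta> d))
        \<le> ereal (?up d)"
        using eventually_ge_at_top[of 2]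
      proof eventually_elim
        fix d :: nat assume d: "2 \<le> d"
        then have pos: "0 < real d * ln (real d)" by simp
        have "ereal (1 / (real d * ln (real d))) * log_card (restrictions E (SA \<G> F n \<delta> d))
          \<le> ereal (1 / (real d * ln (real d))) * ereal (real r * real d * ln (real d + 1) + c * real d + q * real d * ln (real d + 1))"
          using up[of d] d pos by (intro ereal_mult_left_mono) (simp_all add: q_def)
        also have "\<dots> = ereal (?up d)" by simp
        finally show "ereal (1 / (real d * ln (real d))) * log_card (restrictions E (SA \<G> F n \<delta> d)) \<le> ereal (?up d)" .
      qed
    qed
    also have "limsup (\<lambda>d. ereal (?up d)) = ereal (real r + q)"
    proof (rule lim_imp_Limsup)
      have "?up \<longlonglongrightarrow> real r + q" by real_asymp
      then show "(\<lambda>d. ereal (?up d)) \<longlonglongrightarrow> ereal (real r + q)" by (simp only: lim_ereal)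
    qed simp
    finally show ?thesis by (simp add: q_def)
  qed
  show "?I \<le> ereal (real r)"
  proof (rule ereal_le_epsilon2)
    fix x :: real assume x: "0 < x"
    have "?I \<le> ereal (real r + real (card E) * (x / (real (card E) + 1)))" by (rule le) (use x in simp)
    also have "\<dots> \<le> ereal (real r) + ereal x"
    proof -
      have "real (card E) * (x / (real (card E) + 1)) \<le> x" using x by (simp add: field_simps)
      then show ?thesis by simp
    qed
    finally show "?I \<le> ereal (real r) + ereal x" .
  qed
qed

end

lemma lower_sofic_dim_le: "lower_sofic_dim \<G> \<le> sofic_dim \<G>"
  unfolding lower_sofic_dim_def sofic_dim_def sofic_dim_wrt_def sofic_rate_inf_def sofic_rate_def
  by (intro SUP_mono' INF_mono' Liminf_le_Limsup) simp

theorem corollary6p5: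
  fixes r :: nat and M :: "'x measure" and \<alpha> :: "letter list \<Rightarrow> 'x \<Rightarrow> 'x"
  assumes "r \<ge> 1"
    and "standard_prob_space M"
    and "pmp_action (free_group r) M \<alpha>"
  shows "action_sofic_dim (free_group r) M \<alpha> = ereal (real r)
       \<and> action_lower_sofic_dim (free_group r) M \<alpha> = ereal (real r)"
proof -
  interpret free_pmp_action r M \<alpha>
    using assms by (simp add: free_pmp_action_def standard_prob_space_def)
  have "ereal (real r) \<le> lower_sofic_dim \<G>" "lower_sofic_dim \<G> \<le> sofic_dim \<G>" "sofic_dim \<G> \<le> ereal (real r)"
    by (rule lower_sofic_dim_ge lower_sofic_dim_le sofic_dim_le)+
  then show ?thesis by (simp add: action_sofic_dim_def action_lower_sofic_dim_def order_antisym)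
qed

end
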